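(* Let $\Lambda$ be a finite dimensional hereditary algebra over an infinite field $K$, and let $\beta_1,\dots,\beta_k$ be real Schur roots of $\Lambda$ such that the exceptional modules $M_{\beta_i}$ do not extend each other, i.e. $\operatorname{Ext}^1_\Lambda(M_{\beta_i},M_{\beta_j})=0$ for all $i,j$. Then for any nonnegative integer linear combination $\alpha=\sum_{i=1}^k n_i\beta_i$ ($n_i\in\mathbb N$), the generic representation in $\operatorname{Rep}(\Lambda,\alpha)$ is isomorphic to $\bigoplus_{i=1}^k M_{\beta_i}^{n_i}$; that is, the set of all $f\in \operatorname{Rep}(\Lambda,\alpha)$ with $N_f\cong \bigoplus_{i=1}^k M_{\beta_i}^{n_i}$ is an open dense subset of $\operatorname{Rep}(\Lambda,\alpha)$ in the Zariski topology.
   Context: $\Lambda$ is basic (the indecomposable summands of $\Lambda$ as a right module are pairwise nonisomorphic); modules are finite dimensional right $\Lambda$-modules. $S_1,\dots,S_n$ are the simple modules, $P_i$ is the projective cover of $S_i$, and $F_i=\operatorname{End}_\Lambda(S_i)\cong\operatorname{End}_\Lambda(P_i)$. The dimension vector $\underline{\dim}\,V\in\mathbb N^n$ of a module $V$ has $i$-th coordinate $\dim_{F_i}\operatorname{Hom}_\Lambda(P_i,V)$. For $\alpha\in\mathbb N^n$ put $P(\alpha)=\bigoplus_i P_i^{\alpha_i}$. A module $M$ is exceptional if $\operatorname{Ext}^1_\Lambda(M,M)=0$ and $\operatorname{End}_\Lambda(M)$ is a division algebra. A real Schur root of $\Lambda$ is a vector $\beta\in\mathbb N^n$ which is the dimension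 vector of an exceptional module; that module is unique up to isomorphism and is denoted $M_\beta$. Representation space: put $d_{ji}=\dim_{F_i}\operatorname{Ext}^1_\Lambda(S_j,S_i)$ for $i\ne j$ (and $d_{ii}=0$). Fix isomorphisms $\varphi_j:\bigoplus_i P_i^{d_{ji}}\cong \operatorname{rad}P_j$ for each $j$; they induce an isomorphism $\varphi_\alpha=\bigoplus_j\varphi_j^{\alpha_j}:\bigoplus_{i,j}P_i^{\alpha_jd_{ji}}\cong \operatorname{rad}P(\alpha)$. Let $H(\Lambda,\alpha)=\prod_{i}\operatorname{Hom}_\Lambda(\bigoplus_j P_i^{\alpha_jd_{ji}},P_i^{\alpha_i})\subseteq \operatorname{Hom}_\Lambda(\bigoplus_{i,j}P_i^{\alpha_jd_{ji}},P(\alpha))$. Then $\operatorname{Rep}(\Lambda,\alpha)=\{f:\operatorname{rad}P(\alpha)\to P(\alpha)\mid f\circ\varphi_\alpha\in H(\Lambda,\alpha)\}$, an affine space over $K$. For $f\in\operatorname{Rep}(\Lambda,\alpha)$, $N_f=\operatorname{coker}(f-\mathrm{inc}:\operatorname{rad}P(\alpha)\to P(\alpha))$, where $\mathrm{inc}$ is the inclusion; $N_f$ is a $\Lambda$-module of dimension vector $\alpha$. *)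

theory Defs
  imports
    "Jordan_Normal_Form.VS_Connect"
    "HOL-Algebra.AbelCoset"
    "HOL-Analysis.Abstract_Topology"
begin

section \<open>Algebras, right modules, homomorphisms\<close>

text \<open>
  The base field is a type of class \<open>field\<close>, seen as a ring record through \<open>class_ring\<close>.
  An algebra is a record of type \<open>('k, 'l) module\<close>: its ring fields carry the multiplication and
  \<open>\<odot>\<close> is the action of the base field.
\<close>

definition is_basis :: "('r, 'c) ring_scheme \<Rightarrow> ('r, 'v) module \<Rightarrow> nat \<Rightarrow> (nat \<Rightarrow> 'v) \<Rightarrow> bool" where
  "is_basis F V n b \<longleftrightarrow> b \<in> {..<n} \<rightarrow> carrier V \<and>
     (\<forall>v\<in>carrier V. \<exists>!a. a \<in> {..<n} \<rightarrow>\<^sub>E carrier F \<and>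
        v = (\<Oplus>\<^bsub>V\<^esub> i\<in>{..<n}. a i \<odot>\<^bsub>V\<^esub> b i))"

text \<open>
  The scalars may form a noncommutative division ring acting from either side; the scalar is the
  first argument of \<open>\<odot>\<close> in both cases.
\<close>

definition dimension :: "('r, 'c) ring_scheme \<Rightarrow> ('r, 'v) module \<Rightarrow> nat" where
  "dimension F V = (THE n. \<exists>b. is_basis F V n b)"

locale fd_algebra = ring A + vs: Module.module "class_ring :: 'k::field ring" A
  for A :: "('k::field, 'l) module" (structure) +
  assumes smult_mult_left:
      "\<lbrakk>x \<in> carrier A; y \<in> carrier A\<rbrakk> \<Longrightarrow> (a \<odot> x) \<otimes> y = a \<odot> (x \<otimes> y)"
    and smult_mult_right:
      "\<lbrakk>x \<in> carrier A; y \<in> carrier A\<rbrakk> \<Longrightarrow> x \<otimes> (a \<odot> y) = a \<odot> (x \<otimes> y)"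
    and finite_dimensional: "\<exists>n b. is_basis (class_ring :: 'k ring) A n b"

text \<open>For a right module, \<open>r \<odot> x\<close> is the element usually written \<open>x r\<close>.\<close>

locale right_module = R?: ring R + M?: abelian_group M
  for R :: "('r, 'c) ring_scheme" (structure) and M :: "('r, 'm) module" (structure) +
  assumes smult_closed [simp, intro]:
      "\<lbrakk>r \<in> carrier R; x \<in> carrier M\<rbrakk> \<Longrightarrow> r \<odot>\<^bsub>M\<^esub> x \<in> carrier M"
    and smult_l_distr:
      "\<lbrakk>r \<in> carrier R; s \<in> carrier R; x \<in> carrier M\<rbrakk> \<Longrightarrow>
        (r \<oplus> s) \<odot>\<^bsub>M\<^esub> x = r \<odot>\<^bsub>M\<^esub> x \<oplus>\<^bsub>M\<^esub> s \<odot>\<^bsub>M\<^esub> x"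
    and smult_r_distr:
      "\<lbrakk>r \<in> carrier R; x \<in> carrier M; y \<in> carrier M\<rbrakk> \<Longrightarrow>
        r \<odot>\<^bsub>M\<^esub> (x \<oplus>\<^bsub>M\<^esub> y) = r \<odot>\<^bsub>M\<^esub> x \<oplus>\<^bsub>M\<^esub> r \<odot>\<^bsub>M\<^esub> y"
    and smult_assoc:
      "\<lbrakk>r \<in> carrier R; s \<in> carrier R; x \<in> carrier M\<rbrakk> \<Longrightarrow>
        (r \<otimes> s) \<odot>\<^bsub>M\<^esub> x = s \<odot>\<^bsub>M\<^esub> (r \<odot>\<^bsub>M\<^esub> x)"
    and smult_one [simp]: "x \<in> carrier M \<Longrightarrow> \<one> \<odot>\<^bsub>M\<^esub> x = x"

definition mk_module :: "'m set \<Rightarrow> 'm \<Rightarrow> ('m \<Rightarrow> 'm \<Rightarrow> 'm) \<Rightarrow> ('r \<Rightarrow> 'm \<Rightarrow> 'm) \<Rightarrow> ('r, 'm) module" where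
  "mk_module C z p s =
     \<lparr>carrier = C, mult = undefined, one = undefined, zero = z, add = p, smult = s\<rparr>"

definition base_space :: "('k::field, 'l) module \<Rightarrow> ('l, 'm) module \<Rightarrow> ('k, 'm) module" where
  "base_space A M = mk_module (carrier M) \<zero>\<^bsub>M\<^esub> (add M) (\<lambda>a x. (a \<odot>\<^bsub>A\<^esub> \<one>\<^bsub>A\<^esub>) \<odot>\<^bsub>M\<^esub> x)"

definition fd_module :: "('k::field, 'l) module \<Rightarrow> ('l, 'm) module \<Rightarrow> bool" where
  "fd_module A M \<longleftrightarrow> right_module A M \<and>
     (\<exists>n b. is_basis (class_ring :: 'k ring) (base_space A M) n b)"

definition regular :: "('k, 'l) module \<Rightarrow> ('l, 'l) module" where
  "regular A = mk_module (carrier A) \<zero>\<^bsub>A\<^esub> (add A) (\<lambda>r x. x \<otimes>\<^bsub>A\<^esub> r)"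

text \<open>Homomorphisms are extensional functions, so that equal maps are equal as elements.\<close>

definition mhom :: "('k, 'l) module \<Rightarrow> ('l, 'm) module \<Rightarrow> ('l, 'n) module \<Rightarrow> ('m \<Rightarrow> 'n) set" where
  "mhom A M N = {h \<in> carrier M \<rightarrow>\<^sub>E carrier N.
     (\<forall>x\<in>carrier M. \<forall>y\<in>carrier M. h (x \<oplus>\<^bsub>M\<^esub> y) = h x \<oplus>\<^bsub>N\<^esub> h y) \<and>
     (\<forall>r\<in>carrier A. \<forall>x\<in>carrier M. h (r \<odot>\<^bsub>M\<^esub> x) = r \<odot>\<^bsub>N\<^esub> h x)}"

definition mhom_module ::
  "('k, 'l) module \<Rightarrow> ('l, 'm) module \<Rightarrow> ('l, 'n) module \<Rightarrow> ('r \<Rightarrow> ('m \<Rightarrow> 'n) \<Rightarrow> 'm \<Rightarrow> 'n) \<Rightarrow>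
     ('r, 'm \<Rightarrow> 'n) module" where
  "mhom_module A M N s = mk_module (mhom A M N) (\<lambda>x\<in>carrier M. \<zero>\<^bsub>N\<^esub>)
     (\<lambda>f g. \<lambda>x\<in>carrier M. f x \<oplus>\<^bsub>N\<^esub> g x) s"

definition End_ring :: "('k, 'l) module \<Rightarrow> ('l, 'm) module \<Rightarrow> ('m \<Rightarrow> 'm) ring" where
  "End_ring A M = \<lparr>carrier = mhom A M M,
     mult = (\<lambda>g h. compose (carrier M) g h), one = (\<lambda>x\<in>carrier M. x),
     zero = (\<lambda>x\<in>carrier M. \<zero>\<^bsub>M\<^esub>), add = (\<lambda>f g. \<lambda>x\<in>carrier M. f x \<oplus>\<^bsub>M\<^esub> g x)\<rparr>"

definition module_iso :: "('k, 'l) module \<Rightarrow> ('l, 'm) module \<Rightarrow> ('l, 'n) module \<Rightarrow> bool" where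
  "module_iso A M N \<longleftrightarrow> (\<exists>h\<in>mhom A M N. bij_betw h (carrier M) (carrier N))"

definition quot_module :: "('r, 'm) module \<Rightarrow> 'm set \<Rightarrow> ('r, 'm set) module" where
  "quot_module M N = mk_module (a_rcosets\<^bsub>M\<^esub> N) N (set_add M)
     (\<lambda>r X. N <+>\<^bsub>M\<^esub> ((\<lambda>x. r \<odot>\<^bsub>M\<^esub> x) ` X))"

text \<open>The external direct sum; all index sets used below are finite.\<close>

definition dir_sum :: "'i set \<Rightarrow> ('i \<Rightarrow> ('l, 'm) module) \<Rightarrow> ('l, 'i \<Rightarrow> 'm) module" where
  "dir_sum I M = mk_module (\<Pi>\<^sub>E i\<in>I. carrier (M i)) (\<lambda>i\<in>I. \<zero>\<^bsub>M i\<^esub>)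
     (\<lambda>x y. \<lambda>i\<in>I. x i \<oplus>\<^bsub>M i\<^esub> y i) (\<lambda>r x. \<lambda>i\<in>I. r \<odot>\<^bsub>M i\<^esub> x i)"

section \<open>Simple, indecomposable and projective modules\<close>

definition simple_module :: "('k::field, 'l) module \<Rightarrow> ('l, 'm) module \<Rightarrow> bool" where
  "simple_module A M \<longleftrightarrow> fd_module A M \<and> carrier M \<noteq> {\<zero>\<^bsub>M\<^esub>} \<and>
     (\<forall>U. Module.submodule U A M \<longrightarrow> U = {\<zero>\<^bsub>M\<^esub>} \<or> U = carrier M)"

definition indecomposable :: "('k, 'l) module \<Rightarrow> ('l, 'm) module \<Rightarrow> bool" where
  "indecomposable A M \<longleftrightarrow> carrier M \<noteq> {\<zero>\<^bsub>M\<^esub>} \<and>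
     (\<forall>U W. Module.submodule U A M \<and> Module.submodule W A M \<and> U \<inter> W = {\<zero>\<^bsub>M\<^esub>} \<and> U <+>\<^bsub>M\<^esub> W = carrier M
        \<longrightarrow> U = {\<zero>\<^bsub>M\<^esub>} \<or> W = {\<zero>\<^bsub>M\<^esub>})"

definition internal_dir_sum :: "('k, 'l) module \<Rightarrow> ('l, 'm) module \<Rightarrow> nat \<Rightarrow> (nat \<Rightarrow> 'm set) \<Rightarrow> bool" where
  "internal_dir_sum A M m Q \<longleftrightarrow> (\<forall>i<m. Module.submodule (Q i) A M) \<and>
     (\<forall>x\<in>carrier M. \<exists>!q. q \<in> (\<Pi>\<^sub>E i\<in>{..<m}. Q i) \<and> x = (\<Oplus>\<^bsub>M\<^esub> i\<in>{..<m}. q i))"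

definition basic :: "('k, 'l) module \<Rightarrow> bool" where
  "basic A \<longleftrightarrow> (\<forall>m Q. internal_dir_sum A (regular A) m Q \<and>
       (\<forall>i<m. indecomposable A ((regular A)\<lparr>carrier := Q i\<rparr>)) \<longrightarrow>
     (\<forall>i<m. \<forall>j<m. i \<noteq> j \<longrightarrow>
       \<not> module_iso A ((regular A)\<lparr>carrier := Q i\<rparr>) ((regular A)\<lparr>carrier := Q j\<rparr>)))"

text \<open>
  A quantification over all finite dimensional modules is a quantification over the modules with
  carrier in \<open>nat \<Rightarrow> 'k\<close>, where \<open>'k\<close> is the base field: by choosing a basis, every finite
  dimensional module is isomorphic to one of these.
\<close>

definition projective :: "('k::field, 'l) module \<Rightarrow> ('l, 'm) module \<Rightarrow> bool" where
  "projective A P \<longleftrightarrow> fd_module A P \<and>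
     (\<forall>(X :: ('l, nat \<Rightarrow> 'k) module) (Y :: ('l, nat \<Rightarrow> 'k) module). \<forall>g\<in>mhom A X Y. \<forall>f\<in>mhom A P Y.
        fd_module A X \<and> fd_module A Y \<and> g ` carrier X = carrier Y \<longrightarrow>
        (\<exists>h\<in>mhom A P X. compose (carrier P) g h = f))"

text \<open>Every right ideal is projective; for finite dimensional algebras this is left-right symmetric.\<close>

definition hereditary :: "('k::field, 'l) module \<Rightarrow> bool" where
  "hereditary A \<longleftrightarrow>
     (\<forall>I. Module.submodule I A (regular A) \<longrightarrow> projective A ((regular A)\<lparr>carrier := I\<rparr>))"

definition projective_cover ::
  "('k::field, 'l) module \<Rightarrow> ('l, 'p) module \<Rightarrow> ('l, 'm) module \<Rightarrow> bool" where
  "projective_cover A P M \<longleftrightarrow> projective A P \<and>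
     (\<exists>p\<in>mhom A P M. p ` carrier P = carrier M \<and>
        (\<forall>U. Module.submodule U A P \<and> p ` U = carrier M \<longrightarrow> U = carrier P))"

definition complete_simples ::
  "('k::field, 'l) module \<Rightarrow> nat \<Rightarrow> (nat \<Rightarrow> ('l, 's) module) \<Rightarrow> bool" where
  "complete_simples A n S \<longleftrightarrow> (\<forall>i<n. simple_module A (S i)) \<and>
     (\<forall>i<n. \<forall>j<n. i \<noteq> j \<longrightarrow> \<not> module_iso A (S i) (S j)) \<and>
     (\<forall>T :: ('l, nat \<Rightarrow> 'k) module. simple_module A T \<longrightarrow> (\<exists>i<n. module_iso A T (S i)))"

definition maximal_submodule :: "('k, 'l) module \<Rightarrow> ('l, 'm) module \<Rightarrow> 'm set \<Rightarrow> bool" where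
  "maximal_submodule A M U \<longleftrightarrow> Module.submodule U A M \<and> U \<noteq> carrier M \<and>
     (\<forall>W. Module.submodule W A M \<and> U \<subseteq> W \<longrightarrow> W = U \<or> W = carrier M)"

definition radical :: "('k, 'l) module \<Rightarrow> ('l, 'm) module \<Rightarrow> 'm set" where
  "radical A M = {x \<in> carrier M. \<forall>U. maximal_submodule A M U \<longrightarrow> x \<in> U}"

definition rad_module :: "('k, 'l) module \<Rightarrow> ('l, 'm) module \<Rightarrow> ('l, 'm) module" where
  "rad_module A M = M\<lparr>carrier := radical A M\<rparr>"

section \<open>First extension groups\<close>

text \<open>
  \<open>Ext1\<close> is computed from the canonical free presentation of \<open>M\<close>, namely the free right module on
  the set of all elements of \<open>M\<close> (functions of finite support) mapping onto \<open>M\<close> with kernel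
  \<open>syzygy A M\<close>: it is the cokernel of the restriction map from homomorphisms on the free module to
  homomorphisms on the kernel. Endomorphisms of \<open>N\<close> act on it from the left by composition.
\<close>

definition free_module :: "('k, 'l) module \<Rightarrow> 'm set \<Rightarrow> ('l, 'm \<Rightarrow> 'l) module" where
  "free_module A X = mk_module
     {g. finite {x. g x \<noteq> \<zero>\<^bsub>A\<^esub>} \<and> (\<forall>x\<in>X. g x \<in> carrier A) \<and> (\<forall>x. x \<notin> X \<longrightarrow> g x = \<zero>\<^bsub>A\<^esub>)}
     (\<lambda>x. \<zero>\<^bsub>A\<^esub>) (\<lambda>g h x. g x \<oplus>\<^bsub>A\<^esub> h x) (\<lambda>r g x. g x \<otimes>\<^bsub>A\<^esub> r)"

definition free_eval :: "('k, 'l) module \<Rightarrow> ('l, 'm) module \<Rightarrow> ('m \<Rightarrow> 'l) \<Rightarrow> 'm" where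
  "free_eval A M g = (\<Oplus>\<^bsub>M\<^esub> x\<in>{x. g x \<noteq> \<zero>\<^bsub>A\<^esub>}. g x \<odot>\<^bsub>M\<^esub> x)"

definition syzygy :: "('k, 'l) module \<Rightarrow> ('l, 'm) module \<Rightarrow> ('l, 'm \<Rightarrow> 'l) module" where
  "syzygy A M = (free_module A (carrier M))
     \<lparr>carrier := {g \<in> carrier (free_module A (carrier M)). free_eval A M g = \<zero>\<^bsub>M\<^esub>}\<rparr>"

definition Ext1 ::
  "('k, 'l) module \<Rightarrow> ('l, 'm) module \<Rightarrow> ('l, 'n) module \<Rightarrow>
     ('n \<Rightarrow> 'n, (('m \<Rightarrow> 'l) \<Rightarrow> 'n) set) module" where
  "Ext1 A M N = quot_module
     (mhom_module A (syzygy A M) N (\<lambda>e h. compose (carrier (syzygy A M)) e h))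
     ((\<lambda>h. restrict h (carrier (syzygy A M))) ` mhom A (free_module A (carrier M)) N)"

definition Ext1_vanishes :: "('k, 'l) module \<Rightarrow> ('l, 'm) module \<Rightarrow> ('l, 'n) module \<Rightarrow> bool" where
  "Ext1_vanishes A M N \<longleftrightarrow> carrier (Ext1 A M N) = {\<zero>\<^bsub>Ext1 A M N\<^esub>}"

section \<open>Dimension vectors and real Schur roots\<close>

text \<open>
  Vectors in \<open>\<nat>\<^sup>n\<close> are functions on \<open>nat\<close> of which only the values at \<open>i < n\<close> matter.
  The division algebra attached to the index \<open>i\<close> acts on \<open>Hom(P\<^sub>i, V)\<close> as \<open>End(P\<^sub>i)\<close>, from the
  right by precomposition, and on \<open>Ext\<^sup>1(S\<^sub>j, S\<^sub>i)\<close> as \<open>End(S\<^sub>i)\<close>.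
\<close>

definition dim_vector ::
  "('k, 'l) module \<Rightarrow> (nat \<Rightarrow> ('l, 'p) module) \<Rightarrow> ('l, 'm) module \<Rightarrow> nat \<Rightarrow> nat" where
  "dim_vector A P V i = dimension (End_ring A (P i))
     (mhom_module A (P i) V (\<lambda>e h. compose (carrier (P i)) h e))"

definition ext_dim :: "('k, 'l) module \<Rightarrow> (nat \<Rightarrow> ('l, 's) module) \<Rightarrow> nat \<Rightarrow> nat \<Rightarrow> nat" where
  "ext_dim A S j i =
     (if i = j then 0 else dimension (End_ring A (S i)) (Ext1 A (S j) (S i)))"

definition is_division_ring :: "('r, 'c) ring_scheme \<Rightarrow> bool" where
  "is_division_ring R \<longleftrightarrow> ring R \<and> Units R = carrier R - {\<zero>\<^bsub>R\<^esub>}"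

definition exceptional :: "('k::field, 'l) module \<Rightarrow> ('l, 'm) module \<Rightarrow> bool" where
  "exceptional A M \<longleftrightarrow> fd_module A M \<and> Ext1_vanishes A M M \<and> is_division_ring (End_ring A M)"

definition exceptional_of_dim ::
  "('k::field, 'l) module \<Rightarrow> nat \<Rightarrow> (nat \<Rightarrow> ('l, 'p) module) \<Rightarrow> (nat \<Rightarrow> nat) \<Rightarrow> ('l, 'm) module \<Rightarrow> bool"
  where
  "exceptional_of_dim A n P \<beta> M \<longleftrightarrow> exceptional A M \<and> (\<forall>i<n. dim_vector A P M i = \<beta> i)"

definition real_schur_root ::
  "('k::field, 'l) module \<Rightarrow> nat \<Rightarrow> (nat \<Rightarrow> ('l, 'p) module) \<Rightarrow> (nat \<Rightarrow> nat) \<Rightarrow> bool" where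
  "real_schur_root A n P \<beta> \<longleftrightarrow> (\<exists>M :: ('l, nat \<Rightarrow> 'k) module. exceptional_of_dim A n P \<beta> M)"

section \<open>The representation space\<close>

definition proj_sum :: "nat \<Rightarrow> (nat \<Rightarrow> ('l, 'p) module) \<Rightarrow> (nat \<Rightarrow> nat) \<Rightarrow>
    ('l, nat \<Rightarrow> nat \<Rightarrow> 'p) module" where
  "proj_sum n P \<alpha> = dir_sum {..<n} (\<lambda>i. dir_sum {..<\<alpha> i} (\<lambda>_. P i))"

text \<open>
  \<open>src_block\<close> is \<open>\<Oplus>\<^sub>j P\<^sub>i\<^bsup>\<alpha>\<^sub>j d\<^sub>j\<^sub>i\<^esup>\<close>: the summand with index \<open>(j, a, b)\<close> is the \<open>b\<close>-th of the \<open>d j i\<close>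
  copies of \<open>P i\<close> that belong to the \<open>a\<close>-th copy of \<open>P j\<close> in \<open>P(\<alpha>)\<close>.
\<close>

definition src_block ::
  "nat \<Rightarrow> (nat \<Rightarrow> nat \<Rightarrow> nat) \<Rightarrow> (nat \<Rightarrow> ('l, 'p) module) \<Rightarrow> (nat \<Rightarrow> nat) \<Rightarrow> nat \<Rightarrow>
     ('l, nat \<times> nat \<times> nat \<Rightarrow> 'p) module" where
  "src_block n d P \<alpha> i = dir_sum {(j, a, b). j < n \<and> a < \<alpha> j \<and> b < d j i} (\<lambda>_. P i)"

definition src ::
  "nat \<Rightarrow> (nat \<Rightarrow> nat \<Rightarrow> nat) \<Rightarrow> (nat \<Rightarrow> ('l, 'p) module) \<Rightarrow> (nat \<Rightarrow> nat) \<Rightarrow>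
     ('l, nat \<Rightarrow> nat \<times> nat \<times> nat \<Rightarrow> 'p) module" where
  "src n d P \<alpha> = dir_sum {..<n} (src_block n d P \<alpha>)"

definition phi_sum ::
  "nat \<Rightarrow> (nat \<Rightarrow> nat \<Rightarrow> nat) \<Rightarrow> (nat \<Rightarrow> ('l, 'p) module) \<Rightarrow> (nat \<Rightarrow> (nat \<Rightarrow> nat \<Rightarrow> 'p) \<Rightarrow> 'p) \<Rightarrow>
     (nat \<Rightarrow> nat) \<Rightarrow> (nat \<Rightarrow> nat \<times> nat \<times> nat \<Rightarrow> 'p) \<Rightarrow> nat \<Rightarrow> nat \<Rightarrow> 'p" where
  "phi_sum n d P \<phi> \<alpha> = (\<lambda>x\<in>carrier (src n d P \<alpha>). \<lambda>j\<in>{..<n}. \<lambda>a\<in>{..<\<alpha> j}.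
     \<phi> j (\<lambda>i\<in>{..<n}. \<lambda>b\<in>{..<d j i}. x i (j, a, b)))"

definition block_homs ::
  "('k, 'l) module \<Rightarrow> nat \<Rightarrow> (nat \<Rightarrow> nat \<Rightarrow> nat) \<Rightarrow> (nat \<Rightarrow> ('l, 'p) module) \<Rightarrow> (nat \<Rightarrow> nat) \<Rightarrow>
     ((nat \<Rightarrow> nat \<times> nat \<times> nat \<Rightarrow> 'p) \<Rightarrow> nat \<Rightarrow> nat \<Rightarrow> 'p) set" where
  "block_homs A n d P \<alpha> = {(\<lambda>x\<in>carrier (src n d P \<alpha>). \<lambda>i\<in>{..<n}. h i (x i)) | h.
     \<forall>i<n. h i \<in> mhom A (src_block n d P \<alpha> i) (dir_sum {..<\<alpha> i} (\<lambda>_. P i))}"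

definition Rep ::
  "('k, 'l) module \<Rightarrow> nat \<Rightarrow> (nat \<Rightarrow> nat \<Rightarrow> nat) \<Rightarrow> (nat \<Rightarrow> ('l, 'p) module) \<Rightarrow>
     (nat \<Rightarrow> (nat \<Rightarrow> nat \<Rightarrow> 'p) \<Rightarrow> 'p) \<Rightarrow> (nat \<Rightarrow> nat) \<Rightarrow>
     ((nat \<Rightarrow> nat \<Rightarrow> 'p) \<Rightarrow> nat \<Rightarrow> nat \<Rightarrow> 'p) set" where
  "Rep A n d P \<phi> \<alpha> = {f \<in> mhom A (rad_module A (proj_sum n P \<alpha>)) (proj_sum n P \<alpha>).
     compose (carrier (src n d P \<alpha>)) f (phi_sum n d P \<phi> \<alpha>) \<in> block_homs A n d P \<alpha>}"

definition Rep_space ::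
  "('k::field, 'l) module \<Rightarrow> nat \<Rightarrow> (nat \<Rightarrow> nat \<Rightarrow> nat) \<Rightarrow> (nat \<Rightarrow> ('l, 'p) module) \<Rightarrow>
     (nat \<Rightarrow> (nat \<Rightarrow> nat \<Rightarrow> 'p) \<Rightarrow> 'p) \<Rightarrow> (nat \<Rightarrow> nat) \<Rightarrow>
     ('k, (nat \<Rightarrow> nat \<Rightarrow> 'p) \<Rightarrow> nat \<Rightarrow> nat \<Rightarrow> 'p) module" where
  "Rep_space A n d P \<phi> \<alpha> =
     (mhom_module A (rad_module A (proj_sum n P \<alpha>)) (proj_sum n P \<alpha>)
        (\<lambda>c f. \<lambda>x\<in>radical A (proj_sum n P \<alpha>). (c \<odot>\<^bsub>A\<^esub> \<one>\<^bsub>A\<^esub>) \<odot>\<^bsub>proj_sum n P \<alpha>\<^esub> f x))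
     \<lparr>carrier := Rep A n d P \<phi> \<alpha>\<rparr>"

definition rep_module ::
  "('k, 'l) module \<Rightarrow> nat \<Rightarrow> (nat \<Rightarrow> ('l, 'p) module) \<Rightarrow> (nat \<Rightarrow> nat) \<Rightarrow>
     ((nat \<Rightarrow> nat \<Rightarrow> 'p) \<Rightarrow> nat \<Rightarrow> nat \<Rightarrow> 'p) \<Rightarrow> ('l, (nat \<Rightarrow> nat \<Rightarrow> 'p) set) module" where
  "rep_module A n P \<alpha> f = quot_module (proj_sum n P \<alpha>)
     ((\<lambda>x. f x \<ominus>\<^bsub>proj_sum n P \<alpha>\<^esub> x) ` radical A (proj_sum n P \<alpha>))"

section \<open>The Zariski topology of a finite dimensional vector space\<close>

text \<open>
  Polynomial functions are generated by the linear functionals, hence do not refer to a basis.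
  Only their values on \<open>carrier V\<close> matter.
\<close>

definition linear_functional :: "('k::field, 'v) module \<Rightarrow> ('v \<Rightarrow> 'k) \<Rightarrow> bool" where
  "linear_functional V l \<longleftrightarrow>
     (\<forall>x\<in>carrier V. \<forall>y\<in>carrier V. l (x \<oplus>\<^bsub>V\<^esub> y) = l x + l y) \<and>
     (\<forall>c. \<forall>x\<in>carrier V. l (c \<odot>\<^bsub>V\<^esub> x) = c * l x)"

inductive_set poly_functions :: "('k::field, 'v) module \<Rightarrow> ('v \<Rightarrow> 'k) set"
  for V :: "('k::field, 'v) module" where
  const: "(\<lambda>_. c) \<in> poly_functions V"
| linear: "linear_functional V l \<Longrightarrow> l \<in> poly_functions V"
| add: "p \<in> poly_functions V \<Longrightarrow> q \<in> poly_functions V \<Longrightarrow> (\<lambda>x. p x + q x) \<in> poly_functions V"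
| mult: "p \<in> poly_functions V \<Longrightarrow> q \<in> poly_functions V \<Longrightarrow> (\<lambda>x. p x * q x) \<in> poly_functions V"

definition zero_locus :: "('k::field, 'v) module \<Rightarrow> ('v \<Rightarrow> 'k) set \<Rightarrow> 'v set" where
  "zero_locus V E = {v \<in> carrier V. \<forall>p\<in>E. p v = 0}"

definition zariski :: "('k::field, 'v) module \<Rightarrow> 'v topology" where
  "zariski V = topology (\<lambda>U. \<exists>E \<subseteq> poly_functions V. U = carrier V - zero_locus V E)"

lemma istopology_zariski:
  "istopology (\<lambda>U. \<exists>E \<subseteq> poly_functions V. U = carrier V - zero_locus V E)"
  (is "istopology ?O")
  unfolding istopology_def
proof (intro conjI allI impI)
  fix U W assume "?O U" "?O W"
  then obtain E F where E: "E \<subseteq> poly_functions V" "U = carrier V - zero_locus V E"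
    and F: "F \<subseteq> poly_functions V" "W = carrier V - zero_locus V F"
    by (elim exE conjE)
  let ?G = "(\<lambda>(p, q). \<lambda>x. p x * q x) ` (E \<times> F)"
  have G: "?G \<subseteq> poly_functions V"
    using E(1) F(1) by (auto intro: poly_functions.mult)
  have "v \<in> U \<inter> W \<longleftrightarrow> v \<in> carrier V - zero_locus V ?G" for v
    unfolding E(2) F(2) zero_locus_def by simp metis
  then have "U \<inter> W = carrier V - zero_locus V ?G" by (rule Set.set_eqI)
  with G show "?O (U \<inter> W)" by (intro exI[of _ ?G] conjI)
next
  fix \<K> assume K: "\<forall>U\<in>\<K>. ?O U"
  let ?G = "{p \<in> poly_functions V. {v \<in> carrier V. p v \<noteq> 0} \<subseteq> \<Union>\<K>}"
  have "\<Union>\<K> = carrier V - zero_locus V ?G"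
  proof (intro Set.set_eqI iffI)
    fix v assume "v \<in> \<Union>\<K>"
    then obtain U where U: "U \<in> \<K>" "v \<in> U" by (elim UnionE)
    from K U(1) have "?O U" by (rule bspec)
    then obtain E where E: "E \<subseteq> poly_functions V" "U = carrier V - zero_locus V E"
      by (elim exE conjE)
    then obtain p where p: "p \<in> E" "p v \<noteq> 0" "v \<in> carrier V"
      using U(2) by (auto simp: zero_locus_def)
    have "{v \<in> carrier V. p v \<noteq> 0} \<subseteq> U"
      using p(1) unfolding E(2) zero_locus_def by auto
    then have "p \<in> ?G"
      using p(1) E(1) U(1) by auto
    have "v \<notin> zero_locus V ?G"
    proof
      assume "v \<in> zero_locus V ?G"
      then have "\<forall>q\<in>?G. q v = 0" unfolding zero_locus_def mem_Collect_eq by (rule conjunct2)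
      from this \<open>p \<in> ?G\<close> have "p v = 0" by (rule bspec)
      with p(2) show False by (rule notE)
    qed
    with p(3) show "v \<in> carrier V - zero_locus V ?G" by (rule DiffI)
  next
    fix v assume "v \<in> carrier V - zero_locus V ?G"
    then obtain p where "p \<in> ?G" "p v \<noteq> 0" "v \<in> carrier V"
      unfolding zero_locus_def by force
    then show "v \<in> \<Union>\<K>" by auto
  qed
  then show "?O (\<Union>\<K>)" by (intro exI[of _ ?G] conjI Collect_restrict)
qed

lemma openin_zariski:
  "openin (zariski V) U \<longleftrightarrow> (\<exists>E \<subseteq> poly_functions V. U = carrier V - zero_locus V E)"
  unfolding zariski_def by (subst topology_inverse'[OF istopology_zariski]) (rule refl)

lemma topspace_zariski: "topspace (zariski V) = carrier V"
proof -
  have "carrier V = carrier V - zero_locus V {\<lambda>_. 1}"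
    by (auto simp: zero_locus_def)
  moreover have "{\<lambda>_. 1} \<subseteq> poly_functions V" by (auto intro: poly_functions.const)
  ultimately have "openin (zariski V) (carrier V)"
    unfolding openin_zariski by (intro exI[of _ "{\<lambda>_. 1}"] conjI)
  moreover have "topspace (zariski V) \<subseteq> carrier V"
    using openin_topspace[of "zariski V"] unfolding openin_zariski by (elim exE conjE) simp
  ultimately show ?thesis by (intro subset_antisym openin_subset)
qed

end

theory Submission
  imports Defs
begin

text \<open>
  Put \<open>N = \<Oplus>\<^sub>l M\<^sub>l\<^bsup>c\<^sub>l\<^esup>\<close>, write \<open>inc\<close> for the inclusion \<open>rad P(\<alpha>) \<rightarrow> P(\<alpha>)\<close>, and let \<open>U\<close> be the set of the
  \<open>f\<close> in the representation space whose cokernel \<open>N\<^sub>f = coker (f - inc)\<close> is isomorphic to \<open>N\<close>. Over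
  an infinite field any two nonempty open subsets of an affine space meet, since they meet on a line
  (\<open>zariski_dense\<close>). So it suffices that \<open>U\<close> is nonempty and open.

  \<^emph>\<open>\<open>U\<close> is not empty\<close> (\<open>Rep_presents\<close>). The algebra being hereditary, the endomorphism ring of \<open>P\<^sub>i\<close> is a
  division ring (\<open>endo_bij\<close>). Hence \<open>Hom(P\<^sub>i, N)\<close> has a basis over it, of \<open>\<alpha>\<^sub>i\<close> elements by the choice of
  \<open>\<alpha>\<close>; such a basis is a map \<open>P\<^sub>i\<^bsup>\<alpha>\<^sub>i\<^esup> \<rightarrow> N\<close> through which every map \<open>P\<^sub>i \<rightarrow> N\<close> factors in exactly one way
  (\<open>frame\<close>, \<open>frame_multiples\<close>). Together these maps form \<open>\<tau> : P(\<alpha>) \<rightarrow> N\<close>, which is onto because every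
  module is generated by images of the \<open>P\<^sub>i\<close> (\<open>generator\<close>). Factoring \<open>\<tau>\<close> on the summands of
  \<open>rad P(\<alpha>)\<close> block by block gives a block diagonal \<open>f\<close> with \<open>\<tau> \<circ> f = \<tau> \<circ> inc\<close>, so that the image \<open>I\<close> of
  \<open>f - inc\<close> lies in the kernel of \<open>\<tau>\<close>. The two are equal: modulo \<open>I\<close> every map \<open>P\<^sub>i \<rightarrow> P(\<alpha>)\<close> is congruent to
  one into the block \<open>P\<^sub>i\<^bsup>\<alpha>\<^sub>i\<^esup>\<close>, since replacing radical elements by their images under \<open>f\<close> moves the other
  components to summands of smaller dimension (\<open>reduce_to_block\<close>), and on that block \<open>\<tau>\<close> kills no
  nonzero map from \<open>P\<^sub>i\<close>.

  \<^emph>\<open>\<open>U\<close> is open\<close> (\<open>iso_locus_neighbourhood\<close>). Fix \<open>f\<^sub>0\<close> in \<open>U\<close>. A pair \<open>(g, h)\<close> of endomorphisms of \<open>P(\<alpha>)\<close>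
  and \<open>rad P(\<alpha>)\<close> with \<open>g \<circ> (f\<^sub>0 - inc) = (f - inc) \<circ> h\<close> induces a map \<open>N\<^bsub>f\<^sub>0\<^esub> \<rightarrow> N\<^sub>f\<close>. This is a linear
      system
  for \<open>(g, h)\<close> whose coefficients are affine in \<open>f\<close>. At \<open>f = f\<^sub>0\<close> the system has full rank because
  \<open>Ext\<^sup>1(N, N) = 0\<close> (\<open>presentation_surjective\<close>), which is where the modules \<open>M\<^sub>l\<close> must not extend each
  other. By Cramer's rule there is a solution that is polynomial in \<open>f\<close> and equals \<open>(id, id)\<close> at \<open>f\<^sub>0\<close>, and
  the points where the determinant of its first component does not vanish form a neighbourhood of
  \<open>f\<^sub>0\<close> in \<open>U\<close>. There \<open>h\<close> is bijective as well, for \<open>f\<^sub>0 - inc\<close> is injective (\<open>rel_inj\<close>).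

  The vanishing of \<open>Ext\<^sup>1\<close>, defined by free presentations, is used in the form that homomorphisms from the
  kernel of any epimorphism \<open>Y \<rightarrow> N\<close> to \<open>N\<close> extend to \<open>Y\<close> (\<open>extension_property_Ext1\<close>); in this form it
  passes to direct sums in both arguments.
\<close>

section \<open>Linear algebra with separating functionals\<close>

locale kspace = abelian_group V for V :: "('k::field, 'v) module" (structure) +
  assumes smult_closed [simp, intro]: "x \<in> carrier V \<Longrightarrow> a \<odot> x \<in> carrier V"
    and smult_l_distr: "x \<in> carrier V \<Longrightarrow> (a + b) \<odot> x = a \<odot> x \<oplus> b \<odot> x"
    and smult_r_distr: "\<lbrakk>x \<in> carrier V; y \<in> carrier V\<rbrakk> \<Longrightarrow> a \<odot> (x \<oplus> y) = a \<odot> x \<oplus> a \<odot> y"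
    and smult_assoc: "x \<in> carrier V \<Longrightarrow> (a * b) \<odot> x = a \<odot> (b \<odot> x)"
    and smult_one [simp]: "x \<in> carrier V \<Longrightarrow> 1 \<odot> x = x"
begin

lemma smult_zero_left [simp]: "x \<in> carrier V \<Longrightarrow> 0 \<odot> x = \<zero>"
  using smult_l_distr[of x 0 0] by (metis add.l_cancel_one' add_0 smult_closed)

lemma smult_zero_right [simp]: "a \<odot> \<zero> = \<zero>"
  using smult_r_distr[of \<zero> \<zero> a] by (metis add.l_cancel_one' l_zero smult_closed zero_closed)

lemma smult_minus_one: "x \<in> carrier V \<Longrightarrow> (- 1) \<odot> x = \<ominus> x"
  using smult_l_distr[of x 1 "- 1"]
  by (metis add.inv_equality add.right_inverse add.m_comm smult_closed smult_one smult_zero_left)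

lemma minus_zeroD: "x \<ominus> y = \<zero> \<Longrightarrow> x \<in> carrier V \<Longrightarrow> y \<in> carrier V \<Longrightarrow> x = y"
  by simp

lemma finsum_smult:
  assumes "c \<in> I \<rightarrow> carrier V"
  shows "a \<odot> (\<Oplus>i\<in>I. c i) = (\<Oplus>i\<in>I. a \<odot> c i)"
  using assms
proof (induction I rule: infinite_finite_induct)
  case (insert x F)
  then have *: "c \<in> F \<rightarrow> carrier V" "c x \<in> carrier V" by auto
  then show ?case using insert by (simp add: Pi_def smult_r_distr)
qed (simp_all)

end

definition linear_subspace :: "('k::field, 'v) module \<Rightarrow> 'v set \<Rightarrow> bool" where
  "linear_subspace V W \<longleftrightarrow> W \<subseteq> carrier V \<and> \<zero>\<^bsub>V\<^esub> \<in> W \<and> (\<forall>x\<in>W. \<forall>y\<in>W. x \<oplus>\<^bsub>V\<^esub> y \<in> W) \<and>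
     (\<forall>a. \<forall>x\<in>W. a \<odot>\<^bsub>V\<^esub> x \<in> W)"

text \<open>
  Finite dimensionality is expressed by finitely many functionals that separate the points of a
  subset \<open>W\<close>: in this form it passes to subspaces, direct sums and spaces of homomorphisms without a
  choice of bases.
\<close>

definition separating :: "('k::field, 'v) module \<Rightarrow> 'v set \<Rightarrow> 'j set \<Rightarrow> ('j \<Rightarrow> 'v \<Rightarrow> 'k) \<Rightarrow> bool" where
  "separating V W J l \<longleftrightarrow> finite J \<and> (\<forall>j\<in>J. linear_functional V (l j)) \<and>
     (\<forall>w\<in>W. (\<forall>j\<in>J. l j w = 0) \<longrightarrow> w = \<zero>\<^bsub>V\<^esub>)"

definition finite_dim :: "('k::field, 'v) module \<Rightarrow> bool" where
  "finite_dim V \<longleftrightarrow> (\<exists>N (l :: nat \<Rightarrow> 'v \<Rightarrow> 'k). separating V (carrier V) {..<N} l)"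

definition independent :: "('k::field, 'v) module \<Rightarrow> nat \<Rightarrow> (nat \<Rightarrow> 'v) \<Rightarrow> bool" where
  "independent V m c \<longleftrightarrow> c \<in> {..<m} \<rightarrow> carrier V \<and>
     (\<forall>a. (\<Oplus>\<^bsub>V\<^esub>i\<in>{..<m}. a i \<odot>\<^bsub>V\<^esub> c i) = \<zero>\<^bsub>V\<^esub> \<longrightarrow> (\<forall>i<m. a i = 0))"

definition kdim :: "('k::field, 'v) module \<Rightarrow> nat" where
  "kdim V = (GREATEST m. \<exists>c. independent V m c)"

definition klinear :: "('k::field, 'v) module \<Rightarrow> ('k, 'w) module \<Rightarrow> ('v \<Rightarrow> 'w) \<Rightarrow> bool" where
  "klinear V W T \<longleftrightarrow> T \<in> carrier V \<rightarrow> carrier W \<and>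
     (\<forall>x\<in>carrier V. \<forall>y\<in>carrier V. T (x \<oplus>\<^bsub>V\<^esub> y) = T x \<oplus>\<^bsub>W\<^esub> T y) \<and>
     (\<forall>a. \<forall>x\<in>carrier V. T (a \<odot>\<^bsub>V\<^esub> x) = a \<odot>\<^bsub>W\<^esub> T x)"

lemma finite_dimI:
  assumes "separating V (carrier V) (J :: 'j set) l"
  shows "finite_dim V"
proof -
  have fin: "finite J" using assms by (simp add: separating_def)
  then obtain h where h: "bij_betw h {..<card J} J"
    using ex_bij_betw_nat_finite[OF fin] by (metis lessThan_atLeast0)
  have "separating V (carrier V) {..<card J} (\<lambda>i. l (h i))"
    using assms h unfolding separating_def bij_betw_def
    by (metis finite_lessThan imageE imageI)
  then show ?thesis unfolding finite_dim_def by blast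
qed

lemma linear_functional_add:
  "linear_functional V l \<Longrightarrow> x \<in> carrier V \<Longrightarrow> y \<in> carrier V \<Longrightarrow> l (x \<oplus>\<^bsub>V\<^esub> y) = l x + l y"
  by (simp add: linear_functional_def)

lemma linear_functional_smult:
  "linear_functional V l \<Longrightarrow> x \<in> carrier V \<Longrightarrow> l (a \<odot>\<^bsub>V\<^esub> x) = a * l x"
  by (simp add: linear_functional_def)

lemma linear_functional_comp:
  "klinear V W T \<Longrightarrow> linear_functional W l \<Longrightarrow> linear_functional V (\<lambda>x. l (T x))"
  by (simp add: linear_functional_def klinear_def Pi_iff)

lemma linear_functional_combination:
  "linear_functional V l \<Longrightarrow> linear_functional V l' \<Longrightarrow> linear_functional V (\<lambda>x. l x - a * l' x)"
  by (simp add: linear_functional_def algebra_simps)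

context kspace
begin

lemma linear_functional_zero: "linear_functional V l \<Longrightarrow> l \<zero> = 0"
  using linear_functional_smult[of V l \<zero> 0] by simp

lemma linear_functional_minus:
  assumes "linear_functional V l" "x \<in> carrier V" "y \<in> carrier V"
  shows "l (x \<ominus> y) = l x - l y"
  using assms linear_functional_add[of V l x "(-1) \<odot> y"] linear_functional_smult[of V l y "-1"]
  by (simp add: smult_minus_one minus_eq)

lemma linear_functional_finsum:
  assumes l: "linear_functional V l" and "c \<in> I \<rightarrow> carrier V"
  shows "l (\<Oplus>i\<in>I. c i) = (\<Sum>i\<in>I. l (c i))"
  using assms(2)
proof (induction I rule: infinite_finite_induct)
  case (insert x F)
  then have *: "c \<in> F \<rightarrow> carrier V" "c x \<in> carrier V" by auto
  then show ?case using insert l by (simp add: linear_functional_add)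
qed (simp_all add: linear_functional_zero[OF l])

lemma linear_functional_lincomb:
  assumes l: "linear_functional V l" and "c \<in> I \<rightarrow> carrier V"
  shows "l (\<Oplus>i\<in>I. a i \<odot> c i) = (\<Sum>i\<in>I. a i * l (c i))"
  using assms
  by (subst linear_functional_finsum[OF l]) (auto intro!: sum.cong simp: linear_functional_smult[OF l]
    Pi_iff)

lemma lincomb_closed: "c \<in> I \<rightarrow> carrier V \<Longrightarrow> (\<Oplus>i\<in>I. a i \<odot> c i) \<in> carrier V"
  by (intro finsum_closed) (auto simp: Pi_iff)

lemma linear_subspace_minus:
  "linear_subspace V W \<Longrightarrow> x \<in> W \<Longrightarrow> y \<in> W \<Longrightarrow> x \<ominus> y \<in> W"
  unfolding linear_subspace_def minus_eq by (metis smult_minus_one subsetD)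

lemma linear_subspace_lincomb:
  assumes "linear_subspace V W" "c \<in> I \<rightarrow> W"
  shows "(\<Oplus>i\<in>I. a i \<odot> c i) \<in> W"
  using assms(2)
proof (induction I rule: infinite_finite_induct)
  case (insert x F)
  then have *: "c \<in> F \<rightarrow> carrier V" "c x \<in> carrier V" "c x \<in> W" "c \<in> F \<rightarrow> W"
    using assms(1) by (auto simp: linear_subspace_def)
  then have "(\<Oplus>i\<in>insert x F. a i \<odot> c i) = a x \<odot> c x \<oplus> (\<Oplus>i\<in>F. a i \<odot> c i)"
    using insert by (simp add: Pi_iff)
  with * insert show ?case using assms(1) by (simp add: linear_subspace_def)
qed (use assms(1) in \<open>simp_all add: linear_subspace_def\<close>)

text \<open>
  Elimination: a functional that does not vanish on the common kernel of the others contributes one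
  new vector. The dual functionals are defined on all of \<open>V\<close> although the vectors lie in \<open>W\<close>, so
  that they also split \<open>W\<close> off as a direct summand.
\<close>

lemma dual_basis_subspace:
  fixes l :: "nat \<Rightarrow> 'v \<Rightarrow> 'k"
  assumes "linear_subspace V W" and "separating V W {..<N} l"
  shows "\<exists>r (c :: nat \<Rightarrow> 'v) (\<mu> :: nat \<Rightarrow> 'v \<Rightarrow> 'k). c \<in> {..<r} \<rightarrow> W \<and> separating V W {..<r} \<mu> \<and>
           (\<forall>i<r. \<forall>j<r. \<mu> i (c j) = of_bool (i = j))"
  using assms
proof (induction N arbitrary: W)
  case 0
  then have "separating V W {..<0} l" by simp
  then show ?case by (intro exI[of _ 0] exI[of _ l]) (auto)
next
  case (Suc N)
  have lN: "linear_functional V (l N)" and lj: "\<And>j. j < N \<Longrightarrow> linear_functional V (l j)"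
    using Suc.prems(2) by (auto simp: separating_def)
  have WV: "W \<subseteq> carrier V" using Suc.prems(1) by (simp add: linear_subspace_def)
  define W' where "W' = {w \<in> W. l N w = 0}"
  have sub': "linear_subspace V W'"
    using Suc.prems(1) linear_functional_zero[OF lN] linear_functional_add[OF lN]
      linear_functional_smult[OF lN]
    unfolding linear_subspace_def W'_def by (auto simp: subset_iff)
  have "separating V W' {..<N} l"
    using Suc.prems(2) unfolding separating_def W'_def by (auto simp: lessThan_Suc)
  from Suc.IH[OF sub' this] obtain r :: nat and c \<mu> where
    c: "c \<in> {..<r} \<rightarrow> W'" and \<mu>: "separating V W' {..<r} \<mu>"
    and dual: "\<And>i j. i < r \<Longrightarrow> j < r \<Longrightarrow> \<mu> i (c j) = of_bool (i = j)" by blast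
  show ?case
  proof (cases "W' = W")
    case True
    then show ?thesis using c \<mu> dual by blast
  next
    case False
    then obtain w where w: "w \<in> W" "l N w \<noteq> 0" by (auto simp: W'_def)
    define c0 where "c0 = inverse (l N w) \<odot> w"
    have c0: "c0 \<in> W" "l N c0 = 1"
      using w WV Suc.prems(1) linear_functional_smult[OF lN]
      by (auto simp: c0_def linear_subspace_def subset_iff)
    define c' where "c' = c(r := c0)"
    define \<mu>' where "\<mu>' = (\<lambda>i x. \<mu> i x - \<mu> i c0 * l N x)(r := l N)"
    have lin: "linear_functional V (\<mu>' i)" if "i \<in> {..<Suc r}" for i
      using that \<mu> lN linear_functional_combination[of V "\<mu> i" "l N"]
      by (auto simp: \<mu>'_def separating_def less_Suc_eq)
    have "c' \<in> {..<Suc r} \<rightarrow> W"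
      using c c0 by (auto simp: c'_def W'_def Pi_iff less_Suc_eq)
    moreover have "separating V W {..<Suc r} \<mu>'"
      unfolding separating_def
    proof (intro conjI ballI impI lin)
      fix x assume x: "x \<in> W" and z: "\<forall>j\<in>{..<Suc r}. \<mu>' j x = 0"
      from z have "l N x = 0" by (auto simp: \<mu>'_def dest: bspec[of _ _ r])
      moreover have "\<mu> j x = 0" if "j < r" for j
        using z[rule_format, of j] that \<open>l N x = 0\<close> by (auto simp: \<mu>'_def)
      ultimately show "x = \<zero>" using \<mu> x by (auto simp: separating_def W'_def)
    qed auto
    moreover have "\<mu>' i (c' j) = of_bool (i = j)" if "i < Suc r" "j < Suc r" for i j
      using that dual[of i j] c c0 by (auto simp: \<mu>'_def c'_def less_Suc_eq W'_def Pi_iff)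
    ultimately show ?thesis by blast
  qed
qed

lemma linear_subspace_carrier: "linear_subspace V (carrier V)"
  by (auto simp: linear_subspace_def)

lemma dual_basis_exists:
  assumes "finite_dim V"
  shows "\<exists>(r :: nat) c \<mu>. c \<in> {..<r} \<rightarrow> carrier V \<and> separating V (carrier V) {..<r} \<mu> \<and>
    (\<forall>i<r. \<forall>j<r. \<mu> i (c j) = of_bool (i = j))"
proof -
  obtain N and l :: "nat \<Rightarrow> 'v \<Rightarrow> 'k" where "separating V (carrier V) {..<N} l"
    using assms unfolding finite_dim_def by blast
  from dual_basis_subspace[OF linear_subspace_carrier this] show ?thesis .
qed

lemma finite_dimE:
  assumes "finite_dim V"
  obtains r :: nat and c \<mu> where "c \<in> {..<r} \<rightarrow> carrier V" "separating V (carrier V) {..<r} \<mu>"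
    "\<And>i j. i < r \<Longrightarrow> j < r \<Longrightarrow> \<mu> i (c j) = of_bool (i = j)"
proof -
  from dual_basis_exists[OF assms]
  obtain r and c :: "nat \<Rightarrow> 'v" and \<mu> :: "nat \<Rightarrow> 'v \<Rightarrow> 'k"
    where "c \<in> {..<r} \<rightarrow> carrier V" "separating V (carrier V) {..<r} \<mu>"
      "\<forall>i<r. \<forall>j<r. \<mu> i (c j) = of_bool (i = j)" by (elim exE conjE)
  then show ?thesis by (intro that[of c r \<mu>]) simp_all
qed

lemma separating_eqI:
  assumes "separating V (carrier V) J l" "x \<in> carrier V" "y \<in> carrier V" "\<And>j. j \<in> J \<Longrightarrow> l j x = l j y"
  shows "x = y"
proof -
  have "\<forall>j\<in>J. l j (x \<ominus> y) = 0"
  proof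
    fix j assume j: "j \<in> J"
    then have "linear_functional V (l j)" using assms(1) by (simp add: separating_def)
    from linear_functional_minus[OF this assms(2,3)] assms(4)[OF j] show "l j (x \<ominus> y) = 0" by simp
  qed
  then have "x \<ominus> y = \<zero>"
    using assms(1) minus_closed[OF assms(2,3)] unfolding separating_def by blast
  then show ?thesis using assms(2,3) by simp
qed

text \<open>Both sides have the same coordinates, and coordinates separate.\<close>

lemma dual_basis_expansion:
  fixes r :: nat
  assumes c: "c \<in> {..<r} \<rightarrow> carrier V" and \<mu>: "separating V (carrier V) {..<r} \<mu>"
    and dual: "\<And>i j. i < r \<Longrightarrow> j < r \<Longrightarrow> \<mu> i (c j) = of_bool (i = j)" and x: "x \<in> carrier V"
  shows "x = (\<Oplus>i\<in>{..<r}. \<mu> i x \<odot> c i)"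
proof (rule separating_eqI[OF \<mu> x lincomb_closed[OF c]])
  fix j assume j: "j \<in> {..<r}"
  then have "\<mu> j (\<Oplus>i\<in>{..<r}. \<mu> i x \<odot> c i) = (\<Sum>i<r. \<mu> i x * \<mu> j (c i))"
    using \<mu> by (intro linear_functional_lincomb c) (auto simp: separating_def)
  also have "\<dots> = (\<Sum>i<r. if i = j then \<mu> i x else 0)"
    using j by (intro sum.cong) (auto simp: dual)
  finally show "\<mu> j x = \<mu> j (\<Oplus>i\<in>{..<r}. \<mu> i x \<odot> c i)" using j by simp
qed

lemma dual_basis_is_basis:
  fixes r :: nat
  assumes c: "c \<in> {..<r} \<rightarrow> carrier V" and \<mu>: "separating V (carrier V) {..<r} \<mu>"
    and dual: "\<And>i j. i < r \<Longrightarrow> j < r \<Longrightarrow> \<mu> i (c j) = of_bool (i = j)"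
  shows "is_basis class_ring V r c"
  unfolding is_basis_def
proof (intro conjI ballI)
  show "c \<in> {..<r} \<rightarrow> carrier V" by fact
  fix x assume x: "x \<in> carrier V"
  show "\<exists>!a. a \<in> {..<r} \<rightarrow>\<^sub>E carrier class_ring \<and> x = (\<Oplus>i\<in>{..<r}. a i \<odot> c i)"
  proof (intro ex1I[of _ "\<lambda>i\<in>{..<r}. \<mu> i x"] conjI)
    have "(\<Oplus>i\<in>{..<r}. (\<lambda>i\<in>{..<r}. \<mu> i x) i \<odot> c i) = (\<Oplus>i\<in>{..<r}. \<mu> i x \<odot> c i)"
      using c by (intro finsum_cong') auto
    then show "x = (\<Oplus>i\<in>{..<r}. (\<lambda>i\<in>{..<r}. \<mu> i x) i \<odot> c i)"
      using dual_basis_expansion[OF c \<mu> dual x] by simp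
    fix a :: "nat \<Rightarrow> 'k"
    assume a: "a \<in> {..<r} \<rightarrow>\<^sub>E carrier class_ring \<and> x = (\<Oplus>i\<in>{..<r}. a i \<odot> c i)"
    have "\<mu> j x = a j" if j: "j < r" for j
    proof -
      have "\<mu> j x = (\<Sum>i<r. a i * \<mu> j (c i))"
        using \<mu> j a linear_functional_lincomb[of "\<mu> j" c "{..<r}" a] c by (auto simp: separating_def)
      also have "\<dots> = (\<Sum>i<r. if i = j then a i else 0)"
        using j by (intro sum.cong) (auto simp: dual)
      finally show ?thesis using j by simp
    qed
    then show "a = (\<lambda>i\<in>{..<r}. \<mu> i x)" using a by (auto simp: PiE_iff extensional_def fun_eq_iff)
  qed auto
qed

lemma is_basis_finite_dim:
  assumes "is_basis class_ring V r c"
  shows "finite_dim V"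
proof -
  have c: "c \<in> {..<r} \<rightarrow> carrier V"
    and ex: "\<And>x. x \<in> carrier V \<Longrightarrow> \<exists>!a. a \<in> {..<r} \<rightarrow>\<^sub>E (UNIV :: 'k set) \<and> x = (\<Oplus>i\<in>{..<r}. a i \<odot> c i)"
    using assms unfolding is_basis_def by auto
  define X where "X x = (THE a. a \<in> {..<r} \<rightarrow>\<^sub>E (UNIV :: 'k set) \<and> x = (\<Oplus>i\<in>{..<r}. a i \<odot> c i))" for x
  have X: "x = (\<Oplus>i\<in>{..<r}. X x i \<odot> c i)" if "x \<in> carrier V" for x
    using theI'[OF ex[OF that]] unfolding X_def by blast
  have Xu: "X x i = a i" if "x \<in> carrier V" "x = (\<Oplus>i\<in>{..<r}. a i \<odot> c i)" "i < r" for x a i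
  proof -
    have "(\<Oplus>i\<in>{..<r}. (\<lambda>i\<in>{..<r}. a i) i \<odot> c i) = (\<Oplus>i\<in>{..<r}. a i \<odot> c i)"
      using c by (intro finsum_cong') auto
    then have "X x = (\<lambda>i\<in>{..<r}. a i)"
      unfolding X_def using that by (intro the1_equality[OF ex]) auto
    then show ?thesis using that(3) by simp
  qed
  have "separating V (carrier V) {..<r} (\<lambda>i x. X x i)"
    unfolding separating_def linear_functional_def
  proof (intro conjI ballI impI allI)
    fix i x y assume i: "i \<in> {..<r}" and xy: "x \<in> carrier V" "y \<in> carrier V"
    have "(\<Oplus>i\<in>{..<r}. (X x i + X y i) \<odot> c i) = (\<Oplus>i\<in>{..<r}. X x i \<odot> c i \<oplus> X y i \<odot> c i)"
      using c by (intro finsum_cong') (auto simp: smult_l_distr Pi_iff)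
    also have "\<dots> = (\<Oplus>i\<in>{..<r}. X x i \<odot> c i) \<oplus> (\<Oplus>i\<in>{..<r}. X y i \<odot> c i)"
      using c by (intro finsum_addf) (auto simp: Pi_iff)
    also have "\<dots> = x \<oplus> y" using X xy by metis
    finally have e: "x \<oplus> y = (\<Oplus>i\<in>{..<r}. (X x i + X y i) \<odot> c i)" by (rule sym)
    show "X (x \<oplus> y) i = X x i + X y i"
      by (rule Xu[OF _ e]) (use xy i in simp_all)
  next
    fix i a x assume i: "i \<in> {..<r}" and x: "x \<in> carrier V"
    have "(\<Oplus>i\<in>{..<r}. (a * X x i) \<odot> c i) = (\<Oplus>i\<in>{..<r}. a \<odot> (X x i \<odot> c i))"
      using c by (intro finsum_cong') (auto simp: smult_assoc Pi_iff)
    also have "\<dots> = a \<odot> (\<Oplus>i\<in>{..<r}. X x i \<odot> c i)"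
      using c by (subst finsum_smult) (auto simp: Pi_iff)
    also have "\<dots> = a \<odot> x" using X x by metis
    finally have e: "a \<odot> x = (\<Oplus>i\<in>{..<r}. (a * X x i) \<odot> c i)" by (rule sym)
    show "X (a \<odot> x) i = a * X x i"
      by (rule Xu[OF _ e]) (use x i in simp_all)
  next
    fix x assume x: "x \<in> carrier V" "\<forall>j\<in>{..<r}. X x j = 0"
    have "(\<Oplus>i\<in>{..<r}. X x i \<odot> c i) = (\<Oplus>i\<in>{..<r}. \<zero>)"
      using c x by (intro finsum_cong') (auto simp: Pi_iff)
    then show "x = \<zero>" using X[OF x(1)] by simp
  qed auto
  then show ?thesis by (rule finite_dimI)
qed

lemma finite_dim_iff_basis: "finite_dim V \<longleftrightarrow> (\<exists>n b. is_basis class_ring V n b)"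
  using is_basis_finite_dim dual_basis_is_basis finite_dimE by metis

end

text \<open>Padding the coefficient matrix with zero rows makes it square and singular.\<close>

lemma underdetermined_system:
  fixes c :: "nat \<Rightarrow> nat \<Rightarrow> 'k::field"
  assumes "N < m"
  shows "\<exists>a. (\<exists>i<m. a i \<noteq> 0) \<and> (\<forall>j<N. (\<Sum>i<m. a i * c j i) = 0)"
proof -
  define B where "B = mat m m (\<lambda>(j, i). if j < N then c j i else 0)"
  have B: "B \<in> carrier_mat m m" by (simp add: B_def)
  have "det B = 0"
    unfolding det_def'[OF B]
  proof (intro sum.neutral ballI)
    fix p assume "p \<in> {p. p permutes {0..<m}}"
    then have "p (m - 1) < m" using permutes_in_image[of p "{0..<m}" "m - 1"] assms by auto
    then have "B $$ (m - 1, p (m - 1)) = 0" using assms by (auto simp: B_def)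
    then have "(\<Prod>i = 0..<m. B $$ (i, p i)) = 0" using assms by (intro prod_zero bexI[of _ "m - 1"]) auto
    then show "signof p * (\<Prod>i = 0..<m. B $$ (i, p i)) = 0" by simp
  qed
  then obtain v where v: "v \<in> carrier_vec m" "v \<noteq> 0\<^sub>v m" "B *\<^sub>v v = 0\<^sub>v m"
    using det_0_iff_vec_prod_zero_field[OF B] by blast
  have "\<exists>i<m. v $ i \<noteq> 0" using v by (metis carrier_vecD eq_vecI index_zero_vec(1,2))
  moreover have "(\<Sum>i<m. v $ i * c j i) = 0" if "j < N" for j
  proof -
    have "(B *\<^sub>v v) $ j = (\<Sum>i<m. v $ i * c j i)"
      using v(1) that assms
        by (auto simp: B_def scalar_prod_def atLeast0LessThan mult.commute intro!: sum.cong)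
    then show ?thesis using v(3) that assms by simp
  qed
  ultimately show ?thesis by blast
qed

context kspace
begin

text \<open>
  With more vectors than functionals some nontrivial combination is killed by all functionals.
\<close>

lemma independent_le:
  assumes l: "separating V (carrier V) {..<N} l" and ind: "independent V m c"
  shows "m \<le> N"
proof (rule ccontr)
  assume "\<not> m \<le> N"
  then obtain a where a: "\<exists>i<m. a i \<noteq> 0" "\<forall>j<N. (\<Sum>i<m. a i * l j (c i)) = 0"
    using underdetermined_system[of N m "\<lambda>j i. l j (c i)"] by auto
  have c: "c \<in> {..<m} \<rightarrow> carrier V" using ind by (simp add: independent_def)
  have "(\<Oplus>i\<in>{..<m}. a i \<odot> c i) = \<zero>"
    using l a(2) lincomb_closed[OF c] by (auto simp: separating_def linear_functional_lincomb[OF _ c])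
  then show False using ind a(1) by (auto simp: independent_def)
qed

lemma kdim_ge:
  assumes "finite_dim V" "independent V m c"
  shows "m \<le> kdim V"
proof -
  obtain N l where l: "separating V (carrier V) {..<N} (l :: nat \<Rightarrow> _)"
    using assms(1) finite_dim_def by blast
  show ?thesis unfolding kdim_def
    using assms(2) independent_le[OF l] by (intro Greatest_le_nat[of _ _ N]) blast+
qed

lemma kdim_attained:
  assumes "finite_dim V"
  shows "\<exists>c. independent V (kdim V) c"
proof -
  obtain N l where l: "separating V (carrier V) {..<N} (l :: nat \<Rightarrow> _)"
    using assms finite_dim_def by blast
  have "independent V 0 undefined" by (simp add: independent_def)
  then show ?thesis unfolding kdim_def
    using independent_le[OF l]
    by (intro GreatestI_nat[of "\<lambda>m. \<exists>c. independent V m c" 0 N]) blast+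
qed

end

lemma klinear_zero:
  assumes "kspace V" "kspace W" "klinear V W T"
  shows "T \<zero>\<^bsub>V\<^esub> = \<zero>\<^bsub>W\<^esub>"
proof -
  interpret V: kspace V by fact
  interpret W: kspace W by fact
  have "T (0 \<odot>\<^bsub>V\<^esub> \<zero>\<^bsub>V\<^esub>) = 0 \<odot>\<^bsub>W\<^esub> T \<zero>\<^bsub>V\<^esub>" "T \<zero>\<^bsub>V\<^esub> \<in> carrier W"
    using assms(3) V.zero_closed unfolding klinear_def by blast+
  then show ?thesis by simp
qed

lemma klinear_lincomb:
  assumes "kspace V" "kspace W" and T: "klinear V W T" and c: "c \<in> I \<rightarrow> carrier V"
  shows "T (\<Oplus>\<^bsub>V\<^esub>i\<in>I. a i \<odot>\<^bsub>V\<^esub> c i) = (\<Oplus>\<^bsub>W\<^esub>i\<in>I. a i \<odot>\<^bsub>W\<^esub> T (c i))"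
proof -
  interpret V: kspace V by fact
  interpret W: kspace W by fact
  show ?thesis using c
  proof (induction I rule: infinite_finite_induct)
    case (insert x F)
    then have *: "c \<in> F \<rightarrow> carrier V" "c x \<in> carrier V" by auto
    moreover have "\<And>i. i \<in> insert x F \<Longrightarrow> T (c i) \<in> carrier W"
      using insert.prems T by (auto simp: klinear_def Pi_iff)
    ultimately show ?case using insert T V.lincomb_closed[of c F a]
      by (simp add: Pi_iff klinear_def)
  qed (use klinear_zero[OF assms(1-3)] in simp_all)
qed

text \<open>
  A maximal independent family stays independent under an injective map, and a vector outside
  the image can be added to it.
\<close>

lemma independent_image:
  assumes "kspace V" "kspace W" and T: "klinear V W T" and inj: "inj_on T (carrier V)"
    and ind: "independent V m c"
  shows "independent W m (\<lambda>i. T (c i))"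
    and "y \<in> carrier W \<Longrightarrow> y \<notin> T ` carrier V \<Longrightarrow> independent W (Suc m) ((\<lambda>i. T (c i))(m := y))"
proof -
  interpret V: kspace V by fact
  interpret W: kspace W by fact
  have c: "c \<in> {..<m} \<rightarrow> carrier V" using ind by (simp add: independent_def)
  have Tc: "(\<lambda>i. T (c i)) \<in> {..<m} \<rightarrow> carrier W" using T c by (auto simp: klinear_def Pi_iff)
  have zero: "\<forall>i<m. a i = 0" if "(\<Oplus>\<^bsub>W\<^esub>i\<in>{..<m}. a i \<odot>\<^bsub>W\<^esub> T (c i)) = \<zero>\<^bsub>W\<^esub>" for a
  proof -
    have "T (\<Oplus>\<^bsub>V\<^esub>i\<in>{..<m}. a i \<odot>\<^bsub>V\<^esub> c i) = T \<zero>\<^bsub>V\<^esub>"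
      using that klinear_lincomb[OF assms(1,2) T c] klinear_zero[OF assms(1,2) T] by simp
    then have "(\<Oplus>\<^bsub>V\<^esub>i\<in>{..<m}. a i \<odot>\<^bsub>V\<^esub> c i) = \<zero>\<^bsub>V\<^esub>"
      using inj V.lincomb_closed[OF c] by (auto dest: inj_onD)
    then show ?thesis using ind by (auto simp: independent_def)
  qed
  show "independent W m (\<lambda>i. T (c i))" using Tc zero by (auto simp: independent_def)
  assume y: "y \<in> carrier W" "y \<notin> T ` carrier V"
  show "independent W (Suc m) ((\<lambda>i. T (c i))(m := y))"
    unfolding independent_def
  proof (intro conjI allI impI)
    show "(\<lambda>i. T (c i))(m := y) \<in> {..<Suc m} \<rightarrow> carrier W" using Tc y by (auto simp: Pi_iff less_Suc_eq)
    fix a i assume s: "(\<Oplus>\<^bsub>W\<^esub>i\<in>{..<Suc m}. a i \<odot>\<^bsub>W\<^esub> ((\<lambda>i. T (c i))(m := y)) i) = \<zero>\<^bsub>W\<^esub>" and i: "i < Suc m"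
    let ?s = "\<Oplus>\<^bsub>W\<^esub>i\<in>{..<m}. a i \<odot>\<^bsub>W\<^esub> T (c i)"
    have sC: "?s \<in> carrier W" by (rule W.lincomb_closed[OF Tc])
    have "(\<Oplus>\<^bsub>W\<^esub>i\<in>{..<m}. a i \<odot>\<^bsub>W\<^esub> ((\<lambda>i. T (c i))(m := y)) i) = ?s"
      using Tc by (intro W.finsum_cong') auto
    then have eq: "a m \<odot>\<^bsub>W\<^esub> y \<oplus>\<^bsub>W\<^esub> ?s = \<zero>\<^bsub>W\<^esub>"
      using s Tc y by (simp add: lessThan_Suc Pi_iff)
    have "a m = 0"
    proof (rule ccontr)
      assume am: "a m \<noteq> 0"
      have sT: "?s = T (\<Oplus>\<^bsub>V\<^esub>i\<in>{..<m}. a i \<odot>\<^bsub>V\<^esub> c i)" (is "_ = T ?v")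
        using klinear_lincomb[OF assms(1,2) T c] by simp
      have v: "?v \<in> carrier V" by (rule V.lincomb_closed[OF c])
      have "a m \<odot>\<^bsub>W\<^esub> y = \<ominus>\<^bsub>W\<^esub> ?s" using eq sC y by (metis W.minus_equality W.smult_closed)
      also have "\<dots> = (- 1) \<odot>\<^bsub>W\<^esub> ?s" using W.smult_minus_one[OF sC] by simp
      finally have "inverse (a m) \<odot>\<^bsub>W\<^esub> (a m \<odot>\<^bsub>W\<^esub> y) = inverse (a m) \<odot>\<^bsub>W\<^esub> ((- 1) \<odot>\<^bsub>W\<^esub> ?s)" by simp
      then have "y = (- inverse (a m)) \<odot>\<^bsub>W\<^esub> ?s"
        using am y sC W.smult_assoc[symmetric] by simp
      also have "\<dots> = T ((- inverse (a m)) \<odot>\<^bsub>V\<^esub> ?v)" using T v by (simp add: sT klinear_def)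
      finally show False using y v by blast
    qed
    then have "?s = \<zero>\<^bsub>W\<^esub>" using eq sC y by simp
    then show "a i = 0" using zero \<open>a m = 0\<close> i by (auto simp: less_Suc_eq)
  qed
qed

lemma kdim_le:
  assumes "kspace V" "kspace W" "klinear V W T" "inj_on T (carrier V)" "finite_dim V" "finite_dim W"
  shows "kdim V \<le> kdim W"
  using kspace.kdim_attained[OF assms(1,5)] independent_image(1)[OF assms(1-4)]
    kspace.kdim_ge[OF assms(2,6)] by blast

lemma kdim_less:
  assumes "kspace V" "kspace W" "klinear V W T" "inj_on T (carrier V)" "finite_dim V" "finite_dim W"
    and "T ` carrier V \<noteq> carrier W"
  shows "kdim V < kdim W"
proof -
  obtain y where "y \<in> carrier W" "y \<notin> T ` carrier V"
    using assms(3,7) by (auto simp: klinear_def)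
  then show ?thesis
    using kspace.kdim_attained[OF assms(1,5)] independent_image(2)[OF assms(1-4)]
      kspace.kdim_ge[OF assms(2,6)] Suc_le_eq by metis
qed

lemma finite_dim_injective:
  assumes "klinear V W T" "\<And>x. x \<in> carrier V \<Longrightarrow> T x = \<zero>\<^bsub>W\<^esub> \<Longrightarrow> x = \<zero>\<^bsub>V\<^esub>" "finite_dim W"
  shows "finite_dim V"
proof -
  obtain N l where l: "separating W (carrier W) {..<N} (l :: nat \<Rightarrow> _)"
    using assms(3) finite_dim_def by blast
  have "separating V (carrier V) {..<N} (\<lambda>i x. l i (T x))"
    using l assms(1,2) linear_functional_comp[OF assms(1)]
    by (auto simp: separating_def klinear_def)
  then show ?thesis by (rule finite_dimI)
qed

section \<open>Polynomial functions\<close>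

lemma poly_functions_sum:
  "(\<And>i. i \<in> I \<Longrightarrow> p i \<in> poly_functions V) \<Longrightarrow> (\<lambda>x. \<Sum>i\<in>I. p i x) \<in> poly_functions V"
proof (induction I rule: infinite_finite_induct)
  case (insert i I)
  then show ?case using poly_functions.add[of "p i" V "\<lambda>x. \<Sum>i\<in>I. p i x"] by simp
qed (simp_all add: poly_functions.const)

lemma poly_functions_prod:
  "(\<And>i. i \<in> I \<Longrightarrow> p i \<in> poly_functions V) \<Longrightarrow> (\<lambda>x. \<Prod>i\<in>I. p i x) \<in> poly_functions V"
proof (induction I rule: infinite_finite_induct)
  case (insert i I)
  then show ?case using poly_functions.mult[of "p i" V "\<lambda>x. \<Prod>i\<in>I. p i x"] by simp
qed (simp_all add: poly_functions.const)

lemma poly_functions_diff: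
  "p \<in> poly_functions V \<Longrightarrow> q \<in> poly_functions V \<Longrightarrow> (\<lambda>x. p x - q x) \<in> poly_functions V"
  using poly_functions.add[of p V "\<lambda>x. (- 1) * q x"]
    poly_functions.mult[OF poly_functions.const[of "- 1"], of q] by simp

lemma poly_functions_det:
  assumes "\<And>i j. i < n \<Longrightarrow> j < n \<Longrightarrow> e i j \<in> poly_functions V"
  shows "(\<lambda>x. det (mat n n (\<lambda>(i, j). e i j x))) \<in> poly_functions V"
proof -
  have "(\<lambda>x. \<Sum>p\<in>{p. p permutes {0..<n}}. signof p * (\<Prod>i = 0..<n. e i (p i) x)) \<in> poly_functions V"
    by (intro poly_functions_sum poly_functions.mult poly_functions.const poly_functions_prod assms)
       (use permutes_in_image in fastforce)+
  also have "(\<lambda>x. \<Sum>p\<in>{p. p permutes {0..<n}}. signof p * (\<Prod>i = 0..<n. e i (p i) x)) =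
      (\<lambda>x. det (mat n n (\<lambda>(i, j). e i j x)))"
    by (intro ext, subst det_def'[of _ n])
       (auto intro!: sum.cong prod.cong simp: permutes_in_image)
  finally show ?thesis .
qed

text \<open>
  Cramer's rule for a linear system with polynomial coefficients: multiplying by the determinant
  avoids the denominators, so that the solution is defined at every point.
\<close>

lemma polynomial_cramer:
  fixes r :: nat and B :: "nat \<Rightarrow> nat \<Rightarrow> 'v \<Rightarrow> 'k::field"
  assumes B: "\<And>i j. i < r \<Longrightarrow> j < r \<Longrightarrow> B i j \<in> poly_functions V"
    and v: "\<And>i. i < r \<Longrightarrow> v i \<in> poly_functions V"
  shows "\<exists>\<delta> a. \<delta> \<in> poly_functions V \<and> (\<forall>i<r. a i \<in> poly_functions V) \<and>
    (\<forall>x. \<forall>j<r. (\<Sum>i<r. B j i x * a i x) = \<delta> x * v j x) \<and>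
    (\<forall>x. (\<forall>j<r. v j x = 0) \<longrightarrow> (\<forall>i<r. a i x = 0)) \<and>
    (\<forall>x. (\<forall>i<r. \<forall>j<r. B i j x = of_bool (i = j)) \<longrightarrow> \<delta> x = 1)"
proof -
  define M where "M x = mat r r (\<lambda>(i, j). B i j x)" for x
  have M: "M x \<in> carrier_mat r r" for x by (simp add: M_def)
  define \<delta> where "\<delta> x = det (M x)" for x
  define a where "a i x = (\<Sum>k<r. adj_mat (M x) $$ (i, k) * v k x)" for i x
  have "\<delta> \<in> poly_functions V"
    unfolding \<delta>_def M_def by (intro poly_functions_det B)
  moreover have adj: "(\<lambda>x. adj_mat (M x) $$ (i, k)) \<in> poly_functions V" if "i < r" "k < r" for i k
  proof -
    define s where "s u i = (if i < u then i else Suc i)" for u i :: nat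
    have "(\<lambda>x. (- 1) ^ (k + i) * det (mat (r - 1) (r - 1) (\<lambda>(i', j'). B (s k i') (s i j') x)))
        \<in> poly_functions V"
      using that by (intro poly_functions.mult poly_functions.const poly_functions_det B)
        (auto simp: s_def)
    also have "(\<lambda>x. (- 1) ^ (k + i) * det (mat (r - 1) (r - 1) (\<lambda>(i', j'). B (s k i') (s i j') x))) =
        (\<lambda>x. adj_mat (M x) $$ (i, k))"
    proof
      fix x
      have "mat_delete (M x) k i = mat (r - 1) (r - 1) (\<lambda>(i', j'). B (s k i') (s i j') x)"
        using that by (intro eq_matI) (auto simp: mat_delete_def M_def s_def)
      then show "(- 1) ^ (k + i) * det (mat (r - 1) (r - 1) (\<lambda>(i', j'). B (s k i') (s i j') x)) =
          adj_mat (M x) $$ (i, k)"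
        using that by (simp add: adj_mat_def cofactor_def M_def)
    qed
    finally show ?thesis .
  qed
  moreover have "a i \<in> poly_functions V" if "i < r" for i
    unfolding a_def using that by (intro poly_functions_sum poly_functions.mult adj v) auto
  moreover have "(\<Sum>i<r. B j i x * a i x) = \<delta> x * v j x" if j: "j < r" for x j
  proof -
    have e: "(\<Sum>i<r. B j i x * adj_mat (M x) $$ (i, k)) = (if j = k then \<delta> x else 0)" if "k < r" for k
    proof -
      have "(M x * adj_mat (M x)) $$ (j, k) = (\<Sum>i<r. B j i x * adj_mat (M x) $$ (i, k))"
        using j that adj_mat(1)[OF M[of x]]
        by (auto simp: scalar_prod_def atLeast0LessThan M_def intro!: sum.cong)
      then show ?thesis using adj_mat(2)[OF M[of x]] j that by (auto simp: \<delta>_def)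
    qed
    have "(\<Sum>i<r. B j i x * a i x) = (\<Sum>k<r. (\<Sum>i<r. B j i x * adj_mat (M x) $$ (i, k)) * v k x)"
      unfolding a_def sum_distrib_left sum_distrib_right mult.assoc by (rule sum.swap)
    also have "\<dots> = (\<Sum>k<r. if k = j then \<delta> x * v k x else 0)"
      by (intro sum.cong refl) (auto simp: e)
    finally show ?thesis using j by simp
  qed
  moreover have "\<delta> x = 1" if "\<And>i j. i < r \<Longrightarrow> j < r \<Longrightarrow> B i j x = of_bool (i = j)" for x
  proof -
    have "M x = 1\<^sub>m r" using that by (intro eq_matI) (auto simp: M_def)
    then show ?thesis by (simp add: \<delta>_def)
  qed
  moreover have "\<forall>i<r. a i x = 0" if "\<forall>j<r. v j x = 0" for x
    using that by (simp add: a_def)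
  ultimately show ?thesis by (intro exI[of _ \<delta>] exI[of _ a] conjI allI impI) blast+
qed

section \<open>The Zariski topology\<close>

lemma poly_function_on_line:
  assumes V: "kspace V" and p: "p \<in> poly_functions V" and xy: "x \<in> carrier V" "y \<in> carrier V"
  shows "\<exists>P. \<forall>t. p ((1 - t) \<odot>\<^bsub>V\<^esub> x \<oplus>\<^bsub>V\<^esub> t \<odot>\<^bsub>V\<^esub> y) = poly P t"
  using p
proof induction
  case (const c)
  show ?case by (intro exI[of _ "[:c:]"]) simp
next
  case (linear l)
  interpret kspace V by fact
  have "l ((1 - t) \<odot>\<^bsub>V\<^esub> x \<oplus>\<^bsub>V\<^esub> t \<odot>\<^bsub>V\<^esub> y) = poly [:l x, l y - l x:] t" for t
    using linear xy by (simp add: linear_functional_def algebra_simps)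
  then show ?case by blast
next
  case (add p q)
  then show ?case by (metis poly_add)
next
  case (mult p q)
  then show ?case by (metis poly_mult)
qed

text \<open>Over an infinite field two nonempty open sets meet already on the line through a point of each.\<close>

lemma zariski_dense:
  fixes V :: "('k::field, 'v) module"
  assumes inf: "infinite (UNIV :: 'k set)" and V: "kspace V"
    and U: "openin (zariski V) U" "U \<noteq> {}"
  shows "zariski V closure_of U = topspace (zariski V)"
proof -
  interpret kspace V by fact
  obtain y q where y: "y \<in> U" "y \<in> carrier V" and q: "q \<in> poly_functions V" "q y \<noteq> 0"
    and qU: "\<And>v. v \<in> carrier V \<Longrightarrow> q v \<noteq> 0 \<Longrightarrow> v \<in> U"
    using U unfolding openin_zariski zero_locus_def by (auto simp: subset_iff)
  have "x \<in> zariski V closure_of U" if x: "x \<in> carrier V" for x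
    unfolding in_closure_of topspace_zariski
  proof (intro conjI allI impI x)
    fix T assume "x \<in> T \<and> openin (zariski V) T"
    then obtain p where p: "p \<in> poly_functions V" "p x \<noteq> 0"
      and pT: "\<And>v. v \<in> carrier V \<Longrightarrow> p v \<noteq> 0 \<Longrightarrow> v \<in> T"
      unfolding openin_zariski zero_locus_def by (auto simp: subset_iff)
    let ?\<gamma> = "\<lambda>t. (1 - t) \<odot>\<^bsub>V\<^esub> x \<oplus>\<^bsub>V\<^esub> t \<odot>\<^bsub>V\<^esub> y"
    obtain R where R: "\<And>t. p (?\<gamma> t) * q (?\<gamma> t) = poly R t"
      using poly_function_on_line[OF V poly_functions.mult[OF p(1) q(1)] x y(2)] by blast
    obtain P where P: "\<And>t. p (?\<gamma> t) = poly P t"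
      using poly_function_on_line[OF V p(1) x y(2)] by blast
    obtain Q where Q: "\<And>t. q (?\<gamma> t) = poly Q t"
      using poly_function_on_line[OF V q(1) x y(2)] by blast
    have "poly P 0 \<noteq> 0" "poly Q 1 \<noteq> 0"
      using P[of 0] Q[of 1] p q x y by simp_all
    then have "P * Q \<noteq> 0" by auto
    then have "finite {t. poly (P * Q) t = 0}" by (rule poly_roots_finite)
    then obtain t where "poly (P * Q) t \<noteq> 0" using inf by (metis (mono_tags) UNIV_eq_I mem_Collect_eq)
    then have "p (?\<gamma> t) \<noteq> 0" "q (?\<gamma> t) \<noteq> 0" by (auto simp: P Q)
    then have "?\<gamma> t \<in> U \<and> ?\<gamma> t \<in> T" using pT qU x y by auto
    then show "\<exists>y. y \<in> U \<and> y \<in> T" by blast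
  qed
  then show ?thesis using closure_of_subset_topspace[of "zariski V" U] by (auto simp: topspace_zariski)
qed

lemma openin_zariskiI:
  assumes "U \<subseteq> carrier V"
    and "\<And>x. x \<in> U \<Longrightarrow> \<exists>q\<in>poly_functions V. q x \<noteq> 0 \<and> (\<forall>y\<in>carrier V. q y \<noteq> 0 \<longrightarrow> y \<in> U)"
  shows "openin (zariski V) U"
  unfolding openin_zariski
proof (intro exI conjI)
  let ?E = "{q \<in> poly_functions V. \<forall>y\<in>carrier V. q y \<noteq> 0 \<longrightarrow> y \<in> U}"
  show "?E \<subseteq> poly_functions V" by auto
  show "U = carrier V - zero_locus V ?E"
    using assms unfolding zero_locus_def by blast
qed

section \<open>Right modules over a finite dimensional algebra\<close>

text \<open>
  Unlike in \<open>mhom\<close>, the values outside the carrier are arbitrary, so that sums and composites need no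
  restriction.
\<close>

definition module_map :: "('k, 'l) module \<Rightarrow> ('l, 'm) module \<Rightarrow> ('l, 'n) module \<Rightarrow> ('m \<Rightarrow> 'n) \<Rightarrow> bool" where
  "module_map A M N h \<longleftrightarrow> h \<in> carrier M \<rightarrow> carrier N \<and>
     (\<forall>x\<in>carrier M. \<forall>y\<in>carrier M. h (x \<oplus>\<^bsub>M\<^esub> y) = h x \<oplus>\<^bsub>N\<^esub> h y) \<and>
     (\<forall>r\<in>carrier A. \<forall>x\<in>carrier M. h (r \<odot>\<^bsub>M\<^esub> x) = r \<odot>\<^bsub>N\<^esub> h x)"

lemma module_map_closed: "module_map A M N h \<Longrightarrow> x \<in> carrier M \<Longrightarrow> h x \<in> carrier N"
  by (auto simp: module_map_def)

lemma module_map_add: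
  "module_map A M N h \<Longrightarrow> x \<in> carrier M \<Longrightarrow> y \<in> carrier M \<Longrightarrow> h (x \<oplus>\<^bsub>M\<^esub> y) = h x \<oplus>\<^bsub>N\<^esub> h y"
  by (auto simp: module_map_def)

lemma module_map_smult:
  "module_map A M N h \<Longrightarrow> r \<in> carrier A \<Longrightarrow> x \<in> carrier M \<Longrightarrow> h (r \<odot>\<^bsub>M\<^esub> x) = r \<odot>\<^bsub>N\<^esub> h x"
  by (auto simp: module_map_def)

lemma module_map_compose:
  "module_map A L M g \<Longrightarrow> module_map A M N h \<Longrightarrow> module_map A L N (\<lambda>x. h (g x))"
  by (auto simp: module_map_def Pi_iff)

lemma module_map_id: "module_map A M M (\<lambda>x. x)"
  by (simp add: module_map_def)

lemma module_map_restrict: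
  assumes "module_map A M N h" "U \<subseteq> carrier M"
  shows "module_map A (M\<lparr>carrier := U\<rparr>) N h"
  using assms by (auto simp: module_map_def subset_iff Pi_iff)

lemma module_map_into:
  assumes "module_map A M N h" "h ` carrier M \<subseteq> U"
  shows "module_map A M (N\<lparr>carrier := U\<rparr>) h"
  using assms by (auto simp: module_map_def)

lemma module_map_from_submodule:
  assumes "module_map A M (N\<lparr>carrier := U\<rparr>) h" "U \<subseteq> carrier N"
  shows "module_map A M N h"
  using assms by (auto simp: module_map_def)

lemma mhom_iff: "h \<in> mhom A M N \<longleftrightarrow> module_map A M N h \<and> h \<in> extensional (carrier M)"
  by (auto simp: mhom_def module_map_def PiE_def)

lemma mhom_module_map: "h \<in> mhom A M N \<Longrightarrow> module_map A M N h"
  by (simp add: mhom_iff)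

lemma right_moduleI:
  assumes "ring R" "abelian_group M"
    and "\<And>r x. \<lbrakk>r \<in> carrier R; x \<in> carrier M\<rbrakk> \<Longrightarrow> r \<odot>\<^bsub>M\<^esub> x \<in> carrier M"
    and "\<And>r s x. \<lbrakk>r \<in> carrier R; s \<in> carrier R; x \<in> carrier M\<rbrakk> \<Longrightarrow>
        (r \<oplus>\<^bsub>R\<^esub> s) \<odot>\<^bsub>M\<^esub> x = r \<odot>\<^bsub>M\<^esub> x \<oplus>\<^bsub>M\<^esub> s \<odot>\<^bsub>M\<^esub> x"
    and "\<And>r x y. \<lbrakk>r \<in> carrier R; x \<in> carrier M; y \<in> carrier M\<rbrakk> \<Longrightarrow>
        r \<odot>\<^bsub>M\<^esub> (x \<oplus>\<^bsub>M\<^esub> y) = r \<odot>\<^bsub>M\<^esub> x \<oplus>\<^bsub>M\<^esub> r \<odot>\<^bsub>M\<^esub> y"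
    and "\<And>r s x. \<lbrakk>r \<in> carrier R; s \<in> carrier R; x \<in> carrier M\<rbrakk> \<Longrightarrow>
        (r \<otimes>\<^bsub>R\<^esub> s) \<odot>\<^bsub>M\<^esub> x = s \<odot>\<^bsub>M\<^esub> (r \<odot>\<^bsub>M\<^esub> x)"
    and "\<And>x. x \<in> carrier M \<Longrightarrow> \<one>\<^bsub>R\<^esub> \<odot>\<^bsub>M\<^esub> x = x"
  shows "right_module R M"
  using assms by (intro right_module.intro right_module_axioms.intro) auto

context right_module
begin

lemma smult_zero_left [simp]: "x \<in> carrier M \<Longrightarrow> \<zero> \<odot>\<^bsub>M\<^esub> x = \<zero>\<^bsub>M\<^esub>"
  using smult_l_distr[of \<zero> \<zero> x] by (metis M.add.l_cancel_one' R.l_zero R.zero_closed smult_closed)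

lemma smult_zero_right [simp]: "r \<in> carrier R \<Longrightarrow> r \<odot>\<^bsub>M\<^esub> \<zero>\<^bsub>M\<^esub> = \<zero>\<^bsub>M\<^esub>"
  using smult_r_distr[of r "\<zero>\<^bsub>M\<^esub>" "\<zero>\<^bsub>M\<^esub>"] by (metis M.add.l_cancel_one' M.l_zero M.zero_closed smult_closed)

lemma smult_minus_one: "x \<in> carrier M \<Longrightarrow> (\<ominus> \<one>) \<odot>\<^bsub>M\<^esub> x = \<ominus>\<^bsub>M\<^esub> x"
  using smult_l_distr[of "\<ominus> \<one>" \<one> x] smult_closed[of "\<ominus> \<one>" x]
  by (metis M.minus_equality R.a_inv_closed R.l_neg R.one_closed smult_one smult_zero_left)

lemma finsum_smult:
  assumes "r \<in> carrier R" "c \<in> I \<rightarrow> carrier M"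
  shows "r \<odot>\<^bsub>M\<^esub> (\<Oplus>\<^bsub>M\<^esub>i\<in>I. c i) = (\<Oplus>\<^bsub>M\<^esub>i\<in>I. r \<odot>\<^bsub>M\<^esub> c i)"
  using assms(2)
proof (induction I rule: infinite_finite_induct)
  case (insert x F)
  then have *: "c \<in> F \<rightarrow> carrier M" "c x \<in> carrier M" by auto
  then show ?case using insert assms(1) by (simp add: Pi_def smult_r_distr)
qed (simp_all add: assms(1))

lemma minus_zero_iff: "x \<in> carrier M \<Longrightarrow> y \<in> carrier M \<Longrightarrow> x \<ominus>\<^bsub>M\<^esub> y = \<zero>\<^bsub>M\<^esub> \<longleftrightarrow> x = y"
  by simp

lemma submodule_iff:
  "Module.submodule U R M \<longleftrightarrow> U \<subseteq> carrier M \<and> \<zero>\<^bsub>M\<^esub> \<in> U \<and> (\<forall>x\<in>U. \<forall>y\<in>U. x \<oplus>\<^bsub>M\<^esub> y \<in> U) \<and>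
     (\<forall>r\<in>carrier R. \<forall>x\<in>U. r \<odot>\<^bsub>M\<^esub> x \<in> U)" (is "?L \<longleftrightarrow> ?R")
proof
  assume ?L
  then interpret Module.submodule U R M .
  show ?R using subset one_closed m_closed smult_closed by simp
next
  assume ?R
  then have "\<ominus>\<^bsub>M\<^esub> x \<in> U" if "x \<in> U" for x
    using that smult_minus_one[of x] by (metis R.a_inv_closed R.one_closed subsetD)
  with \<open>?R\<close> show ?L
    by (intro Module.submodule.intro subgroup.intro Module.submodule_axioms.intro)
      (auto simp: a_inv_def)
qed

end

context fd_algebra
begin

lemma module_map_zero:
  assumes "right_module A M" "right_module A N" "module_map A M N h"
  shows "h \<zero>\<^bsub>M\<^esub> = \<zero>\<^bsub>N\<^esub>"
proof -
  interpret M: right_module A M by fact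
  interpret N: right_module A N by fact
  have "h (\<zero> \<odot>\<^bsub>M\<^esub> \<zero>\<^bsub>M\<^esub>) = \<zero> \<odot>\<^bsub>N\<^esub> h \<zero>\<^bsub>M\<^esub>"
    by (rule module_map_smult[OF assms(3)]) simp_all
  then show ?thesis using module_map_closed[OF assms(3), of "\<zero>\<^bsub>M\<^esub>"] by simp
qed

lemma module_map_neg:
  assumes "right_module A M" "right_module A N" "module_map A M N h" "x \<in> carrier M"
  shows "h (\<ominus>\<^bsub>M\<^esub> x) = \<ominus>\<^bsub>N\<^esub> h x"
proof -
  interpret M: right_module A M by fact
  interpret N: right_module A N by fact
  have "h ((\<ominus> \<one>) \<odot>\<^bsub>M\<^esub> x) = (\<ominus> \<one>) \<odot>\<^bsub>N\<^esub> h x"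
    by (rule module_map_smult[OF assms(3)]) (simp_all add: assms)
  then show ?thesis
    using module_map_closed[OF assms(3,4)] assms(4) by (simp add: M.smult_minus_one N.smult_minus_one)
qed

lemma module_map_minus:
  assumes "right_module A M" "right_module A N" "module_map A M N h" "x \<in> carrier M" "y \<in> carrier M"
  shows "h (x \<ominus>\<^bsub>M\<^esub> y) = h x \<ominus>\<^bsub>N\<^esub> h y"
proof -
  interpret M: right_module A M by fact
  interpret N: right_module A N by fact
  show ?thesis
    using assms module_map_neg[OF assms(1-3)] module_map_add[OF assms(3)] by (simp add: a_minus_def)
qed

lemma module_map_zero_map:
  assumes "right_module A N" shows "module_map A M N (\<lambda>x. \<zero>\<^bsub>N\<^esub>)"
proof -
  interpret N: right_module A N by fact
  show ?thesis by (simp add: module_map_def)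
qed

lemma module_map_plus_map:
  assumes "right_module A N" "module_map A M N g" "module_map A M N h"
  shows "module_map A M N (\<lambda>x. g x \<oplus>\<^bsub>N\<^esub> h x)"
proof -
  interpret N: right_module A N by fact
  show ?thesis using assms(2,3) unfolding module_map_def
    by (auto simp: Pi_iff N.a_ac N.smult_r_distr)
qed

lemma module_map_minus_map:
  assumes "right_module A N" "module_map A M N g" "module_map A M N h"
  shows "module_map A M N (\<lambda>x. g x \<ominus>\<^bsub>N\<^esub> h x)"
proof -
  interpret N: right_module A N by fact
  have "module_map A M N (\<lambda>x. \<ominus>\<^bsub>N\<^esub> h x)"
  proof -
    have "module_map A N N (\<lambda>y. \<ominus>\<^bsub>N\<^esub> y)"
      unfolding module_map_def
    proof (intro conjI ballI)
      fix r y assume "r \<in> carrier A" "y \<in> carrier N"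
      then show "\<ominus>\<^bsub>N\<^esub> (r \<odot>\<^bsub>N\<^esub> y) = r \<odot>\<^bsub>N\<^esub> (\<ominus>\<^bsub>N\<^esub> y)"
        using N.smult_assoc[of "\<ominus> \<one>" r y] N.smult_assoc[of r "\<ominus> \<one>" y]
        by (simp add: N.smult_minus_one[symmetric] l_minus r_minus)
    qed (auto simp: N.minus_add)
    from module_map_compose[OF assms(3) this] show ?thesis .
  qed
  from module_map_plus_map[OF assms(1,2) this] show ?thesis by (simp add: a_minus_def)
qed

lemma module_map_finsum:
  assumes "right_module A M" "right_module A N" "module_map A M N h" "c \<in> I \<rightarrow> carrier M"
  shows "h (\<Oplus>\<^bsub>M\<^esub>i\<in>I. c i) = (\<Oplus>\<^bsub>N\<^esub>i\<in>I. h (c i))"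
proof -
  interpret M: right_module A M by fact
  interpret N: right_module A N by fact
  show ?thesis using assms(4)
  proof (induction I rule: infinite_finite_induct)
    case (insert x F)
    then have *: "c \<in> F \<rightarrow> carrier M" "c x \<in> carrier M" by auto
    moreover have "(\<lambda>i. h (c i)) \<in> F \<rightarrow> carrier N" "h (c x) \<in> carrier N"
      using * module_map_closed[OF assms(3)] by auto
    ultimately show ?case using insert module_map_add[OF assms(3)] by simp
  qed (simp_all add: module_map_zero[OF assms(1-3)])
qed

lemma module_map_inj_on:
  assumes "right_module A M" "right_module A N" "module_map A M N h"
    and "\<And>x. x \<in> carrier M \<Longrightarrow> h x = \<zero>\<^bsub>N\<^esub> \<Longrightarrow> x = \<zero>\<^bsub>M\<^esub>"
  shows "inj_on h (carrier M)"
proof (rule inj_onI)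
  interpret M: right_module A M by fact
  interpret N: right_module A N by fact
  fix x y assume *: "x \<in> carrier M" "y \<in> carrier M" "h x = h y"
  then have "h (x \<ominus>\<^bsub>M\<^esub> y) = \<zero>\<^bsub>N\<^esub>"
    using module_map_minus[OF assms(1-3)] module_map_closed[OF assms(3)] by simp
  then have "x \<ominus>\<^bsub>M\<^esub> y = \<zero>\<^bsub>M\<^esub>" using assms(4) * by (metis M.minus_closed)
  then show "x = y" using * by simp
qed

lemma module_map_inverse:
  assumes "right_module A M" "right_module A N" "module_map A M N h" "bij_betw h (carrier M) (carrier N)"
  shows "module_map A N M (the_inv_into (carrier M) h)"
proof -
  interpret M: right_module A M by fact
  interpret N: right_module A N by fact
  let ?g = "the_inv_into (carrier M) h"
  have inj: "inj_on h (carrier M)" and im: "h ` carrier M = carrier N"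
    using assms(4) by (auto simp: bij_betw_def)
  have g: "?g y \<in> carrier M" "h (?g y) = y" if "y \<in> carrier N" for y
    using that im by (auto intro: the_inv_into_into[OF inj] f_the_inv_into_f[OF inj])
  have gi: "?g y = x" if "x \<in> carrier M" "h x = y" for x y
    using the_inv_into_f_f[OF inj] that by auto
  show ?thesis unfolding module_map_def
    by (intro conjI ballI; (intro gi)?)
       (auto simp: g module_map_add[OF assms(3)] module_map_smult[OF assms(3)])
qed

lemma mhom_restrict:
  assumes "right_module A M" "module_map A M N h"
  shows "restrict h (carrier M) \<in> mhom A M N"
proof -
  interpret M: right_module A M by fact
  show ?thesis using assms(2) by (auto simp: mhom_iff module_map_def)
qed

lemma module_iso_iff:
  assumes "right_module A M"
  shows "module_iso A M N \<longleftrightarrow> (\<exists>h. module_map A M N h \<and> bij_betw h (carrier M) (carrier N))"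
proof
  assume "\<exists>h. module_map A M N h \<and> bij_betw h (carrier M) (carrier N)"
  then obtain h where h: "module_map A M N h" "bij_betw h (carrier M) (carrier N)" by blast
  have "bij_betw (restrict h (carrier M)) (carrier M) (carrier N)"
    using h(2) by (simp add: bij_betw_restrict_eq)
  with mhom_restrict[OF assms h(1)] show "module_iso A M N" unfolding module_iso_def by blast
qed (auto simp: module_iso_def mhom_iff)

lemma mk_module_simps [simp]:
  "carrier (mk_module C z p s) = C" "\<zero>\<^bsub>mk_module C z p s\<^esub> = z"
  "add (mk_module C z p s) = p" "smult (mk_module C z p s) = s"
  by (simp_all add: mk_module_def)

subsection \<open>The underlying vector space\<close>

lemma scalar_closed [simp, intro]: "a \<odot> \<one> \<in> carrier A"
  using vs.smult_closed[of a \<one>] by simp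

lemma scalar_add: "(a + b) \<odot> \<one> = a \<odot> \<one> \<oplus> b \<odot> \<one>"
  using vs.smult_l_distr[of a b \<one>] by simp

lemma scalar_mult: "(a * b) \<odot> \<one> = (a \<odot> \<one>) \<otimes> (b \<odot> \<one>)"
  using vs.smult_assoc1[of a b \<one>] smult_mult_left[of \<one> "b \<odot> \<one>" a] by simp

lemma scalar_one: "1 \<odot> \<one> = \<one>"
  using vs.smult_one[of \<one>] by simp

lemma scalar_commute:
  assumes "r \<in> carrier A" shows "r \<otimes> (a \<odot> \<one>) = (a \<odot> \<one>) \<otimes> r"
  using smult_mult_left[of \<one> r a] smult_mult_right[of r \<one> a] assms by simp

lemma base_space_simps [simp]:
  "carrier (base_space A M) = carrier M" "\<zero>\<^bsub>base_space A M\<^esub> = \<zero>\<^bsub>M\<^esub>"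
  "add (base_space A M) = add M" "a \<odot>\<^bsub>base_space A M\<^esub> x = (a \<odot> \<one>) \<odot>\<^bsub>M\<^esub> x"
  by (simp_all add: base_space_def)

lemma abelian_group_cong:
  assumes "abelian_group M" "carrier N = carrier M" "\<zero>\<^bsub>N\<^esub> = \<zero>\<^bsub>M\<^esub>" "add N = add M"
  shows "abelian_group N"
proof -
  interpret M: abelian_group M by fact
  show ?thesis
  proof (rule abelian_groupI)
    fix x assume "x \<in> carrier N"
    then show "\<exists>y\<in>carrier N. y \<oplus>\<^bsub>N\<^esub> x = \<zero>\<^bsub>N\<^esub>"
      by (intro bexI[of _ "\<ominus>\<^bsub>M\<^esub> x"]) (simp_all add: assms(2-4) M.l_neg)
  qed (simp_all add: assms(2-4) M.a_ac)
qed

lemma kspace_base_space: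
  assumes "right_module A M" shows "kspace (base_space A M)"
proof -
  interpret M: right_module A M by fact
  have "abelian_group (base_space A M)"
    by (rule abelian_group_cong[OF M.abelian_group_axioms]) simp_all
  then show ?thesis
  proof (intro kspace.intro kspace_axioms.intro)
    fix a b x assume "x \<in> carrier (base_space A M)"
    then show "(a * b) \<odot>\<^bsub>base_space A M\<^esub> x = a \<odot>\<^bsub>base_space A M\<^esub> (b \<odot>\<^bsub>base_space A M\<^esub> x)"
      using M.smult_assoc[of "b \<odot> \<one>" "a \<odot> \<one>" x] by (simp add: scalar_mult mult.commute[of a b])
  qed (auto simp: scalar_add scalar_one M.smult_l_distr M.smult_r_distr)
qed

lemma fd_module_iff: "fd_module A M \<longleftrightarrow> right_module A M \<and> finite_dim (base_space A M)"
  unfolding fd_module_def using kspace.finite_dim_iff_basis[OF kspace_base_space] by blast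

lemma fd_moduleD: "fd_module A M \<Longrightarrow> right_module A M"
  by (simp add: fd_module_def)

lemma module_map_klinear: "module_map A M N h \<Longrightarrow> klinear (base_space A M) (base_space A N) h"
  by (auto simp: module_map_def klinear_def)

text \<open>Separating functionals pull back along injective maps.\<close>

lemma fd_module_injective:
  assumes "right_module A M" "fd_module A N" "module_map A M N h"
    and "\<And>x. x \<in> carrier M \<Longrightarrow> h x = \<zero>\<^bsub>N\<^esub> \<Longrightarrow> x = \<zero>\<^bsub>M\<^esub>"
  shows "fd_module A M"
  using finite_dim_injective[OF module_map_klinear[OF assms(3)]] assms(1,2,4)
  by (auto simp: fd_module_iff)

abbreviation mdim :: "('l, 'm) module \<Rightarrow> nat" where
  "mdim M \<equiv> kdim (base_space A M)"

lemma mdim_le: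
  assumes "fd_module A M" "fd_module A N" "module_map A M N h" "inj_on h (carrier M)"
  shows "mdim M \<le> mdim N"
  using assms kdim_le[OF kspace_base_space kspace_base_space module_map_klinear[OF assms(3)]]
  by (simp add: fd_module_iff)

lemma mdim_less:
  assumes "fd_module A M" "fd_module A N" "module_map A M N h" "inj_on h (carrier M)"
    and "h ` carrier M \<noteq> carrier N"
  shows "mdim M < mdim N"
  using assms kdim_less[OF kspace_base_space kspace_base_space module_map_klinear[OF assms(3)]]
  by (simp add: fd_module_iff)

lemma injective_endo_bij:
  assumes "fd_module A M" "module_map A M M h" "inj_on h (carrier M)"
  shows "bij_betw h (carrier M) (carrier M)"
  using mdim_less[OF assms(1,1,2,3)] assms(3) by (auto simp: bij_betw_def)

subsection \<open>Submodules\<close>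

lemma submodule_subset: "Module.submodule U A M \<Longrightarrow> U \<subseteq> carrier M"
  unfolding Module.submodule_def subgroup_def by auto

lemma right_module_submodule:
  assumes "right_module A M" "Module.submodule U A M"
  shows "right_module A (M\<lparr>carrier := U\<rparr>)"
proof -
  interpret M: right_module A M by fact
  have U: "U \<subseteq> carrier M" "\<zero>\<^bsub>M\<^esub> \<in> U" "\<And>x y. x \<in> U \<Longrightarrow> y \<in> U \<Longrightarrow> x \<oplus>\<^bsub>M\<^esub> y \<in> U"
    "\<And>r x. r \<in> carrier A \<Longrightarrow> x \<in> U \<Longrightarrow> r \<odot>\<^bsub>M\<^esub> x \<in> U"
    using assms(2) by (auto simp: M.submodule_iff)
  have neg: "\<ominus>\<^bsub>M\<^esub> x \<in> U" if "x \<in> U" for x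
    using that U by (metis M.smult_minus_one a_inv_closed one_closed subsetD)
  show ?thesis
  proof (rule right_moduleI)
    show "abelian_group (M\<lparr>carrier := U\<rparr>)"
    proof (rule abelian_groupI)
      fix x assume "x \<in> carrier (M\<lparr>carrier := U\<rparr>)"
      then show "\<exists>y\<in>carrier (M\<lparr>carrier := U\<rparr>). y \<oplus>\<^bsub>M\<lparr>carrier := U\<rparr>\<^esub> x = \<zero>\<^bsub>M\<lparr>carrier := U\<rparr>\<^esub>"
        using U neg M.l_neg by (intro bexI[of _ "\<ominus>\<^bsub>M\<^esub> x"]) auto
    qed (use U in \<open>auto simp: subset_iff M.a_ac\<close>)
  qed (use U in \<open>auto simp: subset_iff M.smult_l_distr M.smult_r_distr M.smult_assoc intro: ring_axioms\<close>)
qed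

lemma fd_module_submodule:
  assumes "fd_module A M" "Module.submodule U A M"
  shows "fd_module A (M\<lparr>carrier := U\<rparr>)"
proof (rule fd_module_injective[OF right_module_submodule[OF fd_moduleD[OF assms(1)] assms(2)] assms(1)])
  show "module_map A (M\<lparr>carrier := U\<rparr>) M (\<lambda>x. x)"
    by (rule module_map_restrict[OF module_map_id submodule_subset[OF assms(2)]])
qed simp

lemma submodule_carrier:
  assumes "right_module A M" shows "Module.submodule (carrier M) A M"
proof -
  interpret M: right_module A M by fact
  show ?thesis by (simp add: M.submodule_iff)
qed

lemma submodule_zero:
  assumes "right_module A M" shows "Module.submodule {\<zero>\<^bsub>M\<^esub>} A M"
proof -
  interpret M: right_module A M by fact
  show ?thesis by (simp add: M.submodule_iff)
qed

lemma submodule_image: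
  assumes "right_module A M" "right_module A N" "module_map A M N h" "Module.submodule U A M"
  shows "Module.submodule (h ` U) A N"
proof -
  interpret M: right_module A M by fact
  interpret N: right_module A N by fact
  have U: "U \<subseteq> carrier M" "\<zero>\<^bsub>M\<^esub> \<in> U" "\<And>x y. x \<in> U \<Longrightarrow> y \<in> U \<Longrightarrow> x \<oplus>\<^bsub>M\<^esub> y \<in> U"
    "\<And>r x. r \<in> carrier A \<Longrightarrow> x \<in> U \<Longrightarrow> r \<odot>\<^bsub>M\<^esub> x \<in> U"
    using assms(4) by (auto simp: M.submodule_iff)
  show ?thesis unfolding N.submodule_iff
  proof (intro conjI ballI)
    show "h ` U \<subseteq> carrier N" using U(1) module_map_closed[OF assms(3)] by auto
    show "\<zero>\<^bsub>N\<^esub> \<in> h ` U" using U(2) module_map_zero[OF assms(1-3)] by force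
    fix x y assume "x \<in> h ` U" "y \<in> h ` U"
    then obtain x' y' where *: "x' \<in> U" "x = h x'" "y' \<in> U" "y = h y'" by blast
    then have "x \<oplus>\<^bsub>N\<^esub> y = h (x' \<oplus>\<^bsub>M\<^esub> y')" using U(1) module_map_add[OF assms(3)] by (simp add: subset_iff)
    with * U(3) show "x \<oplus>\<^bsub>N\<^esub> y \<in> h ` U" by blast
  next
    fix r x assume r: "r \<in> carrier A" and "x \<in> h ` U"
    then obtain x' where *: "x' \<in> U" "x = h x'" by blast
    then have "r \<odot>\<^bsub>N\<^esub> x = h (r \<odot>\<^bsub>M\<^esub> x')" using r U(1) module_map_smult[OF assms(3)]
        by (simp add: subset_iff)
    with * U(4) r show "r \<odot>\<^bsub>N\<^esub> x \<in> h ` U" by blast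
  qed
qed

lemma submodule_preimage:
  assumes "right_module A M" "right_module A N" "module_map A M N h" "Module.submodule U A N"
  shows "Module.submodule {x \<in> carrier M. h x \<in> U} A M"
proof -
  interpret M: right_module A M by fact
  interpret N: right_module A N by fact
  show ?thesis using assms(4) module_map_zero[OF assms(1-3)] module_map_add[OF assms(3)]
      module_map_smult[OF assms(3)]
    by (auto simp: M.submodule_iff N.submodule_iff)
qed

lemma submodule_kernel:
  assumes "right_module A M" "right_module A N" "module_map A M N h"
  shows "Module.submodule {x \<in> carrier M. h x = \<zero>\<^bsub>N\<^esub>} A M"
  using submodule_preimage[OF assms submodule_zero[OF assms(2)]] by simp

lemma submodule_minus:
  assumes "right_module A M" "Module.submodule U A M" "x \<in> U" "y \<in> U"
  shows "x \<ominus>\<^bsub>M\<^esub> y \<in> U"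
proof -
  interpret M: right_module A M by fact
  have "\<ominus>\<^bsub>M\<^esub> y \<in> U" using assms(2,4) M.smult_minus_one[of y]
    by (metis M.submodule_iff a_inv_closed one_closed subsetD)
  then show ?thesis using assms by (simp add: M.submodule_iff a_minus_def)
qed

subsection \<open>Direct sums\<close>

lemma dir_sum_simps [simp]:
  "carrier (dir_sum I M) = (\<Pi>\<^sub>E i\<in>I. carrier (M i))" "\<zero>\<^bsub>dir_sum I M\<^esub> = (\<lambda>i\<in>I. \<zero>\<^bsub>M i\<^esub>)"
  "x \<oplus>\<^bsub>dir_sum I M\<^esub> y = (\<lambda>i\<in>I. x i \<oplus>\<^bsub>M i\<^esub> y i)" "r \<odot>\<^bsub>dir_sum I M\<^esub> x = (\<lambda>i\<in>I. r \<odot>\<^bsub>M i\<^esub> x i)"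
  by (simp_all add: dir_sum_def)

lemma right_module_dir_sum:
  assumes "\<And>i. i \<in> I \<Longrightarrow> right_module A (M i)"
  shows "right_module A (dir_sum I M)"
proof -
  have ag: "abelian_group (M i)" if "i \<in> I" for i
    using right_module.axioms(2)[OF assms[OF that]] .
  have am: "abelian_monoid (M i)" if "i \<in> I" for i
    using abelian_group.axioms(1)[OF ag[OF that]] .
  note M = right_module.smult_closed[OF assms] right_module.smult_l_distr[OF assms]
    right_module.smult_r_distr[OF assms] right_module.smult_assoc[OF assms]
    right_module.smult_one[OF assms] abelian_monoid.a_closed[OF am] abelian_monoid.zero_closed[OF am]
    abelian_monoid.a_assoc[OF am] abelian_monoid.a_comm[OF am] abelian_monoid.l_zero[OF am]
    abelian_group.l_neg[OF ag] abelian_group.a_inv_closed[OF ag]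
  show ?thesis
  proof (rule right_moduleI)
    show "abelian_group (dir_sum I M)"
    proof (rule abelian_groupI)
      fix x assume x: "x \<in> carrier (dir_sum I M)"
      show "\<exists>y\<in>carrier (dir_sum I M). y \<oplus>\<^bsub>dir_sum I M\<^esub> x = \<zero>\<^bsub>dir_sum I M\<^esub>"
        using x by (intro bexI[of _ "\<lambda>i\<in>I. \<ominus>\<^bsub>M i\<^esub> x i"]) (auto intro!: M restrict_ext simp: PiE_iff)
    next
      fix x y assume "x \<in> carrier (dir_sum I M)" "y \<in> carrier (dir_sum I M)"
      then show "x \<oplus>\<^bsub>dir_sum I M\<^esub> y = y \<oplus>\<^bsub>dir_sum I M\<^esub> x"
        by (auto intro!: restrict_ext M simp: PiE_iff)
    qed (auto intro!: M restrict_ext simp: PiE_iff extensional_def fun_eq_iff)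
  qed (auto intro!: M restrict_ext ring_axioms simp: PiE_iff extensional_def fun_eq_iff)
qed

definition ds_inj :: "'i set \<Rightarrow> ('i \<Rightarrow> ('l, 'm) module) \<Rightarrow> 'i \<Rightarrow> 'm \<Rightarrow> 'i \<Rightarrow> 'm" where
  "ds_inj I M i x = (\<lambda>j\<in>I. if j = i then x else \<zero>\<^bsub>M j\<^esub>)"

lemma module_map_ds_inj:
  assumes "\<And>i. i \<in> I \<Longrightarrow> right_module A (M i)" "i \<in> I"
  shows "module_map A (M i) (dir_sum I M) (ds_inj I M i)"
proof -
  have am: "abelian_monoid (M i)" if "i \<in> I" for i
    using abelian_group.axioms(1)[OF right_module.axioms(2)[OF assms(1)[OF that]]] .
  note M = abelian_monoid.zero_closed[OF am] abelian_monoid.l_zero[OF am]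
    right_module.smult_zero_right[OF assms(1)]
  show ?thesis using assms(2)
    by (auto simp: module_map_def ds_inj_def M fun_eq_iff)
qed

lemma module_map_ds_proj: "i \<in> I \<Longrightarrow> module_map A (dir_sum I M) (M i) (\<lambda>x. x i)"
  by (auto simp: module_map_def)

lemma module_map_ds_map:
  assumes "\<And>i. i \<in> I \<Longrightarrow> module_map A N (M i) (h i)"
  shows "module_map A N (dir_sum I M) (\<lambda>x. \<lambda>i\<in>I. h i x)"
  using assms by (auto simp: module_map_def Pi_iff intro!: restrict_ext)

text \<open>A submodule that contains every summand is everything: induct on the finite support.\<close>

lemma ds_inj_generate:
  assumes M: "\<And>i. i \<in> I \<Longrightarrow> right_module A (M i)" and fin: "finite I"
    and U: "Module.submodule U A (dir_sum I M)"
    and inU: "\<And>i y. i \<in> I \<Longrightarrow> y \<in> carrier (M i) \<Longrightarrow> (y = x i) \<Longrightarrow> ds_inj I M i y \<in> U"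
    and x: "x \<in> carrier (dir_sum I M)"
  shows "x \<in> U"
proof -
  interpret D: right_module A "dir_sum I M" by (rule right_module_dir_sum[OF M])
  have am: "abelian_monoid (M i)" if "i \<in> I" for i
    using abelian_group.axioms(1)[OF right_module.axioms(2)[OF M[OF that]]] .
  have "(\<lambda>i\<in>I. if i \<in> F then x i else \<zero>\<^bsub>M i\<^esub>) \<in> U" if "finite F" "F \<subseteq> I" for F
    using that
  proof (induction F)
    case empty
    have "\<zero>\<^bsub>dir_sum I M\<^esub> \<in> U" using U unfolding D.submodule_iff by blast
    then show ?case by (simp add: restrict_def)
  next
    case (insert k F)
    have e: "(\<lambda>i\<in>I. if i \<in> insert k F then x i else \<zero>\<^bsub>M i\<^esub>) =
        ds_inj I M k (x k) \<oplus>\<^bsub>dir_sum I M\<^esub> (\<lambda>i\<in>I. if i \<in> F then x i else \<zero>\<^bsub>M i\<^esub>)"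
      using insert.hyps insert.prems x
      by (auto simp: ds_inj_def fun_eq_iff PiE_iff abelian_monoid.l_zero[OF am]
          abelian_monoid.r_zero[OF am] abelian_monoid.zero_closed[OF am])
    have "ds_inj I M k (x k) \<in> U"
      using insert.prems x by (intro inU) (auto simp: PiE_iff)
    moreover have "(\<lambda>i\<in>I. if i \<in> F then x i else \<zero>\<^bsub>M i\<^esub>) \<in> U"
      using insert by blast
    ultimately show ?case
      unfolding e using U unfolding D.submodule_iff by blast
  qed
  from this[OF fin subset_refl] have "(\<lambda>i\<in>I. x i) \<in> U"
    by (simp cong: restrict_cong)
  then show ?thesis using x by (auto simp: PiE_iff extensional_restrict)
qed

text \<open>The equalizer is a submodule that contains every summand.\<close>

lemma module_map_ds_eqI:
  assumes M: "\<And>i. i \<in> I \<Longrightarrow> right_module A (M i)" and fin: "finite I" and N: "right_module A N"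
    and g: "module_map A (dir_sum I M) N g" and h: "module_map A (dir_sum I M) N h"
    and eq: "\<And>i y. i \<in> I \<Longrightarrow> y \<in> carrier (M i) \<Longrightarrow> g (ds_inj I M i y) = h (ds_inj I M i y)"
    and x: "x \<in> carrier (dir_sum I M)"
  shows "g x = h x"
proof -
  interpret N: right_module A N by fact
  let ?U = "{x \<in> carrier (dir_sum I M). g x \<ominus>\<^bsub>N\<^esub> h x = \<zero>\<^bsub>N\<^esub>}"
  have "Module.submodule ?U A (dir_sum I M)"
    by (rule submodule_kernel[OF right_module_dir_sum[OF M] N module_map_minus_map[OF N g h]])
  moreover have "ds_inj I M i y \<in> ?U" if "i \<in> I" "y \<in> carrier (M i)" for i y
  proof -
    have "ds_inj I M i y \<in> carrier (dir_sum I M)"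
      using module_map_ds_inj[where M = M, OF M that(1)] that(2) by (rule module_map_closed)
    with eq[OF that] module_map_closed[OF h this] show ?thesis by simp
  qed
  ultimately have "x \<in> ?U" by (intro ds_inj_generate[where M = M, OF M fin _ _ x])
  then show ?thesis using module_map_closed[OF g x] module_map_closed[OF h x] by simp
qed

lemma module_map_ds_out:
  assumes fin: "finite I" and N: "right_module A N"
    and h: "\<And>i. i \<in> I \<Longrightarrow> module_map A (M i) N (h i)"
  shows "module_map A (dir_sum I M) N (\<lambda>x. \<Oplus>\<^bsub>N\<^esub>i\<in>I. h i (x i))"
proof -
  interpret N: right_module A N by fact
  have cl: "(\<lambda>i. h i (x i)) \<in> I \<rightarrow> carrier N" if "x \<in> carrier (dir_sum I M)" for x
    using that module_map_closed[OF h] by auto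
  show ?thesis unfolding module_map_def
  proof (intro conjI ballI funcsetI)
    fix x assume x: "x \<in> carrier (dir_sum I M)"
    then show "(\<Oplus>\<^bsub>N\<^esub>i\<in>I. h i (x i)) \<in> carrier N" using cl by (intro N.finsum_closed)
    fix r assume r: "r \<in> carrier A"
    have "(\<Oplus>\<^bsub>N\<^esub>i\<in>I. h i ((r \<odot>\<^bsub>dir_sum I M\<^esub> x) i)) = (\<Oplus>\<^bsub>N\<^esub>i\<in>I. r \<odot>\<^bsub>N\<^esub> h i (x i))"
      using cl[OF x] x r by (intro N.finsum_cong') (auto simp: module_map_smult[OF h] Pi_iff PiE_iff)
    then show "(\<Oplus>\<^bsub>N\<^esub>i\<in>I. h i ((r \<odot>\<^bsub>dir_sum I M\<^esub> x) i)) = r \<odot>\<^bsub>N\<^esub> (\<Oplus>\<^bsub>N\<^esub>i\<in>I. h i (x i))"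
      using N.finsum_smult[OF r cl[OF x]] by simp
  next
    fix x y assume x: "x \<in> carrier (dir_sum I M)" and y: "y \<in> carrier (dir_sum I M)"
    have "(\<Oplus>\<^bsub>N\<^esub>i\<in>I. h i ((x \<oplus>\<^bsub>dir_sum I M\<^esub> y) i)) = (\<Oplus>\<^bsub>N\<^esub>i\<in>I. h i (x i) \<oplus>\<^bsub>N\<^esub> h i (y i))"
      using cl[OF x] cl[OF y] x y by (intro N.finsum_cong') (auto simp: module_map_add[OF h] Pi_iff PiE_iff)
    then show "(\<Oplus>\<^bsub>N\<^esub>i\<in>I. h i ((x \<oplus>\<^bsub>dir_sum I M\<^esub> y) i)) =
        (\<Oplus>\<^bsub>N\<^esub>i\<in>I. h i (x i)) \<oplus>\<^bsub>N\<^esub> (\<Oplus>\<^bsub>N\<^esub>i\<in>I. h i (y i))"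
      using N.finsum_addf[OF cl[OF x] cl[OF y]] by simp
  qed
qed

lemma ds_out_inj:
  assumes fin: "finite I" and N: "right_module A N" and M: "\<And>i. i \<in> I \<Longrightarrow> right_module A (M i)"
    and h: "\<And>i. i \<in> I \<Longrightarrow> module_map A (M i) N (h i)" and i: "i \<in> I" and y: "y \<in> carrier (M i)"
  shows "(\<Oplus>\<^bsub>N\<^esub>j\<in>I. h j (ds_inj I M i y j)) = h i y"
proof -
  interpret N: right_module A N by fact
  have "(\<Oplus>\<^bsub>N\<^esub>j\<in>I. h j (ds_inj I M i y j)) = (\<Oplus>\<^bsub>N\<^esub>j\<in>I. if i = j then h j y else \<zero>\<^bsub>N\<^esub>)"
    using module_map_zero[OF M N h] i y module_map_closed[OF h]
    by (intro N.finsum_cong') (auto simp: ds_inj_def)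
  also have "\<dots> = h i y"
  proof -
    have "(\<Oplus>\<^bsub>N\<^esub>j\<in>I. if i = j then (\<lambda>_. h i y) j else \<zero>\<^bsub>N\<^esub>) = h i y"
      using N.finsum_singleton[OF i fin, of "\<lambda>_. h i y"] module_map_closed[OF h[OF i] y] by auto
    moreover have "(\<Oplus>\<^bsub>N\<^esub>j\<in>I. if i = j then h j y else \<zero>\<^bsub>N\<^esub>) =
        (\<Oplus>\<^bsub>N\<^esub>j\<in>I. if i = j then (\<lambda>_. h i y) j else \<zero>\<^bsub>N\<^esub>)"
      using module_map_closed[OF h[OF i] y] by (intro N.finsum_cong') auto
    ultimately show ?thesis by simp
  qed
  finally show ?thesis .
qed

lemma ds_out_eq:
  assumes "finite I" "\<And>i. i \<in> I \<Longrightarrow> right_module A (X i)" "right_module A V" "module_map A (dir_sum I X) V t"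
    and "y \<in> carrier (dir_sum I X)"
  shows "(\<Oplus>\<^bsub>V\<^esub>j\<in>I. t (ds_inj I X j (y j))) = t y"
proof (rule module_map_ds_eqI[where M = X, OF assms(2,1,3) _ assms(4) _ assms(5)])
  have h: "module_map A (X j) V (\<lambda>x. t (ds_inj I X j x))" if "j \<in> I" for j
    by (rule module_map_compose[OF module_map_ds_inj[where M = X, OF assms(2) that] assms(4)])
  then show "module_map A (dir_sum I X) V (\<lambda>y. \<Oplus>\<^bsub>V\<^esub>j\<in>I. t (ds_inj I X j (y j)))"
    by (rule module_map_ds_out[where M = X, OF assms(1,3)])
  fix i y assume "i \<in> I" "y \<in> carrier (X i)"
  then show "(\<Oplus>\<^bsub>V\<^esub>j\<in>I. t (ds_inj I X j (ds_inj I X i y j))) = t (ds_inj I X i y)"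
    using ds_out_inj[where M = X and N = V and I = I and h = "\<lambda>j x. t (ds_inj I X j x)" and i = i and y = y]
      assms(1-3) h by blast
qed

lemma fd_module_dir_sum:
  assumes fin: "finite I" and M: "\<And>i. i \<in> I \<Longrightarrow> fd_module A (M i)"
  shows "fd_module A (dir_sum I M)"
proof -
  have R: "right_module A (dir_sum I M)" by (intro right_module_dir_sum fd_moduleD M)
  have "\<exists>N (l :: nat \<Rightarrow> _). separating (base_space A (M i)) (carrier (M i)) {..<N} l" if "i \<in> I" for i
    using M[OF that] by (simp add: fd_module_iff finite_dim_def)
  then obtain N l where l:
      "\<And>i. i \<in> I \<Longrightarrow> separating (base_space A (M i)) (carrier (M i)) {..<N i} (l i :: nat \<Rightarrow> _)"
    by metis
  have "separating (base_space A (dir_sum I M)) (carrier (base_space A (dir_sum I M)))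
      (SIGMA i:I. {..<N i}) (\<lambda>(i, j) x. l i j (x i))"
    unfolding separating_def
  proof (intro conjI ballI impI)
    show "finite (SIGMA i:I. {..<N i})" using fin by auto
  next
    fix p assume "p \<in> (SIGMA i:I. {..<N i})"
    then obtain i j where p: "p = (i, j)" "i \<in> I" "j < N i" by blast
    then have "linear_functional (base_space A (M i)) (l i j)"
      using l by (auto simp: separating_def)
    then show "linear_functional (base_space A (dir_sum I M)) ((\<lambda>(i, j) x. l i j (x i)) p)"
      using linear_functional_comp[OF module_map_klinear[OF module_map_ds_proj[OF p(2)]]] p(1) by simp
  next
    fix x assume x: "x \<in> carrier (base_space A (dir_sum I M))"
      and z: "\<forall>p\<in>(SIGMA i:I. {..<N i}). (\<lambda>(i, j) x. l i j (x i)) p x = 0"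
    have "x i = \<zero>\<^bsub>M i\<^esub>" if i: "i \<in> I" for i
      using l[OF i] z x i unfolding separating_def by (auto simp: PiE_iff)
    then show "x = \<zero>\<^bsub>base_space A (dir_sum I M)\<^esub>"
      using x by (auto simp: PiE_iff extensional_def fun_eq_iff)
  qed
  then have "finite_dim (base_space A (dir_sum I M))" by (rule finite_dimI)
  with R show ?thesis by (simp add: fd_module_iff)
qed

end

context fd_algebra
begin

subsection \<open>Quotients\<close>

context
  fixes M :: "('l, 'm) module" and U :: "'m set"
  assumes M: "right_module A M" and U: "Module.submodule U A M"
begin

interpretation M: right_module A M by (rule M)

interpretation S: abelian_subgroup U M
proof (rule abelian_subgroupI3)
  show "additive_subgroup U M"
    using U by (auto intro: additive_subgroup.intro simp: Module.submodule_def)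
qed (rule M.abelian_group_axioms)

lemma quot_carrierE:
  assumes "X \<in> carrier (quot_module M U)"
  obtains x where "x \<in> carrier M" "X = U +>\<^bsub>M\<^esub> x"
  using assms by (auto simp: quot_module_def A_RCOSETS_def')

lemma quot_simps:
  "x \<in> carrier M \<Longrightarrow> U +>\<^bsub>M\<^esub> x \<in> carrier (quot_module M U)"
  "\<zero>\<^bsub>quot_module M U\<^esub> = U +>\<^bsub>M\<^esub> \<zero>\<^bsub>M\<^esub>"
  "x \<in> carrier M \<Longrightarrow> y \<in> carrier M \<Longrightarrow>
     (U +>\<^bsub>M\<^esub> x) \<oplus>\<^bsub>quot_module M U\<^esub> (U +>\<^bsub>M\<^esub> y) = U +>\<^bsub>M\<^esub> (x \<oplus>\<^bsub>M\<^esub> y)"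
  "r \<in> carrier A \<Longrightarrow> x \<in> carrier M \<Longrightarrow> r \<odot>\<^bsub>quot_module M U\<^esub> (U +>\<^bsub>M\<^esub> x) = U +>\<^bsub>M\<^esub> (r \<odot>\<^bsub>M\<^esub> x)"
proof -
  show "x \<in> carrier M \<Longrightarrow> U +>\<^bsub>M\<^esub> x \<in> carrier (quot_module M U)"
    by (auto simp: quot_module_def A_RCOSETS_def')
  show "\<zero>\<^bsub>quot_module M U\<^esub> = U +>\<^bsub>M\<^esub> \<zero>\<^bsub>M\<^esub>"
    using S.a_subset by (simp add: quot_module_def)
  show "x \<in> carrier M \<Longrightarrow> y \<in> carrier M \<Longrightarrow>
     (U +>\<^bsub>M\<^esub> x) \<oplus>\<^bsub>quot_module M U\<^esub> (U +>\<^bsub>M\<^esub> y) = U +>\<^bsub>M\<^esub> (x \<oplus>\<^bsub>M\<^esub> y)"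
    by (simp add: quot_module_def S.a_rcos_sum)
  assume r: "r \<in> carrier A" and x: "x \<in> carrier M"
  have Ui: "U \<subseteq> carrier M" "\<zero>\<^bsub>M\<^esub> \<in> U" "\<And>x y. x \<in> U \<Longrightarrow> y \<in> U \<Longrightarrow> x \<oplus>\<^bsub>M\<^esub> y \<in> U"
    "\<And>r x. r \<in> carrier A \<Longrightarrow> x \<in> U \<Longrightarrow> r \<odot>\<^bsub>M\<^esub> x \<in> U"
    using U by (auto simp: M.submodule_iff)
  have "U <+>\<^bsub>M\<^esub> (\<lambda>x. r \<odot>\<^bsub>M\<^esub> x) ` (U +>\<^bsub>M\<^esub> x) = U +>\<^bsub>M\<^esub> (r \<odot>\<^bsub>M\<^esub> x)"
  proof (intro Set.set_eqI iffI)
    fix z assume "z \<in> U <+>\<^bsub>M\<^esub> (\<lambda>x. r \<odot>\<^bsub>M\<^esub> x) ` (U +>\<^bsub>M\<^esub> x)"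
    then obtain u v where uv: "u \<in> U" "v \<in> U" "z = u \<oplus>\<^bsub>M\<^esub> r \<odot>\<^bsub>M\<^esub> (v \<oplus>\<^bsub>M\<^esub> x)"
      by (auto simp: set_add_def' a_r_coset_def')
    then have "z = (u \<oplus>\<^bsub>M\<^esub> r \<odot>\<^bsub>M\<^esub> v) \<oplus>\<^bsub>M\<^esub> r \<odot>\<^bsub>M\<^esub> x"
      using Ui r x by (simp add: M.smult_r_distr subset_iff M.a_assoc)
    then show "z \<in> U +>\<^bsub>M\<^esub> (r \<odot>\<^bsub>M\<^esub> x)" using uv Ui r by (auto simp: a_r_coset_def')
  next
    fix z assume "z \<in> U +>\<^bsub>M\<^esub> (r \<odot>\<^bsub>M\<^esub> x)"
    then obtain u where u: "u \<in> U" "z = u \<oplus>\<^bsub>M\<^esub> r \<odot>\<^bsub>M\<^esub> x" by (auto simp: a_r_coset_def')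
    have "x \<in> U +>\<^bsub>M\<^esub> x" using x by (rule S.a_rcos_self)
    with u show "z \<in> U <+>\<^bsub>M\<^esub> (\<lambda>x. r \<odot>\<^bsub>M\<^esub> x) ` (U +>\<^bsub>M\<^esub> x)" by (auto simp: set_add_def')
  qed
  then show "r \<odot>\<^bsub>quot_module M U\<^esub> (U +>\<^bsub>M\<^esub> x) = U +>\<^bsub>M\<^esub> (r \<odot>\<^bsub>M\<^esub> x)" by (simp add: quot_module_def)
qed

lemma quot_eq_iff:
  assumes "x \<in> carrier M" "y \<in> carrier M"
  shows "U +>\<^bsub>M\<^esub> x = U +>\<^bsub>M\<^esub> y \<longleftrightarrow> x \<ominus>\<^bsub>M\<^esub> y \<in> U"
proof
  assume "U +>\<^bsub>M\<^esub> x = U +>\<^bsub>M\<^esub> y"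
  then have "x \<in> U +>\<^bsub>M\<^esub> y" using S.a_rcos_self[OF assms(1)] by simp
  then obtain u where u: "u \<in> U" "x = u \<oplus>\<^bsub>M\<^esub> y" by (auto simp: a_r_coset_def')
  then have "x \<ominus>\<^bsub>M\<^esub> y = u"
    using assms S.a_subset by (simp add: subset_iff a_minus_def M.a_assoc M.r_neg)
  with u show "x \<ominus>\<^bsub>M\<^esub> y \<in> U" by simp
next
  assume "x \<ominus>\<^bsub>M\<^esub> y \<in> U"
  moreover have "x = (x \<ominus>\<^bsub>M\<^esub> y) \<oplus>\<^bsub>M\<^esub> y" using assms by (simp add: a_minus_def M.a_assoc M.l_neg)
  ultimately have "x \<in> U +>\<^bsub>M\<^esub> y" by (auto simp: a_r_coset_def')
  then show "U +>\<^bsub>M\<^esub> x = U +>\<^bsub>M\<^esub> y"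
    using S.a_repr_independence' assms(2) M.a_repr_independence[OF _ assms(2)] S.a_subgroup by metis
qed

lemma right_module_quot: "right_module A (quot_module M U)"
proof (rule right_moduleI)
  note q = quot_simps
  show "abelian_group (quot_module M U)"
  proof (rule abelian_groupI)
    fix X assume "X \<in> carrier (quot_module M U)"
    then obtain x where "x \<in> carrier M" "X = U +>\<^bsub>M\<^esub> x" by (rule quot_carrierE)
    then show "\<exists>Y\<in>carrier (quot_module M U). Y \<oplus>\<^bsub>quot_module M U\<^esub> X = \<zero>\<^bsub>quot_module M U\<^esub>"
      by (intro bexI[of _ "U +>\<^bsub>M\<^esub> (\<ominus>\<^bsub>M\<^esub> x)"]) (simp_all add: q M.l_neg)
  qed (auto elim!: quot_carrierE simp: q M.a_ac)
qed (auto elim!: quot_carrierE simp: quot_simps M.smult_l_distr M.smult_r_distr M.smult_assoc ring_axioms)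

lemma module_map_quot: "module_map A M (quot_module M U) (\<lambda>x. U +>\<^bsub>M\<^esub> x)"
  by (auto simp: module_map_def quot_simps)

lemma quot_zero_iff: "x \<in> carrier M \<Longrightarrow> U +>\<^bsub>M\<^esub> x = \<zero>\<^bsub>quot_module M U\<^esub> \<longleftrightarrow> x \<in> U"
proof -
  have m: "\<ominus>\<^bsub>M\<^esub> \<zero>\<^bsub>M\<^esub> = \<zero>\<^bsub>M\<^esub>" by (rule M.minus_equality) simp_all
  then show "x \<in> carrier M \<Longrightarrow> U +>\<^bsub>M\<^esub> x = \<zero>\<^bsub>quot_module M U\<^esub> \<longleftrightarrow> x \<in> U"
    using quot_eq_iff[of x "\<zero>\<^bsub>M\<^esub>"] by (simp add: quot_simps a_minus_def m)
qed

text \<open>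
  The functionals on the quotient come from those on \<open>M\<close> by first projecting along the subspace \<open>U\<close>
  with the help of a dual basis of \<open>U\<close>.
\<close>

lemma fd_module_quot:
  assumes "fd_module A M"
  shows "fd_module A (quot_module M U)"
proof -
  interpret B: kspace "base_space A M" by (rule kspace_base_space[OF M])
  obtain N and l :: "nat \<Rightarrow> 'm \<Rightarrow> 'k" where l: "separating (base_space A M) (carrier M) {..<N} l"
    using assms by (auto simp: fd_module_iff finite_dim_def)
  have sub: "linear_subspace (base_space A M) U"
    using U by (auto simp: linear_subspace_def M.submodule_iff)
  have "separating (base_space A M) U {..<N} l"
    using l S.a_subset by (auto simp: separating_def)
  from B.dual_basis_subspace[OF sub this] obtain r :: nat and c \<mu> where
    c: "c \<in> {..<r} \<rightarrow> U" and \<mu>: "separating (base_space A M) U {..<r} \<mu>"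
    and dual: "\<forall>i<r. \<forall>j<r. \<mu> i (c j) = of_bool (i = j)" by (elim exE conjE)
  have cM: "c \<in> {..<r} \<rightarrow> carrier (base_space A M)" using c S.a_subset by auto
  have lin\<mu>: "linear_functional (base_space A M) (\<mu> i)" if "i < r" for i
    using \<mu> that by (auto simp: separating_def)
  define g where "g k x = l k x - (\<Sum>i<r. \<mu> i x * l k (c i))" for k x
  have ling: "linear_functional (base_space A M) (g k)" if "k < N" for k
    using l that lin\<mu> unfolding linear_functional_def g_def separating_def
    by (auto simp: algebra_simps sum.distrib sum_distrib_left)
  have gU: "g k u = 0" if "u \<in> U" "k < N" for k u
  proof -
    let ?s = "\<Oplus>\<^bsub>base_space A M\<^esub>i\<in>{..<r}. \<mu> i u \<odot>\<^bsub>base_space A M\<^esub> c i"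
    have sU: "?s \<in> U" by (rule B.linear_subspace_lincomb[OF sub c])
    have "u \<ominus>\<^bsub>base_space A M\<^esub> ?s \<in> U" by (rule B.linear_subspace_minus[OF sub that(1) sU])
    moreover have "\<mu> j (u \<ominus>\<^bsub>base_space A M\<^esub> ?s) = 0" if j: "j < r" for j
    proof -
      have "\<mu> j ?s = (\<Sum>i<r. \<mu> i u * \<mu> j (c i))" by (rule B.linear_functional_lincomb[OF lin\<mu>[OF j] cM])
      also have "\<dots> = (\<Sum>i<r. if i = j then \<mu> i u else 0)"
        using j dual by (intro sum.cong) auto
      finally have "\<mu> j ?s = \<mu> j u" using j by simp
      then show ?thesis
        using B.linear_functional_minus[OF lin\<mu>[OF j]] that sU S.a_subset \<open>u \<in> U\<close> by (simp add: subset_iff)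
    qed
    ultimately have z: "u \<ominus>\<^bsub>base_space A M\<^esub> ?s = \<zero>\<^bsub>base_space A M\<^esub>"
      using \<mu> unfolding separating_def by blast
    have "u \<in> carrier (base_space A M)" "?s \<in> carrier (base_space A M)"
      using \<open>u \<in> U\<close> sU S.a_subset by (simp_all add: subset_iff del: base_space_simps(2-4))
    with z have "u = ?s" by (rule B.minus_zeroD)
    then have "l k u = l k ?s" by (rule arg_cong)
    also have "linear_functional (base_space A M) (l k)" using l \<open>k < N\<close> by (auto simp: separating_def)
    then have "l k ?s = (\<Sum>i<r. \<mu> i u * l k (c i))"
      by (rule B.linear_functional_lincomb[OF _ cM])
    finally have "l k u = (\<Sum>i<r. \<mu> i u * l k (c i))" .
    then show ?thesis by (simp add: g_def)
  qed
  have g_eq: "g k x = g k y" if "x \<in> carrier M" "y \<in> carrier M" "x \<ominus>\<^bsub>M\<^esub> y \<in> U" "k < N" for k x y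
  proof -
    have "x = (x \<ominus>\<^bsub>M\<^esub> y) \<oplus>\<^bsub>M\<^esub> y" using that by (simp add: a_minus_def M.a_assoc M.l_neg)
    then have "g k x = g k (x \<ominus>\<^bsub>M\<^esub> y) + g k y"
      using linear_functional_add[OF ling[OF that(4)], of "x \<ominus>\<^bsub>M\<^esub> y" y] that by simp
    then show ?thesis using gU[OF that(3,4)] by simp
  qed
  define rep where "rep X = (SOME x. x \<in> carrier M \<and> X = U +>\<^bsub>M\<^esub> x)" for X
  have rep: "rep X \<in> carrier M" "X = U +>\<^bsub>M\<^esub> rep X" if "X \<in> carrier (quot_module M U)" for X
  proof -
    have "\<exists>x. x \<in> carrier M \<and> X = U +>\<^bsub>M\<^esub> x" using that by (blast elim: quot_carrierE)
    from someI_ex[OF this] show "rep X \<in> carrier M" "X = U +>\<^bsub>M\<^esub> rep X" unfolding rep_def by blast+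
  qed
  have g_rep: "g k (rep (U +>\<^bsub>M\<^esub> x)) = g k x" if "x \<in> carrier M" "k < N" for k x
    using rep[OF quot_simps(1)[OF that(1)]] that quot_eq_iff[of x "rep (U +>\<^bsub>M\<^esub> x)"] g_eq[of x _ k] by simp
  have "separating (base_space A (quot_module M U)) (carrier (quot_module M U)) {..<N} (\<lambda>k X. g k (rep X))"
    unfolding separating_def
  proof (intro conjI ballI impI)
    fix k assume "k \<in> {..<N}"
    then show "linear_functional (base_space A (quot_module M U)) (\<lambda>X. g k (rep X))"
      using ling[of k] unfolding linear_functional_def
      by (auto elim!: quot_carrierE simp: quot_simps g_rep)
  next
    fix X assume X: "X \<in> carrier (quot_module M U)" "\<forall>k\<in>{..<N}. g k (rep X) = 0"
    then obtain x where x: "x \<in> carrier M" "X = U +>\<^bsub>M\<^esub> x" by (auto elim: quot_carrierE)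
    let ?s = "\<Oplus>\<^bsub>base_space A M\<^esub>i\<in>{..<r}. \<mu> i x \<odot>\<^bsub>base_space A M\<^esub> c i"
    have sU: "?s \<in> U" by (rule B.linear_subspace_lincomb[OF sub c])
    have "l k x = l k ?s" if "k \<in> {..<N}" for k
    proof -
      have "linear_functional (base_space A M) (l k)" using l that by (auto simp: separating_def)
      from B.linear_functional_lincomb[OF this cM] show ?thesis
        using X(2) that x g_rep unfolding g_def by simp
    qed
    then have "x = ?s" using B.separating_eqI[of "{..<N}" l x ?s] l x sU S.a_subset
        by (auto simp: subset_iff)
    then show "X = \<zero>\<^bsub>base_space A (quot_module M U)\<^esub>" using sU x quot_zero_iff by simp
  qed auto
  then have "finite_dim (base_space A (quot_module M U))"
    by (intro finite_dimI) simp
  then show ?thesis using right_module_quot by (simp add: fd_module_iff)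
qed

text \<open>
  The homomorphism theorem, used to handle isomorphisms from a cokernel as epimorphisms from \<open>P(\<alpha>)\<close> with
  prescribed kernel.
\<close>

lemma module_iso_quot_iff:
  fixes N :: "('l, 'n) module"
  assumes N: "right_module A N"
  shows "module_iso A (quot_module M U) N \<longleftrightarrow>
     (\<exists>p. module_map A M N p \<and> p ` carrier M = carrier N \<and> (\<forall>x\<in>carrier M. p x = \<zero>\<^bsub>N\<^esub> \<longleftrightarrow> x \<in> U))"
  unfolding module_iso_iff[OF right_module_quot]
proof
  assume "\<exists>h. module_map A (quot_module M U) N h \<and> bij_betw h (carrier (quot_module M U)) (carrier N)"
  then obtain h where h: "module_map A (quot_module M U) N h"
      "bij_betw h (carrier (quot_module M U)) (carrier N)"
    by blast
  let ?p = "\<lambda>x. h (U +>\<^bsub>M\<^esub> x)"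
  have "module_map A M N ?p" by (rule module_map_compose[OF module_map_quot h(1)])
  moreover have "?p ` carrier M = h ` carrier (quot_module M U)"
    by (auto elim!: quot_carrierE simp: quot_simps(1))
  moreover have "?p x = \<zero>\<^bsub>N\<^esub> \<longleftrightarrow> x \<in> U" if x: "x \<in> carrier M" for x
  proof -
    have "h \<zero>\<^bsub>quot_module M U\<^esub> = \<zero>\<^bsub>N\<^esub>" by (rule module_map_zero[OF right_module_quot N h(1)])
    moreover have "\<zero>\<^bsub>quot_module M U\<^esub> \<in> carrier (quot_module M U)" by (simp add: quot_simps)
    ultimately have "?p x = \<zero>\<^bsub>N\<^esub> \<longleftrightarrow> U +>\<^bsub>M\<^esub> x = \<zero>\<^bsub>quot_module M U\<^esub>"
      using h(2) quot_simps(1)[OF x] by (metis bij_betw_def inj_onD)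
    then show ?thesis using quot_zero_iff[OF x] by simp
  qed
  ultimately show "\<exists>p. module_map A M N p \<and> p ` carrier M = carrier N \<and> (\<forall>x\<in>carrier M. p x = \<zero>\<^bsub>N\<^esub> \<longleftrightarrow> x \<in> U)"
    using h(2) by (intro exI[of _ ?p]) (auto simp: bij_betw_def)
next
  interpret N: right_module A N by (rule N)
  assume "\<exists>p. module_map A M N p \<and> p ` carrier M = carrier N \<and> (\<forall>x\<in>carrier M. p x = \<zero>\<^bsub>N\<^esub> \<longleftrightarrow> x \<in> U)"
  then obtain p where p: "module_map A M N p" "p ` carrier M = carrier N"
    "\<And>x. x \<in> carrier M \<Longrightarrow> p x = \<zero>\<^bsub>N\<^esub> \<longleftrightarrow> x \<in> U" by blast
  have p_eq: "p x = p y \<longleftrightarrow> U +>\<^bsub>M\<^esub> x = U +>\<^bsub>M\<^esub> y" if "x \<in> carrier M" "y \<in> carrier M" for x y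
    using that quot_eq_iff p(3)[of "x \<ominus>\<^bsub>M\<^esub> y"] module_map_minus[OF M N p(1)] module_map_closed[OF p(1)]
      by simp
  define h where "h X = p (SOME x. x \<in> carrier M \<and> X = U +>\<^bsub>M\<^esub> x)" for X
  have h: "h (U +>\<^bsub>M\<^esub> x) = p x" if "x \<in> carrier M" for x
  proof -
    let ?y = "SOME y. y \<in> carrier M \<and> U +>\<^bsub>M\<^esub> x = U +>\<^bsub>M\<^esub> y"
    have "?y \<in> carrier M \<and> U +>\<^bsub>M\<^esub> x = U +>\<^bsub>M\<^esub> ?y" 
      by (rule someI[of "\<lambda>y. y \<in> carrier M \<and> U +>\<^bsub>M\<^esub> x = U +>\<^bsub>M\<^esub> y" x]) (use that in blast)
    then show ?thesis using p_eq[OF that, of ?y] by (simp add: h_def)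
  qed
  have "module_map A (quot_module M U) N h"
    unfolding module_map_def
    by (auto elim!: quot_carrierE simp: quot_simps h module_map_closed[OF p(1)] module_map_add[OF p(1)]
        module_map_smult[OF p(1)])
  moreover have "bij_betw h (carrier (quot_module M U)) (carrier N)"
    unfolding bij_betw_def
  proof
    show "inj_on h (carrier (quot_module M U))"
      by (auto intro!: inj_onI elim!: quot_carrierE simp: h p_eq)
    have "h ` carrier (quot_module M U) = p ` carrier M"
    proof (intro subset_antisym image_subsetI)
      fix X assume "X \<in> carrier (quot_module M U)"
      then show "h X \<in> p ` carrier M" by (auto elim!: quot_carrierE simp: h)
    next
      fix x assume x: "x \<in> carrier M"
      then show "p x \<in> h ` carrier (quot_module M U)" using quot_simps(1)[OF x] h[OF x] by (metis imageI)
    qed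
    then show "h ` carrier (quot_module M U) = carrier N" using p(2) by simp
  qed
  ultimately show "\<exists>h. module_map A (quot_module M U) N h
      \<and> bij_betw h (carrier (quot_module M U)) (carrier N)"
    by blast
qed

end

end

context fd_algebra
begin

subsection \<open>Coordinates\<close>

lemma module_iso_sym:
  assumes "right_module A M" "right_module A N" "module_iso A M N"
  shows "module_iso A N M"
proof -
  obtain h where h: "module_map A M N h" "bij_betw h (carrier M) (carrier N)"
    using assms by (auto simp: module_iso_iff)
  have "bij_betw (the_inv_into (carrier M) h) (carrier N) (carrier M)"
    by (rule bij_betw_the_inv_into[OF h(2)])
  with module_map_inverse[OF assms(1,2) h] show ?thesis using assms(2) by (auto simp: module_iso_iff)
qed

lemma module_iso_trans:
  assumes "right_module A L" "right_module A M" "module_iso A L M" "module_iso A M N"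
  shows "module_iso A L N"
proof -
  obtain g where g: "module_map A L M g" "bij_betw g (carrier L) (carrier M)"
    using assms by (auto simp: module_iso_iff)
  obtain h where h: "module_map A M N h" "bij_betw h (carrier M) (carrier N)"
    using assms by (auto simp: module_iso_iff)
  have "module_map A L N (h \<circ> g)" using module_map_compose[OF g(1) h(1)] by (simp add: comp_def)
  with bij_betw_trans[OF g(2) h(2)] show ?thesis using assms(1) by (auto simp: module_iso_iff)
qed

text \<open>
  A finite family of separating functionals embeds a module into \<open>nat \<Rightarrow> 'k\<close>, the carrier type to
  which the quantifications over all modules in the definitions refer.
\<close>

lemma coordinate_module:
  fixes M :: "('l, 'm) module"
  assumes "fd_module A M"
  obtains M' :: "('l, nat \<Rightarrow> 'k) module" and h where "fd_module A M'" "module_map A M M' h"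
    "bij_betw h (carrier M) (carrier M')"
proof -
  interpret M: right_module A M by (rule fd_moduleD[OF assms])
  interpret B: kspace "base_space A M" by (rule kspace_base_space[OF fd_moduleD[OF assms]])
  obtain N and l :: "nat \<Rightarrow> 'm \<Rightarrow> 'k" where l: "separating (base_space A M) (carrier M) {..<N} l"
    using assms by (auto simp: fd_module_iff finite_dim_def)
  define h where "h x = (\<lambda>i. if i < N then l i x else 0)" for x
  have inj: "inj_on h (carrier M)"
  proof (rule inj_onI)
    fix x y assume xy: "x \<in> carrier M" "y \<in> carrier M" "h x = h y"
    show "x = y"
    proof (rule B.separating_eqI)
      show "separating (base_space A M) (carrier (base_space A M)) {..<N} l" using l by simp
      show "\<And>j. j \<in> {..<N} \<Longrightarrow> l j x = l j y"
        using xy(3) unfolding h_def by (metis lessThan_iff)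
    qed (use xy in simp_all)
  qed
  let ?g = "the_inv_into (carrier M) h"
  have g[simp]: "?g (h x) = x" if "x \<in> carrier M" for x
    using that by (rule the_inv_into_f_f[OF inj])
  define M' :: "('l, nat \<Rightarrow> 'k) module" where
    "M' = mk_module (h ` carrier M) (h \<zero>\<^bsub>M\<^esub>) (\<lambda>x y. h (?g x \<oplus>\<^bsub>M\<^esub> ?g y)) (\<lambda>r x. h (r \<odot>\<^bsub>M\<^esub> ?g x))"
  have hom: "module_map A M M' h" by (auto simp: module_map_def M'_def)
  have bij: "bij_betw h (carrier M) (carrier M')" using inj by (simp add: bij_betw_def M'_def)
  have "right_module A M'"
  proof (rule right_moduleI)
    show "abelian_group M'"
    proof (rule abelian_groupI)
      fix x assume "x \<in> carrier M'"
      then obtain y where "y \<in> carrier M" "x = h y" by (auto simp: M'_def)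
      then show "\<exists>z\<in>carrier M'. z \<oplus>\<^bsub>M'\<^esub> x = \<zero>\<^bsub>M'\<^esub>"
        by (intro bexI[of _ "h (\<ominus>\<^bsub>M\<^esub> y)"]) (auto simp: M'_def M.l_neg)
    qed (auto simp: M'_def M.a_ac)
  qed (auto simp: M'_def M.smult_l_distr M.smult_r_distr M.smult_assoc ring_axioms)
  moreover have "fd_module A M'"
  proof (rule fd_module_injective[OF calculation assms module_map_inverse[OF fd_moduleD[OF assms]
      calculation hom bij]])
    fix x assume "x \<in> carrier M'" "?g x = \<zero>\<^bsub>M\<^esub>"
    then show "x = \<zero>\<^bsub>M'\<^esub>" by (auto simp: M'_def)
  qed
  ultimately show ?thesis using hom bij that by blast
qed

text \<open>Both modules are replaced by their coordinate modules, for which projectivity is stated.\<close>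

lemma projective_lift:
  assumes P: "projective A P" and X: "fd_module A X" and Y: "fd_module A Y"
    and g: "module_map A X Y g" "g ` carrier X = carrier Y" and f: "module_map A P Y f"
  shows "\<exists>h. module_map A P X h \<and> (\<forall>x\<in>carrier P. g (h x) = f x)"
proof -
  have PR: "right_module A P" using P by (simp add: projective_def fd_moduleD)
  obtain X' :: "('l, nat \<Rightarrow> 'k) module" and u where X': "fd_module A X'" "module_map A X X' u"
    "bij_betw u (carrier X) (carrier X')" using coordinate_module[OF X] by metis
  obtain Y' :: "('l, nat \<Rightarrow> 'k) module" and v where Y': "fd_module A Y'" "module_map A Y Y' v"
    "bij_betw v (carrier Y) (carrier Y')" using coordinate_module[OF Y] by metis
  let ?u = "the_inv_into (carrier X) u"
  have u': "module_map A X' X ?u"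
      by (rule module_map_inverse[OF fd_moduleD[OF X] fd_moduleD[OF X'(1)] X'(2,3)])
  have imu: "?u ` carrier X' = carrier X"
    using bij_betw_the_inv_into[OF X'(3)] by (simp add: bij_betw_def)
  let ?g = "restrict (\<lambda>x. v (g (?u x))) (carrier X')" and ?f = "restrict (\<lambda>x. v (f x)) (carrier P)"
  have g': "?g \<in> mhom A X' Y'"
    by (intro mhom_restrict fd_moduleD X'(1) module_map_compose[OF u'] module_map_compose[OF g(1)] Y'(2))
  have f': "?f \<in> mhom A P Y'"
    by (intro mhom_restrict PR module_map_compose[OF f] Y'(2))
  have "?g ` carrier X' = v ` g ` ?u ` carrier X'" by (auto simp: image_image)
  also have "\<dots> = carrier Y'" using imu g(2) Y'(3) by (simp add: bij_betw_def)
  finally obtain h where h: "h \<in> mhom A P X'" "compose (carrier P) ?g h = ?f"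
    using P g' f' X'(1) Y'(1) unfolding projective_def by blast
  have hom: "module_map A P X' h" using h(1) by (rule mhom_module_map)
  have "g (?u (h x)) = f x" if x: "x \<in> carrier P" for x
  proof -
    have hx: "h x \<in> carrier X'" by (rule module_map_closed[OF hom x])
    have "v (g (?u (h x))) = v (f x)" using fun_cong[OF h(2), of x] x hx by (simp add: compose_def)
    moreover have "g (?u (h x)) \<in> carrier Y" "f x \<in> carrier Y"
      using module_map_closed[OF f x] module_map_closed[OF g(1)] module_map_closed[OF u' hx] by auto
    ultimately show ?thesis using Y'(3) by (auto simp: bij_betw_def dest: inj_onD)
  qed
  then show ?thesis using module_map_compose[OF hom u'] by blast
qed

lemma simple_module_iso:
  assumes S: "simple_module A M" and N: "fd_module A N" and h: "module_map A M N h"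
    "bij_betw h (carrier M) (carrier N)"
  shows "simple_module A N"
proof -
  have M: "fd_module A M" using S by (simp add: simple_module_def)
  note MR = fd_moduleD[OF M] and NR = fd_moduleD[OF N]
  have h0: "h \<zero>\<^bsub>M\<^esub> = \<zero>\<^bsub>N\<^esub>" by (rule module_map_zero[OF MR NR h(1)])
  interpret MM: right_module A M by (rule MR)
  have im: "h ` carrier M = carrier N" using h(2) by (simp add: bij_betw_def)
  have ne: "carrier N \<noteq> {\<zero>\<^bsub>N\<^esub>}"
  proof
    assume a: "carrier N = {\<zero>\<^bsub>N\<^esub>}"
    have "x = \<zero>\<^bsub>M\<^esub>" if "x \<in> carrier M" for x
    proof (rule inj_onD[of h "carrier M"])
      show "inj_on h (carrier M)" using h(2) by (simp add: bij_betw_def)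
      show "h x = h \<zero>\<^bsub>M\<^esub>" using module_map_closed[OF h(1) that] a h0 by simp
    qed (use that in simp_all)
    then have "carrier M = {\<zero>\<^bsub>M\<^esub>}" by auto
    then show False using S by (simp add: simple_module_def)
  qed
  have "U = {\<zero>\<^bsub>N\<^esub>} \<or> U = carrier N" if U: "Module.submodule U A N" for U
  proof -
    let ?V = "{x \<in> carrier M. h x \<in> U}"
    have "Module.submodule ?V A M" by (rule submodule_preimage[OF MR NR h(1) U])
    then have "?V = {\<zero>\<^bsub>M\<^esub>} \<or> ?V = carrier M" using S by (simp add: simple_module_def)
    moreover have "U = h ` ?V" using submodule_subset[OF U] im by (auto simp: image_iff)
    ultimately show ?thesis using im h0 by auto
  qed
  then show ?thesis using N ne by (simp add: simple_module_def)
qed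

lemma simple_module_index:
  assumes "complete_simples A n S" and T: "simple_module A T"
  shows "\<exists>i<n. module_iso A T (S i)"
proof -
  have fd: "fd_module A T" using T by (simp add: simple_module_def)
  obtain T' :: "('l, nat \<Rightarrow> 'k) module" and h where T': "fd_module A T'" "module_map A T T' h"
    "bij_betw h (carrier T) (carrier T')" using coordinate_module[OF fd] by metis
  have "simple_module A T'" by (rule simple_module_iso[OF T T'])
  then obtain i where "i < n" "module_iso A T' (S i)" using assms(1) by (auto simp: complete_simples_def)
  moreover have "module_iso A T T'" using T' fd by (auto simp: module_iso_iff fd_moduleD)
  ultimately show ?thesis using module_iso_trans[OF fd_moduleD[OF fd] fd_moduleD[OF T'(1)]] by blast
qed

subsection \<open>Lifting along a homomorphism\<close>

text \<open>
  The induced map \<open>Hom(X, Q) \<rightarrow> Hom(X, V)\<close> is surjective, respectively injective. These properties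
  replace exactness of \<open>Hom(X, -)\<close> and counting of dimensions.
\<close>

definition lifts :: "('l, 'x) module \<Rightarrow> ('l, 'q) module \<Rightarrow> ('l, 'v) module \<Rightarrow> ('q \<Rightarrow> 'v) \<Rightarrow> bool" where
  "lifts X Q V t \<longleftrightarrow>
     (\<forall>u. module_map A X V u \<longrightarrow> (\<exists>v. module_map A X Q v \<and> (\<forall>x\<in>carrier X. t (v x) = u x)))"

definition monic_for :: "('l, 'x) module \<Rightarrow> ('l, 'q) module \<Rightarrow> ('l, 'v) module \<Rightarrow> ('q \<Rightarrow> 'v) \<Rightarrow> bool" where
  "monic_for X Q V t \<longleftrightarrow>
     (\<forall>v. module_map A X Q v \<longrightarrow> (\<forall>x\<in>carrier X. t (v x) = \<zero>\<^bsub>V\<^esub>) \<longrightarrow> (\<forall>x\<in>carrier X. v x = \<zero>\<^bsub>Q\<^esub>))"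

lemma projective_lifts:
  assumes "projective A P" "fd_module A X" "fd_module A Y" "module_map A X Y g" "g ` carrier X = carrier Y"
  shows "lifts P X Y g"
  using projective_lift[OF assms] unfolding lifts_def by blast

text \<open>The lifts of the restrictions to the summands add up.\<close>

lemma lifts_dir_sum:
  assumes fin: "finite I" and X: "\<And>i. i \<in> I \<Longrightarrow> right_module A (X i)"
    and Q: "right_module A Q" and V: "right_module A V" and t: "module_map A Q V t"
    and l: "\<And>i. i \<in> I \<Longrightarrow> lifts (X i) Q V t"
  shows "lifts (dir_sum I X) Q V t"
  unfolding lifts_def
proof (intro allI impI)
  fix u assume u: "module_map A (dir_sum I X) V u"
  have "\<exists>v. module_map A (X i) Q v \<and> (\<forall>x\<in>carrier (X i). t (v x) = u (ds_inj I X i x))" if i: "i \<in> I" for i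
    using l[OF i] module_map_compose[OF module_map_ds_inj[where M = X, OF X i] u]
      unfolding lifts_def by blast
  then obtain v where v: "\<And>i. i \<in> I \<Longrightarrow> module_map A (X i) Q (v i)"
    "\<And>i x. i \<in> I \<Longrightarrow> x \<in> carrier (X i) \<Longrightarrow> t (v i x) = u (ds_inj I X i x)" by metis
  let ?v = "\<lambda>x. \<Oplus>\<^bsub>Q\<^esub>i\<in>I. v i (x i)"
  have hom: "module_map A (dir_sum I X) Q ?v" by (rule module_map_ds_out[OF fin Q v(1)])
  have "t (?v x) = u x" if x: "x \<in> carrier (dir_sum I X)" for x
  proof (rule module_map_ds_eqI[where M = X, OF X fin V module_map_compose[OF hom t] u _ x])
    fix i y assume iy: "i \<in> I" "y \<in> carrier (X i)"
    have "?v (ds_inj I X i y) = v i y"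
      by (rule ds_out_inj[where M = X and h = v, OF fin Q X v(1) iy])
    then show "t (?v (ds_inj I X i y)) = u (ds_inj I X i y)" using v(2)[OF iy] by simp
  qed
  then show "\<exists>v. module_map A (dir_sum I X) Q v \<and> (\<forall>x\<in>carrier (dir_sum I X). t (v x) = u x)"
    using hom by blast
qed

lemma monic_for_dir_sum:
  assumes fin: "finite I" and X: "\<And>i. i \<in> I \<Longrightarrow> right_module A (X i)"
    and Q: "right_module A Q"
    and l: "\<And>i. i \<in> I \<Longrightarrow> monic_for (X i) Q V t"
  shows "monic_for (dir_sum I X) Q V t"
  unfolding monic_for_def
proof (intro allI impI ballI)
  fix v x assume v: "module_map A (dir_sum I X) Q v" and z: "\<forall>x\<in>carrier (dir_sum I X). t (v x) = \<zero>\<^bsub>V\<^esub>"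
    and x: "x \<in> carrier (dir_sum I X)"
  show "v x = \<zero>\<^bsub>Q\<^esub>"
  proof (rule module_map_ds_eqI[where M = X, OF X fin Q v module_map_zero_map[OF Q] _ x])
    fix i y assume iy: "i \<in> I" "y \<in> carrier (X i)"
    have hom: "module_map A (X i) (dir_sum I X) (ds_inj I X i)"
        by (rule module_map_ds_inj[where M = X, OF X iy(1)])
    show "v (ds_inj I X i y) = \<zero>\<^bsub>Q\<^esub>"
      using l[OF iy(1)] module_map_compose[OF hom v] z module_map_closed[OF hom] iy(2)
      unfolding monic_for_def by blast
  qed
qed

text \<open>Both properties are also inherited by direct sums of the maps.\<close>

lemma module_map_ds_componentwise:
  assumes "\<And>i. i \<in> I \<Longrightarrow> module_map A (Q i) (V i) (t i)"
  shows "module_map A (dir_sum I Q) (dir_sum I V) (\<lambda>x. \<lambda>i\<in>I. t i (x i))"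
proof (rule module_map_ds_map)
  fix i assume i: "i \<in> I"
  show "module_map A (dir_sum I Q) (V i) (\<lambda>x. t i (x i))"
    by (rule module_map_compose[OF module_map_ds_proj[where M = Q, OF i] assms[OF i]])
qed

lemma lifts_componentwise:
  assumes "\<And>i. i \<in> I \<Longrightarrow> lifts X (Q i) (V i) (t i)"
  shows "lifts X (dir_sum I Q) (dir_sum I V) (\<lambda>x. \<lambda>i\<in>I. t i (x i))"
  unfolding lifts_def
proof (intro allI impI)
  fix u assume u: "module_map A X (dir_sum I V) u"
  have "\<exists>v. module_map A X (Q i) v \<and> (\<forall>x\<in>carrier X. t i (v x) = u x i)" if i: "i \<in> I" for i
    using assms[OF i] module_map_compose[OF u module_map_ds_proj[OF i]] unfolding lifts_def by blast
  then obtain v where v: "\<And>i. i \<in> I \<Longrightarrow> module_map A X (Q i) (v i)"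
    "\<And>i x. i \<in> I \<Longrightarrow> x \<in> carrier X \<Longrightarrow> t i (v i x) = u x i" by metis
  have "(\<lambda>i\<in>I. t i ((\<lambda>i\<in>I. v i x) i)) = u x" if "x \<in> carrier X" for x
    using module_map_closed[OF u that] v(2)[OF _ that] by (auto simp: PiE_iff extensional_def fun_eq_iff)
  then show "\<exists>v. module_map A X (dir_sum I Q) v \<and> (\<forall>x\<in>carrier X. (\<lambda>i\<in>I. t i (v x i)) = u x)"
    using module_map_ds_map[where M = Q and h = v, OF v(1)]
    by (intro exI[of _ "\<lambda>x. \<lambda>i\<in>I. v i x"]) simp
qed

lemma monic_for_componentwise:
  assumes "\<And>i. i \<in> I \<Longrightarrow> monic_for X (Q i) (V i) (t i)"
  shows "monic_for X (dir_sum I Q) (dir_sum I V) (\<lambda>x. \<lambda>i\<in>I. t i (x i))"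
  unfolding monic_for_def
proof (intro allI impI ballI)
  fix v x assume v: "module_map A X (dir_sum I Q) v" and x: "x \<in> carrier X"
    and z: "\<forall>x\<in>carrier X. (\<lambda>i\<in>I. t i (v x i)) = \<zero>\<^bsub>dir_sum I V\<^esub>"
  have "v x i = \<zero>\<^bsub>Q i\<^esub>" if i: "i \<in> I" for i
  proof -
    have "t i (v y i) = \<zero>\<^bsub>V i\<^esub>" if "y \<in> carrier X" for y
      using fun_cong[OF z[rule_format, OF that], of i] i by simp
    then show ?thesis using assms[OF i] module_map_compose[OF v module_map_ds_proj[OF i]] x
      unfolding monic_for_def by blast
  qed
  then show "v x = \<zero>\<^bsub>dir_sum I Q\<^esub>"
    using module_map_closed[OF v x] by (auto simp: PiE_iff extensional_def fun_eq_iff)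
qed

section \<open>Extensions\<close>

text \<open>The homomorphism from the free module that is determined by the images of the generators.\<close>

definition free_lift :: "('l, 'y) module \<Rightarrow> ('m \<Rightarrow> 'y) \<Rightarrow> ('m \<Rightarrow> 'l) \<Rightarrow> 'y" where
  "free_lift Y \<sigma> g = (\<Oplus>\<^bsub>Y\<^esub> z\<in>{z. g z \<noteq> \<zero>}. g z \<odot>\<^bsub>Y\<^esub> \<sigma> z)"

lemma free_module_simps [simp]:
  "g \<in> carrier (free_module A X) \<longleftrightarrow>
     finite {x. g x \<noteq> \<zero>} \<and> (\<forall>x\<in>X. g x \<in> carrier A) \<and> (\<forall>x. x \<notin> X \<longrightarrow> g x = \<zero>)"
  "\<zero>\<^bsub>free_module A X\<^esub> = (\<lambda>x. \<zero>)" "g \<oplus>\<^bsub>free_module A X\<^esub> h = (\<lambda>x. g x \<oplus> h x)"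
  "r \<odot>\<^bsub>free_module A X\<^esub> g = (\<lambda>x. g x \<otimes> r)"
  by (simp_all add: free_module_def)

lemma free_module_coeff: "g \<in> carrier (free_module A X) \<Longrightarrow> g x \<in> carrier A"
  by (cases "x \<in> X") auto

lemma right_module_free: "right_module A (free_module A X)"
proof (rule right_moduleI)
  note c = free_module_coeff
  show "abelian_group (free_module A X)"
  proof (rule abelian_groupI)
    fix g assume g: "g \<in> carrier (free_module A X)"
    have "{x. \<ominus> g x \<noteq> \<zero>} \<subseteq> {x. g x \<noteq> \<zero>}" by auto
    then have "finite {x. \<ominus> g x \<noteq> \<zero>}" by (rule finite_subset) (use g in auto)
    then show "\<exists>h\<in>carrier (free_module A X). h \<oplus>\<^bsub>free_module A X\<^esub> g = \<zero>\<^bsub>free_module A X\<^esub>"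
      using g c[OF g] by (intro bexI[of _ "\<lambda>x. \<ominus> g x"]) (auto simp: l_neg)
  next
    fix g h assume gh: "g \<in> carrier (free_module A X)" "h \<in> carrier (free_module A X)"
    have "{x. g x \<oplus> h x \<noteq> \<zero>} \<subseteq> {x. g x \<noteq> \<zero>} \<union> {x. h x \<noteq> \<zero>}" by auto
    then have "finite {x. g x \<oplus> h x \<noteq> \<zero>}" by (rule finite_subset) (use gh in auto)
    then show "g \<oplus>\<^bsub>free_module A X\<^esub> h \<in> carrier (free_module A X)" using gh by auto
    show "g \<oplus>\<^bsub>free_module A X\<^esub> h = h \<oplus>\<^bsub>free_module A X\<^esub> g"
      using c[OF gh(1)] c[OF gh(2)] by (simp add: a_comm)
  qed (use c[of _ X] in \<open>simp_all add: a_assoc del: free_module_simps(1)\<close>, simp)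
next
  fix r g assume r: "r \<in> carrier A" and g: "g \<in> carrier (free_module A X)"
  have "{x. g x \<otimes> r \<noteq> \<zero>} \<subseteq> {x. g x \<noteq> \<zero>}" using r by auto
  then have "finite {x. g x \<otimes> r \<noteq> \<zero>}" by (rule finite_subset) (use g in auto)
  then show "r \<odot>\<^bsub>free_module A X\<^esub> g \<in> carrier (free_module A X)" using g r by auto
qed (use free_module_coeff[of _ X]
    in \<open>simp_all add: ring_axioms r_distr l_distr m_assoc del: free_module_simps(1)\<close>)

text \<open>A summation range that does not depend on \<open>g\<close> is what makes the map visibly linear.\<close>

lemma free_lift_superset:
  assumes Y: "right_module A Y" and \<sigma>: "\<And>x. x \<in> X \<Longrightarrow> \<sigma> x \<in> carrier Y"
    and g: "g \<in> carrier (free_module A X)" and S: "finite S" "{x. g x \<noteq> \<zero>} \<subseteq> S" "S \<subseteq> X"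
  shows "free_lift Y \<sigma> g = (\<Oplus>\<^bsub>Y\<^esub> z\<in>S. g z \<odot>\<^bsub>Y\<^esub> \<sigma> z)"
proof -
  interpret Y: right_module A Y by fact
  show ?thesis unfolding free_lift_def
    using S g \<sigma> free_module_coeff[OF g]
    by (intro Y.add.finprod_mono_neutral_cong_left) (auto simp: subset_iff simp del: free_module_simps)
qed

lemma module_map_free_lift:
  assumes Y: "right_module A Y" and \<sigma>: "\<And>x. x \<in> X \<Longrightarrow> \<sigma> x \<in> carrier Y"
  shows "module_map A (free_module A X) Y (free_lift Y \<sigma>)"
  unfolding module_map_def
proof (intro conjI ballI funcsetI)
  interpret Y: right_module A Y by fact
  interpret F: right_module A "free_module A X" by (rule right_module_free)
  note c = free_module_coeff
  have supp: "finite {x. g x \<noteq> \<zero>}" "{x. g x \<noteq> \<zero>} \<subseteq> X" if "g \<in> carrier (free_module A X)" for g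
    using that by auto
  have cl: "(\<lambda>z. g z \<odot>\<^bsub>Y\<^esub> \<sigma> z) \<in> S \<rightarrow> carrier Y" if "g \<in> carrier (free_module A X)" "S \<subseteq> X" for g S
    using that c[OF that(1)] \<sigma> by (auto simp del: free_module_simps)
  fix g assume g: "g \<in> carrier (free_module A X)"
  show "free_lift Y \<sigma> g \<in> carrier Y"
    unfolding free_lift_def by (intro Y.finsum_closed cl g supp)
  { fix h assume h: "h \<in> carrier (free_module A X)"
    let ?S = "{x. g x \<noteq> \<zero>} \<union> {x. h x \<noteq> \<zero>}"
    have S: "finite ?S" "?S \<subseteq> X" using supp[OF g] supp[OF h] by auto
    have "free_lift Y \<sigma> (g \<oplus>\<^bsub>free_module A X\<^esub> h) = (\<Oplus>\<^bsub>Y\<^esub> z\<in>?S. (g \<oplus>\<^bsub>free_module A X\<^esub> h) z \<odot>\<^bsub>Y\<^esub> \<sigma> z)"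
      using F.a_closed[OF g h] S by (intro free_lift_superset[OF Y \<sigma>]) auto
    also have "\<dots> = (\<Oplus>\<^bsub>Y\<^esub> z\<in>?S. g z \<odot>\<^bsub>Y\<^esub> \<sigma> z \<oplus>\<^bsub>Y\<^esub> h z \<odot>\<^bsub>Y\<^esub> \<sigma> z)"
    proof (intro Y.finsum_cong')
      fix z assume "z \<in> ?S"
      then have "\<sigma> z \<in> carrier Y" using S(2) \<sigma> by blast
      then show "(g \<oplus>\<^bsub>free_module A X\<^esub> h) z \<odot>\<^bsub>Y\<^esub> \<sigma> z = g z \<odot>\<^bsub>Y\<^esub> \<sigma> z \<oplus>\<^bsub>Y\<^esub> h z \<odot>\<^bsub>Y\<^esub> \<sigma> z"
        using c[OF g] c[OF h] by (simp add: Y.smult_l_distr)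
    qed (use cl[OF g S(2)] cl[OF h S(2)] in \<open>auto simp: Pi_iff\<close>)
    also have "\<dots> = (\<Oplus>\<^bsub>Y\<^esub> z\<in>?S. g z \<odot>\<^bsub>Y\<^esub> \<sigma> z) \<oplus>\<^bsub>Y\<^esub> (\<Oplus>\<^bsub>Y\<^esub> z\<in>?S. h z \<odot>\<^bsub>Y\<^esub> \<sigma> z)"
      by (rule Y.finsum_addf[OF cl[OF g S(2)] cl[OF h S(2)]])
    also have "\<dots> = free_lift Y \<sigma> g \<oplus>\<^bsub>Y\<^esub> free_lift Y \<sigma> h"
      using free_lift_superset[of Y X \<sigma> g ?S, OF Y \<sigma> g S(1) _ S(2)]
        free_lift_superset[of Y X \<sigma> h ?S, OF Y \<sigma> h S(1) _ S(2)] by auto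
    finally show "free_lift Y \<sigma> (g \<oplus>\<^bsub>free_module A X\<^esub> h) = free_lift Y \<sigma> g \<oplus>\<^bsub>Y\<^esub> free_lift Y \<sigma> h" . }
  fix r assume r: "r \<in> carrier A"
  let ?S = "{x. g x \<noteq> \<zero>}"
  have "free_lift Y \<sigma> (r \<odot>\<^bsub>free_module A X\<^esub> g) = (\<Oplus>\<^bsub>Y\<^esub> z\<in>?S. (r \<odot>\<^bsub>free_module A X\<^esub> g) z \<odot>\<^bsub>Y\<^esub> \<sigma> z)"
    using F.smult_closed[OF r g] supp[OF g] r by (intro free_lift_superset[OF Y \<sigma>]) auto
  also have "\<dots> = (\<Oplus>\<^bsub>Y\<^esub> z\<in>?S. r \<odot>\<^bsub>Y\<^esub> (g z \<odot>\<^bsub>Y\<^esub> \<sigma> z))"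
  proof (intro Y.finsum_cong')
    fix z assume "z \<in> ?S"
    then have "\<sigma> z \<in> carrier Y" using supp[OF g] \<sigma> by blast
    then show "(r \<odot>\<^bsub>free_module A X\<^esub> g) z \<odot>\<^bsub>Y\<^esub> \<sigma> z = r \<odot>\<^bsub>Y\<^esub> (g z \<odot>\<^bsub>Y\<^esub> \<sigma> z)"
      using c[OF g] r by (simp add: Y.smult_assoc)
  qed (use cl[OF g supp(2)[OF g]] r in \<open>auto simp: Pi_iff\<close>)
  also have "\<dots> = r \<odot>\<^bsub>Y\<^esub> free_lift Y \<sigma> g"
    unfolding free_lift_def by (rule Y.finsum_smult[OF r cl[OF g supp(2)[OF g]], symmetric])
  finally show "free_lift Y \<sigma> (r \<odot>\<^bsub>free_module A X\<^esub> g) = r \<odot>\<^bsub>Y\<^esub> free_lift Y \<sigma> g" .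
qed

lemma free_lift_generator:
  assumes Y: "right_module A Y" and \<sigma>: "\<And>x. x \<in> X \<Longrightarrow> \<sigma> x \<in> carrier Y" and z: "z \<in> X"
  defines "\<delta> \<equiv> \<lambda>x. if x = z then \<one> else \<zero>"
  shows "\<delta> \<in> carrier (free_module A X)" "free_lift Y \<sigma> \<delta> = \<sigma> z"
proof -
  interpret Y: right_module A Y by fact
  have "{x. \<delta> x \<noteq> \<zero>} \<subseteq> {z}" by (auto simp: \<delta>_def)
  then have fin: "finite {x. \<delta> x \<noteq> \<zero>}" by (rule finite_subset) simp
  then show *: "\<delta> \<in> carrier (free_module A X)" using z by (auto simp: \<delta>_def)
  have "free_lift Y \<sigma> \<delta> = (\<Oplus>\<^bsub>Y\<^esub> z\<in>{z}. \<delta> z \<odot>\<^bsub>Y\<^esub> \<sigma> z)"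
    using z by (intro free_lift_superset[OF Y \<sigma> *]) (auto simp: \<delta>_def)
  also have "\<dots> = \<sigma> z" using \<sigma>[OF z] by (simp add: \<delta>_def)
  finally show "free_lift Y \<sigma> \<delta> = \<sigma> z" .
qed

lemma syzygy_eq:
  "syzygy A N = (free_module A (carrier N))
     \<lparr>carrier := {g \<in> carrier (free_module A (carrier N)). free_lift N (\<lambda>z. z) g = \<zero>\<^bsub>N\<^esub>}\<rparr>"
  by (simp add: syzygy_def free_eval_def free_lift_def)

lemma submodule_syzygy:
  assumes "right_module A N"
  shows "Module.submodule {g \<in> carrier (free_module A (carrier N)). free_lift N (\<lambda>z. z) g = \<zero>\<^bsub>N\<^esub>} A
    (free_module A (carrier N))"
  by (rule submodule_kernel[OF right_module_free assms module_map_free_lift[OF assms]])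

text \<open>
  The coset of a map from the syzygy is the zero element of \<open>Ext1\<close> only if that map is a restriction of
  one on the free module.
\<close>

lemma Ext1_vanishesD:
  assumes N: "right_module A N" and L: "right_module A L" and ext: "Ext1_vanishes A N L"
    and f: "module_map A (syzygy A N) L f"
  shows "\<exists>e. module_map A (free_module A (carrier N)) L e \<and> (\<forall>g\<in>carrier (syzygy A N). e g = f g)"
proof -
  interpret L: right_module A L by (rule L)
  let ?S = "carrier (syzygy A N)" and ?F = "free_module A (carrier N)"
  let ?H = "mhom_module A (syzygy A N) L (\<lambda>e h. compose ?S e h)"
  let ?B = "(\<lambda>h. restrict h ?S) ` mhom A ?F L"
  let ?f = "restrict f ?S"
  have S: "right_module A (syzygy A N)"
    unfolding syzygy_eq by (rule right_module_submodule[OF right_module_free submodule_syzygy[OF N]])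
  have SF: "?S \<subseteq> carrier ?F" by (auto simp: syzygy_def)
  have f': "?f \<in> mhom A (syzygy A N) L" by (rule mhom_restrict[OF S f])
  have cH: "carrier ?H = mhom A (syzygy A N) L"
    and aH: "g \<oplus>\<^bsub>?H\<^esub> h = (\<lambda>x\<in>?S. g x \<oplus>\<^bsub>L\<^esub> h x)" for g h
    by (simp_all add: mhom_module_def)
  have "?B +>\<^bsub>?H\<^esub> ?f \<in> carrier (Ext1 A N L)"
    using f' by (auto simp: Ext1_def quot_module_def A_RCOSETS_def' cH simp del: Set.image_eqI)
  then have eq: "?B +>\<^bsub>?H\<^esub> ?f = ?B"
    using ext by (simp add: Ext1_vanishes_def Ext1_def quot_module_def)
  have "restrict (\<lambda>x. \<zero>\<^bsub>L\<^esub>) ?S \<in> ?B"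
  proof (rule image_eqI)
    show "restrict (\<lambda>x. \<zero>\<^bsub>L\<^esub>) (carrier ?F) \<in> mhom A ?F L"
      by (rule mhom_restrict[OF right_module_free module_map_zero_map[OF L]])
    show "restrict (\<lambda>x. \<zero>\<^bsub>L\<^esub>) ?S = restrict (restrict (\<lambda>x. \<zero>\<^bsub>L\<^esub>) (carrier ?F)) ?S"
      using SF by (auto simp: fun_eq_iff)
  qed
  moreover have "?f = restrict (\<lambda>x. \<zero>\<^bsub>L\<^esub>) ?S \<oplus>\<^bsub>?H\<^esub> ?f"
    using module_map_closed[OF f] by (auto simp: aH fun_eq_iff)
  ultimately have "?f \<in> ?B +>\<^bsub>?H\<^esub> ?f" unfolding a_r_coset_def' by blast
  then obtain e where e: "e \<in> mhom A ?F L" "?f = restrict e ?S" unfolding eq by blast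
  have "e g = f g" if "g \<in> ?S" for g
    using fun_cong[OF e(2), of g] that by simp
  with mhom_module_map[OF e(1)] show ?thesis by blast
qed

text \<open>
  Every homomorphism to \<open>L\<close> from the kernel of an epimorphism \<open>Y \<rightarrow> N\<close> extends to \<open>Y\<close>. The first argument
  only carries the type of the elements of \<open>Y\<close>, over which a formula cannot quantify.
\<close>

definition extension_property :: "'y itself \<Rightarrow> ('l, 'm) module \<Rightarrow> ('l, 'n) module \<Rightarrow> bool" where
  "extension_property T N L \<longleftrightarrow> (\<forall>(Y :: ('l, 'y) module) p \<psi>. right_module A Y \<longrightarrow> module_map A Y N p \<longrightarrow>
     p ` carrier Y = carrier N \<longrightarrow> module_map A (Y\<lparr>carrier := {y \<in> carrier Y. p y = \<zero>\<^bsub>N\<^esub>}\<rparr>) L \<psi> \<longrightarrow>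
     (\<exists>\<chi>. module_map A Y L \<chi> \<and> (\<forall>y\<in>carrier Y. p y = \<zero>\<^bsub>N\<^esub> \<longrightarrow> \<chi> y = \<psi> y)))"

text \<open>
  Choosing a preimage \<open>\<sigma> z\<close> of every \<open>z\<close> in \<open>N\<close> defines a homomorphism \<open>s\<close> from the free module on
  the elements of \<open>N\<close> to \<open>Y\<close> over \<open>N\<close>. It maps the syzygy into the kernel \<open>X\<close>, so that \<open>\<psi>\<close> pulls back
  to the syzygy and, since \<open>Ext\<^sup>1\<close> vanishes, extends to some \<open>e\<close> on the free module. Then
  \<open>y \<mapsto> \<psi> (y - \<sigma> (p y)) + e (\<delta>\<^bsub>p y\<^esub>)\<close> extends \<open>\<psi>\<close>, where \<open>\<delta>\<close> denotes the free generators: adding elements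
  and multiplying them by scalars changes the generators by elements of the syzygy only.
\<close>

lemma extension_property_Ext1:
  assumes N: "right_module A N" and L: "right_module A L" and ext: "Ext1_vanishes A N L"
  shows "extension_property TYPE('y) N L"
  unfolding extension_property_def
proof (intro allI impI)
  fix Y :: "('l, 'y) module" and p \<psi>
  assume Y: "right_module A Y" and p: "module_map A Y N p" and sur: "p ` carrier Y = carrier N"
    and \<psi>: "module_map A (Y\<lparr>carrier := {y \<in> carrier Y. p y = \<zero>\<^bsub>N\<^esub>}\<rparr>) L \<psi>"
  interpret N: right_module A N by (rule N)
  interpret L: right_module A L by (rule L)
  interpret Y: right_module A Y by (rule Y)
  let ?F = "free_module A (carrier N)" and ?X = "{y \<in> carrier Y. p y = \<zero>\<^bsub>N\<^esub>}"
  interpret F: right_module A ?F by (rule right_module_free)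
  let ?ev = "free_lift N (\<lambda>z. z)"
  define \<sigma> where "\<sigma> z = (SOME y. y \<in> carrier Y \<and> p y = z)" for z
  have \<sigma>: "\<sigma> z \<in> carrier Y" "p (\<sigma> z) = z" if "z \<in> carrier N" for z
  proof -
    have "\<exists>y. y \<in> carrier Y \<and> p y = z" using that sur by (metis imageE)
    from someI_ex[OF this] show "\<sigma> z \<in> carrier Y" "p (\<sigma> z) = z" unfolding \<sigma>_def by blast+
  qed
  let ?s = "free_lift Y \<sigma>"
  have s: "module_map A ?F Y ?s" by (rule module_map_free_lift[OF Y \<sigma>(1)])
  have ev: "module_map A ?F N ?ev" by (rule module_map_free_lift[OF N])
  have ps: "p (?s g) = ?ev g" if g: "g \<in> carrier ?F" for g
  proof -
    have c: "g x \<in> carrier A" for x using free_module_coeff[OF g] .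
    have N': "x \<in> carrier N" if "g x \<noteq> \<zero>" for x using g that by auto
    have "p (?s g) = (\<Oplus>\<^bsub>N\<^esub> z\<in>{z. g z \<noteq> \<zero>}. p (g z \<odot>\<^bsub>Y\<^esub> \<sigma> z))"
      unfolding free_lift_def using c N' \<sigma> by (intro module_map_finsum[OF Y N p]) auto
    also have "\<dots> = ?ev g"
      unfolding free_lift_def using c N' \<sigma> by (intro N.finsum_cong') (auto simp: module_map_smult[OF p])
    finally show ?thesis .
  qed
  have XL: "module_map A (syzygy A N) L (\<lambda>g. \<psi> (?s g))"
  proof (rule module_map_compose[OF _ \<psi>])
    show "module_map A (syzygy A N) (Y\<lparr>carrier := ?X\<rparr>) ?s"
      unfolding syzygy_eq
    proof (rule module_map_into[OF module_map_restrict[OF s]])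
      show "?s ` carrier (?F\<lparr>carrier := {g \<in> carrier ?F. ?ev g = \<zero>\<^bsub>N\<^esub>}\<rparr>) \<subseteq> ?X"
        using ps module_map_closed[OF s] by (auto simp del: free_module_simps)
    qed auto
  qed
  obtain e where e: "module_map A ?F L e" and es: "\<And>g. g \<in> carrier ?F \<Longrightarrow> ?ev g = \<zero>\<^bsub>N\<^esub> \<Longrightarrow> e g = \<psi> (?s g)"
    using Ext1_vanishesD[OF N L ext XL] unfolding syzygy_eq by auto
  have \<psi>c: "\<psi> x \<in> carrier L" if "x \<in> ?X" for x using module_map_closed[OF \<psi>] that by simp
  have \<psi>a: "\<psi> (x \<oplus>\<^bsub>Y\<^esub> y) = \<psi> x \<oplus>\<^bsub>L\<^esub> \<psi> y" if "x \<in> ?X" "y \<in> ?X" for x y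
    using module_map_add[OF \<psi>] that by simp
  have \<psi>s: "\<psi> (r \<odot>\<^bsub>Y\<^esub> x) = r \<odot>\<^bsub>L\<^esub> \<psi> x" if "r \<in> carrier A" "x \<in> ?X" for r x
    using module_map_smult[OF \<psi>] that by simp
  have X: "y \<ominus>\<^bsub>Y\<^esub> ?s g \<in> ?X" if "y \<in> carrier Y" "g \<in> carrier ?F" "?ev g = p y" for y g
    using that module_map_closed[OF s that(2)] module_map_closed[OF p] ps[OF that(2)]
    by (simp add: module_map_minus[OF Y N p] del: free_module_simps)
  define \<chi> where "\<chi> y = \<psi> (y \<ominus>\<^bsub>Y\<^esub> ?s (\<lambda>x. if x = p y then \<one> else \<zero>)) \<oplus>\<^bsub>L\<^esub> e (\<lambda>x. if x = p y then \<one> else \<zero>)"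
      for y
  have \<delta>: "(\<lambda>x. if x = p y then \<one> else \<zero>) \<in> carrier ?F" "?ev (\<lambda>x. if x = p y then \<one> else \<zero>) = p y"
    if "y \<in> carrier Y" for y
    using free_lift_generator[of N "carrier N" "\<lambda>z. z" "p y"] N module_map_closed[OF p that] by auto
  \<comment> \<open>Any lift of \<open>p y\<close> to the free module may replace the generator.\<close>
  have ind: "\<psi> (y \<ominus>\<^bsub>Y\<^esub> ?s g) \<oplus>\<^bsub>L\<^esub> e g = \<psi> (y \<ominus>\<^bsub>Y\<^esub> ?s h) \<oplus>\<^bsub>L\<^esub> e h"
    if y: "y \<in> carrier Y" and g: "g \<in> carrier ?F" "?ev g = p y" and h: "h \<in> carrier ?F" "?ev h = p y"
        for y g h
  proof -
    let ?d = "g \<ominus>\<^bsub>?F\<^esub> h"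
    have d: "?d \<in> carrier ?F" using g h by (intro F.minus_closed)
    have evd: "?ev ?d = \<zero>\<^bsub>N\<^esub>"
      using module_map_minus[OF right_module_free N ev g(1) h(1)] g(2) h(2) module_map_closed[OF p y]
        by simp
    have sd: "?s ?d = ?s g \<ominus>\<^bsub>Y\<^esub> ?s h" by (rule module_map_minus[OF right_module_free Y s g(1) h(1)])
    have ed: "e ?d = e g \<ominus>\<^bsub>L\<^esub> e h" by (rule module_map_minus[OF right_module_free L e g(1) h(1)])
    note cl = module_map_closed[OF s g(1)] module_map_closed[OF s h(1)] module_map_closed[OF e g(1)]
        module_map_closed[OF e h(1)]
    have sX: "?s ?d \<in> ?X" using module_map_closed[OF s d] ps[OF d] evd by simp
    have "y \<ominus>\<^bsub>Y\<^esub> ?s h = (y \<ominus>\<^bsub>Y\<^esub> ?s g) \<oplus>\<^bsub>Y\<^esub> ?s ?d"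
      unfolding sd using y cl by (simp add: a_minus_def Y.a_ac Y.r_neg1 Y.r_neg2)
    then have "\<psi> (y \<ominus>\<^bsub>Y\<^esub> ?s h) = \<psi> (y \<ominus>\<^bsub>Y\<^esub> ?s g) \<oplus>\<^bsub>L\<^esub> (e g \<ominus>\<^bsub>L\<^esub> e h)"
      using \<psi>a[OF X[OF y g] sX] es[OF d evd] ed by simp
    then show ?thesis
      using \<psi>c[OF X[OF y g]] cl by (simp add: a_minus_def L.a_assoc L.l_neg)
  qed
  have \<chi>: "\<chi> y = \<psi> (y \<ominus>\<^bsub>Y\<^esub> ?s g) \<oplus>\<^bsub>L\<^esub> e g" if "y \<in> carrier Y" "g \<in> carrier ?F" "?ev g = p y" for y g
    unfolding \<chi>_def by (rule ind[OF that(1) \<delta>[OF that(1)] that(2,3)])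
  have "module_map A Y L \<chi>" unfolding module_map_def
  proof (intro conjI ballI funcsetI)
    fix y assume y: "y \<in> carrier Y"
    note dy = \<delta>[OF y]
    let ?g = "\<lambda>x. if x = p y then \<one> else \<zero>"
    note c = module_map_closed[OF s dy(1)] module_map_closed[OF e dy(1)]
    show "\<chi> y \<in> carrier L" unfolding \<chi>_def using \<psi>c[OF X[OF y dy]] c(2) by (rule L.a_closed)
    { fix y' assume y': "y' \<in> carrier Y"
      note dy' = \<delta>[OF y']
      let ?g' = "\<lambda>x. if x = p y' then \<one> else \<zero>"
      note c' = module_map_closed[OF s dy'(1)] module_map_closed[OF e dy'(1)]
      have gc: "?g \<oplus>\<^bsub>?F\<^esub> ?g' \<in> carrier ?F" using dy(1) dy'(1) by (rule F.a_closed)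
      have "?ev (?g \<oplus>\<^bsub>?F\<^esub> ?g') = p (y \<oplus>\<^bsub>Y\<^esub> y')"
        unfolding module_map_add[OF ev dy(1) dy'(1)] module_map_add[OF p y y'] dy(2) dy'(2) ..
      from \<chi>[OF Y.a_closed[OF y y'] gc this]
      have "\<chi> (y \<oplus>\<^bsub>Y\<^esub> y') = \<psi> ((y \<oplus>\<^bsub>Y\<^esub> y') \<ominus>\<^bsub>Y\<^esub> (?s ?g \<oplus>\<^bsub>Y\<^esub> ?s ?g')) \<oplus>\<^bsub>L\<^esub> (e ?g \<oplus>\<^bsub>L\<^esub> e ?g')"
        unfolding module_map_add[OF s dy(1) dy'(1)] module_map_add[OF e dy(1) dy'(1)] .
      also have "(y \<oplus>\<^bsub>Y\<^esub> y') \<ominus>\<^bsub>Y\<^esub> (?s ?g \<oplus>\<^bsub>Y\<^esub> ?s ?g') = (y \<ominus>\<^bsub>Y\<^esub> ?s ?g) \<oplus>\<^bsub>Y\<^esub> (y' \<ominus>\<^bsub>Y\<^esub> ?s ?g')"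
        using y y' c(1) c'(1) by (simp add: a_minus_def Y.minus_add Y.a_ac)
      also have "\<psi> \<dots> = \<psi> (y \<ominus>\<^bsub>Y\<^esub> ?s ?g) \<oplus>\<^bsub>L\<^esub> \<psi> (y' \<ominus>\<^bsub>Y\<^esub> ?s ?g')"
        by (rule \<psi>a[OF X[OF y dy] X[OF y' dy']])
      also have "\<dots> \<oplus>\<^bsub>L\<^esub> (e ?g \<oplus>\<^bsub>L\<^esub> e ?g') = \<chi> y \<oplus>\<^bsub>L\<^esub> \<chi> y'"
        unfolding \<chi>_def using \<psi>c[OF X[OF y dy]] \<psi>c[OF X[OF y' dy']] c(2) c'(2) by (simp add: L.a_ac)
      finally show "\<chi> (y \<oplus>\<^bsub>Y\<^esub> y') = \<chi> y \<oplus>\<^bsub>L\<^esub> \<chi> y'" . }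
    fix r assume r: "r \<in> carrier A"
    have gc: "r \<odot>\<^bsub>?F\<^esub> ?g \<in> carrier ?F" by (rule F.smult_closed[OF r dy(1)])
    have "?ev (r \<odot>\<^bsub>?F\<^esub> ?g) = p (r \<odot>\<^bsub>Y\<^esub> y)"
      unfolding module_map_smult[OF ev r dy(1)] module_map_smult[OF p r y] dy(2) ..
    from \<chi>[OF Y.smult_closed[OF r y] gc this]
    have "\<chi> (r \<odot>\<^bsub>Y\<^esub> y) = \<psi> (r \<odot>\<^bsub>Y\<^esub> y \<ominus>\<^bsub>Y\<^esub> r \<odot>\<^bsub>Y\<^esub> ?s ?g) \<oplus>\<^bsub>L\<^esub> r \<odot>\<^bsub>L\<^esub> e ?g"
      unfolding module_map_smult[OF s r dy(1)] module_map_smult[OF e r dy(1)] .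
    also have "r \<odot>\<^bsub>Y\<^esub> y \<ominus>\<^bsub>Y\<^esub> r \<odot>\<^bsub>Y\<^esub> ?s ?g = r \<odot>\<^bsub>Y\<^esub> (y \<ominus>\<^bsub>Y\<^esub> ?s ?g)"
    proof -
      have "r \<odot>\<^bsub>Y\<^esub> (\<ominus>\<^bsub>Y\<^esub> ?s ?g) = \<ominus>\<^bsub>Y\<^esub> (r \<odot>\<^bsub>Y\<^esub> ?s ?g)"
        using Y.smult_assoc[of "\<ominus> \<one>" r "?s ?g"] Y.smult_assoc[of r "\<ominus> \<one>" "?s ?g"] r c(1)
        by (simp add: Y.smult_minus_one[symmetric] l_minus r_minus)
      then show ?thesis using y c(1) r by (simp add: a_minus_def Y.smult_r_distr)
    qed
    also have "\<psi> \<dots> = r \<odot>\<^bsub>L\<^esub> \<psi> (y \<ominus>\<^bsub>Y\<^esub> ?s ?g)" by (rule \<psi>s[OF r X[OF y dy]])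
    also have "\<dots> \<oplus>\<^bsub>L\<^esub> r \<odot>\<^bsub>L\<^esub> e ?g = r \<odot>\<^bsub>L\<^esub> \<chi> y"
      unfolding \<chi>_def using \<psi>c[OF X[OF y dy]] c(2) r by (simp add: L.smult_r_distr)
    finally show "\<chi> (r \<odot>\<^bsub>Y\<^esub> y) = r \<odot>\<^bsub>L\<^esub> \<chi> y" .
  qed
  moreover have "\<chi> y = \<psi> y" if y: "y \<in> carrier Y" "p y = \<zero>\<^bsub>N\<^esub>" for y
  proof -
    note z = module_map_zero[OF right_module_free N ev] module_map_zero[OF right_module_free Y s]
      module_map_zero[OF right_module_free L e]
    have "\<chi> y = \<psi> (y \<ominus>\<^bsub>Y\<^esub> \<zero>\<^bsub>Y\<^esub>) \<oplus>\<^bsub>L\<^esub> \<zero>\<^bsub>L\<^esub>"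
      using \<chi>[OF y(1) F.zero_closed] z y(2) by simp
    moreover have "y \<ominus>\<^bsub>Y\<^esub> \<zero>\<^bsub>Y\<^esub> = y" 
      using y Y.minus_equality[of "\<zero>\<^bsub>Y\<^esub>" "\<zero>\<^bsub>Y\<^esub>"] by (simp add: a_minus_def)
    ultimately show ?thesis using \<psi>c y by simp
  qed
  ultimately show "\<exists>\<chi>. module_map A Y L \<chi> \<and> (\<forall>y\<in>carrier Y. p y = \<zero>\<^bsub>N\<^esub> \<longrightarrow> \<chi> y = \<psi> y)" by blast
qed

lemma extension_property_dir_sum_right:
  assumes "\<And>i. i \<in> I \<Longrightarrow> extension_property TYPE('y) N (L i)"
  shows "extension_property TYPE('y) N (dir_sum I L)"
  unfolding extension_property_def
proof (intro allI impI)
  fix Y :: "('l, 'y) module" and p \<psi>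
  let ?X = "{y \<in> carrier Y. p y = \<zero>\<^bsub>N\<^esub>}"
  assume Y: "right_module A Y" and p: "module_map A Y N p" "p ` carrier Y = carrier N"
    and \<psi>: "module_map A (Y\<lparr>carrier := ?X\<rparr>) (dir_sum I L) \<psi>"
  have "\<exists>\<chi>. module_map A Y (L i) \<chi> \<and> (\<forall>y\<in>carrier Y. p y = \<zero>\<^bsub>N\<^esub> \<longrightarrow> \<chi> y = \<psi> y i)" if i: "i \<in> I" for i
    using assms[OF i] Y p module_map_compose[OF \<psi> module_map_ds_proj[OF i]]
    unfolding extension_property_def by blast
  then obtain \<chi> where \<chi>: "\<And>i. i \<in> I \<Longrightarrow> module_map A Y (L i) (\<chi> i)"
    "\<And>i y. i \<in> I \<Longrightarrow> y \<in> carrier Y \<Longrightarrow> p y = \<zero>\<^bsub>N\<^esub> \<Longrightarrow> \<chi> i y = \<psi> y i" by metis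
  have "(\<lambda>i\<in>I. \<chi> i y) = \<psi> y" if "y \<in> carrier Y" "p y = \<zero>\<^bsub>N\<^esub>" for y
    using module_map_closed[OF \<psi>, of y] that \<chi>(2) by (auto simp: PiE_iff extensional_def fun_eq_iff)
  then show "\<exists>\<chi>. module_map A Y (dir_sum I L) \<chi> \<and> (\<forall>y\<in>carrier Y. p y = \<zero>\<^bsub>N\<^esub> \<longrightarrow> \<chi> y = \<psi> y)"
    using module_map_ds_map[where M = L and h = \<chi>, OF \<chi>(1)] by blast
qed

text \<open>For a sum in the first argument the map is extended to the preimage of one more summand at a time.\<close>

lemma extension_property_dir_sum_left:
  assumes fin: "finite I" and N: "\<And>i. i \<in> I \<Longrightarrow> right_module A (N i)"
    and ext: "\<And>i. i \<in> I \<Longrightarrow> extension_property TYPE('y) (N i) L"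
  shows "extension_property TYPE('y) (dir_sum I N) L"
  unfolding extension_property_def
proof (intro allI impI)
  fix Y :: "('l, 'y) module" and p \<psi>
  let ?X = "{y \<in> carrier Y. p y = \<zero>\<^bsub>dir_sum I N\<^esub>}"
  assume Y: "right_module A Y" and p: "module_map A Y (dir_sum I N) p"
    and sur: "p ` carrier Y = carrier (dir_sum I N)"
    and \<psi>: "module_map A (Y\<lparr>carrier := ?X\<rparr>) L \<psi>"
  define Z where "Z F = {y \<in> carrier Y. \<forall>i\<in>I - F. p y i = \<zero>\<^bsub>N i\<^esub>}" for F
  interpret Y: right_module A Y by (rule Y)
  have pi: "module_map A Y (N i) (\<lambda>y. p y i)" if "i \<in> I" for i
    by (rule module_map_compose[OF p module_map_ds_proj[where M = N, OF that]])
  have subZ: "Module.submodule (Z F) A Y" for F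
  proof -
    have z: "p \<zero>\<^bsub>Y\<^esub> i = \<zero>\<^bsub>N i\<^esub>" if "i \<in> I" for i by (rule module_map_zero[OF Y N[OF that] pi[OF that]])
    show ?thesis
      unfolding Y.submodule_iff Z_def
    proof (intro conjI ballI)
      fix x y assume "x \<in> {y \<in> carrier Y. \<forall>i\<in>I - F. p y i = \<zero>\<^bsub>N i\<^esub>}"
          "y \<in> {y \<in> carrier Y. \<forall>i\<in>I - F. p y i = \<zero>\<^bsub>N i\<^esub>}"
      then show "x \<oplus>\<^bsub>Y\<^esub> y \<in> {y \<in> carrier Y. \<forall>i\<in>I - F. p y i = \<zero>\<^bsub>N i\<^esub>}"
        using module_map_add[OF pi]
          abelian_monoid.l_zero[OF abelian_group.axioms(1)[OF right_module.axioms(2)[OF N]]]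
          abelian_monoid.zero_closed[OF abelian_group.axioms(1)[OF right_module.axioms(2)[OF N]]]
        by auto
    next
      fix r x assume "r \<in> carrier A" "x \<in> {y \<in> carrier Y. \<forall>i\<in>I - F. p y i = \<zero>\<^bsub>N i\<^esub>}"
      then show "r \<odot>\<^bsub>Y\<^esub> x \<in> {y \<in> carrier Y. \<forall>i\<in>I - F. p y i = \<zero>\<^bsub>N i\<^esub>}"
        using module_map_smult[OF pi] right_module.smult_zero_right[OF N] by auto
    qed (use z in auto)
  qed
  have "\<exists>\<chi>. module_map A (Y\<lparr>carrier := Z F\<rparr>) L \<chi> \<and> (\<forall>y\<in>?X. \<chi> y = \<psi> y)" if "finite F" "F \<subseteq> I" for F
    using that
  proof (induction F)
    case empty
    have "Z {} = ?X"
      using module_map_closed[OF p] by (auto simp: Z_def PiE_iff extensional_def fun_eq_iff)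
    then show ?case using \<psi> by auto
  next
    case (insert k F)
    then have k: "k \<in> I" by simp
    obtain \<chi> where \<chi>: "module_map A (Y\<lparr>carrier := Z F\<rparr>) L \<chi>" "\<And>y. y \<in> ?X \<Longrightarrow> \<chi> y = \<psi> y"
      using insert.IH insert.prems by blast
    let ?W = "Y\<lparr>carrier := Z (insert k F)\<rparr>"
    have W: "right_module A ?W" by (rule right_module_submodule[OF Y subZ])
    have q: "module_map A ?W (N k) (\<lambda>y. p y k)"
      by (rule module_map_restrict[OF pi[OF k]]) (auto simp: Z_def)
    have surq: "(\<lambda>y. p y k) ` carrier ?W = carrier (N k)"
    proof (intro subset_antisym image_subsetI subsetI)
      fix z assume z: "z \<in> carrier (N k)"
      have "ds_inj I N k z \<in> carrier (dir_sum I N)"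
        using module_map_ds_inj[where M = N, OF N k] z by (rule module_map_closed)
      then obtain y where y: "y \<in> carrier Y" "p y = ds_inj I N k z" using sur by (metis imageE)
      then have "y \<in> carrier ?W" "z = p y k" using k by (auto simp: Z_def ds_inj_def)
      then show "z \<in> (\<lambda>y. p y k) ` carrier ?W" by blast
    qed (use module_map_closed[OF q] in blast)
    have ker: "{y \<in> carrier ?W. p y k = \<zero>\<^bsub>N k\<^esub>} = Z F" using k insert.hyps by (auto simp: Z_def)
    have "module_map A (?W\<lparr>carrier := {y \<in> carrier ?W. p y k = \<zero>\<^bsub>N k\<^esub>}\<rparr>) L \<chi>"
      unfolding ker using \<chi>(1) by simp
    then obtain \<chi>' where \<chi>': "module_map A ?W L \<chi>'"
      "\<And>y. y \<in> carrier ?W \<Longrightarrow> p y k = \<zero>\<^bsub>N k\<^esub> \<Longrightarrow> \<chi>' y = \<chi> y"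
      using ext[OF k] W q surq unfolding extension_property_def by blast
    have "\<chi>' y = \<psi> y" if y: "y \<in> ?X" for y
    proof -
      have "y \<in> carrier ?W" "p y k = \<zero>\<^bsub>N k\<^esub>" using y k by (auto simp: Z_def)
      then show ?thesis using \<chi>'(2) \<chi>(2)[OF y] by simp
    qed
    then show ?case using \<chi>'(1) by blast
  qed
  from this[OF fin subset_refl] obtain \<chi> where "module_map A (Y\<lparr>carrier := Z I\<rparr>) L \<chi>" "\<forall>y\<in>?X. \<chi> y = \<psi> y"
      by blast
  moreover have "Y\<lparr>carrier := Z I\<rparr> = Y" by (simp add: Z_def)
  ultimately show "\<exists>\<chi>. module_map A Y L \<chi> \<and> (\<forall>y\<in>carrier Y. p y = \<zero>\<^bsub>dir_sum I N\<^esub> \<longrightarrow> \<chi> y = \<psi> y)" by auto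
qed

end

section \<open>Spaces of homomorphisms\<close>

context fd_algebra
begin

abbreviation hom_space :: "('l, 'x) module \<Rightarrow> ('l, 'v) module \<Rightarrow> ('k, 'x \<Rightarrow> 'v) module" where
  "hom_space X V \<equiv> mhom_module A X V (\<lambda>c f. \<lambda>x\<in>carrier X. (c \<odot> \<one>) \<odot>\<^bsub>V\<^esub> f x)"

lemma mhom_module_simps [simp]:
  "carrier (mhom_module A X V s) = mhom A X V" "\<zero>\<^bsub>mhom_module A X V s\<^esub> = (\<lambda>x\<in>carrier X. \<zero>\<^bsub>V\<^esub>)"
  "f \<oplus>\<^bsub>mhom_module A X V s\<^esub> g = (\<lambda>x\<in>carrier X. f x \<oplus>\<^bsub>V\<^esub> g x)" "a \<odot>\<^bsub>mhom_module A X V s\<^esub> f = s a f"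
  by (simp_all add: mhom_module_def)

lemma mhom_eqI:
  assumes "f \<in> mhom A X V" "g \<in> mhom A X V" "\<And>x. x \<in> carrier X \<Longrightarrow> f x = g x"
  shows "f = g"
  using assms by (intro extensionalityI[of f "carrier X" g]) (auto simp: mhom_iff)

lemma abelian_group_mhom:
  assumes X: "right_module A X" and V: "right_module A V"
  shows "abelian_group (mhom_module A X V s)"
proof (rule abelian_groupI)
  interpret V: right_module A V by (rule V)
  note c = module_map_closed[OF mhom_module_map]
  note plus = mhom_restrict[OF X module_map_plus_map[OF V mhom_module_map mhom_module_map]]
  show "\<zero>\<^bsub>mhom_module A X V s\<^esub> \<in> carrier (mhom_module A X V s)"
    using mhom_restrict[OF X module_map_zero_map[OF V]] by simp
  fix f assume f: "f \<in> carrier (mhom_module A X V s)"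
  then have f': "f \<in> mhom A X V" by simp
  have "restrict (\<lambda>x. \<zero>\<^bsub>V\<^esub> \<ominus>\<^bsub>V\<^esub> f x) (carrier X) \<in> mhom A X V"
    by (rule mhom_restrict[OF X module_map_minus_map[OF V module_map_zero_map[OF V]
      mhom_module_map[OF f']]])
  then show "\<exists>g\<in>carrier (mhom_module A X V s). g \<oplus>\<^bsub>mhom_module A X V s\<^esub> f = \<zero>\<^bsub>mhom_module A X V s\<^esub>"
    using c[OF f'] by (intro bexI) (auto simp: a_minus_def V.l_neg fun_eq_iff)
  show "\<zero>\<^bsub>mhom_module A X V s\<^esub> \<oplus>\<^bsub>mhom_module A X V s\<^esub> f = f"
    using f' c[OF f'] by (auto simp: mhom_iff extensional_def fun_eq_iff)
qed (auto intro!: mhom_restrict[OF X] module_map_plus_map[OF V] simp: mhom_module_map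
      right_module.axioms(2)[OF V, THEN abelian_group.axioms(1), THEN abelian_monoid.a_assoc]
      right_module.axioms(2)[OF V, THEN abelian_group.axioms(1), THEN abelian_monoid.a_comm]
      module_map_closed[OF mhom_module_map] cong: restrict_cong)

lemma module_map_scalar_map:
  assumes V: "right_module A V" and f: "module_map A X V f"
  shows "module_map A X V (\<lambda>x. (a \<odot> \<one>) \<odot>\<^bsub>V\<^esub> f x)"
proof -
  interpret V: right_module A V by (rule V)
  show ?thesis using f unfolding module_map_def
    by (auto simp: V.smult_r_distr Pi_iff V.smult_assoc[symmetric] scalar_commute)
qed

lemma kspace_hom_space:
  assumes X: "right_module A X" and V: "right_module A V"
  shows "kspace (hom_space X V)"
proof (intro kspace.intro kspace_axioms.intro abelian_group_mhom[OF X V])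
  interpret B: kspace "base_space A V" by (rule kspace_base_space[OF V])
  note c = module_map_closed[OF mhom_module_map[where A = A and M = X and N = V]]
  note d = B.smult_l_distr[simplified] B.smult_r_distr[simplified] B.smult_assoc[simplified]
      B.smult_one[simplified]
  fix f and a b :: 'k assume f: "f \<in> carrier (hom_space X V)"
  show "a \<odot>\<^bsub>hom_space X V\<^esub> f \<in> carrier (hom_space X V)"
    using f mhom_restrict[OF X module_map_scalar_map[OF V mhom_module_map[of f A X V]]]
    by (simp add: restrict_def)
  show "(a + b) \<odot>\<^bsub>hom_space X V\<^esub> f = a \<odot>\<^bsub>hom_space X V\<^esub> f \<oplus>\<^bsub>hom_space X V\<^esub> b \<odot>\<^bsub>hom_space X V\<^esub> f"
    using f c by (auto simp: fun_eq_iff d)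
  show "(a * b) \<odot>\<^bsub>hom_space X V\<^esub> f = a \<odot>\<^bsub>hom_space X V\<^esub> (b \<odot>\<^bsub>hom_space X V\<^esub> f)"
    using f c by (auto simp: fun_eq_iff d)
  show "1 \<odot>\<^bsub>hom_space X V\<^esub> f = f"
    using f c by (auto simp: fun_eq_iff d mhom_iff extensional_def)
  fix g assume g: "g \<in> carrier (hom_space X V)"
  show "a \<odot>\<^bsub>hom_space X V\<^esub> (f \<oplus>\<^bsub>hom_space X V\<^esub> g) =
      a \<odot>\<^bsub>hom_space X V\<^esub> f \<oplus>\<^bsub>hom_space X V\<^esub> a \<odot>\<^bsub>hom_space X V\<^esub> g"
    using f g c by (auto simp: fun_eq_iff d)
qed

lemma klinear_evaluation:
  "x \<in> carrier X \<Longrightarrow> klinear (hom_space X V) (base_space A V) (\<lambda>f. f x)"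
  by (auto simp: klinear_def module_map_closed[OF mhom_module_map])

text \<open>A homomorphism is determined by the coordinates of its values on a basis.\<close>

lemma finite_dim_hom_space:
  assumes X: "fd_module A X" and V: "fd_module A V"
  shows "finite_dim (hom_space X V)"
proof -
  interpret BX: kspace "base_space A X" by (rule kspace_base_space[OF fd_moduleD[OF X]])
  have "finite_dim (base_space A X)" "finite_dim (base_space A V)"
    using X V by (auto simp: fd_module_iff)
  then obtain r :: nat and b \<mu> N and l :: "nat \<Rightarrow> 'b \<Rightarrow> 'k" where
    b: "b \<in> {..<r} \<rightarrow> carrier (base_space A X)"
    and \<mu>: "separating (base_space A X) (carrier (base_space A X)) {..<r} \<mu>"
    and dual: "\<And>i j. i < r \<Longrightarrow> j < r \<Longrightarrow> \<mu> i (b j) = of_bool (i = j)"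
    and l: "separating (base_space A V) (carrier (base_space A V)) {..<N} l"
    by (metis BX.finite_dimE finite_dim_def)
  have bX: "b i \<in> carrier X" if "i < r" for i using b that by auto
  have "separating (hom_space X V) (carrier (hom_space X V)) ({..<r} \<times> {..<N}) (\<lambda>(i, j) f. l j (f (b i)))"
    unfolding separating_def
  proof (intro conjI ballI impI)
    fix p assume "p \<in> {..<r} \<times> {..<N}"
    then obtain i j where p: "p = (i, j)" "i < r" "j < N" by auto
    have "linear_functional (base_space A V) (l j)" using l p by (auto simp: separating_def)
    from linear_functional_comp[OF klinear_evaluation[OF bX[OF p(2)]] this]
    show "linear_functional (hom_space X V) ((\<lambda>(i, j) f. l j (f (b i))) p)" using p by simp
  next
    fix f assume f: "f \<in> carrier (hom_space X V)"
        and z: "\<forall>p\<in>{..<r} \<times> {..<N}. (\<lambda>(i, j) f. l j (f (b i))) p f = 0"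
    have hom: "module_map A X V f" using f by (simp add: mhom_module_map)
    have fb: "f (b i) = \<zero>\<^bsub>V\<^esub>" if "i < r" for i
      using l z that module_map_closed[OF hom bX[OF that]] unfolding separating_def by auto
    have "f x = \<zero>\<^bsub>V\<^esub>" if x: "x \<in> carrier X" for x
    proof -
      interpret BV: kspace "base_space A V" by (rule kspace_base_space[OF fd_moduleD[OF V]])
      have "f x = f (\<Oplus>\<^bsub>base_space A X\<^esub>i\<in>{..<r}. \<mu> i x \<odot>\<^bsub>base_space A X\<^esub> b i)"
        using BX.dual_basis_expansion[OF b \<mu> dual] x by simp
      also have "\<dots> = (\<Oplus>\<^bsub>base_space A V\<^esub>i\<in>{..<r}. \<mu> i x \<odot>\<^bsub>base_space A V\<^esub> f (b i))"
        by (rule klinear_lincomb[OF BX.kspace_axioms BV.kspace_axioms module_map_klinear[OF hom] b])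
      also have "\<dots> = (\<Oplus>\<^bsub>base_space A V\<^esub>i\<in>{..<r}. \<zero>\<^bsub>base_space A V\<^esub>)"
      proof (rule BV.finsum_cong')
        fix i assume "i \<in> {..<r}"
        then have "f (b i) = \<zero>\<^bsub>base_space A V\<^esub>" using fb by simp
        then show "\<mu> i x \<odot>\<^bsub>base_space A V\<^esub> f (b i) = \<zero>\<^bsub>base_space A V\<^esub>"
          by (simp only: BV.smult_zero_right)
      qed (simp only: BV.zero_closed Pi_I)+
      also have "\<dots> = \<zero>\<^bsub>base_space A V\<^esub>" by (rule BV.finsum_zero)
      finally show ?thesis by simp
    qed
    then show "f = \<zero>\<^bsub>hom_space X V\<^esub>"
      using f by (auto simp: fun_eq_iff mhom_iff extensional_def)
  qed auto
  then show ?thesis by (rule finite_dimI)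
qed

lemma finsum_mhom:
  assumes X: "right_module A X" and V: "right_module A V"
    and f: "f \<in> I \<rightarrow> mhom A X V" and x: "x \<in> carrier X"
  shows "(\<Oplus>\<^bsub>mhom_module A X V s\<^esub>i\<in>I. f i) x = (\<Oplus>\<^bsub>V\<^esub>i\<in>I. f i x)"
proof -
  interpret V: right_module A V by (rule V)
  interpret H: abelian_group "mhom_module A X V s" by (rule abelian_group_mhom[OF X V])
  show ?thesis using f
  proof (induction I rule: infinite_finite_induct)
    case (insert i F)
    then have "f \<in> F \<rightarrow> carrier (mhom_module A X V s)" "f i \<in> carrier (mhom_module A X V s)" by auto
    moreover have "(\<lambda>i. f i x) \<in> F \<rightarrow> carrier V" "f i x \<in> carrier V"
      using insert.prems by (auto intro!: module_map_closed[where M = X and N = V, OF mhom_module_map x])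
    ultimately show ?case using insert x by simp
  qed (use x in simp_all)
qed

subsection \<open>The regular module\<close>

lemma kspace_algebra: "kspace A"
  by (intro kspace.intro kspace_axioms.intro abelian_group_axioms)
    (use vs.smult_closed vs.smult_l_distr vs.smult_r_distr vs.smult_assoc1 vs.smult_one in auto)

lemma regular_simps [simp]:
  "carrier (regular A) = carrier A" "\<zero>\<^bsub>regular A\<^esub> = \<zero>" "add (regular A) = add A"
  "r \<odot>\<^bsub>regular A\<^esub> x = x \<otimes> r"
  by (simp_all add: regular_def)

lemma right_module_regular: "right_module A (regular A)"
proof (rule right_moduleI)
  show "abelian_group (regular A)" by (rule abelian_group_cong[OF abelian_group_axioms]) simp_all
qed (simp_all add: ring_axioms l_distr r_distr m_assoc)

lemma fd_module_regular: "fd_module A (regular A)"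
proof -
  have fin: "finite_dim A" using finite_dimensional kspace.finite_dim_iff_basis[OF kspace_algebra] by blast
  have lin: "klinear (base_space A (regular A)) A (\<lambda>x. x)"
    using smult_mult_right[of _ \<one>] by (auto simp: klinear_def)
  have "finite_dim (base_space A (regular A))"
    by (rule finite_dim_injective[OF lin _ fin]) simp
  then show ?thesis using right_module_regular by (simp add: fd_module_iff)
qed

lemma module_map_regular:
  assumes "right_module A M" "y \<in> carrier M"
  shows "module_map A (regular A) M (\<lambda>r. r \<odot>\<^bsub>M\<^esub> y)"
proof -
  interpret M: right_module A M by fact
  show ?thesis using assms(2) by (auto simp: module_map_def M.smult_l_distr M.smult_assoc)
qed

lemma projectiveD: "projective A M \<Longrightarrow> fd_module A M" "projective A M \<Longrightarrow> right_module A M"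
  by (auto simp: projective_def fd_moduleD)

lemma simpleD: "simple_module A M \<Longrightarrow> fd_module A M" "simple_module A M \<Longrightarrow> right_module A M"
  by (auto simp: simple_module_def fd_moduleD)

lemma simple_module_submodule:
  "simple_module A M \<Longrightarrow> Module.submodule U A M \<Longrightarrow> x \<in> U \<Longrightarrow> x \<noteq> \<zero>\<^bsub>M\<^esub> \<Longrightarrow> U = carrier M"
  by (auto simp: simple_module_def)

end

section \<open>Projective covers of the simple modules\<close>

locale projective_covers = fd_algebra A
  for A :: "('k::field, 'l) module" (structure) +
  fixes n :: nat and S :: "nat \<Rightarrow> ('l, 's) module" and P :: "nat \<Rightarrow> ('l, 'p) module"
  assumes hereditary: "hereditary A"
    and complete_simples: "complete_simples A n S"
    and projective_cover: "\<And>i. i < n \<Longrightarrow> projective_cover A (P i) (S i)"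
begin

definition top_map :: "nat \<Rightarrow> 'p \<Rightarrow> 's" where
  "top_map i = (SOME p. p \<in> mhom A (P i) (S i) \<and> p ` carrier (P i) = carrier (S i) \<and>
        (\<forall>U. Module.submodule U A (P i) \<and> p ` U = carrier (S i) \<longrightarrow> U = carrier (P i)))"

lemma top_map:
  assumes "i < n"
  shows "module_map A (P i) (S i) (top_map i)" "top_map i ` carrier (P i) = carrier (S i)"
    "\<And>U. Module.submodule U A (P i) \<Longrightarrow> top_map i ` U = carrier (S i) \<Longrightarrow> U = carrier (P i)"
proof -
  have "\<exists>p. p \<in> mhom A (P i) (S i) \<and> p ` carrier (P i) = carrier (S i) \<and>
        (\<forall>U. Module.submodule U A (P i) \<and> p ` U = carrier (S i) \<longrightarrow> U = carrier (P i))"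
    using projective_cover[OF assms] by (auto simp: projective_cover_def)
  from someI_ex[OF this]
      have *: "top_map i \<in> mhom A (P i) (S i) \<and> top_map i ` carrier (P i) = carrier (S i) \<and>
        (\<forall>U. Module.submodule U A (P i) \<and> top_map i ` U = carrier (S i) \<longrightarrow> U = carrier (P i))"
    unfolding top_map_def .
  then show "module_map A (P i) (S i) (top_map i)" "top_map i ` carrier (P i) = carrier (S i)"
    "\<And>U. Module.submodule U A (P i) \<Longrightarrow> top_map i ` U = carrier (S i) \<Longrightarrow> U = carrier (P i)"
    by (auto intro: mhom_module_map)
qed

lemma simple_S: "i < n \<Longrightarrow> simple_module A (S i)"
  using complete_simples by (simp add: complete_simples_def)

lemma projective_P: "i < n \<Longrightarrow> projective A (P i)"
  using projective_cover by (simp add: projective_cover_def)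

lemmas fd_P = projectiveD(1)[OF projective_P] and right_module_P = projectiveD(2)[OF projective_P]
lemmas fd_S = simpleD(1)[OF simple_S] and right_module_S = simpleD(2)[OF simple_S]

lemma top_map_nonzero: "i < n \<Longrightarrow> \<exists>x\<in>carrier (P i). top_map i x \<noteq> \<zero>\<^bsub>S i\<^esub>"
proof -
  assume i: "i < n"
  interpret SS: right_module A "S i" by (rule right_module_S[OF i])
  have "carrier (S i) \<noteq> {\<zero>\<^bsub>S i\<^esub>}" using simple_S[OF i] by (simp add: simple_module_def)
  then obtain s where "s \<in> carrier (S i)" "s \<noteq> \<zero>\<^bsub>S i\<^esub>" using SS.zero_closed by blast
  then show ?thesis using top_map(2)[OF i] by (metis imageE)
qed

lemma P_nonzero: "i < n \<Longrightarrow> \<exists>x\<in>carrier (P i). x \<noteq> \<zero>\<^bsub>P i\<^esub>"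
  using top_map_nonzero module_map_zero[OF right_module_P right_module_S top_map(1)] by metis

text \<open>
  Since \<open>P\<^sub>i\<close> covers \<open>S\<^sub>i\<close>, a proper submodule cannot map onto the simple module \<open>S\<^sub>i\<close>, so it maps to zero:
  \<open>P\<^sub>i\<close> has a largest proper submodule.
\<close>

lemma proper_submodule_P:
  assumes i: "i < n" and U: "Module.submodule U A (P i)" and ne: "U \<noteq> carrier (P i)" and x: "x \<in> U"
  shows "top_map i x = \<zero>\<^bsub>S i\<^esub>"
proof (rule ccontr)
  assume "top_map i x \<noteq> \<zero>\<^bsub>S i\<^esub>"
  then have "top_map i ` U = carrier (S i)"
    using simple_module_submodule[OF simple_S[OF i] submodule_image[OF right_module_P[OF i]
      right_module_S[OF i]
      top_map(1)[OF i] U]] x by blast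
  then show False using top_map(3)[OF i U] ne by blast
qed

lemma top_kernel_maximal:
  assumes i: "i < n"
  shows "maximal_submodule A (P i) {x \<in> carrier (P i). top_map i x = \<zero>\<^bsub>S i\<^esub>}"
  unfolding maximal_submodule_def
proof (intro conjI allI impI)
  show "Module.submodule {x \<in> carrier (P i). top_map i x = \<zero>\<^bsub>S i\<^esub>} A (P i)"
    by (rule submodule_kernel[OF right_module_P[OF i] right_module_S[OF i] top_map(1)[OF i]])
  show "{x \<in> carrier (P i). top_map i x = \<zero>\<^bsub>S i\<^esub>} \<noteq> carrier (P i)" using top_map_nonzero[OF i] by auto
  fix W assume W: "Module.submodule W A (P i) \<and> {x \<in> carrier (P i). top_map i x = \<zero>\<^bsub>S i\<^esub>} \<subseteq> W"
  show "W = {x \<in> carrier (P i). top_map i x = \<zero>\<^bsub>S i\<^esub>} \<or> W = carrier (P i)"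
    using W proper_submodule_P[OF i, of W] submodule_subset[of W] by blast
qed

lemma radical_P:
  assumes i: "i < n"
  shows "radical A (P i) = {x \<in> carrier (P i). top_map i x = \<zero>\<^bsub>S i\<^esub>}"
proof (intro subset_antisym subsetI)
  fix x assume "x \<in> radical A (P i)"
  then show "x \<in> {x \<in> carrier (P i). top_map i x = \<zero>\<^bsub>S i\<^esub>}"
    using top_kernel_maximal[OF i] unfolding radical_def by blast
next
  fix x assume x: "x \<in> {x \<in> carrier (P i). top_map i x = \<zero>\<^bsub>S i\<^esub>}"
  have "x \<in> U" if U: "maximal_submodule A (P i) U" for U
  proof -
    have "Module.submodule U A (P i)" "U \<noteq> carrier (P i)" using U by (auto simp: maximal_submodule_def)
    then have "U \<subseteq> {x \<in> carrier (P i). top_map i x = \<zero>\<^bsub>S i\<^esub>}"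
      using proper_submodule_P[OF i] submodule_subset by blast
    then show ?thesis using U top_kernel_maximal[OF i] x unfolding maximal_submodule_def by blast
  qed
  then show "x \<in> radical A (P i)" using x by (simp add: radical_def)
qed

lemma submodule_radical_P: "i < n \<Longrightarrow> Module.submodule (radical A (P i)) A (P i)"
  using top_kernel_maximal radical_P by (simp add: maximal_submodule_def)

lemma radical_P_proper: "i < n \<Longrightarrow> radical A (P i) \<noteq> carrier (P i)"
  using top_kernel_maximal radical_P by (simp add: maximal_submodule_def)

text \<open>
  Otherwise the composite with \<open>P\<^sub>j \<rightarrow> S\<^sub>j\<close> is onto, and its kernel coincides with the kernel of
  \<open>P\<^sub>i \<rightarrow> S\<^sub>i\<close>, the only maximal submodule of \<open>P\<^sub>i\<close>; then \<open>S\<^sub>i\<close> and \<open>S\<^sub>j\<close> are isomorphic.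
\<close>

lemma hom_into_radical:
  assumes i: "i < n" and j: "j < n" and ij: "i \<noteq> j" and u: "module_map A (P i) (P j) u"
      and x: "x \<in> carrier (P i)"
  shows "u x \<in> radical A (P j)"
proof (rule ccontr)
  note Pi = right_module_P[OF i] and Si = right_module_S[OF i] and Sj = right_module_S[OF j]
  let ?w = "\<lambda>x. top_map j (u x)" and ?K = "{x \<in> carrier (P i). top_map j (u x) = \<zero>\<^bsub>S j\<^esub>}"
  let ?R = "{x \<in> carrier (P i). top_map i x = \<zero>\<^bsub>S i\<^esub>}"
  interpret PP: right_module A "P i" by (rule Pi)
  interpret SS: right_module A "S j" by (rule Sj)
  assume "u x \<notin> radical A (P j)"
  then have wx: "?w x \<noteq> \<zero>\<^bsub>S j\<^esub>" using module_map_closed[OF u x] radical_P[OF j] by simp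
  have w: "module_map A (P i) (S j) ?w" by (rule module_map_compose[OF u top_map(1)[OF j]])
  have K: "Module.submodule ?K A (P i)" by (rule submodule_kernel[OF Pi Sj w])
  have R: "Module.submodule ?R A (P i)" by (rule submodule_kernel[OF Pi Si top_map(1)[OF i]])
  have sur: "?w ` carrier (P i) = carrier (S j)"
    using simple_module_submodule[OF simple_S[OF j] submodule_image[OF Pi Sj w submodule_carrier[OF Pi]]]
      x wx by blast
  have "?K \<noteq> carrier (P i)" using x wx by blast
  then have KR: "?K \<subseteq> ?R" using proper_submodule_P[OF i K] by blast
  then have "?R \<subseteq> ?K \<or> ?R = carrier (P i)"
  proof -
    have "\<forall>z\<in>?R. ?w z = \<zero>\<^bsub>S j\<^esub>" if "?R \<noteq> carrier (P i)"
    proof (rule ccontr)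
      assume "\<not> (\<forall>z\<in>?R. ?w z = \<zero>\<^bsub>S j\<^esub>)"
      then have full: "?w ` ?R = carrier (S j)"
        using simple_module_submodule[OF simple_S[OF j] submodule_image[OF Pi Sj w R]] by blast
      have "y \<in> ?R" if y: "y \<in> carrier (P i)" for y
      proof -
        obtain z where z: "z \<in> ?R" "?w y = ?w z" using full module_map_closed[OF w y]
            by (metis (no_types, lifting) imageE)
        then have "?w (y \<ominus>\<^bsub>P i\<^esub> z) = \<zero>\<^bsub>S j\<^esub>"
          using y module_map_minus[OF Pi Sj w, of y z] module_map_closed[OF w] by simp
        then have "y \<ominus>\<^bsub>P i\<^esub> z \<in> ?R" using KR y z(1) by blast
        then have "(y \<ominus>\<^bsub>P i\<^esub> z) \<oplus>\<^bsub>P i\<^esub> z \<in> ?R" using z(1) R unfolding PP.submodule_iff by blast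
        then show ?thesis using y z(1) by (simp add: a_minus_def PP.a_assoc PP.l_neg)
      qed
      then show False using that by blast
    qed
    then show ?thesis by blast
  qed
  moreover have "?R \<noteq> carrier (P i)" using top_map_nonzero[OF i] by auto
  ultimately have KR': "?K = ?R" using KR by blast
  have "module_iso A (quot_module (P i) ?R) (S i)"
    unfolding module_iso_quot_iff[OF Pi R Si] using top_map[OF i] by blast
  moreover have "module_iso A (quot_module (P i) ?R) (S j)"
    unfolding module_iso_quot_iff[OF Pi R Sj] using w sur KR' by blast
  ultimately have "module_iso A (S i) (S j)"
    using module_iso_sym[OF right_module_quot[OF Pi R] Si]
      module_iso_trans[OF Si right_module_quot[OF Pi R]] by blast
  then show False using complete_simples i j ij by (auto simp: complete_simples_def)
qed

text \<open>
  Every proper submodule lies in a maximal one because dimensions are bounded. The simple quotient is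
  covered by one of the \<open>P\<^sub>i\<close>, and the covering map lifts to the whole module.
\<close>

lemma generator:
  assumes V: "fd_module A V" and U: "Module.submodule U A V" "U \<noteq> carrier V"
  shows "\<exists>i<n. \<exists>u. module_map A (P i) V u \<and> \<not> u ` carrier (P i) \<subseteq> U"
proof -
  note VR = fd_moduleD[OF V]
  interpret VV: right_module A V by (rule VR)
  let ?D = "\<lambda>W. Module.submodule W A V \<and> W \<noteq> carrier V \<and> U \<subseteq> W"
  let ?d = "\<lambda>W. mdim (V\<lparr>carrier := W\<rparr>)"
  have incl: "module_map A (V\<lparr>carrier := W\<rparr>) (V\<lparr>carrier := W'\<rparr>) (\<lambda>x. x)"
    if "W \<subseteq> W'" for W W' using that by (auto simp: module_map_def)
  have bound: "\<forall>W. ?D W \<longrightarrow> ?d W < Suc (mdim V)"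
  proof (intro allI impI)
    fix W assume W: "?D W"
    then have "W \<subseteq> carrier V" by (auto dest: submodule_subset)
    from mdim_le[OF fd_module_submodule[OF V] V module_map_restrict[OF module_map_id this]] W
    show "?d W < Suc (mdim V)" by (simp add: less_Suc_eq_le)
  qed
  obtain W where W: "?D W" "\<And>W'. ?D W' \<Longrightarrow> ?d W' \<le> ?d W"
    using ex_has_greatest_nat[of ?D U ?d "Suc (mdim V)"] U bound by blast
  have max: "W' = W \<or> W' = carrier V" if W': "Module.submodule W' A V" "W \<subseteq> W'" for W'
  proof (rule ccontr)
    assume n: "\<not> ?thesis"
    have "?d W < ?d W'"
      using W(1) W' n
      by (intro mdim_less[OF fd_module_submodule[OF V] fd_module_submodule[OF V] incl[OF W'(2)]]) auto
    moreover have "?D W'" using W(1) W' n by auto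
    ultimately show False using W(2) by fastforce
  qed
  have WS: "Module.submodule W A V" using W by blast
  note Q = fd_module_quot[OF VR WS V] and QR = right_module_quot[OF VR WS]
  note \<pi> = module_map_quot[OF VR WS] and \<pi>0 = quot_zero_iff[OF VR WS]
  have "simple_module A (quot_module V W)" unfolding simple_module_def
  proof (intro conjI allI impI Q)
    obtain x where x: "x \<in> carrier V" "x \<notin> W" using W(1) submodule_subset[OF WS] by blast
    then show "carrier (quot_module V W) \<noteq> {\<zero>\<^bsub>quot_module V W\<^esub>}"
      using \<pi>0[OF x(1)] module_map_closed[OF \<pi> x(1)] by auto
    fix X assume X: "Module.submodule X A (quot_module V W)"
    interpret QQ: right_module A "quot_module V W" by (rule QR)
    have X0: "\<zero>\<^bsub>quot_module V W\<^esub> \<in> X" using X by (simp add: QQ.submodule_iff)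
    let ?W = "{x \<in> carrier V. W +>\<^bsub>V\<^esub> x \<in> X}"
    have "Module.submodule ?W A V" by (rule submodule_preimage[OF VR QR \<pi> X])
    moreover have "W \<subseteq> ?W"
    proof
      fix x assume x: "x \<in> W"
      then have xV: "x \<in> carrier V" using submodule_subset[OF WS] by blast
      with x \<pi>0[OF xV] X0 show "x \<in> ?W" by simp
    qed
    ultimately have "?W = W \<or> ?W = carrier V" by (rule max)
    moreover have "X = (\<lambda>x. W +>\<^bsub>V\<^esub> x) ` ?W"
      using submodule_subset[OF X] by (auto elim!: quot_carrierE[OF VR WS] simp: subset_iff image_iff)
    ultimately show "X = {\<zero>\<^bsub>quot_module V W\<^esub>} \<or> X = carrier (quot_module V W)"
    proof (elim disjE)
      assume a: "?W = W" and b: "X = (\<lambda>x. W +>\<^bsub>V\<^esub> x) ` ?W"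
      have "X \<subseteq> {\<zero>\<^bsub>quot_module V W\<^esub>}"
      proof
        fix z assume "z \<in> X"
        then have "z \<in> (\<lambda>x. W +>\<^bsub>V\<^esub> x) ` ?W" using b by (rule subst[rotated])
        then obtain x where "x \<in> ?W" "z = W +>\<^bsub>V\<^esub> x" by (rule imageE)
        moreover have "x \<in> W" "x \<in> carrier V" using a \<open>x \<in> ?W\<close> by blast+
        ultimately show "z \<in> {\<zero>\<^bsub>quot_module V W\<^esub>}" using \<pi>0 by simp
      qed
      then show ?thesis using X0 by blast
    next
      assume a: "?W = carrier V" and b: "X = (\<lambda>x. W +>\<^bsub>V\<^esub> x) ` ?W"
      have "carrier (quot_module V W) \<subseteq> X"
      proof
        fix z assume "z \<in> carrier (quot_module V W)"
        then obtain x where x: "x \<in> carrier V" "z = W +>\<^bsub>V\<^esub> x" by (rule quot_carrierE[OF VR WS])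
        then have "x \<in> ?W" using a by blast
        with x show "z \<in> X" by blast
      qed
      then show ?thesis using submodule_subset[OF X] by blast
    qed
  qed
  then obtain i where i: "i < n" "module_iso A (quot_module V W) (S i)"
    using simple_module_index[OF complete_simples] by blast
  then obtain t where t: "module_map A V (S i) t" "t ` carrier V = carrier (S i)"
    "\<forall>x\<in>carrier V. t x = \<zero>\<^bsub>S i\<^esub> \<longleftrightarrow> x \<in> W"
    unfolding module_iso_quot_iff[OF VR WS right_module_S[OF i(1)]] by blast
  obtain u where u: "module_map A (P i) V u" "\<forall>x\<in>carrier (P i). t (u x) = top_map i x"
    using projective_lift[OF projective_P[OF i(1)] V fd_S[OF i(1)] t(1,2) top_map(1)[OF i(1)]] by blast
  obtain x where x: "x \<in> carrier (P i)" "top_map i x \<noteq> \<zero>\<^bsub>S i\<^esub>" using top_map_nonzero[OF i(1)] by blast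
  then have "u x \<notin> W" using u(2) t(3) module_map_closed[OF u(1)] by metis
  then have "\<not> u ` carrier (P i) \<subseteq> U" using x W(1) by blast
  with u(1) i(1) show ?thesis by blast
qed

text \<open>
  An element of \<open>P\<^sub>i\<close> outside the largest proper submodule generates \<open>P\<^sub>i\<close>, so that the regular module maps
  onto \<open>P\<^sub>i\<close>; this map splits because \<open>P\<^sub>i\<close> is projective.
\<close>

lemma P_embeds:
  assumes i: "i < n"
  obtains e where "module_map A (P i) (regular A) e" "inj_on e (carrier (P i))"
proof -
  note Pi = right_module_P[OF i] and Si = right_module_S[OF i]
  interpret PP: right_module A "P i" by (rule Pi)
  obtain y where y: "y \<in> carrier (P i)" "top_map i y \<noteq> \<zero>\<^bsub>S i\<^esub>" using top_map_nonzero[OF i] by blast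
  let ?h = "\<lambda>r. r \<odot>\<^bsub>P i\<^esub> y"
  have h: "module_map A (regular A) (P i) ?h" by (rule module_map_regular[OF Pi y(1)])
  have im: "Module.submodule (?h ` carrier A) A (P i)"
    using submodule_image[OF right_module_regular Pi h submodule_carrier[OF right_module_regular]] by simp
  have "y \<in> ?h ` carrier A" using y by (intro image_eqI[of _ _ \<one>]) auto
  then have sur: "?h ` carrier (regular A) = carrier (P i)"
    using proper_submodule_P[OF i im] y(2) by auto
  obtain e where e: "module_map A (P i) (regular A) e" "\<forall>x\<in>carrier (P i). ?h (e x) = x"
    using projective_lift[OF projective_P[OF i] fd_module_regular fd_P[OF i] h sur module_map_id] by blast
  then have "inj_on e (carrier (P i))" by (metis inj_onI)
  with e(1) that show ?thesis by blast
qed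

text \<open>
  The image of an endomorphism is isomorphic to a right ideal and hence projective, so that it
  splits off; but \<open>P\<^sub>i\<close> is not the sum of two proper submodules.
\<close>

lemma endo_bij:
  assumes i: "i < n" and u: "module_map A (P i) (P i) u" and nz: "x \<in> carrier (P i)" "u x \<noteq> \<zero>\<^bsub>P i\<^esub>"
  shows "bij_betw u (carrier (P i)) (carrier (P i))"
proof -
  note Pi = right_module_P[OF i] and Si = right_module_S[OF i]
  interpret PP: right_module A "P i" by (rule Pi)
  interpret SS: right_module A "S i" by (rule Si)
  obtain e where e: "module_map A (P i) (regular A) e" "inj_on e (carrier (P i))" by (rule P_embeds[OF i])
  let ?eu = "\<lambda>x. e (u x)"
  have eu: "module_map A (P i) (regular A) ?eu" by (rule module_map_compose[OF u e(1)])
  let ?J = "?eu ` carrier (P i)"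
  let ?RJ = "(regular A)\<lparr>carrier := ?J\<rparr>"
  have J: "Module.submodule ?J A (regular A)"
    by (rule submodule_image[OF Pi right_module_regular eu submodule_carrier[OF Pi]])
  then have proj: "projective A ?RJ" using hereditary by (simp add: hereditary_def)
  note RJ = projectiveD(2)[OF proj]
  have euJ: "module_map A (P i) ?RJ ?eu" by (rule module_map_into[OF eu]) simp
  obtain s where s: "module_map A ?RJ (P i) s" "\<forall>z\<in>carrier ?RJ. ?eu (s z) = z"
    using projective_lift[OF proj fd_P[OF i] projectiveD(1)[OF proj] euJ _ module_map_id] by auto
  let ?U = "s ` ?J" and ?K = "{x \<in> carrier (P i). u x = \<zero>\<^bsub>P i\<^esub>}"
  have U: "Module.submodule ?U A (P i)"
    using submodule_image[OF RJ Pi s(1) submodule_carrier[OF RJ]] by simp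
  have K: "Module.submodule ?K A (P i)" by (rule submodule_kernel[OF Pi Pi u])
  have Kne: "?K \<noteq> carrier (P i)" using nz by blast
  have split: "y \<ominus>\<^bsub>P i\<^esub> s (?eu y) \<in> ?K" if y: "y \<in> carrier (P i)" for y
  proof -
    have sy: "s (?eu y) \<in> carrier (P i)" using module_map_closed[OF s(1), of "?eu y"] y by simp
    have "e (u (s (?eu y))) = e (u y)" using s(2) y by simp
    then have "u (s (?eu y)) = u y"
      using e(2) module_map_closed[OF u sy] module_map_closed[OF u y] by (meson inj_onD)
    then show ?thesis using module_map_minus[OF Pi Pi u y sy] module_map_closed[OF u y] y sy by simp
  qed
  have "?U = carrier (P i)"
  proof (rule ccontr)
    assume ne: "?U \<noteq> carrier (P i)"
    have "top_map i y = \<zero>\<^bsub>S i\<^esub>" if y: "y \<in> carrier (P i)" for y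
    proof -
      let ?v = "s (?eu y)"
      have v: "?v \<in> ?U" "?v \<in> carrier (P i)" using y module_map_closed[OF s(1), of "?eu y"] by auto
      have "top_map i y = top_map i ((y \<ominus>\<^bsub>P i\<^esub> ?v) \<oplus>\<^bsub>P i\<^esub> ?v)"
        using y v(2) by (simp add: a_minus_def PP.a_assoc PP.l_neg)
      also have "\<dots> = top_map i (y \<ominus>\<^bsub>P i\<^esub> ?v) \<oplus>\<^bsub>S i\<^esub> top_map i ?v"
        using y v(2) by (intro module_map_add[OF top_map(1)[OF i]]) auto
      also have "\<dots> = \<zero>\<^bsub>S i\<^esub>"
        using proper_submodule_P[OF i K Kne split[OF y]] proper_submodule_P[OF i U ne v(1)] by simp
      finally show ?thesis .
    qed
    then show False using top_map_nonzero[OF i] by blast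
  qed
  have "inj_on u (carrier (P i))"
  proof (rule module_map_inj_on[OF Pi Pi u])
    fix y assume y: "y \<in> carrier (P i)" "u y = \<zero>\<^bsub>P i\<^esub>"
    then obtain z where z: "z \<in> ?J" "y = s z" using \<open>?U = carrier (P i)\<close> by blast
    have "z = e (u (s z))" using s(2) z(1) by auto
    also have "\<dots> = e \<zero>\<^bsub>P i\<^esub>" using y(2) z(2) by simp
    also have "\<dots> = \<zero>\<^bsub>?RJ\<^esub>" using module_map_zero[OF Pi right_module_regular e(1)] by simp
    finally show "y = \<zero>\<^bsub>P i\<^esub>" using z(2) module_map_zero[OF RJ Pi s(1)] by simp
  qed
  then show ?thesis by (rule injective_endo_bij[OF fd_P[OF i] u])
qed

end

section \<open>Dimension vectors\<close>

context projective_covers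
begin

abbreviation copies :: "nat \<Rightarrow> nat \<Rightarrow> ('l, nat \<Rightarrow> 'p) module" where
  "copies i m \<equiv> dir_sum {..<m} (\<lambda>_. P i)"

text \<open>
  The maps \<open>P\<^sub>i\<^sup>m \<rightarrow> V\<close> whose components form a basis of \<open>Hom(P\<^sub>i, V)\<close> over the division ring of
  endomorphisms of \<open>P\<^sub>i\<close>: surjectivity and injectivity are tested on the maps from \<open>P\<^sub>i\<close> only.
\<close>

definition frame :: "nat \<Rightarrow> ('l, 'q) module \<Rightarrow> ('l, 'v) module \<Rightarrow> ('q \<Rightarrow> 'v) \<Rightarrow> bool" where
  "frame i Q V t \<longleftrightarrow> module_map A Q V t \<and> lifts (P i) Q V t \<and> monic_for (P i) Q V t"

lemma right_module_copies: "i < n \<Longrightarrow> right_module A (copies i m)"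
  by (intro right_module_dir_sum right_module_P)

lemma fd_module_copies: "i < n \<Longrightarrow> fd_module A (copies i m)"
  by (intro fd_module_dir_sum fd_P) auto

lemma scalar_zero_divisor:
  assumes V: "right_module A V" and y: "y \<in> carrier V" "y \<noteq> \<zero>\<^bsub>V\<^esub>" and z: "(a \<odot> \<one>) \<odot>\<^bsub>V\<^esub> y = \<zero>\<^bsub>V\<^esub>"
  shows "a = 0"
proof (rule ccontr)
  interpret B: kspace "base_space A V" by (rule kspace_base_space[OF V])
  assume "a \<noteq> 0"
  then have "y = (inverse a * a) \<odot>\<^bsub>base_space A V\<^esub> y" using B.smult_one[of y] y by simp
  also have "\<dots> = inverse a \<odot>\<^bsub>base_space A V\<^esub> (a \<odot>\<^bsub>base_space A V\<^esub> y)"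
    using y by (intro B.smult_assoc) simp
  also have "a \<odot>\<^bsub>base_space A V\<^esub> y = \<zero>\<^bsub>base_space A V\<^esub>" using z by simp
  also have "inverse a \<odot>\<^bsub>base_space A V\<^esub> \<zero>\<^bsub>base_space A V\<^esub> = \<zero>\<^bsub>base_space A V\<^esub>" by (rule B.smult_zero_right)
  finally show False using y by simp
qed

text \<open>
  Independence over the endomorphism ring implies independence over the base field, so that a
  maximal independent family exists; as nonzero endomorphisms are invertible, it also spans.
\<close>

lemma frame_exists:
  fixes V :: "('l, 'v) module"
  assumes i: "i < n" and V: "fd_module A V"
  shows "\<exists>m t. frame i (copies i m) V t"
proof -
  note Pi = right_module_P[OF i] and VR = fd_moduleD[OF V]
  interpret VV: right_module A V by (rule VR)
  interpret PP: right_module A "P i" by (rule Pi)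
  define comb where "comb m b y = (\<Oplus>\<^bsub>V\<^esub>a\<in>{..<m}. b a (y a))" for m :: nat and b :: "nat \<Rightarrow> 'p \<Rightarrow> 'v" and y
  define ind where "ind m b \<longleftrightarrow> (\<forall>a<m. module_map A (P i) V (b a))
      \<and> monic_for (P i) (copies i m) V (comb m b)" for m b
  have comb_hom: "module_map A (copies i m) V (comb m b)" if "\<forall>a<m. module_map A (P i) V (b a)" for m b
    unfolding comb_def using that by (intro module_map_ds_out VR) auto
  have bound: "m \<le> kdim (hom_space (P i) V)" if "ind m b" for m b
  proof (rule kspace.kdim_ge[OF kspace_hom_space[OF Pi VR] finite_dim_hom_space[OF fd_P[OF i] V]])
    let ?b = "\<lambda>a. restrict (b a) (carrier (P i))"
    have b: "module_map A (P i) V (b a)" if "a < m" for a using \<open>ind m b\<close> that by (simp add: ind_def)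
    have bH: "?b a \<in> mhom A (P i) V" if "a < m" for a by (rule mhom_restrict[OF Pi b[OF that]])
    show "independent (hom_space (P i) V) m ?b" unfolding independent_def
    proof (intro conjI allI impI)
      show "?b \<in> {..<m} \<rightarrow> carrier (hom_space (P i) V)" using bH by auto
      fix c a assume z: "(\<Oplus>\<^bsub>hom_space (P i) V\<^esub>a\<in>{..<m}. c a \<odot>\<^bsub>hom_space (P i) V\<^esub> ?b a)
          = \<zero>\<^bsub>hom_space (P i) V\<^esub>"
        and a: "a < m"
      let ?v = "\<lambda>y. \<lambda>a\<in>{..<m}. (c a \<odot> \<one>) \<odot>\<^bsub>P i\<^esub> y"
      have v: "module_map A (P i) (copies i m) ?v"
        by (intro module_map_ds_map module_map_scalar_map[OF Pi module_map_id])
      have "comb m b (?v y) = \<zero>\<^bsub>V\<^esub>" if y: "y \<in> carrier (P i)" for y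
      proof -
        have fH: "(\<lambda>a. c a \<odot>\<^bsub>hom_space (P i) V\<^esub> ?b a) \<in> {..<m} \<rightarrow> mhom A (P i) V"
          using kspace.smult_closed[OF kspace_hom_space[OF Pi VR]] bH
            by (auto simp del: mhom_module_simps(4))
        have "comb m b (?v y) = (\<Oplus>\<^bsub>V\<^esub>a\<in>{..<m}. (c a \<odot>\<^bsub>hom_space (P i) V\<^esub> ?b a) y)"
          unfolding comb_def using y module_map_smult[OF b scalar_closed y] module_map_closed[OF b y]
          by (intro VV.finsum_cong') auto
        also have "\<dots> = (\<Oplus>\<^bsub>hom_space (P i) V\<^esub>a\<in>{..<m}. c a \<odot>\<^bsub>hom_space (P i) V\<^esub> ?b a) y"
          by (rule finsum_mhom[OF Pi VR fH y, symmetric])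
        also have "\<dots> = \<zero>\<^bsub>V\<^esub>" unfolding z using y by simp
        finally show ?thesis .
      qed
      then have v0: "?v y = \<zero>\<^bsub>copies i m\<^esub>" if "y \<in> carrier (P i)" for y
        using \<open>ind m b\<close> v that unfolding ind_def monic_for_def by blast
      obtain y where y: "y \<in> carrier (P i)" "y \<noteq> \<zero>\<^bsub>P i\<^esub>" using P_nonzero[OF i] by blast
      have "(c a \<odot> \<one>) \<odot>\<^bsub>P i\<^esub> y = \<zero>\<^bsub>P i\<^esub>" using fun_cong[OF v0[OF y(1)], of a] a by simp
      then show "c a = 0" by (rule scalar_zero_divisor[OF Pi y])
    qed
  qed
  have ind0: "ind 0 undefined"
    unfolding ind_def monic_for_def by (auto simp: module_map_def restrict_def Pi_iff)
  define m where "m = (GREATEST m. \<exists>b. ind m b)"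
  have bd: "m' \<le> kdim (hom_space (P i) V)" if "\<exists>b. ind m' b" for m' using that bound by blast
  have "\<exists>b. ind m b"
    unfolding m_def by (rule GreatestI_nat[of "\<lambda>m. \<exists>b. ind m b", OF _ bd]) (use ind0 in blast)
  then obtain b where b: "ind m b" by blast
  have max: "m' \<le> m" if "ind m' b'" for m' b'
    unfolding m_def by (rule Greatest_le_nat[of "\<lambda>m. \<exists>b. ind m b", OF _ bd]) (use that in blast)
  have bh: "module_map A (P i) V (b a)" if "a < m" for a using b that by (simp add: ind_def)
  have "lifts (P i) (copies i m) V (comb m b)" unfolding lifts_def
  proof (intro allI impI)
    fix u assume u: "module_map A (P i) V u"
    let ?b = "b(m := u)"
    have bh': "\<forall>a<Suc m. module_map A (P i) V (?b a)" using bh u by (auto simp: less_Suc_eq)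
    have "\<not> ind (Suc m) ?b" using max[of "Suc m"] by fastforce
    then obtain v x0 where v: "module_map A (P i) (copies i (Suc m)) v"
      "\<And>x. x \<in> carrier (P i) \<Longrightarrow> comb (Suc m) ?b (v x) = \<zero>\<^bsub>V\<^esub>"
          and x0: "x0 \<in> carrier (P i)" "v x0 \<noteq> \<zero>\<^bsub>copies i (Suc m)\<^esub>"
      using bh' unfolding ind_def monic_for_def by blast
    have va: "module_map A (P i) (P i) (\<lambda>x. v x a)" if "a < Suc m" for a
      using module_map_compose[OF v(1) module_map_ds_proj[where M = "\<lambda>_. P i"]] that by simp
    let ?w = "\<lambda>x. \<lambda>a\<in>{..<m}. v x a"
    have w: "module_map A (P i) (copies i m) ?w" using va by (intro module_map_ds_map) auto
    have split: "u (v x m) \<oplus>\<^bsub>V\<^esub> comb m b (?w x) = \<zero>\<^bsub>V\<^esub>" if x: "x \<in> carrier (P i)" for x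
    proof -
      have cl: "v x a \<in> carrier (P i)" if "a < Suc m" for a using module_map_closed[OF va[OF that] x] .
      have cl': "b a (v x a) \<in> carrier V" if "a < m" for a using module_map_closed[OF bh cl] that by simp
      have "(\<Oplus>\<^bsub>V\<^esub>a\<in>{..<m}. ?b a (v x a)) = comb m b (?w x)"
        unfolding comb_def using cl' by (intro VV.finsum_cong') auto
      moreover have "comb (Suc m) ?b (v x) = u (v x m) \<oplus>\<^bsub>V\<^esub> (\<Oplus>\<^bsub>V\<^esub>a\<in>{..<m}. ?b a (v x a))"
        unfolding comb_def lessThan_Suc using cl' module_map_closed[OF u cl]
        by (subst VV.finsum_insert) auto
      ultimately show ?thesis using v(2)[OF x] by simp
    qed
    have "\<exists>x\<in>carrier (P i). v x m \<noteq> \<zero>\<^bsub>P i\<^esub>"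
    proof (rule ccontr)
      assume "\<not> ?thesis"
      then have vm: "v x m = \<zero>\<^bsub>P i\<^esub>" if "x \<in> carrier (P i)" for x using that by blast
      have "comb m b (?w x) = \<zero>\<^bsub>V\<^esub>" if "x \<in> carrier (P i)" for x
        using split[OF that] vm[OF that] module_map_zero[OF Pi VR u]
          module_map_closed[OF comb_hom module_map_closed[OF w that]] bh by simp
      then have w0: "?w x0 = \<zero>\<^bsub>copies i m\<^esub>"
        using b w x0(1) unfolding ind_def monic_for_def by blast
      have "v x0 a = \<zero>\<^bsub>P i\<^esub>" if "a < Suc m" for a
      proof (cases "a = m")
        case False
        then show ?thesis using fun_cong[OF w0, of a] that by simp
      qed (use vm[OF x0(1)] in simp)
      then have "v x0 = \<zero>\<^bsub>copies i (Suc m)\<^esub>"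
        using module_map_closed[OF v(1) x0(1)] by (auto simp: PiE_iff extensional_def fun_eq_iff)
      then show False using x0(2) by blast
    qed
    then obtain x1 where "x1 \<in> carrier (P i)" "v x1 m \<noteq> \<zero>\<^bsub>P i\<^esub>" by blast
    from endo_bij[OF i va[of m] this] have bij: "bij_betw (\<lambda>x. v x m) (carrier (P i)) (carrier (P i))"
        by simp
    \<comment> \<open>The dependence relation is solved for \<open>u\<close> by inverting its coefficient.\<close>
    let ?g = "the_inv_into (carrier (P i)) (\<lambda>x. v x m)"
    have g: "module_map A (P i) (P i) ?g" using module_map_inverse[OF Pi Pi va[of m] bij] by simp
    have vg: "v (?g x) m = x" if "x \<in> carrier (P i)" for x
      using f_the_inv_into_f_bij_betw[OF bij] that by simp
    let ?h = "\<lambda>x. \<zero>\<^bsub>copies i m\<^esub> \<ominus>\<^bsub>copies i m\<^esub> ?w (?g x)"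
    have wg: "module_map A (P i) (copies i m) (\<lambda>x. ?w (?g x))" by (rule module_map_compose[OF g w])
    note Q = right_module_copies[OF i, of m]
    have h: "module_map A (P i) (copies i m) ?h"
        by (rule module_map_minus_map[OF Q module_map_zero_map[OF Q] wg])
    have "comb m b (?h x) = u x" if x: "x \<in> carrier (P i)" for x
    proof -
      have gx: "?g x \<in> carrier (P i)" by (rule module_map_closed[OF g x])
      have ch: "module_map A (copies i m) V (comb m b)" using comb_hom bh by blast
      have cC: "comb m b (?w (?g x)) \<in> carrier V"
          by (rule module_map_closed[OF ch module_map_closed[OF wg x]])
      interpret QQ: right_module A "copies i m" by (rule Q)
      have "comb m b (?h x) = comb m b \<zero>\<^bsub>copies i m\<^esub> \<ominus>\<^bsub>V\<^esub> comb m b (?w (?g x))"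
        by (rule module_map_minus[OF Q VR ch QQ.zero_closed module_map_closed[OF wg x]])
      also have "\<dots> = \<ominus>\<^bsub>V\<^esub> comb m b (?w (?g x))"
        using module_map_zero[OF Q VR ch] cC by (simp add: a_minus_def)
      also have "\<dots> = u x"
        using split[OF gx] vg[OF x] cC module_map_closed[OF u x] by (metis VV.minus_equality)
      finally show ?thesis .
    qed
    then show "\<exists>v. module_map A (P i) (copies i m) v \<and> (\<forall>x\<in>carrier (P i). comb m b (v x) = u x)" using h
        by blast
  qed
  then have "frame i (copies i m) V (comb m b)"
    using b comb_hom bh unfolding frame_def ind_def by blast
  then show ?thesis by blast
qed

text \<open>
  Two frames of the same module factor through each other by mutually inverse maps, so that
  \<open>P\<^sub>i\<^sup>m\<close> embeds in \<open>P\<^sub>i\<^bsup>m'\<^esup>\<close>; compare dimensions.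
\<close>

lemma frame_le:
  assumes i: "i < n" and V: "right_module A V"
    and t: "frame i (copies i m) V t" and t': "frame i (copies i m') V t'"
  shows "m \<le> m'"
proof (rule ccontr)
  assume "\<not> m \<le> m'"
  then have mm: "m' < m" by simp
  note Pi = right_module_P[OF i]
  let ?Q = "copies i m" and ?Q' = "copies i m'"
  note Q = right_module_copies[OF i, of m] and Q' = right_module_copies[OF i, of m']
  have th: "module_map A ?Q V t" "module_map A ?Q' V t'" using t t' by (auto simp: frame_def)
  have l: "lifts ?Q ?Q' V t'"
    using t' by (intro lifts_dir_sum Pi Q' V) (auto simp: frame_def)
  have l': "lifts ?Q' ?Q V t"
    using t by (intro lifts_dir_sum Pi Q V) (auto simp: frame_def)
  have mon: "monic_for ?Q ?Q V t"
    using t by (intro monic_for_dir_sum Pi Q) (auto simp: frame_def)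
  obtain X where X: "module_map A ?Q ?Q' X" "\<forall>x\<in>carrier ?Q. t' (X x) = t x"
    using l th(1) unfolding lifts_def by blast
  obtain Y where Y: "module_map A ?Q' ?Q Y" "\<forall>x\<in>carrier ?Q'. t (Y x) = t' x"
    using l' th(2) unfolding lifts_def by blast
  let ?d = "\<lambda>x. Y (X x) \<ominus>\<^bsub>?Q\<^esub> x"
  have d: "module_map A ?Q ?Q ?d"
      by (rule module_map_minus_map[OF Q module_map_compose[OF X(1) Y(1)] module_map_id])
  interpret QQ: right_module A ?Q by (rule Q)
  interpret VV: right_module A V by (rule V)
  have td: "\<forall>x\<in>carrier ?Q. t (?d x) = \<zero>\<^bsub>V\<^esub>"
  proof
    fix x assume x: "x \<in> carrier ?Q"
    have "t (?d x) = t (Y (X x)) \<ominus>\<^bsub>V\<^esub> t x"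
      by (rule module_map_minus[OF Q V th(1) module_map_closed[OF Y(1) module_map_closed[OF X(1) x]] x])
    also have "t (Y (X x)) = t x" using X(2) Y(2) x module_map_closed[OF X(1) x] by metis
    also have "t x \<ominus>\<^bsub>V\<^esub> t x = \<zero>\<^bsub>V\<^esub>" using VV.minus_zero_iff module_map_closed[OF th(1) x] by blast
    finally show "t (?d x) = \<zero>\<^bsub>V\<^esub>" .
  qed
  have YX: "Y (X x) = x" if x: "x \<in> carrier ?Q" for x
  proof -
    have "?d x = \<zero>\<^bsub>?Q\<^esub>" using mon d td x unfolding monic_for_def by blast
    then show ?thesis
      using QQ.minus_zero_iff[OF module_map_closed[OF Y(1) module_map_closed[OF X(1) x]] x] by blast
  qed
  then have "inj_on X (carrier ?Q)" by (metis inj_onI)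
  then have "mdim ?Q \<le> mdim ?Q'" by (rule mdim_le[OF fd_module_copies[OF i] fd_module_copies[OF i] X(1)])
  moreover have "mdim ?Q' < mdim ?Q"
  proof -
    let ?e = "\<lambda>x. \<lambda>a\<in>{..<m}. if a < m' then x a else \<zero>\<^bsub>P i\<^esub>"
    have e: "module_map A ?Q' ?Q ?e"
    proof (rule module_map_ds_map)
      fix a assume "a \<in> {..<m}"
      show "module_map A ?Q' (P i) (\<lambda>x. if a < m' then x a else \<zero>\<^bsub>P i\<^esub>)"
        using module_map_ds_proj[of a "{..<m'}" "\<lambda>_. P i"] module_map_zero_map[OF Pi]
          by (cases "a < m'") auto
    qed
    have inj: "inj_on ?e (carrier ?Q')"
    proof (rule inj_onI)
      fix x y assume xy: "x \<in> carrier ?Q'" "y \<in> carrier ?Q'" "?e x = ?e y"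
      have "x a = y a" if "a \<in> {..<m'}" for a using fun_cong[OF xy(3), of a] that mm by simp
      then show "x = y" using xy(1,2) by (intro PiE_ext[of x "{..<m'}" "\<lambda>_. carrier (P i)" y]) auto
    qed
    obtain y where y: "y \<in> carrier (P i)" "y \<noteq> \<zero>\<^bsub>P i\<^esub>" using P_nonzero[OF i] by blast
    have "ds_inj {..<m} (\<lambda>_. P i) m' y \<in> carrier ?Q"
      by (rule module_map_closed[OF module_map_ds_inj[where I = "{..<m}" and M = "\<lambda>_. P i"
        and i = m', OF Pi] y(1)])
        (use mm in simp)
    moreover have "ds_inj {..<m} (\<lambda>_. P i) m' y \<notin> ?e ` carrier ?Q'"
    proof
      assume "ds_inj {..<m} (\<lambda>_. P i) m' y \<in> ?e ` carrier ?Q'"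
      then obtain x where "ds_inj {..<m} (\<lambda>_. P i) m' y = ?e x" by blast
      from fun_cong[OF this, of m'] show False using mm y(2) by (simp add: ds_inj_def)
    qed
    ultimately have "?e ` carrier ?Q' \<noteq> carrier ?Q" by blast
    then show ?thesis by (rule mdim_less[OF fd_module_copies[OF i] fd_module_copies[OF i] e inj])
  qed
  ultimately show False by simp
qed

text \<open>
  A coefficient family \<open>a\<close> over \<open>End(P\<^sub>i)\<close> is a map \<open>P\<^sub>i \<rightarrow> P\<^sub>i\<^sup>m\<close>, and the linear combination with these
  coefficients is its composite with the map \<open>P\<^sub>i\<^sup>m \<rightarrow> V\<close> given by the family \<open>b\<close>. Existence and uniqueness
  of coefficients are the two halves of the notion of a frame.
\<close>

lemma basis_iff_frame:
  assumes i: "i < n" and V: "right_module A V"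
  shows "(\<exists>b. is_basis (End_ring A (P i)) (mhom_module A (P i) V (\<lambda>e h. compose (carrier (P i)) h e)) m b)
     \<longleftrightarrow> (\<exists>t. frame i (copies i m) V t)" (is "(\<exists>b. is_basis ?F ?H m b) \<longleftrightarrow> _")
proof
  note Pi = right_module_P[OF i]
  interpret VV: right_module A V by (rule V)
  have F: "carrier ?F = mhom A (P i) (P i)" by (simp add: End_ring_def)
  have comp: "compose (carrier (P i)) g a \<in> mhom A (P i) V"
    if "g \<in> mhom A (P i) V" "a \<in> mhom A (P i) (P i)" for g a
    using mhom_restrict[OF Pi module_map_compose[OF mhom_module_map[OF that(2)]
      mhom_module_map[OF that(1)]]]
    by (simp add: compose_def)
  have aP: "a j y \<in> carrier (P i)"
    if "a \<in> {..<m} \<rightarrow> mhom A (P i) (P i)" "j < m" "y \<in> carrier (P i)" for a j y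
  proof -
    have "a j \<in> mhom A (P i) (P i)" using that by auto
    from module_map_closed[OF mhom_module_map[OF this] that(3)] show ?thesis .
  qed
  have bV: "b j y \<in> carrier V"
    if "b \<in> {..<m} \<rightarrow> mhom A (P i) V" "j < m" "y \<in> carrier (P i)" for b j y
  proof -
    have "b j \<in> mhom A (P i) V" using that by auto
    from module_map_closed[OF mhom_module_map[OF this] that(3)] show ?thesis .
  qed
  have eval: "(\<Oplus>\<^bsub>?H\<^esub>j\<in>{..<m}. a j \<odot>\<^bsub>?H\<^esub> b j) x = (\<Oplus>\<^bsub>V\<^esub>j\<in>{..<m}. b j (a j x))"
    if "a \<in> {..<m} \<rightarrow> mhom A (P i) (P i)" "b \<in> {..<m} \<rightarrow> mhom A (P i) V" "x \<in> carrier (P i)" for a b x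
  proof -
    have "(\<lambda>j. a j \<odot>\<^bsub>?H\<^esub> b j) \<in> {..<m} \<rightarrow> mhom A (P i) V" using comp that by auto
    from finsum_mhom[OF Pi V this that(3)]
    have "(\<Oplus>\<^bsub>?H\<^esub>j\<in>{..<m}. a j \<odot>\<^bsub>?H\<^esub> b j) x = (\<Oplus>\<^bsub>V\<^esub>j\<in>{..<m}. (a j \<odot>\<^bsub>?H\<^esub> b j) x)" .
    also have "\<dots> = (\<Oplus>\<^bsub>V\<^esub>j\<in>{..<m}. b j (a j x))"
    proof (rule VV.finsum_cong')
      show "(\<lambda>j. b j (a j x)) \<in> {..<m} \<rightarrow> carrier V"
        using bV[OF that(2)] aP[OF that(1)] that(3) by simp
    qed (use that in \<open>auto simp: compose_def\<close>)
    finally show ?thesis .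
  qed
  have sumH: "(\<Oplus>\<^bsub>?H\<^esub>j\<in>{..<m}. a j \<odot>\<^bsub>?H\<^esub> b j) \<in> mhom A (P i) V"
    if "a \<in> {..<m} \<rightarrow> mhom A (P i) (P i)" "b \<in> {..<m} \<rightarrow> mhom A (P i) V" for a b
  proof -
    interpret H: abelian_group ?H by (rule abelian_group_mhom[OF Pi V])
    have "(\<Oplus>\<^bsub>?H\<^esub>j\<in>{..<m}. a j \<odot>\<^bsub>?H\<^esub> b j) \<in> carrier ?H"
      using comp that by (intro H.finsum_closed) auto
    then show ?thesis by simp
  qed
  { assume "\<exists>b. is_basis ?F ?H m b"
    then obtain b where b: "b \<in> {..<m} \<rightarrow> mhom A (P i) V"
      and ex: "\<And>u. u \<in> mhom A (P i) V \<Longrightarrow> \<exists>!a. a \<in> {..<m} \<rightarrow>\<^sub>E mhom A (P i) (P i) \<and>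
        u = (\<Oplus>\<^bsub>?H\<^esub>j\<in>{..<m}. a j \<odot>\<^bsub>?H\<^esub> b j)"
      unfolding is_basis_def F by auto
    define t where "t y = (\<Oplus>\<^bsub>V\<^esub>j\<in>{..<m}. b j (y j))" for y
    have t: "module_map A (copies i m) V t"
      unfolding t_def using b by (intro module_map_ds_out V) (auto intro: mhom_module_map)
    have "lifts (P i) (copies i m) V t" unfolding lifts_def
    proof (intro allI impI)
      fix u assume u: "module_map A (P i) V u"
      obtain a where a: "a \<in> {..<m} \<rightarrow>\<^sub>E mhom A (P i) (P i)"
        "restrict u (carrier (P i)) = (\<Oplus>\<^bsub>?H\<^esub>j\<in>{..<m}. a j \<odot>\<^bsub>?H\<^esub> b j)"
        using ex[OF mhom_restrict[OF Pi u]] by blast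
      let ?v = "\<lambda>x. \<lambda>j\<in>{..<m}. a j x"
      have v: "module_map A (P i) (copies i m) ?v"
        using a(1) by (intro module_map_ds_map) (auto intro: mhom_module_map)
      have "t (?v x) = u x" if x: "x \<in> carrier (P i)" for x
      proof -
        have aF: "a \<in> {..<m} \<rightarrow> mhom A (P i) (P i)" using a(1) by auto
        have "t (?v x) = (\<Oplus>\<^bsub>V\<^esub>j\<in>{..<m}. b j (a j x))"
          unfolding t_def
        proof (rule VV.finsum_cong')
          show "(\<lambda>j. b j (a j x)) \<in> {..<m} \<rightarrow> carrier V"
            using bV[OF b] aP[OF aF] x by simp
        qed auto
        also have "\<dots> = u x" using eval[OF aF b x] a(2) x by (metis restrict_apply')
        finally show ?thesis .
      qed
      then show "\<exists>v. module_map A (P i) (copies i m) v \<and> (\<forall>x\<in>carrier (P i). t (v x) = u x)" using v by blast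
    qed
    moreover have "monic_for (P i) (copies i m) V t" unfolding monic_for_def
    proof (intro allI impI ballI)
      fix v x assume v: "module_map A (P i) (copies i m) v" and z: "\<forall>x\<in>carrier (P i). t (v x) = \<zero>\<^bsub>V\<^esub>"
        and x: "x \<in> carrier (P i)"
      define a where "a = (\<lambda>j\<in>{..<m}. restrict (\<lambda>x. v x j) (carrier (P i)))"
      define a' where "a' = (\<lambda>j\<in>{..<m}. restrict (\<lambda>x. \<zero>\<^bsub>P i\<^esub>) (carrier (P i)))"
      have vj: "module_map A (P i) (P i) (\<lambda>x. v x j)" if "j < m" for j
        using module_map_compose[OF v module_map_ds_proj[where M = "\<lambda>_. P i"]] that by simp
      have aE: "a \<in> {..<m} \<rightarrow>\<^sub>E mhom A (P i) (P i)"
        using mhom_restrict[OF Pi vj] unfolding a_def by auto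
      have aE': "a' \<in> {..<m} \<rightarrow>\<^sub>E mhom A (P i) (P i)"
        using mhom_restrict[OF Pi module_map_zero_map[OF Pi]] unfolding a'_def by auto
      have aF: "a \<in> {..<m} \<rightarrow> mhom A (P i) (P i)" and aF': "a' \<in> {..<m} \<rightarrow> mhom A (P i) (P i)"
        using aE aE' by auto
      have bc: "b j y \<in> carrier V" if "j < m" "y \<in> carrier (P i)" for j y
        using bV[OF b] that by simp
      have b0: "b j \<zero>\<^bsub>P i\<^esub> = \<zero>\<^bsub>V\<^esub>" if "j < m" for j
      proof -
        have "b j \<in> mhom A (P i) V" using b that by auto
        from module_map_zero[OF Pi V mhom_module_map[OF this]] show ?thesis .
      qed
      have "(\<Oplus>\<^bsub>?H\<^esub>j\<in>{..<m}. a j \<odot>\<^bsub>?H\<^esub> b j) = (\<Oplus>\<^bsub>?H\<^esub>j\<in>{..<m}. a' j \<odot>\<^bsub>?H\<^esub> b j)"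
      proof (rule mhom_eqI[OF sumH[OF aF b] sumH[OF aF' b]])
        fix y assume y: "y \<in> carrier (P i)"
        have "(\<Oplus>\<^bsub>V\<^esub>j\<in>{..<m}. b j (a j y)) = t (v y)"
          unfolding t_def using y module_map_closed[OF vj y]
          by (intro VV.finsum_cong') (auto simp: a_def bc)
        moreover have "(\<Oplus>\<^bsub>V\<^esub>j\<in>{..<m}. b j (a' j y)) = (\<Oplus>\<^bsub>V\<^esub>j\<in>{..<m}. \<zero>\<^bsub>V\<^esub>)"
          using y by (intro VV.finsum_cong') (auto simp: a'_def b0)
        ultimately show "(\<Oplus>\<^bsub>?H\<^esub>j\<in>{..<m}. a j \<odot>\<^bsub>?H\<^esub> b j) y = (\<Oplus>\<^bsub>?H\<^esub>j\<in>{..<m}. a' j \<odot>\<^bsub>?H\<^esub> b j) y"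
          unfolding eval[OF aF b y] eval[OF aF' b y] using z y by simp
      qed
      then have aa: "a = a'" using ex[OF sumH[OF aF b]] aE aE' by blast
      have "v x j = \<zero>\<^bsub>P i\<^esub>" if "j < m" for j
        using fun_cong[OF fun_cong[OF aa, of j], of x] that x by (simp add: a_def a'_def)
      then show "v x = \<zero>\<^bsub>copies i m\<^esub>"
        using module_map_closed[OF v x] by (auto simp: PiE_iff extensional_def fun_eq_iff)
    qed
    ultimately show "\<exists>t. frame i (copies i m) V t" using t unfolding frame_def by blast }
  assume "\<exists>t. frame i (copies i m) V t"
  then obtain t where t: "module_map A (copies i m) V t" "lifts (P i) (copies i m) V t"
    "monic_for (P i) (copies i m) V t" unfolding frame_def by blast
  note Q = right_module_copies[OF i, of m]
  interpret QQ: right_module A "copies i m" by (rule Q)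
  let ?\<iota> = "ds_inj {..<m} (\<lambda>_. P i)"
  have \<iota>: "module_map A (P i) (copies i m) (?\<iota> j)" if "j < m" for j
    using module_map_ds_inj[where I = "{..<m}" and M = "\<lambda>_. P i", OF Pi, of j] that by simp
  define b where "b j = restrict (\<lambda>x. t (?\<iota> j x)) (carrier (P i))" for j
  have b: "b \<in> {..<m} \<rightarrow> mhom A (P i) V"
    unfolding b_def using mhom_restrict[OF Pi module_map_compose[OF \<iota> t(1)]] by auto
  have tv: "(\<Oplus>\<^bsub>V\<^esub>j\<in>{..<m}. b j (y j)) = t y" if y: "y \<in> carrier (copies i m)" for y
  proof -
    have yj: "y j \<in> carrier (P i)" if "j < m" for j using y that by auto
    have "(\<Oplus>\<^bsub>V\<^esub>j\<in>{..<m}. b j (y j)) = (\<Oplus>\<^bsub>V\<^esub>j\<in>{..<m}. t (?\<iota> j (y j)))"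
      using yj module_map_closed[OF t(1) module_map_closed[OF \<iota> yj]]
        by (intro VV.finsum_cong') (auto simp: b_def)
    also have "\<dots> = t y"
      using ds_out_eq[where I = "{..<m}" and X = "\<lambda>_. P i", OF _ Pi V t(1) y] by simp
    finally show ?thesis .
  qed
  have rep: "(\<Oplus>\<^bsub>?H\<^esub>j\<in>{..<m}. a j \<odot>\<^bsub>?H\<^esub> b j) x = t (\<lambda>j\<in>{..<m}. a j x)"
    if a: "a \<in> {..<m} \<rightarrow> mhom A (P i) (P i)" and x: "x \<in> carrier (P i)" for a x
  proof -
    have ax: "(\<lambda>j\<in>{..<m}. a j x) \<in> carrier (copies i m)"
      using aP[OF a] x by auto
    have "(\<Oplus>\<^bsub>V\<^esub>j\<in>{..<m}. b j (a j x)) = (\<Oplus>\<^bsub>V\<^esub>j\<in>{..<m}. b j ((\<lambda>j\<in>{..<m}. a j x) j))"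
      using bV[OF b] aP[OF a] x by (intro VV.finsum_cong') auto
    then show ?thesis using eval[OF a b x] tv[OF ax] by simp
  qed
  have "is_basis ?F ?H m b" unfolding is_basis_def F
  proof (intro conjI ballI)
    show "b \<in> {..<m} \<rightarrow> carrier ?H" using b by simp
    fix u assume "u \<in> carrier ?H"
    then have u: "u \<in> mhom A (P i) V" by simp
    obtain v where v: "module_map A (P i) (copies i m) v" "\<forall>x\<in>carrier (P i). t (v x) = u x"
      using t(2) mhom_module_map[OF u] unfolding lifts_def by blast
    have vj: "module_map A (P i) (P i) (\<lambda>x. v x j)" if "j < m" for j
      using module_map_compose[OF v(1) module_map_ds_proj[where M = "\<lambda>_. P i"]] that by simp
    define a where "a = (\<lambda>j\<in>{..<m}. restrict (\<lambda>x. v x j) (carrier (P i)))"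
    have aE: "a \<in> {..<m} \<rightarrow>\<^sub>E mhom A (P i) (P i)"
      using mhom_restrict[OF Pi vj] unfolding a_def by auto
    then have aF: "a \<in> {..<m} \<rightarrow> mhom A (P i) (P i)" by auto
    have av: "(\<lambda>j\<in>{..<m}. a j x) = v x" if "x \<in> carrier (P i)" for x
      using module_map_closed[OF v(1) that] that by (auto simp: a_def PiE_iff extensional_def fun_eq_iff)
    show "\<exists>!a. a \<in> {..<m} \<rightarrow>\<^sub>E mhom A (P i) (P i) \<and> u = (\<Oplus>\<^bsub>?H\<^esub>j\<in>{..<m}. a j \<odot>\<^bsub>?H\<^esub> b j)"
    proof (intro ex1I[of _ a] conjI aE)
      show "u = (\<Oplus>\<^bsub>?H\<^esub>j\<in>{..<m}. a j \<odot>\<^bsub>?H\<^esub> b j)"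
        using rep[OF aF] av v(2) by (intro mhom_eqI[OF u sumH[OF aF b]]) auto
    next
      fix a' assume a': "a' \<in> {..<m} \<rightarrow>\<^sub>E mhom A (P i) (P i) \<and> u = (\<Oplus>\<^bsub>?H\<^esub>j\<in>{..<m}. a' j \<odot>\<^bsub>?H\<^esub> b j)"
      then have aF': "a' \<in> {..<m} \<rightarrow> mhom A (P i) (P i)" by auto
      let ?v' = "\<lambda>x. \<lambda>j\<in>{..<m}. a' j x"
      have v': "module_map A (P i) (copies i m) ?v'"
        using aF' by (intro module_map_ds_map) (auto intro: mhom_module_map)
      let ?d = "\<lambda>x. ?v' x \<ominus>\<^bsub>copies i m\<^esub> v x"
      have d: "module_map A (P i) (copies i m) ?d" by (rule module_map_minus_map[OF Q v' v(1)])
      have td: "\<forall>x\<in>carrier (P i). t (?d x) = \<zero>\<^bsub>V\<^esub>"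
      proof
        fix x assume x: "x \<in> carrier (P i)"
        have "t (?d x) = t (?v' x) \<ominus>\<^bsub>V\<^esub> t (v x)"
          by (rule module_map_minus[OF Q V t(1) module_map_closed[OF v' x] module_map_closed[OF v(1) x]])
        also have "t (?v' x) = u x" using rep[OF aF' x] a' by metis
        also have "t (v x) = u x" using v(2) x by blast
        also have "u x \<ominus>\<^bsub>V\<^esub> u x = \<zero>\<^bsub>V\<^esub>"
          using VV.minus_zero_iff module_map_closed[OF mhom_module_map[OF u] x] by blast
        finally show "t (?d x) = \<zero>\<^bsub>V\<^esub>" .
      qed
      have vv: "?v' x = v x" if x: "x \<in> carrier (P i)" for x
      proof -
        have "?d x = \<zero>\<^bsub>copies i m\<^esub>" using t(3) d td x unfolding monic_for_def by blast
        then show ?thesis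
          using QQ.minus_zero_iff[OF module_map_closed[OF v' x] module_map_closed[OF v(1) x]] by blast
      qed
      have "a' j = a j" if "j < m" for j
      proof (rule mhom_eqI[of _ "P i" "P i"])
        show "a' j \<in> mhom A (P i) (P i)" "a j \<in> mhom A (P i) (P i)" using aF aF' that by auto
        fix x assume x: "x \<in> carrier (P i)"
        show "a' j x = a j x" using fun_cong[OF vv[OF x], of j] that x by (simp add: a_def)
      qed
      then show "a' = a" using a' aE by (intro PiE_ext[of a' "{..<m}" "\<lambda>_. mhom A (P i) (P i)" a]) auto
    qed
  qed
  then show "\<exists>b. is_basis ?F ?H m b" by blast
qed

lemma dim_vector_frame:
  assumes i: "i < n" and V: "right_module A V"
  shows "frame i (copies i m) V t \<Longrightarrow> dim_vector A P V i = m"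
  unfolding dim_vector_def dimension_def basis_iff_frame[OF assms]
  using frame_le[OF assms] by (intro the_equality) (blast intro: order_antisym)+

lemma frame_dim_vector:
  assumes i: "i < n" and V: "fd_module A V"
  shows "\<exists>t. frame i (copies i (dim_vector A P V i)) V t"
  using frame_exists[OF assms] dim_vector_frame[OF i fd_moduleD[OF V]] by blast

lemma frame_componentwise:
  assumes "\<And>j. j \<in> I \<Longrightarrow> frame i (Q j) (V j) (t j)"
  shows "frame i (dir_sum I Q) (dir_sum I V) (\<lambda>x. \<lambda>j\<in>I. t j (x j))"
  using assms unfolding frame_def
  by (intro conjI module_map_ds_componentwise lifts_componentwise monic_for_componentwise) auto

lemma frame_reindex:
  assumes i: "i < n" and Q: "right_module A Q" "right_module A Q'" and t: "frame i Q V t"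
    and \<rho>: "module_map A Q' Q \<rho>" "bij_betw \<rho> (carrier Q') (carrier Q)"
  shows "frame i Q' V (\<lambda>x. t (\<rho> x))"
proof -
  let ?g = "the_inv_into (carrier Q') \<rho>"
  have g: "module_map A Q Q' ?g" by (rule module_map_inverse[OF Q(2,1) \<rho>])
  have \<rho>g: "\<rho> (?g x) = x" if "x \<in> carrier Q" for x
    using f_the_inv_into_f_bij_betw[OF \<rho>(2)] that by simp
  have "lifts (P i) Q' V (\<lambda>x. t (\<rho> x))" unfolding lifts_def
  proof (intro allI impI)
    fix u assume "module_map A (P i) V u"
    then obtain v where v: "module_map A (P i) Q v" "\<forall>x\<in>carrier (P i). t (v x) = u x"
      using t unfolding frame_def lifts_def by blast
    then show "\<exists>v. module_map A (P i) Q' v \<and> (\<forall>x\<in>carrier (P i). t (\<rho> (v x)) = u x)"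
      using module_map_compose[OF v(1) g] \<rho>g module_map_closed[OF v(1)]
      by (intro exI[of _ "\<lambda>x. ?g (v x)"]) auto
  qed
  moreover have "monic_for (P i) Q' V (\<lambda>x. t (\<rho> x))" unfolding monic_for_def
  proof (intro allI impI ballI)
    fix v x assume v: "module_map A (P i) Q' v" "\<forall>x\<in>carrier (P i). t (\<rho> (v x)) = \<zero>\<^bsub>V\<^esub>"
        and x: "x \<in> carrier (P i)"
    have "\<rho> (v x) = \<zero>\<^bsub>Q\<^esub>"
      using t module_map_compose[OF v(1) \<rho>(1)] v(2) x unfolding frame_def monic_for_def by blast
    also have "\<dots> = \<rho> \<zero>\<^bsub>Q'\<^esub>" using module_map_zero[OF Q(2,1) \<rho>(1)] by simp
    finally show "v x = \<zero>\<^bsub>Q'\<^esub>"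
      using \<rho>(2) module_map_closed[OF v(1) x]
        abelian_monoid.zero_closed[OF abelian_group.axioms(1)[OF right_module.axioms(2)[OF Q(2)]]]
      by (meson bij_betw_def inj_onD)
  qed
  ultimately show ?thesis using t module_map_compose[OF \<rho>(1)] unfolding frame_def by blast
qed

text \<open>
  The componentwise sum of frames of the \<open>V\<^sub>l\<close> is a frame of the direct sum, up to a renumbering of the
  copies of \<open>P\<^sub>i\<close>.
\<close>

lemma frame_multiples:
  fixes V :: "nat \<Rightarrow> ('l, 'v) module"
  assumes i: "i < n" and V: "\<And>l. l < k \<Longrightarrow> fd_module A (V l)"
  shows "\<exists>t. frame i (copies i (\<Sum>l<k. c l * dim_vector A P (V l) i))
     (dir_sum {..<k} (\<lambda>l. dir_sum {..<c l} (\<lambda>_. V l))) t"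
proof -
  let ?b = "\<lambda>l. dim_vector A P (V l) i"
  let ?Q = "dir_sum {..<k} (\<lambda>l. dir_sum {..<c l} (\<lambda>_. copies i (?b l)))"
  let ?J = "SIGMA l:{..<k}. {..<c l} \<times> {..<?b l}"
  let ?m = "\<Sum>l<k. c l * ?b l"
  have "\<exists>t. frame i (copies i (?b l)) (V l) t" if "l < k" for l by (rule frame_dim_vector[OF i V[OF that]])
  then obtain t where "\<And>l. l < k \<Longrightarrow> frame i (copies i (?b l)) (V l) (t l)" by metis
  then have fr: "frame i ?Q (dir_sum {..<k} (\<lambda>l. dir_sum {..<c l} (\<lambda>_. V l)))
      (\<lambda>x. \<lambda>l\<in>{..<k}. \<lambda>a\<in>{..<c l}. t l (x l a))"
    by (intro frame_componentwise) auto
  have "card ?J = ?m" by (simp add: card_cartesian_product)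
  then obtain e where e: "bij_betw e {..<?m} ?J"
    using ex_bij_betw_nat_finite[of ?J] by (auto simp: atLeast0LessThan)
  let ?e' = "the_inv_into {..<?m} e"
  have e': "?e' p < ?m" "e (?e' p) = p" if "p \<in> ?J" for p
    using bij_betw_the_inv_into[OF e] that f_the_inv_into_f_bij_betw[OF e] by (auto simp: bij_betw_def)
  have ee: "?e' (e s) = s" "e s \<in> ?J" if "s < ?m" for s
    using e that by (auto simp: bij_betw_def the_inv_into_f_f)
  let ?\<rho> = "\<lambda>y. \<lambda>l\<in>{..<k}. \<lambda>a\<in>{..<c l}. \<lambda>b\<in>{..<?b l}. y (?e' (l, a, b))"
  let ?\<rho>' = "\<lambda>z. \<lambda>s\<in>{..<?m}. z (fst (e s)) (fst (snd (e s))) (snd (snd (e s)))"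
  have Q: "right_module A ?Q" by (intro right_module_dir_sum right_module_copies i)
  have \<rho>: "module_map A (copies i ?m) ?Q ?\<rho>"
    using e'(1) by (intro module_map_ds_map module_map_ds_proj[where M = "\<lambda>_. P i"]) auto
  have "bij_betw ?\<rho> (carrier (copies i ?m)) (carrier ?Q)"
  proof (rule bij_betw_byWitness[where f' = ?\<rho>'])
    show "\<forall>y\<in>carrier (copies i ?m). ?\<rho>' (?\<rho> y) = y"
    proof (intro ballI ext)
      fix y s assume y: "y \<in> carrier (copies i ?m)"
      show "?\<rho>' (?\<rho> y) s = y s"
      proof (cases "s < ?m")
        case True
        obtain l a b where lab: "e s = (l, a, b)" by (metis prod.exhaust)
        then show ?thesis using ee[OF True] True by auto
      next
        case False
        then show ?thesis using y by (auto simp: PiE_iff extensional_def)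
      qed
    qed
    show "\<forall>z\<in>carrier ?Q. ?\<rho> (?\<rho>' z) = z"
    proof
      fix z assume z: "z \<in> carrier ?Q"
      have zl: "z l \<in> (\<Pi>\<^sub>E a\<in>{..<c l}. carrier (copies i (?b l)))" if "l < k" for l using z that by auto
      have za: "z l a \<in> (\<Pi>\<^sub>E b\<in>{..<?b l}. carrier (P i))" if "l < k" "a < c l" for l a
        using zl[OF that(1)] that by auto
      have "z (fst (e (?e' (l, a, b)))) (fst (snd (e (?e' (l, a, b))))) (snd (snd (e (?e' (l, a, b)))))
          = z l a b"
        if "l < k" "a < c l" "b < ?b l" for l a b
        using that e'(2)[of "(l, a, b)"] by simp
      then have "?\<rho> (?\<rho>' z) = (\<lambda>l\<in>{..<k}. \<lambda>a\<in>{..<c l}. \<lambda>b\<in>{..<?b l}. z l a b)"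
        using e'(1) by (intro restrict_ext) simp
      also have "\<dots> = (\<lambda>l\<in>{..<k}. \<lambda>a\<in>{..<c l}. z l a)"
        using za by (intro restrict_ext) (simp add: PiE_iff extensional_restrict)
      also have "\<dots> = (\<lambda>l\<in>{..<k}. z l)"
        using zl by (intro restrict_ext) (simp add: PiE_iff extensional_restrict)
      also have "\<dots> = z" using z by (simp add: PiE_iff extensional_restrict)
      finally show "?\<rho> (?\<rho>' z) = z" .
    qed
    show "?\<rho> ` carrier (copies i ?m) \<subseteq> carrier ?Q" using module_map_closed[OF \<rho>] by blast
    show "?\<rho>' ` carrier ?Q \<subseteq> carrier (copies i ?m)"
    proof (intro image_subsetI)
      fix z assume z: "z \<in> carrier ?Q"
      have "z (fst (e s)) (fst (snd (e s))) (snd (snd (e s))) \<in> carrier (P i)" if s: "s < ?m" for s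
      proof -
        obtain l a b where lab: "e s = (l, a, b)" by (metis prod.exhaust)
        then have "l < k" "a < c l" "b < ?b l" using ee(2)[OF s] by auto
        then show ?thesis using z lab by (fastforce simp: PiE_iff)
      qed
      then show "?\<rho>' z \<in> carrier (copies i ?m)" by auto
    qed
  qed
  from frame_reindex[OF i Q right_module_copies[OF i] fr \<rho> this] show ?thesis by blast
qed

end

lemma (in abelian_group) add_minus_cancel:
  assumes "p \<in> carrier G" "u \<in> carrier G"
  shows "p \<oplus> (u \<ominus> p) = u"
  using assms a_lcomm[of p u "\<ominus> p"] by (simp add: a_minus_def r_neg)

lemma (in abelian_group) minus_minus_cancel:
  assumes "g \<in> carrier G" "x \<in> carrier G"
  shows "g \<ominus> (g \<ominus> x) = x"
  using assms by (simp add: a_minus_def minus_add r_neg2)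

lemma (in abelian_group) exchange_summand:
  assumes "p \<in> carrier G" "g \<in> carrier G" "b \<in> carrier G" "w \<in> carrier G"
  shows "((p \<oplus> g) \<ominus> b) \<ominus> (g \<ominus> w) = (p \<oplus> w) \<ominus> b"
proof -
  have "((p \<oplus> g) \<ominus> b) \<ominus> (g \<ominus> w) = (p \<oplus> w \<oplus> \<ominus> b) \<oplus> (g \<oplus> \<ominus> g)"
    using assms by (simp add: a_minus_def minus_add a_ac del: r_neg)
  then show ?thesis using assms by (simp add: a_minus_def r_neg)
qed

section \<open>Radicals of direct sums\<close>

context fd_algebra
begin

lemma submodule_radical:
  assumes M: "right_module A M"
  shows "Module.submodule (radical A M) A M"
proof -
  interpret M: right_module A M by (rule M)
  show ?thesis
    unfolding M.submodule_iff radical_def maximal_submodule_def by auto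
qed

text \<open>The preimage of a maximal submodule is maximal or everything.\<close>

lemma radical_hom:
  assumes M: "right_module A M" and N: "right_module A N" and h: "module_map A M N h"
      and x: "x \<in> radical A M"
  shows "h x \<in> radical A N"
  unfolding radical_def
proof (intro CollectI conjI allI impI)
  interpret M: right_module A M by (rule M)
  interpret N: right_module A N by (rule N)
  have xM: "x \<in> carrier M" using x by (simp add: radical_def)
  then show "h x \<in> carrier N" by (rule module_map_closed[OF h])
  fix U assume U: "maximal_submodule A N U"
  then have US: "Module.submodule U A N" by (simp add: maximal_submodule_def)
  let ?K = "{x \<in> carrier M. h x \<in> U}"
  have K: "Module.submodule ?K A M" by (rule submodule_preimage[OF M N h US])
  show "h x \<in> U"
  proof (cases "?K = carrier M")
    case True
    then show ?thesis using xM by blast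
  next
    case False
    have "W = ?K \<or> W = carrier M" if W: "Module.submodule W A M" "?K \<subseteq> W" for W
    proof -
      note Wi = W(1)[unfolded M.submodule_iff] and Ui = US[unfolded N.submodule_iff]
      let ?T = "{h w \<oplus>\<^bsub>N\<^esub> u |w u. w \<in> W \<and> u \<in> U}"
      have hc: "h w \<in> carrier N" if "w \<in> W" for w using that Wi module_map_closed[OF h] by blast
      have uc: "u \<in> carrier N" if "u \<in> U" for u using that Ui by blast
      have "Module.submodule ?T A N" unfolding N.submodule_iff
      proof (intro conjI ballI)
        show "?T \<subseteq> carrier N" using hc uc by auto
        have "h \<zero>\<^bsub>M\<^esub> \<oplus>\<^bsub>N\<^esub> \<zero>\<^bsub>N\<^esub> \<in> ?T" using Wi Ui by blast
        then show "\<zero>\<^bsub>N\<^esub> \<in> ?T" using module_map_zero[OF M N h] by simp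
        fix y z assume "y \<in> ?T" "z \<in> ?T"
        then obtain w u w' u' where *: "w \<in> W" "u \<in> U" "y = h w \<oplus>\<^bsub>N\<^esub> u" "w' \<in> W" "u' \<in> U" "z = h w' \<oplus>\<^bsub>N\<^esub> u'"
          by blast
        then have "y \<oplus>\<^bsub>N\<^esub> z = h (w \<oplus>\<^bsub>M\<^esub> w') \<oplus>\<^bsub>N\<^esub> (u \<oplus>\<^bsub>N\<^esub> u')"
          using hc uc module_map_add[OF h] Wi by (simp add: subset_iff N.a_ac)
        then show "y \<oplus>\<^bsub>N\<^esub> z \<in> ?T" using * Wi Ui by blast
      next
        fix r y assume r: "r \<in> carrier A" and "y \<in> ?T"
        then obtain w u where *: "w \<in> W" "u \<in> U" "y = h w \<oplus>\<^bsub>N\<^esub> u" by blast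
        then have "r \<odot>\<^bsub>N\<^esub> y = h (r \<odot>\<^bsub>M\<^esub> w) \<oplus>\<^bsub>N\<^esub> r \<odot>\<^bsub>N\<^esub> u"
          using hc uc module_map_smult[OF h] Wi r by (simp add: subset_iff N.smult_r_distr)
        then show "r \<odot>\<^bsub>N\<^esub> y \<in> ?T" using * Wi Ui r by blast
      qed
      moreover have "U \<subseteq> ?T"
      proof
        fix u assume u: "u \<in> U"
        have "u = h \<zero>\<^bsub>M\<^esub> \<oplus>\<^bsub>N\<^esub> u" using module_map_zero[OF M N h] uc[OF u] by simp
        then show "u \<in> ?T" using u Wi by blast
      qed
      ultimately have "?T = U \<or> ?T = carrier N" using U unfolding maximal_submodule_def by blast
      then show ?thesis
      proof
        assume T: "?T = U"
        have "w \<in> ?K" if w: "w \<in> W" for w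
        proof -
          have "h w \<oplus>\<^bsub>N\<^esub> \<zero>\<^bsub>N\<^esub> \<in> ?T" using w Ui by blast
          then have "h w \<in> ?T" using hc[OF w] by simp
          then show ?thesis unfolding T using w Wi by blast
        qed
        then show ?thesis using W(2) by blast
      next
        assume T: "?T = carrier N"
        have "m \<in> W" if m: "m \<in> carrier M" for m
        proof -
          have "h m \<in> ?T" unfolding T by (rule module_map_closed[OF h m])
          then obtain w u where wu: "w \<in> W" "u \<in> U" "h m = h w \<oplus>\<^bsub>N\<^esub> u" by blast
          have wM: "w \<in> carrier M" using wu(1) Wi by blast
          have "h (m \<ominus>\<^bsub>M\<^esub> w) = u"
            using module_map_minus[OF M N h m wM] wu(3) hc[OF wu(1)] uc[OF wu(2)]
            by (simp add: a_minus_def N.a_ac N.r_neg)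
          then have "m \<ominus>\<^bsub>M\<^esub> w \<in> ?K" using m wM wu(2) by simp
          then have "(m \<ominus>\<^bsub>M\<^esub> w) \<oplus>\<^bsub>M\<^esub> w \<in> W" using W(2) wu(1) Wi by blast
          then show ?thesis using m wM by (simp add: a_minus_def M.a_assoc M.l_neg)
        qed
        then show ?thesis using Wi by blast
      qed
    qed
    then have "maximal_submodule A M ?K" using K False unfolding maximal_submodule_def by blast
    then show ?thesis using x unfolding radical_def by blast
  qed
qed

lemma radical_dir_sum:
  assumes M: "\<And>i. i \<in> I \<Longrightarrow> right_module A (M i)" and fin: "finite I"
  shows "radical A (dir_sum I M) = {x \<in> carrier (dir_sum I M). \<forall>i\<in>I. x i \<in> radical A (M i)}"
proof (intro subset_antisym subsetI)
  fix x assume "x \<in> radical A (dir_sum I M)"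
  then show "x \<in> {x \<in> carrier (dir_sum I M). \<forall>i\<in>I. x i \<in> radical A (M i)}"
    using radical_hom[OF right_module_dir_sum[where M = M, OF M] M module_map_ds_proj[where M = M]]
    by (simp add: radical_def)
next
  fix x assume x: "x \<in> {x \<in> carrier (dir_sum I M). \<forall>i\<in>I. x i \<in> radical A (M i)}"
  show "x \<in> radical A (dir_sum I M)"
  proof (rule ds_inj_generate[where M = M, OF M fin submodule_radical[OF right_module_dir_sum[where M = M,
      OF M]]])
    fix i y assume "i \<in> I" "y = x i"
    then show "ds_inj I M i y \<in> radical A (dir_sum I M)"
      using radical_hom[OF M right_module_dir_sum[where M = M, OF M] module_map_ds_inj[where M = M, OF M]] x
        by blast
  qed (use x in auto)
qed

end

section \<open>The representation space\<close>

locale representation_space = projective_covers A n S P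
  for A :: "('k::field, 'l) module" (structure) and n :: nat
    and S :: "nat \<Rightarrow> ('l, 's) module" and P :: "nat \<Rightarrow> ('l, 'p) module" +
  fixes d :: "nat \<Rightarrow> nat \<Rightarrow> nat" and \<phi> :: "nat \<Rightarrow> (nat \<Rightarrow> nat \<Rightarrow> 'p) \<Rightarrow> 'p" and \<alpha> :: "nat \<Rightarrow> nat"
  assumes phi: "\<And>j. j < n \<Longrightarrow> \<phi> j \<in> mhom A (proj_sum n P (d j)) (rad_module A (P j))"
    and phi_bij: "\<And>j. j < n \<Longrightarrow> bij_betw (\<phi> j) (carrier (proj_sum n P (d j))) (radical A (P j))"
begin

abbreviation "PA \<equiv> proj_sum n P \<alpha>"
abbreviation "RA \<equiv> radical A PA"
abbreviation "RM \<equiv> rad_module A PA"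
abbreviation "\<Phi> \<equiv> phi_sum n d P \<phi> \<alpha>"
abbreviation "SRC \<equiv> src n d P \<alpha>"

definition block_index :: "nat \<Rightarrow> (nat \<times> nat \<times> nat) set" where
  "block_index i = {(j, a, b). j < n \<and> a < \<alpha> j \<and> b < d j i}"

abbreviation "SB i \<equiv> dir_sum (block_index i) (\<lambda>_. P i)"

lemma src_eq: "SRC = dir_sum {..<n} SB"
  by (simp add: src_def src_block_def[abs_def] block_index_def)

lemma finite_block_index: "finite (block_index i)"
proof (rule finite_subset)
  show "block_index i \<subseteq> (SIGMA j:{..<n}. {..<\<alpha> j} \<times> {..<d j i})" by (auto simp: block_index_def)
qed auto

lemma PA_eq: "proj_sum n P \<beta> = dir_sum {..<n} (\<lambda>i. copies i (\<beta> i))"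
  by (simp add: proj_sum_def)

lemma right_module_PA: "right_module A (proj_sum n P \<beta>)"
  unfolding PA_eq by (intro right_module_dir_sum right_module_P) auto

lemma fd_module_PA: "fd_module A (proj_sum n P \<beta>)"
  unfolding PA_eq by (intro fd_module_dir_sum fd_P) auto

lemma right_module_SB: "i < n \<Longrightarrow> right_module A (SB i)"
  by (intro right_module_dir_sum right_module_P)

lemma right_module_SRC: "right_module A SRC"
  unfolding src_eq by (intro right_module_dir_sum right_module_P) auto

lemma PA_carrier:
  "x \<in> carrier (proj_sum n P \<beta>) \<longleftrightarrow> x \<in> (\<Pi>\<^sub>E i\<in>{..<n}. \<Pi>\<^sub>E a\<in>{..<\<beta> i}. carrier (P i))"
  unfolding PA_eq by simp

lemma PA_eqI:
  assumes "x \<in> carrier (proj_sum n P \<beta>)" "y \<in> carrier (proj_sum n P \<beta>)"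
    "\<And>i a. i < n \<Longrightarrow> a < \<beta> i \<Longrightarrow> x i a = y i a"
  shows "x = y"
proof (rule PiE_ext[of _ "{..<n}" "\<lambda>i. \<Pi>\<^sub>E a\<in>{..<\<beta> i}. carrier (P i)"])
  fix i assume i: "i \<in> {..<n}"
  show "x i = y i"
    using assms i unfolding PA_carrier
    by (intro PiE_ext[of _ "{..<\<beta> i}" "\<lambda>_. carrier (P i)"]) auto
qed (use assms in \<open>auto simp: PA_carrier\<close>)

lemma PA_zero: "\<zero>\<^bsub>proj_sum n P \<beta>\<^esub> = (\<lambda>i\<in>{..<n}. \<lambda>a\<in>{..<\<beta> i}. \<zero>\<^bsub>P i\<^esub>)"
  unfolding PA_eq by simp

lemma RA_iff: "x \<in> RA \<longleftrightarrow> x \<in> carrier PA \<and> (\<forall>i<n. \<forall>a<\<alpha> i. x i a \<in> radical A (P i))"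
proof -
  have "radical A (copies i (\<alpha> i)) = {y \<in> carrier (copies i (\<alpha> i)). \<forall>a\<in>{..<\<alpha> i}. y a \<in> radical A (P i)}"
    if "i < n" for i by (rule radical_dir_sum) (auto intro: right_module_P[OF that])
  moreover have "radical A PA = {x \<in> carrier PA. \<forall>i\<in>{..<n}. x i \<in> radical A (copies i (\<alpha> i))}"
    unfolding PA_eq by (rule radical_dir_sum) (auto intro: right_module_copies)
  ultimately show ?thesis by (auto simp: PA_carrier)
qed

lemma RM_simps [simp]:
  "carrier RM = RA" "\<zero>\<^bsub>RM\<^esub> = \<zero>\<^bsub>PA\<^esub>" "add RM = add PA" "smult RM = smult PA"
  by (simp_all add: rad_module_def)

lemma right_module_RM: "right_module A RM"
  unfolding rad_module_def
    by (rule right_module_submodule[OF right_module_PA submodule_radical[OF right_module_PA]])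

lemma fd_module_RM: "fd_module A RM"
  unfolding rad_module_def
    by (rule fd_module_submodule[OF fd_module_PA submodule_radical[OF right_module_PA]])

lemma module_map_incl: "module_map A RM PA (\<lambda>x. x)"
  unfolding rad_module_def by (rule module_map_restrict[OF module_map_id]) (auto simp: radical_def)

lemma RA_subset: "RA \<subseteq> carrier PA"
  by (auto simp: radical_def)

lemma phi_hom: "j < n \<Longrightarrow> module_map A (proj_sum n P (d j)) (P j) (\<phi> j)"
  by (rule module_map_from_submodule[OF mhom_module_map[OF phi, unfolded rad_module_def]])
    (auto simp: radical_def)

text \<open>
  \<open>\<phi>\<^sub>j\<close> embeds every \<open>P\<^sub>i\<close> that occurs in the radical of \<open>P\<^sub>j\<close> as a proper submodule, so that the arrows
  \<open>j \<rightarrow> i\<close> decrease the dimension.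
\<close>

lemma arrow_decreases:
  assumes j: "j < n" and i: "i < n" and d: "d j i > 0"
  shows "mdim (P i) < mdim (P j)"
proof -
  let ?e = "\<lambda>y. ds_inj {..<n} (\<lambda>i. copies i (d j i)) i (ds_inj {..<d j i} (\<lambda>_. P i) 0 y)"
  have e: "module_map A (P i) (proj_sum n P (d j)) ?e"
  proof -
    have h1: "module_map A (P i) (copies i (d j i)) (ds_inj {..<d j i} (\<lambda>_. P i) 0)"
      by (rule module_map_ds_inj[where M = "\<lambda>_. P i"]) (use d i in \<open>auto intro: right_module_P\<close>)
    have h2: "module_map A (copies i (d j i)) (proj_sum n P (d j)) (ds_inj {..<n} (\<lambda>i. copies i (d j i)) i)"
      unfolding PA_eq by (rule module_map_ds_inj[where M = "\<lambda>i. copies i (d j i)"])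
        (use i in \<open>auto intro: right_module_copies\<close>)
    show ?thesis by (rule module_map_compose[OF h1 h2])
  qed
  have inje: "inj_on ?e (carrier (P i))"
  proof (rule inj_onI)
    fix x y assume "?e x = ?e y"
    from fun_cong[OF fun_cong[OF this, of i], of 0] show "x = y" using i d by (simp add: ds_inj_def)
  qed
  have h: "module_map A (P i) (P j) (\<lambda>y. \<phi> j (?e y))" by (rule module_map_compose[OF e phi_hom[OF j]])
  have inj: "inj_on (\<lambda>y. \<phi> j (?e y)) (carrier (P i))"
  proof (rule inj_onI)
    fix x y assume xy: "x \<in> carrier (P i)" "y \<in> carrier (P i)" "\<phi> j (?e x) = \<phi> j (?e y)"
    have "?e x = ?e y"
      using phi_bij[OF j] module_map_closed[OF e xy(1)] module_map_closed[OF e xy(2)] xy(3)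
      by (meson bij_betw_def inj_onD)
    then show "x = y" using inje xy by (meson inj_onD)
  qed
  have "(\<lambda>y. \<phi> j (?e y)) ` carrier (P i) \<subseteq> radical A (P j)"
    using phi_bij[OF j] module_map_closed[OF e] by (auto simp: bij_betw_def)
  moreover have "radical A (P j) \<subset> carrier (P j)"
    using radical_P_proper[OF j] by (auto simp: radical_def)
  ultimately have "(\<lambda>y. \<phi> j (?e y)) ` carrier (P i) \<noteq> carrier (P j)" by blast
  then show ?thesis by (rule mdim_less[OF fd_P[OF i] fd_P[OF j] h inj])
qed

text \<open>The part of an element of the source that \<open>\<Phi>\<close> maps to the \<open>a\<close>-th copy of \<open>P\<^sub>j\<close>.\<close>

definition arrow_part :: "nat \<Rightarrow> nat \<Rightarrow> (nat \<Rightarrow> nat \<times> nat \<times> nat \<Rightarrow> 'p) \<Rightarrow> nat \<Rightarrow> nat \<Rightarrow> 'p" where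
  "arrow_part j a x = (\<lambda>i\<in>{..<n}. \<lambda>b\<in>{..<d j i}. x i (j, a, b))"

lemma Phi_apply:
  "x \<in> carrier SRC \<Longrightarrow> \<Phi> x = (\<lambda>j\<in>{..<n}. \<lambda>a\<in>{..<\<alpha> j}. \<phi> j (arrow_part j a x))"
  by (simp add: phi_sum_def arrow_part_def)

lemma arrow_part_hom:
  assumes "j < n" "a < \<alpha> j"
  shows "module_map A SRC (proj_sum n P (d j)) (arrow_part j a)"
  unfolding PA_eq src_eq arrow_part_def[abs_def]
proof (intro module_map_ds_map)
  fix i b assume "i \<in> {..<n}" "b \<in> {..<d j i}"
  then have "module_map A (SB i) (P i) (\<lambda>y. y (j, a, b))" "i \<in> {..<n}"
    using assms by (auto intro!: module_map_ds_proj[where M = "\<lambda>_. P i"] simp: block_index_def)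
  then show "module_map A (dir_sum {..<n} SB) (P i) (\<lambda>x. x i (j, a, b))"
    using module_map_compose[OF module_map_ds_proj[where M = SB]] by blast
qed

lemma Phi_hom: "module_map A SRC RM \<Phi>"
proof -
  have "module_map A SRC PA (\<lambda>x. \<lambda>j\<in>{..<n}. \<lambda>a\<in>{..<\<alpha> j}. \<phi> j (arrow_part j a x))"
    unfolding PA_eq[of \<alpha>]
    by (intro module_map_ds_map module_map_compose[OF arrow_part_hom phi_hom]) auto
  then have h: "module_map A SRC PA \<Phi>"
    using right_module.smult_closed[OF right_module_SRC]
      abelian_monoid.a_closed[OF abelian_group.axioms(1)[OF right_module.axioms(2)[OF right_module_SRC]]]
    unfolding module_map_def by (simp add: Phi_apply Pi_iff)
  show ?thesis unfolding rad_module_def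
  proof (rule module_map_into[OF h], rule image_subsetI)
    fix x assume x: "x \<in> carrier SRC"
    have "\<phi> j (arrow_part j a x) \<in> radical A (P j)" if "j < n" "a < \<alpha> j" for j a
      using phi_bij[OF that(1)] module_map_closed[OF arrow_part_hom[OF that] x] by (auto simp: bij_betw_def)
    then show "\<Phi> x \<in> RA"
      unfolding RA_iff using module_map_closed[OF h x] x by (auto simp: Phi_apply)
  qed
qed

lemma SRC_eqI:
  assumes x: "x \<in> carrier SRC" and y: "y \<in> carrier SRC"
    and e: "\<And>i j a b. i < n \<Longrightarrow> j < n \<Longrightarrow> a < \<alpha> j \<Longrightarrow> b < d j i \<Longrightarrow> x i (j, a, b) = y i (j, a, b)"
  shows "x = y"
proof -
  have xs: "x \<in> (\<Pi>\<^sub>E i\<in>{..<n}. carrier (SB i))" and ys: "y \<in> (\<Pi>\<^sub>E i\<in>{..<n}. carrier (SB i))"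
    using x y unfolding src_eq by simp_all
  show ?thesis
  proof (rule PiE_ext[OF xs ys])
    fix i assume i: "i \<in> {..<n}"
    have xi: "x i \<in> (\<Pi>\<^sub>E p\<in>block_index i. carrier (P i))"
        and yi: "y i \<in> (\<Pi>\<^sub>E p\<in>block_index i. carrier (P i))"
      using xs ys i by auto
    show "x i = y i"
      by (rule PiE_ext[OF xi yi]) (use e i in \<open>auto simp: block_index_def\<close>)
  qed
qed

lemma arrow_part_eqI:
  assumes "x \<in> carrier SRC" "y \<in> carrier SRC"
    "\<And>j a. j < n \<Longrightarrow> a < \<alpha> j \<Longrightarrow> arrow_part j a x = arrow_part j a y"
  shows "x = y"
proof (rule SRC_eqI[OF assms(1,2)])
  fix i j a b assume ij: "i < n" "j < n" "a < \<alpha> j" "b < d j i"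
  from fun_cong[OF fun_cong[OF assms(3)[OF ij(2,3)], of i], of b] ij
  show "x i (j, a, b) = y i (j, a, b)" by (simp add: arrow_part_def)
qed

lemma Phi_bij: "bij_betw \<Phi> (carrier SRC) RA"
  unfolding bij_betw_def
proof (intro conjI subset_antisym)
  show "inj_on \<Phi> (carrier SRC)"
  proof (rule inj_onI, rule arrow_part_eqI)
    fix x y j a assume xy: "x \<in> carrier SRC" "y \<in> carrier SRC" "\<Phi> x = \<Phi> y" and ja: "j < n" "a < \<alpha> j"
    have "\<phi> j (arrow_part j a x) = \<phi> j (arrow_part j a y)"
      using fun_cong[OF fun_cong[OF xy(3), of j], of a] xy(1,2) ja by (simp add: Phi_apply)
    then show "arrow_part j a x = arrow_part j a y"
      using phi_bij[OF ja(1)] module_map_closed[OF arrow_part_hom[OF ja]] xy(1,2)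
        by (meson bij_betw_def inj_onD)
  qed
  show "\<Phi> ` carrier SRC \<subseteq> RA" using module_map_closed[OF Phi_hom] by auto
  show "RA \<subseteq> \<Phi> ` carrier SRC"
  proof
    fix z assume z: "z \<in> RA"
    let ?g = "\<lambda>j a. the_inv_into (carrier (proj_sum n P (d j))) (\<phi> j) (z j a)"
    have g: "?g j a \<in> carrier (proj_sum n P (d j))" "\<phi> j (?g j a) = z j a" if "j < n" "a < \<alpha> j" for j a
    proof -
      have zr: "z j a \<in> radical A (P j)" using z that by (simp add: RA_iff)
      then show "\<phi> j (?g j a) = z j a" by (rule f_the_inv_into_f_bij_betw[OF phi_bij[OF that(1)]])
      show "?g j a \<in> carrier (proj_sum n P (d j))"
        using bij_betw_the_inv_into[OF phi_bij[OF that(1)]] zr by (auto simp: bij_betw_def)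
    qed
    define x where "x = (\<lambda>i\<in>{..<n}. \<lambda>p\<in>block_index i. ?g (fst p) (fst (snd p)) i (snd (snd p)))"
    have x: "x \<in> carrier SRC"
      using g(1) unfolding src_eq x_def PA_carrier by (fastforce simp: block_index_def PiE_iff)
    have ap: "arrow_part j a x = ?g j a" if "j < n" "a < \<alpha> j" for j a
      by (rule PA_eqI[OF module_map_closed[OF arrow_part_hom[OF that] x] g(1)[OF that]])
        (use that in \<open>auto simp: arrow_part_def x_def block_index_def\<close>)
    have "\<Phi> x = z"
      by (rule PA_eqI) (use module_map_closed[OF Phi_hom x] RA_subset z ap g(2) x in \<open>auto simp: Phi_apply\<close>)
    then show "z \<in> \<Phi> ` carrier SRC" using x by blast
  qed
qed

abbreviation "RepA \<equiv> Rep A n d P \<phi> \<alpha>"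

text \<open>The blocks may be given by homomorphisms with arbitrary values outside the carriers.\<close>

lemma Rep_iff:
  "f \<in> RepA \<longleftrightarrow> f \<in> mhom A RM PA \<and>
     (\<exists>h. (\<forall>i<n. module_map A (SB i) (copies i (\<alpha> i)) (h i)) \<and>
       (\<forall>x\<in>carrier SRC. f (\<Phi> x) = (\<lambda>i\<in>{..<n}. h i (x i))))"
proof -
  have blk: "src_block n d P \<alpha> i = SB i" for i by (simp add: src_block_def block_index_def)
  have "compose (carrier SRC) f \<Phi> \<in> block_homs A n d P \<alpha> \<longleftrightarrow>
     (\<exists>h. (\<forall>i<n. module_map A (SB i) (copies i (\<alpha> i)) (h i)) \<and>
       (\<forall>x\<in>carrier SRC. f (\<Phi> x) = (\<lambda>i\<in>{..<n}. h i (x i))))" (is "?L \<longleftrightarrow> ?R")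
  proof
    assume ?L
    then obtain h where h: "\<forall>i<n. h i \<in> mhom A (SB i) (copies i (\<alpha> i))"
      "compose (carrier SRC) f \<Phi> = (\<lambda>x\<in>carrier SRC. \<lambda>i\<in>{..<n}. h i (x i))"
      unfolding block_homs_def blk by blast
    have "f (\<Phi> x) = (\<lambda>i\<in>{..<n}. h i (x i))" if "x \<in> carrier SRC" for x
      using fun_cong[OF h(2), of x] that by (simp add: compose_def)
    then show ?R using h(1) mhom_module_map by blast
  next
    assume ?R
    then obtain h where h: "\<forall>i<n. module_map A (SB i) (copies i (\<alpha> i)) (h i)"
      "\<forall>x\<in>carrier SRC. f (\<Phi> x) = (\<lambda>i\<in>{..<n}. h i (x i))" by blast
    let ?h = "\<lambda>i. restrict (h i) (carrier (SB i))"
    have "\<forall>i<n. ?h i \<in> mhom A (SB i) (copies i (\<alpha> i))"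
      using h(1) mhom_restrict[OF right_module_SB] by blast
    moreover have "compose (carrier SRC) f \<Phi> = (\<lambda>x\<in>carrier SRC. \<lambda>i\<in>{..<n}. ?h i (x i))"
      unfolding compose_def
    proof (rule restrict_ext)
      fix x assume x: "x \<in> carrier SRC"
      then have "x i \<in> carrier (SB i)" if "i < n" for i using that unfolding src_eq by auto
      then have e: "(\<lambda>i\<in>{..<n}. h i (x i)) = (\<lambda>i\<in>{..<n}. ?h i (x i))"
        by (intro restrict_ext) (simp only: restrict_apply' lessThan_iff)
      show "f (\<Phi> x) = (\<lambda>i\<in>{..<n}. ?h i (x i))"
        by (rule trans[OF h(2)[rule_format, OF x] e])
    qed
    ultimately show ?L
      unfolding block_homs_def blk mem_Collect_eq by (intro exI[of _ ?h] conjI)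
  qed
  then show ?thesis by (simp only: Rep_def mem_Collect_eq)
qed

lemma Rep_hom: "f \<in> RepA \<Longrightarrow> module_map A RM PA f"
  by (simp add: Rep_iff mhom_module_map)

text \<open>
  A block diagonal map sees of an element of the radical only what arrows into the vertex \<open>k\<close> carry
  there, and these start at vertices of larger dimension.
\<close>

lemma Rep_support:
  assumes f: "f \<in> RepA" and z: "z \<in> RA" and k: "k < n" and a: "a < \<alpha> k"
    and van: "\<And>j a. j < n \<Longrightarrow> mdim (P k) < mdim (P j) \<Longrightarrow> a < \<alpha> j \<Longrightarrow> z j a = \<zero>\<^bsub>P j\<^esub>"
  shows "f z k a = \<zero>\<^bsub>P k\<^esub>"
proof -
  obtain h where h: "\<forall>i<n. module_map A (SB i) (copies i (\<alpha> i)) (h i)"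
    "\<forall>x\<in>carrier SRC. f (\<Phi> x) = (\<lambda>i\<in>{..<n}. h i (x i))" using f unfolding Rep_iff by blast
  obtain x where x: "x \<in> carrier SRC" "z = \<Phi> x" using z Phi_bij by (auto simp: bij_betw_def)
  have xk: "x k \<in> carrier (SB k)" using x(1) k unfolding src_eq by auto
  have "x k = \<zero>\<^bsub>SB k\<^esub>"
  proof (rule PiE_ext[of _ "block_index k" "\<lambda>_. carrier (P k)"])
    show "x k \<in> block_index k \<rightarrow>\<^sub>E carrier (P k)" using xk by simp
    show "\<zero>\<^bsub>SB k\<^esub> \<in> block_index k \<rightarrow>\<^sub>E carrier (P k)"
      using abelian_monoid.zero_closed[OF abelian_group.axioms(1)[OF right_module.axioms(2)[OF
        right_module_P[OF k]]]] by auto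
    fix p assume "p \<in> block_index k"
    then obtain j c b where p: "p = (j, c, b)" "j < n" "c < \<alpha> j" "b < d j k" by (auto simp: block_index_def)
    note ap = arrow_part_hom[OF p(2,3)]
    have "mdim (P k) < mdim (P j)" using arrow_decreases[OF p(2) k] p(4) by simp
    then have "z j c = \<zero>\<^bsub>P j\<^esub>" by (rule van[OF p(2) _ p(3)])
    then have "\<phi> j (arrow_part j c x) = \<phi> j \<zero>\<^bsub>proj_sum n P (d j)\<^esub>"
      using x p module_map_zero[OF right_module_PA right_module_P[OF p(2)] phi_hom[OF p(2)]]
        by (simp add: Phi_apply)
    then have "arrow_part j c x = \<zero>\<^bsub>proj_sum n P (d j)\<^esub>"
      using phi_bij[OF p(2)] module_map_closed[OF ap x(1)]
        abelian_monoid.zero_closed[OF abelian_group.axioms(1)[OF right_module.axioms(2)[OF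
            right_module_PA[of "d j"]]]]
      by (meson bij_betw_def inj_onD)
    from fun_cong[OF fun_cong[OF this, of k], of b] show "x k p = \<zero>\<^bsub>SB k\<^esub> p"
      using p k \<open>p \<in> block_index k\<close> by (simp add: arrow_part_def PA_zero)
  qed
  then have "h k (x k) = \<zero>\<^bsub>copies k (\<alpha> k)\<^esub>"
    using module_map_zero[OF right_module_SB[OF k] right_module_copies[OF k]] h(1) k by simp
  then show ?thesis using h(2) x k a by simp
qed

text \<open>The relations imposed on \<open>P(\<alpha>)\<close> in the cokernel \<open>N\<^sub>f\<close>.\<close>

abbreviation rel :: "((nat \<Rightarrow> nat \<Rightarrow> 'p) \<Rightarrow> nat \<Rightarrow> nat \<Rightarrow> 'p) \<Rightarrow> (nat \<Rightarrow> nat \<Rightarrow> 'p) \<Rightarrow> nat \<Rightarrow> nat \<Rightarrow> 'p" where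
  "rel f x \<equiv> f x \<ominus>\<^bsub>PA\<^esub> x"

lemma rel_hom: "f \<in> RepA \<Longrightarrow> module_map A RM PA (rel f)"
  by (intro module_map_minus_map right_module_PA Rep_hom module_map_incl)

lemma submodule_rel: "f \<in> RepA \<Longrightarrow> Module.submodule (rel f ` RA) A PA"
  using submodule_image[OF right_module_RM right_module_PA rel_hom submodule_carrier[OF right_module_RM]]
    by simp

text \<open>In a fixed vector of \<open>f\<close> a nonzero component at a vertex of maximal dimension is impossible.\<close>

lemma rel_inj:
  assumes f: "f \<in> RepA"
  shows "inj_on (rel f) RA"
proof -
  have "inj_on (rel f) (carrier RM)"
  proof (rule module_map_inj_on[OF right_module_RM right_module_PA rel_hom[OF f]])
    fix z assume z: "z \<in> carrier RM" "rel f z = \<zero>\<^bsub>PA\<^esub>"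
    interpret PP: right_module A PA by (rule right_module_PA)
    have fz: "f z = z"
      using z PP.minus_zero_iff[of "f z" z] module_map_closed[OF Rep_hom[OF f] z(1)] RA_subset by auto
    let ?B = "{j. j < n \<and> (\<exists>a<\<alpha> j. z j a \<noteq> \<zero>\<^bsub>P j\<^esub>)}"
    have "?B = {}"
    proof (rule ccontr)
      assume ne: "?B \<noteq> {}"
      have "finite ?B" by simp
      let ?D = "(\<lambda>j. mdim (P j)) ` ?B"
      have "finite ?D" using \<open>finite ?B\<close> by (rule finite_imageI)
      moreover have "?D \<noteq> {}" using ne by blast
      ultimately have "Max ?D \<in> ?D" by (rule Max_in)
      then obtain k where k: "k \<in> ?B" "Max ?D = mdim (P k)" by blast
      have kmax: "mdim (P j) \<le> mdim (P k)" if "j \<in> ?B" for j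
        unfolding k(2)[symmetric] using that by (intro Max_ge \<open>finite ?D\<close>) blast
      obtain a where a: "k < n" "a < \<alpha> k" "z k a \<noteq> \<zero>\<^bsub>P k\<^esub>" using k(1) by blast
      have "f z k a = \<zero>\<^bsub>P k\<^esub>"
      proof (rule Rep_support[OF f _ a(1,2)])
        show "z \<in> RA" using z(1) by simp
        fix j b assume "j < n" "mdim (P k) < mdim (P j)" "b < \<alpha> j"
        then show "z j b = \<zero>\<^bsub>P j\<^esub>" using kmax[of j] by fastforce
      qed
      then show False using a(3) fz by simp
    qed
    then show "z = \<zero>\<^bsub>RM\<^esub>"
    proof -
      have "z = \<zero>\<^bsub>PA\<^esub>"
      proof (rule PA_eqI)
        show "z \<in> carrier PA" using z(1) RA_subset by auto
        show "\<zero>\<^bsub>PA\<^esub> \<in> carrier PA" by (rule PP.zero_closed)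
      qed (use \<open>?B = {}\<close> in \<open>auto simp: PA_zero\<close>)
      then show ?thesis by simp
    qed
  qed
  then show ?thesis by simp
qed

section \<open>Every module of the given dimension vector is a cokernel\<close>

abbreviation block_incl :: "nat \<Rightarrow> (nat \<Rightarrow> 'p) \<Rightarrow> nat \<Rightarrow> nat \<Rightarrow> 'p" where
  "block_incl i \<equiv> ds_inj {..<n} (\<lambda>i. copies i (\<alpha> i)) i"

lemma block_incl_hom: "i < n \<Longrightarrow> module_map A (copies i (\<alpha> i)) PA (block_incl i)"
  unfolding PA_eq by (rule module_map_ds_inj[where M = "\<lambda>i. copies i (\<alpha> i)"])
    (auto intro: right_module_copies)

lemma block_proj_hom: "i < n \<Longrightarrow> module_map A PA (copies i (\<alpha> i)) (\<lambda>x. x i)"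
  unfolding PA_eq by (rule module_map_ds_proj) simp

text \<open>
  Modulo the image of \<open>f - inc\<close> an element of the radical may be replaced by its image under \<open>f\<close>.
  The components of a map from \<open>P\<^sub>i\<close> outside the \<open>i\<close>-th block lie in the radical, and each
  replacement moves them to blocks of smaller dimension, until only the \<open>i\<close>-th block is left.
\<close>

lemma reduce_to_block:
  assumes f: "f \<in> RepA" and i: "i < n"
  shows "module_map A (P i) PA u \<Longrightarrow>
    (\<And>j a y. j < n \<Longrightarrow> j \<noteq> i \<Longrightarrow> D \<le> mdim (P j) \<Longrightarrow> a < \<alpha> j \<Longrightarrow> y \<in> carrier (P i) \<Longrightarrow> u y j a = \<zero>\<^bsub>P j\<^esub>) \<Longrightarrow>
    \<exists>v. module_map A (P i) (copies i (\<alpha> i)) v \<and>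
      (\<forall>y\<in>carrier (P i). u y \<ominus>\<^bsub>PA\<^esub> block_incl i (v y) \<in> rel f ` RA)"
proof (induction D arbitrary: u)
  case 0
  interpret PP: right_module A PA by (rule right_module_PA)
  let ?v = "\<lambda>y. u y i"
  have v: "module_map A (P i) (copies i (\<alpha> i)) ?v"
      by (rule module_map_compose[OF 0(1) block_proj_hom[OF i]])
  have "u y \<ominus>\<^bsub>PA\<^esub> block_incl i (?v y) \<in> rel f ` RA" if y: "y \<in> carrier (P i)" for y
  proof -
    have "u y = block_incl i (?v y)"
      by (rule PA_eqI) (use module_map_closed[OF 0(1) y] module_map_closed[OF block_incl_hom[OF i]
        module_map_closed[OF v y]] 0(2) y i
        in \<open>auto simp: ds_inj_def\<close>)
    then have "u y \<ominus>\<^bsub>PA\<^esub> block_incl i (?v y) = \<zero>\<^bsub>PA\<^esub>"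
      using PP.minus_zero_iff module_map_closed[OF 0(1) y] module_map_closed[OF block_incl_hom[OF i]
        module_map_closed[OF v y]] by blast
    then show ?thesis using submodule_rel[OF f] unfolding PP.submodule_iff by simp
  qed
  then show ?case using v by blast
next
  case (Suc D)
  interpret PP: right_module A PA by (rule right_module_PA)
  let ?p = "\<lambda>y. block_incl i (u y i)"
  let ?w = "\<lambda>y. u y \<ominus>\<^bsub>PA\<^esub> ?p y"
  have p: "module_map A (P i) PA ?p"
    by (rule module_map_compose[OF module_map_compose[OF Suc.prems(1) block_proj_hom[OF i]]
      block_incl_hom[OF i]])
  have w: "module_map A (P i) PA ?w" by (rule module_map_minus_map[OF right_module_PA Suc.prems(1) p])
  have proj: "module_map A PA (P j) (\<lambda>x. x j a)" if "j < n" "a < \<alpha> j" for j a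
    using module_map_compose[OF block_proj_hom[OF that(1)] module_map_ds_proj[where M = "\<lambda>_. P j"]] that(2)
      by simp
  have wc: "?w y j a = (if j = i then \<zero>\<^bsub>P j\<^esub> else u y j a)" if y: "y \<in> carrier (P i)" "j < n" "a < \<alpha> j"
      for y j a
  proof -
    interpret PJ: right_module A "P j" by (rule right_module_P[OF y(2)])
    have "?w y j a = u y j a \<ominus>\<^bsub>P j\<^esub> ?p y j a"
      by (rule module_map_minus[OF right_module_PA right_module_P[OF y(2)] proj[OF y(2,3)]
        module_map_closed[OF Suc.prems(1) y(1)] module_map_closed[OF p y(1)]])
    also have "?p y j a = (if j = i then u y j a else \<zero>\<^bsub>P j\<^esub>)" using y by (simp add: ds_inj_def)
    finally show ?thesis
      using module_map_closed[OF proj[OF y(2,3)] module_map_closed[OF Suc.prems(1) y(1)]] PJ.minus_zero_iff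
        PJ.minus_equality[of "\<zero>\<^bsub>P j\<^esub>" "\<zero>\<^bsub>P j\<^esub>"] by (auto simp: a_minus_def PJ.r_neg)
  qed
  have wR: "?w y \<in> RA" if y: "y \<in> carrier (P i)" for y
    unfolding RA_iff
  proof (intro conjI allI impI)
    show "?w y \<in> carrier PA" by (rule module_map_closed[OF w y])
    fix j a assume ja: "j < n" "a < \<alpha> j"
    show "?w y j a \<in> radical A (P j)"
    proof (cases "j = i")
      case True
      interpret PI: right_module A "P i" by (rule right_module_P[OF i])
      show ?thesis using wc[OF y ja] True submodule_radical_P[OF i] unfolding PI.submodule_iff by simp
    next
      case False
      then show ?thesis
        using wc[OF y ja] hom_into_radical[OF i ja(1) _ module_map_compose[OF Suc.prems(1) proj[OF ja]] y]
          by simp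
    qed
  qed
  have wRM: "module_map A (P i) RM ?w"
    unfolding rad_module_def by (rule module_map_into[OF w]) (use wR in blast)
  have fw: "module_map A (P i) PA (\<lambda>y. f (?w y))" by (rule module_map_compose[OF wRM Rep_hom[OF f]])
  \<comment> \<open>One replacement: \<open>u = p + w\<close> with \<open>w\<close> in the radical is congruent to \<open>p + f w\<close>.\<close>
  let ?u = "\<lambda>y. ?p y \<oplus>\<^bsub>PA\<^esub> f (?w y)"
  have u': "module_map A (P i) PA ?u" by (rule module_map_plus_map[OF right_module_PA p fw])
  have "\<exists>v. module_map A (P i) (copies i (\<alpha> i)) v \<and>
      (\<forall>y\<in>carrier (P i). ?u y \<ominus>\<^bsub>PA\<^esub> block_incl i (v y) \<in> rel f ` RA)"
  proof (rule Suc.IH[OF u'])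
    fix j a y assume j: "j < n" "j \<noteq> i" "D \<le> mdim (P j)" "a < \<alpha> j" and y: "y \<in> carrier (P i)"
    interpret PJ: right_module A "P j" by (rule right_module_P[OF j(1)])
    have "f (?w y) j a = \<zero>\<^bsub>P j\<^esub>"
    proof (rule Rep_support[OF f wR[OF y] j(1,4)])
      fix j' b assume "j' < n" "mdim (P j) < mdim (P j')" "b < \<alpha> j'"
      then show "?w y j' b = \<zero>\<^bsub>P j'\<^esub>" using wc[OF y] Suc.prems(2)[OF _ _ _ _ y] j(3) by simp
    qed
    moreover have "?u y j a = ?p y j a \<oplus>\<^bsub>P j\<^esub> f (?w y) j a"
      by (rule module_map_add[OF proj[OF j(1,4)] module_map_closed[OF p y] module_map_closed[OF fw y]])
    moreover have "?p y j a = \<zero>\<^bsub>P j\<^esub>" using j by (simp add: ds_inj_def)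
    ultimately show "?u y j a = \<zero>\<^bsub>P j\<^esub>" by simp
  qed
  then obtain v where v: "module_map A (P i) (copies i (\<alpha> i)) v"
    "\<forall>y\<in>carrier (P i). ?u y \<ominus>\<^bsub>PA\<^esub> block_incl i (v y) \<in> rel f ` RA" by blast
  have "u y \<ominus>\<^bsub>PA\<^esub> block_incl i (v y) \<in> rel f ` RA" if y: "y \<in> carrier (P i)" for y
  proof -
    note c = module_map_closed[OF Suc.prems(1) y] module_map_closed[OF p y] module_map_closed[OF fw y]
        module_map_closed[OF w y]
      module_map_closed[OF block_incl_hom[OF i] module_map_closed[OF v(1) y]]
    have "(?u y \<ominus>\<^bsub>PA\<^esub> block_incl i (v y)) \<ominus>\<^bsub>PA\<^esub> rel f (?w y) \<in> rel f ` RA"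
      using submodule_minus[OF right_module_PA submodule_rel[OF f]] v(2) y wR[OF y] by blast
    moreover have "(?u y \<ominus>\<^bsub>PA\<^esub> block_incl i (v y)) \<ominus>\<^bsub>PA\<^esub> rel f (?w y) =
        (?p y \<oplus>\<^bsub>PA\<^esub> ?w y) \<ominus>\<^bsub>PA\<^esub> block_incl i (v y)"
      by (rule PP.exchange_summand[OF c(2,3,5,4)])
    moreover have "?p y \<oplus>\<^bsub>PA\<^esub> ?w y = u y"
      using PP.add_minus_cancel[OF c(2,1)] .
    ultimately show ?thesis by simp
  qed
  then show ?case using v(1) by blast
qed

end

lemma kspace_subspace:
  assumes V: "kspace V" and W: "linear_subspace V W"
  shows "kspace (V\<lparr>carrier := W\<rparr>)"
proof -
  interpret kspace V by (rule V)
  have sub: "x \<in> W \<Longrightarrow> x \<in> carrier V" for x using W by (auto simp: linear_subspace_def)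
  have neg: "\<ominus>\<^bsub>V\<^esub> x \<in> W" if "x \<in> W" for x
    using W that smult_minus_one[OF sub[OF that]] unfolding linear_subspace_def by metis
  have "abelian_group (V\<lparr>carrier := W\<rparr>)"
  proof (rule abelian_groupI)
    fix x assume "x \<in> carrier (V\<lparr>carrier := W\<rparr>)"
    then show "\<exists>y\<in>carrier (V\<lparr>carrier := W\<rparr>). y \<oplus>\<^bsub>V\<lparr>carrier := W\<rparr>\<^esub> x = \<zero>\<^bsub>V\<lparr>carrier := W\<rparr>\<^esub>"
      using neg sub by (intro bexI[of _ "\<ominus>\<^bsub>V\<^esub> x"]) (auto simp: l_neg)
  qed (use W in \<open>auto simp: linear_subspace_def sub a_ac\<close>)
  then show ?thesis
    using W by (intro kspace.intro kspace_axioms.intro)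
      (auto simp: linear_subspace_def sub smult_l_distr smult_r_distr smult_assoc)
qed

lemma linear_functional_subspace:
  "linear_functional V l \<Longrightarrow> W \<subseteq> carrier V \<Longrightarrow> linear_functional (V\<lparr>carrier := W\<rparr>) l"
  unfolding linear_functional_def by (simp add: subset_iff)

context representation_space
begin

lemma rep_module_eq: "rep_module A n P \<alpha> f = quot_module PA (rel f ` RA)"
  by (simp add: rep_module_def)

lemma module_iso_rep_iff:
  assumes "f \<in> RepA" "right_module A N"
  shows "module_iso A (rep_module A n P \<alpha> f) N \<longleftrightarrow>
    (\<exists>p. module_map A PA N p \<and> p ` carrier PA = carrier N \<and>
      (\<forall>x\<in>carrier PA. p x = \<zero>\<^bsub>N\<^esub> \<longleftrightarrow> x \<in> rel f ` RA))"
  unfolding rep_module_eq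
    by (rule module_iso_quot_iff[OF right_module_PA submodule_rel[OF assms(1)] assms(2)])

text \<open>
  The frames add up to a map onto \<open>N\<close>. The maps from the source of \<open>\<Phi>\<close> to \<open>N\<close> lift through them block
  by block, which defines \<open>f\<close> so that \<open>f - inc\<close> maps into the kernel. A map from \<open>P\<^sub>i\<close> into the kernel is
  congruent, modulo the image of \<open>f - inc\<close>, to one into the \<open>i\<close>-th block; that one vanishes because a
  frame kills no nonzero map from \<open>P\<^sub>i\<close>.
\<close>

lemma Rep_presents:
  assumes N: "fd_module A N" and t: "\<And>i. i < n \<Longrightarrow> frame i (copies i (\<alpha> i)) N (t i)"
  shows "\<exists>f\<in>RepA. module_iso A (rep_module A n P \<alpha> f) N"
proof -
  note NR = fd_moduleD[OF N]
  interpret NN: right_module A N by (rule NR)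
  interpret PP: right_module A PA by (rule right_module_PA)
  have th: "module_map A (copies i (\<alpha> i)) N (t i)" if "i < n" for i using t[OF that]
      by (simp add: frame_def)
  define \<tau> where "\<tau> x = (\<Oplus>\<^bsub>N\<^esub>i\<in>{..<n}. t i (x i))" for x
  have \<tau>: "module_map A PA N \<tau>"
    unfolding \<tau>_def PA_eq by (intro module_map_ds_out NR th) auto
  have \<tau>b: "\<tau> (block_incl i y) = t i y" if "i < n" "y \<in> carrier (copies i (\<alpha> i))" for i y
    unfolding \<tau>_def
    using ds_out_inj[where I = "{..<n}" and N = N and M = "\<lambda>i. copies i (\<alpha> i)" and h = t and i = i
      and y = y]
      NR right_module_copies th that by auto
  have sur: "\<tau> ` carrier PA = carrier N"
  proof (rule ccontr)
    assume ne: "\<tau> ` carrier PA \<noteq> carrier N"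
    have "Module.submodule (\<tau> ` carrier PA) A N"
      by (rule submodule_image[OF right_module_PA NR \<tau> submodule_carrier[OF right_module_PA]])
    from generator[OF N this ne] obtain i u where i: "i < n" "module_map A (P i) N u"
      "\<not> u ` carrier (P i) \<subseteq> \<tau> ` carrier PA" by blast
    obtain v where v: "module_map A (P i) (copies i (\<alpha> i)) v" "\<forall>x\<in>carrier (P i). t i (v x) = u x"
      using t[OF i(1)] i(2) unfolding frame_def lifts_def by blast
    have "u x \<in> \<tau> ` carrier PA" if x: "x \<in> carrier (P i)" for x
    proof
      show "u x = \<tau> (block_incl i (v x))" using \<tau>b[OF i(1) module_map_closed[OF v(1) x]] v(2) x by simp
      show "block_incl i (v x) \<in> carrier PA"
        by (rule module_map_closed[OF block_incl_hom[OF i(1)] module_map_closed[OF v(1) x]])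
    qed
    then show False using i(3) by blast
  qed
  have \<tau>R: "module_map A SRC N (\<lambda>x. \<tau> (\<Phi> x))"
    using module_map_compose[OF module_map_compose[OF Phi_hom module_map_incl] \<tau>] .
  let ?\<iota> = "ds_inj {..<n} SB"
  have \<iota>: "module_map A (SB i) SRC (?\<iota> i)" if "i < n" for i
    unfolding src_eq by (rule module_map_ds_inj[where M = SB]) (use that right_module_SB in auto)
  have "\<exists>h. module_map A (SB i) (copies i (\<alpha> i)) h \<and> (\<forall>y\<in>carrier (SB i). t i (h y) = \<tau> (\<Phi> (?\<iota> i y)))"
      if i: "i < n" for i
  proof -
    have "lifts (SB i) (copies i (\<alpha> i)) N (t i)"
      using t[OF i] i by (intro lifts_dir_sum finite_block_index right_module_P right_module_copies NR th)
        (auto simp: frame_def)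
    then show ?thesis using module_map_compose[OF \<iota>[OF i] \<tau>R] unfolding lifts_def by blast
  qed
  then have "\<forall>i. \<exists>h. i < n \<longrightarrow> module_map A (SB i) (copies i (\<alpha> i)) h \<and>
      (\<forall>y\<in>carrier (SB i). t i (h y)
          = \<tau> (\<Phi> (?\<iota> i y)))" by (simp only: ex_simps simp_thms atomize_all atomize_imp)
  from choice[OF this] obtain h where "\<forall>i. i < n \<longrightarrow> module_map A (SB i) (copies i (\<alpha> i)) (h i) \<and>
      (\<forall>y\<in>carrier (SB i). t i (h i y) = \<tau> (\<Phi> (?\<iota> i y)))" by (rule exE)
  then have h: "\<And>i. i < n \<Longrightarrow> module_map A (SB i) (copies i (\<alpha> i)) (h i)"
    "\<And>i y. i < n \<Longrightarrow> y \<in> carrier (SB i) \<Longrightarrow> t i (h i y) = \<tau> (\<Phi> (?\<iota> i y))" by (simp_all only: simp_thms)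
  define F where "F x = (\<lambda>i\<in>{..<n}. h i (x i))" for x
  have F: "module_map A SRC PA F"
    unfolding F_def src_eq PA_eq by (intro module_map_ds_componentwise h(1)) auto
  have \<tau>F: "\<tau> (F x) = \<tau> (\<Phi> x)" if x: "x \<in> carrier SRC" for x
  proof (rule module_map_ds_eqI[where I = "{..<n}" and M = SB and N = N and g = "\<lambda>x. \<tau> (F x)"
      and h = "\<lambda>x. \<tau> (\<Phi> x)"])
    show "module_map A (dir_sum {..<n} SB) N (\<lambda>x. \<tau> (F x))"
        "module_map A (dir_sum {..<n} SB) N (\<lambda>x. \<tau> (\<Phi> x))"
      using module_map_compose[OF F \<tau>] \<tau>R unfolding src_eq by auto
    show "x \<in> carrier (dir_sum {..<n} SB)" using x unfolding src_eq .
    fix i y assume i: "i \<in> {..<n}" and y: "y \<in> carrier (SB i)"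
    have hz: "h j \<zero>\<^bsub>SB j\<^esub> = \<zero>\<^bsub>copies j (\<alpha> j)\<^esub>" if "j < n" for j
      by (rule module_map_zero[OF right_module_SB[OF that] right_module_copies[OF that] h(1)[OF that]])
    have "F (?\<iota> i y) = block_incl i (h i y)"
    proof (rule ext)
      fix j show "F (?\<iota> i y) j = block_incl i (h i y) j"
      proof (cases "j < n \<and> j \<noteq> i")
        case True
        then have "F (?\<iota> i y) j = h j \<zero>\<^bsub>SB j\<^esub>"
            by (simp only: F_def ds_inj_def restrict_apply lessThan_iff if_True if_False)
        then show ?thesis using hz[of j] True
            by (simp only: ds_inj_def restrict_apply lessThan_iff if_True if_False)
      next
        case False
        then show ?thesis by (auto simp: F_def ds_inj_def simp del: dir_sum_simps)
      qed
    qed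
    then show "\<tau> (F (?\<iota> i y)) = \<tau> (\<Phi> (?\<iota> i y))"
      using \<tau>b[of i "h i y"] module_map_closed[OF h(1) y] h(2)[OF _ y] i by simp
  qed (use NR right_module_SB in auto)
  let ?\<Psi> = "the_inv_into (carrier SRC) \<Phi>"
  have \<Psi>: "module_map A RM SRC ?\<Psi>"
    by (rule module_map_inverse[OF right_module_SRC right_module_RM Phi_hom]) (use Phi_bij in simp)
  have \<Psi>\<Phi>: "?\<Psi> (\<Phi> x) = x" if "x \<in> carrier SRC" for x
    using Phi_bij that by (auto simp: bij_betw_def the_inv_into_f_f)
  define f where "f = restrict (\<lambda>z. F (?\<Psi> z)) (carrier RM)"
  have f: "f \<in> RepA" unfolding Rep_iff
  proof (intro conjI exI[of _ h] allI impI ballI h(1))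
    show "f \<in> mhom A RM PA" unfolding f_def
        by (rule mhom_restrict[OF right_module_RM module_map_compose[OF \<Psi> F]])
    fix x assume x: "x \<in> carrier SRC"
    then show "f (\<Phi> x) = (\<lambda>i\<in>{..<n}. h i (x i))"
      using module_map_closed[OF Phi_hom x] \<Psi>\<Phi>[OF x] by (simp add: f_def F_def)
  qed
  have \<tau>f: "\<tau> (rel f z) = \<zero>\<^bsub>N\<^esub>" if z: "z \<in> RA" for z
  proof -
    obtain x where x: "x \<in> carrier SRC" "z = \<Phi> x" using z Phi_bij by (auto simp: bij_betw_def)
    have "f z = F x" using x \<Psi>\<Phi>[OF x(1)] z by (simp add: f_def)
    then have "\<tau> (f z) = \<tau> z" using \<tau>F[OF x(1)] x(2) by simp
    moreover have "\<tau> (rel f z) = \<tau> (f z) \<ominus>\<^bsub>N\<^esub> \<tau> z"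
      using z RA_subset module_map_closed[OF Rep_hom[OF f], of z]
      by (intro module_map_minus[OF right_module_PA NR \<tau>]) auto
    moreover have "\<tau> z \<in> carrier N" using z RA_subset module_map_closed[OF \<tau>] by blast
    ultimately show ?thesis using NN.minus_zero_iff by simp
  qed
  let ?I = "rel f ` RA" and ?L = "{x \<in> carrier PA. \<tau> x = \<zero>\<^bsub>N\<^esub>}"
  have IL: "?I \<subseteq> ?L" using \<tau>f submodule_subset[OF submodule_rel[OF f]] by blast
  have "?I = ?L"
  proof (rule ccontr)
    assume ne: "?I \<noteq> ?L"
    have L: "Module.submodule ?L A PA" by (rule submodule_kernel[OF right_module_PA NR \<tau>])
    let ?M = "PA\<lparr>carrier := ?L\<rparr>"
    interpret MM: right_module A ?M by (rule right_module_submodule[OF right_module_PA L])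
    have "Module.submodule ?I A ?M"
      unfolding MM.submodule_iff using IL submodule_rel[OF f] unfolding PP.submodule_iff by auto
    moreover have "?I \<noteq> carrier ?M" using ne by simp
    ultimately obtain i u where i: "i < n" and u: "module_map A (P i) ?M u"
        and nu: "\<not> u ` carrier (P i) \<subseteq> ?I"
      using generator[OF fd_module_submodule[OF fd_module_PA L]] by blast
    have u': "module_map A (P i) PA u" by (rule module_map_from_submodule[OF u]) blast
    have u0: "\<tau> (u y) = \<zero>\<^bsub>N\<^esub>" if "y \<in> carrier (P i)" for y using module_map_closed[OF u that] by simp
    have "\<not> Suc (\<Sum>j<n. mdim (P j)) \<le> mdim (P j)" if "j < n" for j
      using member_le_sum[of j "{..<n}" "\<lambda>j. mdim (P j)"] that by simp
    then obtain v where v: "module_map A (P i) (copies i (\<alpha> i)) v"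
      "\<And>y. y \<in> carrier (P i) \<Longrightarrow> u y \<ominus>\<^bsub>PA\<^esub> block_incl i (v y) \<in> ?I"
      using reduce_to_block[OF f i u', of "Suc (\<Sum>j<n. mdim (P j))"] by blast
    have "t i (v y) = \<zero>\<^bsub>N\<^esub>" if y: "y \<in> carrier (P i)" for y
    proof -
      note c = module_map_closed[OF u' y] module_map_closed[OF v(1) y]
      have cb: "block_incl i (v y) \<in> carrier PA" by (rule module_map_closed[OF block_incl_hom[OF i] c(2)])
      have "\<tau> (u y \<ominus>\<^bsub>PA\<^esub> block_incl i (v y)) = \<zero>\<^bsub>N\<^esub>" using v(2)[OF y] IL by blast
      then have "\<tau> (u y) \<ominus>\<^bsub>N\<^esub> \<tau> (block_incl i (v y)) = \<zero>\<^bsub>N\<^esub>"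
        using module_map_minus[OF right_module_PA NR \<tau> c(1) cb] by simp
      then have "\<tau> (u y) = \<tau> (block_incl i (v y))"
        using NN.minus_zero_iff module_map_closed[OF \<tau> c(1)] module_map_closed[OF \<tau> cb] by blast
      then show ?thesis using u0[OF y] \<tau>b[OF i c(2)] by simp
    qed
    then have v0: "v y = \<zero>\<^bsub>copies i (\<alpha> i)\<^esub>" if "y \<in> carrier (P i)" for y
      using t[OF i] v(1) that unfolding frame_def monic_for_def by blast
    have "u y \<in> ?I" if y: "y \<in> carrier (P i)" for y
    proof -
      have "block_incl i (v y) = \<zero>\<^bsub>PA\<^esub>"
        unfolding v0[OF y] by (rule module_map_zero[OF right_module_copies[OF i]
          right_module_PA block_incl_hom[OF i]])
      moreover have "u y \<ominus>\<^bsub>PA\<^esub> \<zero>\<^bsub>PA\<^esub> = u y"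
        using module_map_closed[OF u' y] PP.minus_equality[of "\<zero>\<^bsub>PA\<^esub>" "\<zero>\<^bsub>PA\<^esub>"] by (simp add: a_minus_def)
      ultimately show ?thesis using v(2)[OF y] by simp
    qed
    then show False using nu by blast
  qed
  then have "\<forall>x\<in>carrier PA. \<tau> x = \<zero>\<^bsub>N\<^esub> \<longleftrightarrow> x \<in> ?I" by blast
  then have "module_iso A (rep_module A n P \<alpha> f) N"
    unfolding module_iso_rep_iff[OF f NR] using \<tau> sur by blast
  with f show ?thesis by blast
qed

abbreviation "RS \<equiv> Rep_space A n d P \<phi> \<alpha>"

lemma Rep_space_eq: "RS = (hom_space RM PA)\<lparr>carrier := RepA\<rparr>"
  by (simp add: Rep_space_def)

lemma RepA_subset: "RepA \<subseteq> mhom A RM PA"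
  by (auto simp: Rep_iff)

lemma linear_subspace_RepA: "linear_subspace (hom_space RM PA) RepA"
proof -
  interpret C: kspace "hom_space RM PA" by (rule kspace_hom_space[OF right_module_RM right_module_PA])
  have PR: "\<Phi> x \<in> RA" if "x \<in> carrier SRC" for x using module_map_closed[OF Phi_hom that] by simp
  have xi: "x i \<in> carrier (SB i)" if "x \<in> carrier SRC" "i < n" for x i using that unfolding src_eq by auto
  show ?thesis unfolding linear_subspace_def
  proof (intro conjI ballI allI)
    show "RepA \<subseteq> carrier (hom_space RM PA)" using RepA_subset by simp
    show "\<zero>\<^bsub>hom_space RM PA\<^esub> \<in> RepA" unfolding Rep_iff
    proof (intro conjI exI[of _ "\<lambda>i _. \<zero>\<^bsub>copies i (\<alpha> i)\<^esub>"] allI impI ballI)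
      show "\<zero>\<^bsub>hom_space RM PA\<^esub> \<in> mhom A RM PA" using C.zero_closed by simp
      show "module_map A (SB i) (copies i (\<alpha> i)) (\<lambda>_. \<zero>\<^bsub>copies i (\<alpha> i)\<^esub>)" if "i < n" for i
        by (rule module_map_zero_map[OF right_module_copies[OF that]])
      show "\<zero>\<^bsub>hom_space RM PA\<^esub> (\<Phi> x) = (\<lambda>i\<in>{..<n}. \<zero>\<^bsub>copies i (\<alpha> i)\<^esub>)" if "x \<in> carrier SRC" for x
        using PR[OF that] by (simp add: PA_zero)
    qed
    fix f assume f: "f \<in> RepA"
    obtain h where h: "\<forall>i<n. module_map A (SB i) (copies i (\<alpha> i)) (h i)"
      "\<forall>x\<in>carrier SRC. f (\<Phi> x) = (\<lambda>i\<in>{..<n}. h i (x i))" using f unfolding Rep_iff by blast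
    fix a :: 'k
    show "a \<odot>\<^bsub>hom_space RM PA\<^esub> f \<in> RepA" unfolding Rep_iff
    proof (intro conjI exI[of _ "\<lambda>i y. (a \<odot> \<one>) \<odot>\<^bsub>copies i (\<alpha> i)\<^esub> h i y"] allI impI ballI)
      show "a \<odot>\<^bsub>hom_space RM PA\<^esub> f \<in> mhom A RM PA"
        using C.smult_closed[of f a] f RepA_subset by auto
      show "module_map A (SB i) (copies i (\<alpha> i)) (\<lambda>y. (a \<odot> \<one>) \<odot>\<^bsub>copies i (\<alpha> i)\<^esub> h i y)" if "i < n" for i
        using h(1) that by (intro module_map_scalar_map right_module_copies) auto
      fix x assume x: "x \<in> carrier SRC"
      have "(a \<odot>\<^bsub>hom_space RM PA\<^esub> f) (\<Phi> x) = (a \<odot> \<one>) \<odot>\<^bsub>PA\<^esub> (\<lambda>i\<in>{..<n}. h i (x i))"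
        using PR[OF x] h(2) x by simp
      also have "\<dots> = (\<lambda>i\<in>{..<n}. (a \<odot> \<one>) \<odot>\<^bsub>copies i (\<alpha> i)\<^esub> h i (x i))"
        unfolding PA_eq dir_sum_simps(4) by (intro restrict_ext) simp
      finally show "(a \<odot>\<^bsub>hom_space RM PA\<^esub> f) (\<Phi> x) = (\<lambda>i\<in>{..<n}. (a \<odot> \<one>) \<odot>\<^bsub>copies i (\<alpha> i)\<^esub> h i (x i))" .
    qed
    fix g assume g: "g \<in> RepA"
    obtain h' where h': "\<forall>i<n. module_map A (SB i) (copies i (\<alpha> i)) (h' i)"
      "\<forall>x\<in>carrier SRC. g (\<Phi> x) = (\<lambda>i\<in>{..<n}. h' i (x i))" using g unfolding Rep_iff by blast
    show "f \<oplus>\<^bsub>hom_space RM PA\<^esub> g \<in> RepA" unfolding Rep_iff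
    proof (intro conjI exI[of _ "\<lambda>i y. h i y \<oplus>\<^bsub>copies i (\<alpha> i)\<^esub> h' i y"] allI impI ballI)
      show "f \<oplus>\<^bsub>hom_space RM PA\<^esub> g \<in> mhom A RM PA"
        using C.a_closed[of f g] f g RepA_subset by auto
      show "module_map A (SB i) (copies i (\<alpha> i)) (\<lambda>y. h i y \<oplus>\<^bsub>copies i (\<alpha> i)\<^esub> h' i y)" if "i < n" for i
        using h(1) h'(1) that by (intro module_map_plus_map right_module_copies) auto
      fix x assume x: "x \<in> carrier SRC"
      have "(f \<oplus>\<^bsub>hom_space RM PA\<^esub> g) (\<Phi> x) = (\<lambda>i\<in>{..<n}. h i (x i)) \<oplus>\<^bsub>PA\<^esub> (\<lambda>i\<in>{..<n}. h' i (x i))"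
        using PR[OF x] h(2) h'(2) x by simp
      also have "\<dots> = (\<lambda>i\<in>{..<n}. h i (x i) \<oplus>\<^bsub>copies i (\<alpha> i)\<^esub> h' i (x i))"
        unfolding PA_eq dir_sum_simps(3) by (intro restrict_ext) simp
      finally show "(f \<oplus>\<^bsub>hom_space RM PA\<^esub> g) (\<Phi> x) = (\<lambda>i\<in>{..<n}. h i (x i) \<oplus>\<^bsub>copies i (\<alpha> i)\<^esub> h' i (x i))" .
    qed
  qed
qed

lemma kspace_RS: "kspace RS"
  unfolding Rep_space_eq
  by (rule kspace_subspace[OF kspace_hom_space[OF right_module_RM right_module_PA] linear_subspace_RepA])

lemma linear_functional_RS: "linear_functional (hom_space RM PA) l \<Longrightarrow> linear_functional RS l"
  unfolding Rep_space_eq using RepA_subset by (intro linear_functional_subspace) auto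

lemma PA_lifts:
  assumes "fd_module A X" "fd_module A Y" "module_map A X Y g" "g ` carrier X = carrier Y"
  shows "lifts PA X Y g"
  unfolding PA_eq
  by (intro lifts_dir_sum projective_lifts[OF projective_P]
    right_module_copies right_module_P fd_moduleD assms) auto

end

section \<open>The isomorphism class of a module without self-extensions is open\<close>

context fd_algebra
begin

lemma klinear_precompose:
  assumes X: "right_module A X" and X': "right_module A X'" and V: "right_module A V"
      and h: "module_map A X' X h"
  shows "klinear (hom_space X V) (hom_space X' V) (\<lambda>f. \<lambda>x\<in>carrier X'. f (h x))"
  unfolding klinear_def
proof (intro conjI ballI allI funcsetI)
  note c = module_map_closed[OF h]
  fix f assume f: "f \<in> carrier (hom_space X V)"
  then show "(\<lambda>x\<in>carrier X'. f (h x)) \<in> carrier (hom_space X' V)"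
    using mhom_restrict[OF X' module_map_compose[OF h mhom_module_map]] by simp
  show "(\<lambda>x\<in>carrier X'. (a \<odot>\<^bsub>hom_space X V\<^esub> f) (h x)) = a \<odot>\<^bsub>hom_space X' V\<^esub> (\<lambda>x\<in>carrier X'. f (h x))" for a
    using c by (auto simp: fun_eq_iff)
  fix g assume "g \<in> carrier (hom_space X V)"
  show "(\<lambda>x\<in>carrier X'. (f \<oplus>\<^bsub>hom_space X V\<^esub> g) (h x)) =
      (\<lambda>x\<in>carrier X'. f (h x)) \<oplus>\<^bsub>hom_space X' V\<^esub> (\<lambda>x\<in>carrier X'. g (h x))"
    using c by (auto simp: fun_eq_iff)
qed

lemma klinear_postcompose:
  assumes X: "right_module A X" and V': "right_module A V'" and k: "module_map A V V' k"
  shows "klinear (hom_space X V) (hom_space X V') (\<lambda>f. \<lambda>x\<in>carrier X. k (f x))"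
  unfolding klinear_def
proof (intro conjI ballI allI funcsetI)
  fix f assume f: "f \<in> carrier (hom_space X V)"
  then have fh: "module_map A X V f" by (simp add: mhom_module_map)
  show "(\<lambda>x\<in>carrier X. k (f x)) \<in> carrier (hom_space X V')"
    using mhom_restrict[OF X module_map_compose[OF fh k]] by simp
  show "(\<lambda>x\<in>carrier X. k ((a \<odot>\<^bsub>hom_space X V\<^esub> f) x)) = a \<odot>\<^bsub>hom_space X V'\<^esub> (\<lambda>x\<in>carrier X. k (f x))" for a
    using module_map_closed[OF fh] module_map_smult[OF k] by (auto simp: fun_eq_iff)
  fix g assume "g \<in> carrier (hom_space X V)"
  then have gh: "module_map A X V g" by (simp add: mhom_module_map)
  show "(\<lambda>x\<in>carrier X. k ((f \<oplus>\<^bsub>hom_space X V\<^esub> g) x)) =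
      (\<lambda>x\<in>carrier X. k (f x)) \<oplus>\<^bsub>hom_space X V'\<^esub> (\<lambda>x\<in>carrier X. k (g x))"
    using module_map_closed[OF fh] module_map_closed[OF gh] module_map_add[OF k] by (auto simp: fun_eq_iff)
qed

end

lemma linear_functional_difference:
  assumes V: "kspace V" and l: "linear_functional V l" and x: "x \<in> carrier V"
      and g: "g \<in> {..<r} \<rightarrow> carrier V"
  shows "l (\<delta> \<odot>\<^bsub>V\<^esub> x \<ominus>\<^bsub>V\<^esub> (\<Oplus>\<^bsub>V\<^esub>i\<in>{..<r}. a i \<odot>\<^bsub>V\<^esub> g i)) = \<delta> * l x - (\<Sum>i<r. a i * l (g i))"
proof -
  interpret kspace V by (rule V)
  show ?thesis
    using linear_functional_minus[OF l smult_closed[OF x] lincomb_closed[OF g]]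
      linear_functional_smult[OF l x] linear_functional_lincomb[OF l g] by simp
qed

context representation_space
begin

text \<open>
  The pairs \<open>(g, h)\<close> with \<open>g \<circ> (f\<^sub>0 - inc) = (f - inc) \<circ> h\<close> are the lifts of homomorphisms between the two
  cokernels to their presentations. The linear map
  \<open>L\<^sub>f (g, h) = g \<circ> (f\<^sub>0 - inc) - (f - inc) \<circ> h\<close> is onto \<open>Hom(rad P(\<alpha>), P(\<alpha>))\<close> for \<open>f = f\<^sub>0\<close> because the cokernel
  has no self-extensions.
\<close>

lemma presentation_surjective:
  assumes N: "fd_module A N" and ext: "extension_property TYPE(nat \<Rightarrow> nat \<Rightarrow> 'p) N N" and f0: "f0 \<in> RepA"
    and \<tau>: "module_map A PA N \<tau>" "\<tau> ` carrier PA = carrier N"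
    and ker: "\<And>x. x \<in> carrier PA \<Longrightarrow> \<tau> x = \<zero>\<^bsub>N\<^esub> \<longleftrightarrow> x \<in> rel f0 ` RA"
    and \<xi>: "module_map A RM PA \<xi>"
  shows "\<exists>g h. module_map A PA PA g \<and> module_map A RM RM h \<and>
    (\<forall>z\<in>RA. \<xi> z = g (rel f0 z) \<ominus>\<^bsub>PA\<^esub> rel f0 (h z))"
proof -
  note NR = fd_moduleD[OF N]
  interpret PP: right_module A PA by (rule right_module_PA)
  interpret NN: right_module A N by (rule NR)
  let ?I = "rel f0 ` RA"
  let ?IM = "PA\<lparr>carrier := ?I\<rparr>"
  have kerI: "{x \<in> carrier PA. \<tau> x = \<zero>\<^bsub>N\<^esub>} = ?I"
    using ker submodule_subset[OF submodule_rel[OF f0]] by blast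
  have IR: "right_module A ?IM" by (rule right_module_submodule[OF right_module_PA submodule_rel[OF f0]])
  have rI: "module_map A RM ?IM (rel f0)" by (rule module_map_into[OF rel_hom[OF f0]]) simp
  have bij: "bij_betw (rel f0) (carrier RM) (carrier ?IM)" using rel_inj[OF f0] by (simp add: bij_betw_def)
  let ?\<theta> = "the_inv_into (carrier RM) (rel f0)"
  have \<theta>: "module_map A ?IM RM ?\<theta>" by (rule module_map_inverse[OF right_module_RM IR rI bij])
  have \<theta>r: "?\<theta> (rel f0 z) = z" if "z \<in> RA" for z
    using the_inv_into_f_f[of "rel f0" "carrier RM" z] rel_inj[OF f0] that by simp
  have r\<theta>: "rel f0 (?\<theta> y) = y" if "y \<in> ?I" for y
    using f_the_inv_into_f_bij_betw[OF bij, of y] that by simp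
  have "module_map A (PA\<lparr>carrier := {x \<in> carrier PA. \<tau> x = \<zero>\<^bsub>N\<^esub>}\<rparr>) N (\<lambda>y. \<tau> (\<xi> (?\<theta> y)))"
    unfolding kerI by (rule module_map_compose[OF module_map_compose[OF \<theta> \<xi>] \<tau>(1)])
  then obtain \<chi> where \<chi>: "module_map A PA N \<chi>" "\<forall>y\<in>carrier PA. \<tau> y = \<zero>\<^bsub>N\<^esub> \<longrightarrow> \<chi> y = \<tau> (\<xi> (?\<theta> y))"
    using ext[unfolded extension_property_def, rule_format, OF right_module_PA \<tau>] by blast
  obtain g where g: "module_map A PA PA g" "\<forall>x\<in>carrier PA. \<tau> (g x) = \<chi> x"
    using PA_lifts[OF fd_module_PA N \<tau>] \<chi>(1) unfolding lifts_def by blast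
  let ?k = "\<lambda>z. g (rel f0 z) \<ominus>\<^bsub>PA\<^esub> \<xi> z"
  have k: "module_map A RM PA ?k"
    by (rule module_map_minus_map[OF right_module_PA module_map_compose[OF rel_hom[OF f0] g(1)] \<xi>])
  have kI: "?k z \<in> ?I" if z: "z \<in> RA" for z
  proof -
    have zM: "z \<in> carrier RM" using z by simp
    note c = module_map_closed[OF rel_hom[OF f0] zM] module_map_closed[OF \<xi> zM]
    note gc = module_map_closed[OF g(1) c(1)]
    have "\<tau> (rel f0 z) = \<zero>\<^bsub>N\<^esub>" using ker[OF c(1)] z by blast
    then have "\<tau> (g (rel f0 z)) = \<tau> (\<xi> z)" using g(2) \<chi>(2) c(1) \<theta>r[OF z] by simp
    then have "\<tau> (?k z) = \<zero>\<^bsub>N\<^esub>"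
      using module_map_minus[OF right_module_PA NR \<tau>(1) gc c(2)] NN.minus_zero_iff module_map_closed[OF \<tau>(1)
        c(2)] by simp
    then show ?thesis using ker[OF module_map_closed[OF k zM]] by blast
  qed
  have kM: "module_map A RM ?IM ?k" by (rule module_map_into[OF k]) (use kI in auto)
  let ?h = "\<lambda>z. ?\<theta> (?k z)"
  have h: "module_map A RM RM ?h" by (rule module_map_compose[OF kM \<theta>])
  have "\<xi> z = g (rel f0 z) \<ominus>\<^bsub>PA\<^esub> rel f0 (?h z)" if z: "z \<in> RA" for z
  proof -
    have zM: "z \<in> carrier RM" using z by simp
    note c = module_map_closed[OF g(1) module_map_closed[OF rel_hom[OF f0] zM]] module_map_closed[OF \<xi> zM]
    have "g (rel f0 z) \<ominus>\<^bsub>PA\<^esub> rel f0 (?h z) = g (rel f0 z) \<ominus>\<^bsub>PA\<^esub> ?k z" using r\<theta>[OF kI[OF z]] by simp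
    also have "\<dots> = \<xi> z" using c by (rule PP.minus_minus_cancel)
    finally show ?thesis by simp
  qed
  then show ?thesis using g(1) h by blast
qed

text \<open>
  Choose \<open>(g\<^sub>i, h\<^sub>i)\<close> over a basis of the target of \<open>L\<close>. Cramer's rule applied to \<open>L\<^sub>f (id, id)\<close> yields a
  combination \<open>(G, H) = \<delta> (id, id) - \<Sum> a\<^sub>i (g\<^sub>i, h\<^sub>i)\<close> in the kernel of \<open>L\<^sub>f\<close> with coefficients that are
  polynomials in \<open>f\<close>, and \<open>G = id\<close> at \<open>f = f\<^sub>0\<close>. Wherever the determinant of \<open>G\<close> does not vanish, \<open>G\<close>
  is an automorphism that carries the image of \<open>f\<^sub>0 - inc\<close> to that of \<open>f - inc\<close>.
\<close>

lemma iso_locus_neighbourhood: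
  assumes N: "fd_module A N" and ext: "extension_property TYPE(nat \<Rightarrow> nat \<Rightarrow> 'p) N N" and f0: "f0 \<in> RepA"
    and iso: "module_iso A (rep_module A n P \<alpha> f0) N"
  shows "\<exists>q\<in>poly_functions RS. q f0 \<noteq> 0 \<and> (\<forall>f\<in>RepA. q f \<noteq> 0 \<longrightarrow> module_iso A (rep_module A n P \<alpha> f) N)"
proof -
  note NR = fd_moduleD[OF N]
  obtain \<tau> where \<tau>: "module_map A PA N \<tau>" "\<tau> ` carrier PA = carrier N"
    and ker: "\<And>x. x \<in> carrier PA \<Longrightarrow> \<tau> x = \<zero>\<^bsub>N\<^esub> \<longleftrightarrow> x \<in> rel f0 ` RA"
    using iso unfolding module_iso_rep_iff[OF f0 NR] by blast
  interpret PP: right_module A PA by (rule right_module_PA)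
  let ?C = "hom_space RM PA" and ?E = "hom_space PA PA" and ?R = "hom_space RM RM"
  interpret C: kspace ?C by (rule kspace_hom_space[OF right_module_RM right_module_PA])
  interpret E: kspace ?E by (rule kspace_hom_space[OF right_module_PA right_module_PA])
  interpret R: kspace ?R by (rule kspace_hom_space[OF right_module_RM right_module_RM])
  interpret B: kspace "base_space A PA" by (rule kspace_base_space[OF right_module_PA])
  let ?dual = "\<lambda>r c \<mu>. c \<in> {..<r} \<rightarrow> carrier ?C \<and> separating ?C (carrier ?C) {..<r} \<mu> \<and>
    (\<forall>i<r. \<forall>j<r. \<mu> i (c j) = of_bool (i = j))"
  have "\<exists>(r :: nat) c \<mu>. ?dual r c \<mu>"
    by (rule C.dual_basis_exists[OF finite_dim_hom_space[OF fd_module_RM fd_module_PA]])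
  then obtain r :: nat where "\<exists>c \<mu>. ?dual r c \<mu>" by (rule exE)
  then obtain c where "\<exists>\<mu>. ?dual r c \<mu>" by (rule exE)
  then obtain \<mu> where "?dual r c \<mu>" by (rule exE)
  then have c: "c \<in> {..<r} \<rightarrow> carrier ?C" and \<mu>: "separating ?C (carrier ?C) {..<r} \<mu>"
    and dual_all: "\<forall>i<r. \<forall>j<r. \<mu> i (c j) = of_bool (i = j)" by blast+
  have dual: "\<mu> i (c j) = of_bool (i = j)" if "i < r" "j < r" for i j using dual_all that by blast
  have \<mu>l: "linear_functional ?C (\<mu> j)" if "j < r" for j using \<mu> that by (simp add: separating_def)
  have "\<exists>g h. g \<in> mhom A PA PA \<and> h \<in> mhom A RM RM \<and> (\<forall>z\<in>RA. c i z = g (rel f0 z) \<ominus>\<^bsub>PA\<^esub> rel f0 (h z))"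
    if i: "i < r" for i
  proof -
    have "module_map A RM PA (c i)" using c i by (auto intro: mhom_module_map)
    from presentation_surjective[OF N ext f0 \<tau> ker this]
    obtain g h where gh: "module_map A PA PA g" "module_map A RM RM h"
        "\<forall>z\<in>RA. c i z = g (rel f0 z) \<ominus>\<^bsub>PA\<^esub> rel f0 (h z)"
      by blast
    have "restrict g (carrier PA) \<in> mhom A PA PA" "restrict h (carrier RM) \<in> mhom A RM RM"
      using gh(1,2) by (auto intro: mhom_restrict right_module_PA right_module_RM simp del: RM_simps)
    moreover have "\<forall>z\<in>RA. c i z
        = restrict g (carrier PA) (rel f0 z) \<ominus>\<^bsub>PA\<^esub> rel f0 (restrict h (carrier RM) z)"
      using gh(3) module_map_closed[OF rel_hom[OF f0]] by simp
    ultimately show ?thesis by blast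
  qed
  then have "\<forall>i. \<exists>g. \<exists>h. i < r \<longrightarrow> g \<in> mhom A PA PA \<and> h \<in> mhom A RM RM \<and>
      (\<forall>z\<in>RA. c i z = g (rel f0 z) \<ominus>\<^bsub>PA\<^esub> rel f0 (h z))" by blast
  from choice[OF this] obtain g where "\<forall>i. \<exists>h. i < r \<longrightarrow> g i \<in> mhom A PA PA \<and> h \<in> mhom A RM RM \<and>
      (\<forall>z\<in>RA. c i z = g i (rel f0 z) \<ominus>\<^bsub>PA\<^esub> rel f0 (h z))" by (rule exE)
  from choice[OF this] obtain h where "\<forall>i. i < r \<longrightarrow> g i \<in> mhom A PA PA \<and> h i \<in> mhom A RM RM \<and>
      (\<forall>z\<in>RA. c i z = g i (rel f0 z) \<ominus>\<^bsub>PA\<^esub> rel f0 (h i z))" by (rule exE)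
  then have gE: "g \<in> {..<r} \<rightarrow> carrier ?E" and hR: "h \<in> {..<r} \<rightarrow> carrier ?R"
    and cgh: "\<And>i z. i < r \<Longrightarrow> z \<in> RA \<Longrightarrow> c i z = g i (rel f0 z) \<ominus>\<^bsub>PA\<^esub> rel f0 (h i z)" by auto
  let ?idE = "\<lambda>x\<in>carrier PA. x" and ?idR = "\<lambda>x\<in>carrier RM. x"
  have idE: "?idE \<in> carrier ?E" and idR: "?idR \<in> carrier ?R"
    using mhom_restrict[OF right_module_PA module_map_id] mhom_restrict[OF right_module_RM module_map_id]
      by auto
  \<comment> \<open>The two halves of \<open>L\<^sub>f\<close>, so that \<open>L\<^sub>f (g, h) = \<Lambda> g - \<Gamma> f h\<close>.\<close>
  let ?\<Lambda> = "\<lambda>k. \<lambda>z\<in>carrier RM. k (rel f0 z)"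
  let ?\<Gamma> = "\<lambda>f k. \<lambda>z\<in>carrier RM. rel f (k z)"
  have \<Lambda>: "klinear ?E ?C ?\<Lambda>"
      by (rule klinear_precompose[OF right_module_PA right_module_RM right_module_PA rel_hom[OF f0]])
  have \<Gamma>: "klinear ?R ?C (?\<Gamma> f)" if "f \<in> RepA" for f
    by (rule klinear_postcompose[OF right_module_RM right_module_PA rel_hom[OF that]])
  let ?T = "\<lambda>i f. \<lambda>z\<in>carrier RM. f (h i z)"
  let ?inc = "\<lambda>k. \<lambda>z\<in>carrier RM. k z"
  have T: "klinear ?C ?C (?T i)" if "i < r" for i
    using hR that by (intro klinear_precompose right_module_RM right_module_PA mhom_module_map) auto
  have inc: "klinear ?R ?C ?inc"
      by (rule klinear_postcompose[OF right_module_RM right_module_PA module_map_incl])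
  \<comment> \<open>The coordinates of \<open>L\<^sub>f (g\<^sub>i, h\<^sub>i)\<close> and of \<open>L\<^sub>f (id, id) = f\<^sub>0 - f\<close>, written so that they are visibly
    polynomial in \<open>f\<close>.\<close>
  define Bm where "Bm j i f = \<mu> j (?\<Lambda> (g i)) - (\<mu> j (?T i f) - \<mu> j (?inc (h i)))" for j i f
  define v where "v j f = \<mu> j f0 - \<mu> j f" for j f
  have pB: "Bm j i \<in> poly_functions RS" if "j < r" "i < r" for j i
    unfolding Bm_def[abs_def]
    by (intro poly_functions_diff poly_functions.const poly_functions.linear linear_functional_RS
        linear_functional_comp[OF T] \<mu>l that)
  have pv: "v j \<in> poly_functions RS" if "j < r" for j
    unfolding v_def[abs_def]
    by (intro poly_functions_diff poly_functions.const poly_functions.linear linear_functional_RS \<mu>l that)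
  let ?cramer = "\<lambda>\<delta> a. \<delta> \<in> poly_functions RS \<and> (\<forall>i<r. a i \<in> poly_functions RS) \<and>
    (\<forall>x. \<forall>j<r. (\<Sum>i<r. Bm j i x * a i x) = \<delta> x * v j x) \<and>
    (\<forall>x. (\<forall>j<r. v j x = 0) \<longrightarrow> (\<forall>i<r. a i x = 0)) \<and>
    (\<forall>x. (\<forall>i<r. \<forall>j<r. Bm i j x = of_bool (i = j)) \<longrightarrow> \<delta> x = 1)"
  have "\<exists>\<delta> a. ?cramer \<delta> a" by (rule polynomial_cramer[of r Bm RS v, OF pB pv])
  then obtain \<delta> where "\<exists>a. ?cramer \<delta> a" by (rule exE)
  then obtain a where \<delta>a: "?cramer \<delta> a" by (rule exE)
  have p\<delta>: "\<delta> \<in> poly_functions RS" using \<delta>a by blast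
  have pa: "a i \<in> poly_functions RS" if "i < r" for i using \<delta>a that by blast
  have cramer: "(\<Sum>i<r. Bm j i f * a i f) = \<delta> f * v j f" if "j < r" for f j using \<delta>a that by blast
  have a0: "a i f = 0" if "\<And>j. j < r \<Longrightarrow> v j f = 0" "i < r" for f i using \<delta>a that by blast
  have \<delta>1: "\<delta> f = 1" if "\<And>i j. i < r \<Longrightarrow> j < r \<Longrightarrow> Bm i j f = of_bool (i = j)" for f using \<delta>a that by blast
  have diff: "\<mu> j (?\<Gamma> f (h i)) = \<mu> j (?T i f) - \<mu> j (?inc (h i))" if f: "f \<in> RepA" and ij: "i < r" "j < r"
      for f i j
  proof -
    have hi: "h i \<in> carrier ?R" using hR ij by auto
    have hz: "h i z \<in> RA" if "z \<in> RA" for z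
        using module_map_closed[OF mhom_module_map, of "h i" A RM RM z] hi that by simp
    have TC: "?T i f \<in> carrier ?C" using T[OF ij(1)] f RepA_subset unfolding klinear_def by auto
    have GC: "?\<Gamma> f (h i) \<in> carrier ?C" using \<Gamma>[OF f] hi unfolding klinear_def by blast
    have IC: "?inc (h i) \<in> carrier ?C" using inc hi unfolding klinear_def by blast
    have "?T i f = ?\<Gamma> f (h i) \<oplus>\<^bsub>?C\<^esub> ?inc (h i)"
    proof (rule HOL.ext)
      fix z show "?T i f z = (?\<Gamma> f (h i) \<oplus>\<^bsub>?C\<^esub> ?inc (h i)) z"
      proof (cases "z \<in> RA")
        case True
        have "f (h i z) \<in> carrier PA" using module_map_closed[OF Rep_hom[OF f], of "h i z"] hz[OF True]
            by simp
        moreover have "h i z \<in> carrier PA" using hz[OF True] RA_subset by blast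
        ultimately have "rel f (h i z) \<oplus>\<^bsub>PA\<^esub> h i z = f (h i z)"
          using PP.add_minus_cancel[of "h i z" "f (h i z)"] PP.a_comm[of "rel f (h i z)" "h i z"] by simp
        then show ?thesis using True by simp
      qed simp
    qed
    then have "\<mu> j (?T i f) = \<mu> j (?\<Gamma> f (h i)) + \<mu> j (?inc (h i))"
      using linear_functional_add[OF \<mu>l[OF ij(2)] GC IC] by simp
    then show ?thesis by simp
  qed
  have vdiff: "\<mu> j (?\<Lambda> ?idE) - \<mu> j (?\<Gamma> f ?idR) = v j f" if f: "f \<in> RepA" and j: "j < r" for f j
  proof -
    have IC: "?inc ?idR \<in> carrier ?C" using inc idR unfolding klinear_def by blast
    have e: "\<mu> j f' = \<mu> j (\<lambda>z\<in>carrier RM. rel f' z) + \<mu> j (?inc ?idR)" if f': "f' \<in> RepA" for f'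
    proof -
      have GC: "(\<lambda>z\<in>carrier RM. rel f' z) \<in> carrier ?C"
        using mhom_restrict[OF right_module_RM rel_hom[OF f']] by simp
      have fm: "f' \<in> mhom A RM PA" using f' RepA_subset by blast
      have "f' = (\<lambda>z\<in>carrier RM. rel f' z) \<oplus>\<^bsub>?C\<^esub> ?inc ?idR"
      proof (rule HOL.ext)
        fix z show "f' z = ((\<lambda>z\<in>carrier RM. rel f' z) \<oplus>\<^bsub>?C\<^esub> ?inc ?idR) z"
        proof (cases "z \<in> RA")
          case True
          have "f' z \<in> carrier PA" using module_map_closed[OF Rep_hom[OF f'], of z] True by simp
          moreover have "z \<in> carrier PA" using True RA_subset by blast
          ultimately have "rel f' z \<oplus>\<^bsub>PA\<^esub> z = f' z"
            using PP.add_minus_cancel[of z "f' z"] PP.a_comm[of "rel f' z" z] by simp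
          then show ?thesis using True by simp
        next
          case False
          then show ?thesis using fm by (simp add: mhom_iff extensional_def)
        qed
      qed
      then have "\<mu> j f' = \<mu> j ((\<lambda>z\<in>carrier RM. rel f' z) \<oplus>\<^bsub>?C\<^esub> ?inc ?idR)" by (rule arg_cong)
      also have "\<dots> = \<mu> j (\<lambda>z\<in>carrier RM. rel f' z) + \<mu> j (?inc ?idR)"
        by (rule linear_functional_add[OF \<mu>l[OF j] GC IC])
      finally show ?thesis .
    qed
    have "?\<Lambda> ?idE = (\<lambda>z\<in>carrier RM. rel f0 z)"
      using module_map_closed[OF rel_hom[OF f0]] by (intro restrict_ext) simp
    moreover have "?\<Gamma> f ?idR = (\<lambda>z\<in>carrier RM. rel f z)" by (intro restrict_ext) simp
    ultimately show ?thesis using e[OF f0] e[OF f] by (simp add: v_def)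
  qed
  \<comment> \<open>The pair \<open>(G, H)\<close> of the combination in the kernel of \<open>L\<^sub>f\<close>.\<close>
  define G where "G f = \<delta> f \<odot>\<^bsub>?E\<^esub> ?idE \<ominus>\<^bsub>?E\<^esub> (\<Oplus>\<^bsub>?E\<^esub>i\<in>{..<r}. a i f \<odot>\<^bsub>?E\<^esub> g i)" for f
  define H where "H f = \<delta> f \<odot>\<^bsub>?R\<^esub> ?idR \<ominus>\<^bsub>?R\<^esub> (\<Oplus>\<^bsub>?R\<^esub>i\<in>{..<r}. a i f \<odot>\<^bsub>?R\<^esub> h i)" for f
  have GE: "G f \<in> carrier ?E" for f
    unfolding G_def by (intro E.minus_closed E.smult_closed E.lincomb_closed idE gE)
  have HR: "H f \<in> carrier ?R" for f
    unfolding H_def by (intro R.minus_closed R.smult_closed R.lincomb_closed idR hR)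
  have Gh: "module_map A PA PA (G f)" for f using GE[of f] by (simp add: mhom_module_map)
  have Hh: "module_map A RM RM (H f)" for f using HR[of f] by (simp add: mhom_module_map)
  have GH: "G f (rel f0 z) = rel f (H f z)" if f: "f \<in> RepA" and z: "z \<in> RA" for f z
  proof -
    have "?\<Lambda> (G f) = ?\<Gamma> f (H f)"
    proof (rule C.separating_eqI[OF \<mu>])
      show "?\<Lambda> (G f) \<in> carrier ?C" using \<Lambda> GE[of f] unfolding klinear_def by blast
      show "?\<Gamma> f (H f) \<in> carrier ?C" using \<Gamma>[OF f] HR[of f] unfolding klinear_def by blast
      fix j assume "j \<in> {..<r}"
      then have j: "j < r" by simp
      have "\<mu> j (?\<Lambda> (G f)) = \<delta> f * \<mu> j (?\<Lambda> ?idE) - (\<Sum>i<r. a i f * \<mu> j (?\<Lambda> (g i)))"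
        unfolding G_def
        by (rule linear_functional_difference[OF E.kspace_axioms linear_functional_comp[OF \<Lambda> \<mu>l[OF j]]
          idE gE])
      moreover have "\<mu> j (?\<Gamma> f (H f)) = \<delta> f * \<mu> j (?\<Gamma> f ?idR) - (\<Sum>i<r. a i f * \<mu> j (?\<Gamma> f (h i)))"
        unfolding H_def
        by (rule linear_functional_difference[OF R.kspace_axioms linear_functional_comp[OF \<Gamma>[OF f] \<mu>l[OF j]]
          idR hR])
      ultimately have "\<mu> j (?\<Lambda> (G f)) - \<mu> j (?\<Gamma> f (H f)) =
          \<delta> f * (\<mu> j (?\<Lambda> ?idE) - \<mu> j (?\<Gamma> f ?idR)) - ((\<Sum>i<r. a i f * \<mu> j (?\<Lambda> (g i)))
              - (\<Sum>i<r. a i f * \<mu> j (?\<Gamma> f (h i))))"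
        by (simp only: right_diff_distrib) (simp only: algebra_simps)
      also have "(\<Sum>i<r. a i f * \<mu> j (?\<Lambda> (g i))) - (\<Sum>i<r. a i f * \<mu> j (?\<Gamma> f (h i)))
          = (\<Sum>i<r. Bm j i f * a i f)"
        unfolding sum_subtractf[symmetric]
      proof (rule sum.cong[OF refl])
        fix i assume "i \<in> {..<r}"
        then have i: "i < r" by simp
        show "a i f * \<mu> j (?\<Lambda> (g i)) - a i f * \<mu> j (?\<Gamma> f (h i)) = Bm j i f * a i f"
          unfolding diff[OF f i j] Bm_def by (simp only: right_diff_distrib left_diff_distrib mult.commute)
      qed
      also have "\<mu> j (?\<Lambda> ?idE) - \<mu> j (?\<Gamma> f ?idR) = v j f" by (rule vdiff[OF f j])
      finally show "\<mu> j (?\<Lambda> (G f)) = \<mu> j (?\<Gamma> f (H f))"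
        by (simp only: cramer[OF j] diff_self right_minus_eq)
    qed
    from fun_cong[OF this, of z] show ?thesis using z by simp
  qed
  \<comment> \<open>The determinant of \<open>G\<close> in a basis of \<open>P(\<alpha>)\<close>.\<close>
  let ?dual' = "\<lambda>s b \<nu>. b \<in> {..<s} \<rightarrow> carrier (base_space A PA) \<and>
    separating (base_space A PA) (carrier (base_space A PA)) {..<s} \<nu> \<and>
    (\<forall>i<s. \<forall>j<s. \<nu> i (b j) = of_bool (i = j))"
  have "finite_dim (base_space A PA)" using fd_module_PA[of \<alpha>] by (simp only: fd_module_iff)
  then have "\<exists>(s :: nat) b \<nu>. ?dual' s b \<nu>" by (rule B.dual_basis_exists)
  then obtain s :: nat where "\<exists>b \<nu>. ?dual' s b \<nu>" by (rule exE)
  then obtain b where "\<exists>\<nu>. ?dual' s b \<nu>" by (rule exE)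
  then obtain \<nu> where "?dual' s b \<nu>" by (rule exE)
  then have b: "b \<in> {..<s} \<rightarrow> carrier (base_space A PA)"
    and \<nu>: "separating (base_space A PA) (carrier (base_space A PA)) {..<s} \<nu>"
    and dual_all': "\<forall>i<s. \<forall>j<s. \<nu> i (b j) = of_bool (i = j)" by blast+
  have dual': "\<nu> i (b j) = of_bool (i = j)" if "i < s" "j < s" for i j using dual_all' that by blast
  have \<nu>l: "linear_functional (base_space A PA) (\<nu> k)" if "k < s" for k using \<nu> that
      by (simp add: separating_def)
  have bP: "b l \<in> carrier PA" if "l < s" for l using b that by auto
  define e where "e k l f = \<delta> f * \<nu> k (b l) - (\<Sum>i<r. a i f * \<nu> k (g i (b l)))" for k l f
  have pe: "e k l \<in> poly_functions RS" for k l
    unfolding e_def[abs_def]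
    by (intro poly_functions_diff poly_functions.mult p\<delta> poly_functions.const poly_functions_sum pa) simp
  have Ge: "\<nu> k (G f (b l)) = e k l f" if "k < s" "l < s" for k l f
  proof -
    have "\<nu> k (G f (b l)) = \<delta> f * \<nu> k (?idE (b l)) - (\<Sum>i<r. a i f * \<nu> k (g i (b l)))"
      unfolding G_def
      by (rule linear_functional_difference[OF E.kspace_axioms
            linear_functional_comp[OF klinear_evaluation[OF bP[OF that(2)]] \<nu>l[OF that(1)]] idE gE])
    then show ?thesis using bP[OF that(2)] by (simp add: e_def)
  qed
  let ?M = "\<lambda>f. mat s s (\<lambda>(k, l). e k l f)"
  define q where "q f = det (?M f)" for f
  have pq: "q \<in> poly_functions RS" unfolding q_def[abs_def] by (intro poly_functions_det pe)
  \<comment> \<open>At \<open>f\<^sub>0\<close> the right-hand side \<open>v\<close> vanishes and the matrix is the identity, so \<open>G\<close> is the identity.\<close>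
  have "q f0 = 1"
  proof -
    have "a i f0 = 0" if "i < r" for i by (rule a0[OF _ that]) (simp add: v_def)
    moreover have "\<delta> f0 = 1"
    proof (rule \<delta>1)
      fix j i assume ji: "j < r" "i < r"
      have LC: "?\<Lambda> (g i) \<in> carrier ?C" using \<Lambda> gE ji unfolding klinear_def by blast
      have GC: "?\<Gamma> f0 (h i) \<in> carrier ?C" using \<Gamma>[OF f0] hR ji unfolding klinear_def by blast
      have ci: "c i \<in> carrier ?C" using c ji by blast
      have "?\<Lambda> (g i) = c i \<oplus>\<^bsub>?C\<^esub> ?\<Gamma> f0 (h i)"
      proof (rule HOL.ext)
        fix z show "?\<Lambda> (g i) z = (c i \<oplus>\<^bsub>?C\<^esub> ?\<Gamma> f0 (h i)) z"
        proof (cases "z \<in> RA")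
          case True
          have "?\<Lambda> (g i) z \<in> carrier PA" "?\<Gamma> f0 (h i) z \<in> carrier PA"
            using LC GC module_map_closed[OF mhom_module_map, of _ A RM PA z] True
              by (auto simp del: restrict_apply)
          then have cl: "g i (rel f0 z) \<in> carrier PA" "rel f0 (h i z) \<in> carrier PA" using True by simp_all
          have "c i z \<oplus>\<^bsub>PA\<^esub> rel f0 (h i z) = g i (rel f0 z)"
            unfolding cgh[OF ji(2) True] using PP.add_minus_cancel[OF cl(2,1)]
              PP.a_comm[OF PP.minus_closed[OF cl] cl(2)] by simp
          then show ?thesis using True by simp
        qed simp
      qed
      then have "\<mu> j (?\<Lambda> (g i)) = \<mu> j (c i) + \<mu> j (?\<Gamma> f0 (h i))"
        using linear_functional_add[OF \<mu>l[OF ji(1)] ci GC] by simp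
      then show "Bm j i f0 = of_bool (j = i)"
        unfolding Bm_def diff[OF f0 ji(2,1), symmetric] using dual[OF ji] by simp
    qed
    ultimately have "e k l f0 = of_bool (k = l)" if "k < s" "l < s" for k l
      using dual'[OF that] by (simp add: e_def)
    then have "?M f0 = 1\<^sub>m s" by (intro eq_matI) auto
    then show ?thesis by (simp add: q_def)
  qed
  moreover have "module_iso A (rep_module A n P \<alpha> f) N" if f: "f \<in> RepA" and qf: "q f \<noteq> 0" for f
  proof -
    have injG: "inj_on (G f) (carrier PA)"
    proof (rule module_map_inj_on[OF right_module_PA right_module_PA Gh])
      fix y assume y: "y \<in> carrier PA" "G f y = \<zero>\<^bsub>PA\<^esub>"
      define w where "w = vec s (\<lambda>l. \<nu> l y)"
      have M: "?M f \<in> carrier_mat s s" by simp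
      have "?M f *\<^sub>v w = 0\<^sub>v s"
      proof (rule eq_vecI)
        fix k assume "k < dim_vec (0\<^sub>v s)"
        then have k: "k < s" by simp
        have yb: "y = (\<Oplus>\<^bsub>base_space A PA\<^esub>l\<in>{..<s}. \<nu> l y \<odot>\<^bsub>base_space A PA\<^esub> b l)"
          by (rule B.dual_basis_expansion[OF b \<nu> dual']) (use y in simp_all)
        have "linear_functional (base_space A PA) (\<lambda>x. \<nu> k (G f x))"
          by (rule linear_functional_comp[OF module_map_klinear[OF Gh] \<nu>l[OF k]])
        from B.linear_functional_lincomb[OF this b, of "\<lambda>l. \<nu> l y"]
        have "\<nu> k (G f y) = (\<Sum>l<s. \<nu> l y * \<nu> k (G f (b l)))" unfolding yb[symmetric] .
        also have "\<dots> = (\<Sum>l<s. e k l f * \<nu> l y)"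
          by (intro sum.cong refl) (simp add: Ge[OF k] mult.commute)
        also have "\<dots> = (?M f *\<^sub>v w) $ k"
          using k by (simp add: w_def scalar_prod_def atLeast0LessThan)
        finally have "(?M f *\<^sub>v w) $ k = \<nu> k \<zero>\<^bsub>base_space A PA\<^esub>" using y(2) by simp
        then show "(?M f *\<^sub>v w) $ k = 0\<^sub>v s $ k" using B.linear_functional_zero[OF \<nu>l[OF k]] k by simp
      qed simp
      moreover have "w \<in> carrier_vec s" by (simp add: w_def)
      ultimately have "w = 0\<^sub>v s"
        using qf det_0_iff_vec_prod_zero_field[OF M] unfolding q_def by blast
      then have "\<nu> l y = 0" if "l < s" for l using that unfolding w_def
          by (metis index_vec index_zero_vec(1))
      then show "y = \<zero>\<^bsub>PA\<^esub>" using \<nu> y(1) by (auto simp: separating_def)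
    qed
    have bijG: "bij_betw (G f) (carrier PA) (carrier PA)"
        by (rule injective_endo_bij[OF fd_module_PA Gh injG])
    have rz: "rel f0 z \<in> carrier PA" if "z \<in> RA" for z using module_map_closed[OF rel_hom[OF f0]] that
        by simp
    have injH: "inj_on (H f) (carrier RM)"
    proof (rule inj_onI)
      fix x y assume xy: "x \<in> carrier RM" "y \<in> carrier RM" "H f x = H f y"
      then have "G f (rel f0 x) = G f (rel f0 y)" using GH[OF f] by simp
      then have "rel f0 x = rel f0 y" using injG rz xy by (simp add: inj_on_def)
      then show "x = y" using rel_inj[OF f0] xy by (simp add: inj_on_def)
    qed
    have bijH: "bij_betw (H f) RA RA" using injective_endo_bij[OF fd_module_RM Hh injH] by simp
    have img: "G f ` rel f0 ` RA = rel f ` RA"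
    proof -
      have "G f ` rel f0 ` RA = rel f ` H f ` RA" unfolding image_image using GH[OF f]
          by (intro image_cong) auto
      then show ?thesis using bijH by (simp add: bij_betw_def)
    qed
    let ?g = "the_inv_into (carrier PA) (G f)"
    have ghom: "module_map A PA PA ?g"
        by (rule module_map_inverse[OF right_module_PA right_module_PA Gh bijG])
    have bijg: "bij_betw ?g (carrier PA) (carrier PA)" by (rule bij_betw_the_inv_into[OF bijG])
    have Gg: "G f (?g x) = x" if "x \<in> carrier PA" for x using f_the_inv_into_f_bij_betw[OF bijG] that
        by blast
    have gG: "?g (G f x) = x" if "x \<in> carrier PA" for x using the_inv_into_f_f[OF injG that] .
    have "(\<lambda>x. \<tau> (?g x)) ` carrier PA = carrier N"
      using bijg \<tau>(2) by (metis bij_betw_def image_image)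
    moreover have "\<tau> (?g x) = \<zero>\<^bsub>N\<^esub> \<longleftrightarrow> x \<in> rel f ` RA" if x: "x \<in> carrier PA" for x
    proof -
      have gx: "?g x \<in> carrier PA" by (rule module_map_closed[OF ghom x])
      have "?g x \<in> rel f0 ` RA \<longleftrightarrow> x \<in> G f ` rel f0 ` RA"
      proof
        assume "?g x \<in> rel f0 ` RA"
        then have "G f (?g x) \<in> G f ` rel f0 ` RA" by (rule imageI)
        then show "x \<in> G f ` rel f0 ` RA" unfolding Gg[OF x] .
      next
        assume "x \<in> G f ` rel f0 ` RA"
        then obtain w where w: "w \<in> RA" "x = G f (rel f0 w)" by blast
        have "?g x = rel f0 w" unfolding w(2) by (rule gG[OF rz[OF w(1)]])
        then show "?g x \<in> rel f0 ` RA" using w(1) by blast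
      qed
      then show ?thesis using ker[OF gx] img by simp
    qed
    ultimately show ?thesis
      unfolding module_iso_rep_iff[OF f NR] using module_map_compose[OF ghom \<tau>(1)] by blast
  qed
  ultimately show ?thesis using pq by (intro bexI[of _ q]) auto
qed

end

section \<open>The generic representation\<close>

theorem theorem0p0p1:
  fixes A :: "('k::field, 'l) module"
    and n k :: nat
    and S :: "nat \<Rightarrow> ('l, 's) module"
    and P :: "nat \<Rightarrow> ('l, 'p) module"
    and \<phi> :: "nat \<Rightarrow> (nat \<Rightarrow> nat \<Rightarrow> 'p) \<Rightarrow> 'p"
    and \<beta> :: "nat \<Rightarrow> nat \<Rightarrow> nat"
    and M :: "nat \<Rightarrow> ('l, 'm) module"
    and c \<alpha> :: "nat \<Rightarrow> nat"
  assumes "infinite (UNIV :: 'k set)"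
    and "fd_algebra A" and "basic A" and "hereditary A"
    and "complete_simples A n S"
    and "\<forall>i<n. projective_cover A (P i) (S i)"
    and "\<forall>j<n. \<phi> j \<in> mhom A (proj_sum n P (ext_dim A S j)) (rad_module A (P j)) \<and>
           bij_betw (\<phi> j) (carrier (proj_sum n P (ext_dim A S j))) (radical A (P j))"
    and "\<forall>l<k. real_schur_root A n P (\<beta> l)"
    and "\<forall>l<k. exceptional_of_dim A n P (\<beta> l) (M l)"
    and "\<forall>l<k. \<forall>m<k. Ext1_vanishes A (M l) (M m)"
    and "\<forall>i<n. \<alpha> i = (\<Sum>l<k. c l * \<beta> l i)"
  shows "let d = ext_dim A S;
             X = zariski (Rep_space A n d P \<phi> \<alpha>);
             U = {f \<in> Rep A n d P \<phi> \<alpha>. module_iso A (rep_module A n P \<alpha> f)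
                    (dir_sum {..<k} (\<lambda>l. dir_sum {..<c l} (\<lambda>_. M l)))}
         in openin X U \<and> X closure_of U = topspace X"
proof -
  interpret fd_algebra A by fact
  interpret representation_space A n S P "ext_dim A S" \<phi> \<alpha>
    by unfold_locales (use assms(4-7) in auto)
  let ?N = "dir_sum {..<k} (\<lambda>l. dir_sum {..<c l} (\<lambda>_. M l))"
  let ?U = "{f \<in> RepA. module_iso A (rep_module A n P \<alpha> f) ?N}"
  have M: "fd_module A (M l)" if "l < k" for l
    using assms(9) that by (simp add: exceptional_of_dim_def exceptional_def)
  have MR: "right_module A (M l)" if "l < k" for l by (rule fd_moduleD[OF M[OF that]])
  have N: "fd_module A ?N" by (intro fd_module_dir_sum M) auto
  have ext: "extension_property TYPE(nat \<Rightarrow> nat \<Rightarrow> 'p) ?N ?N"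
    by (intro extension_property_dir_sum_left extension_property_dir_sum_right extension_property_Ext1
        right_module_dir_sum MR finite_lessThan) (use assms(10) in auto)
  have "\<exists>t. frame i (copies i (\<alpha> i)) ?N t" if i: "i < n" for i
  proof -
    have "(\<Sum>l<k. c l * dim_vector A P (M l) i) = \<alpha> i"
      using assms(9,11) i by (auto simp: exceptional_of_dim_def intro!: sum.cong)
    then show ?thesis using frame_multiples[where V = M and k = k and c = c, OF i M] by simp
  qed
  then have "\<forall>i. \<exists>t. i < n \<longrightarrow> frame i (copies i (\<alpha> i)) ?N t" by blast
  from choice[OF this] obtain t where "\<forall>i. i < n \<longrightarrow> frame i (copies i (\<alpha> i)) ?N (t i)" by (rule exE)
  then have "frame i (copies i (\<alpha> i)) ?N (t i)" if "i < n" for i using that by blast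
  from Rep_presents[OF N this] have ne: "?U \<noteq> {}" by blast
  have carrier_RS: "carrier RS = RepA" by (simp add: Rep_space_def)
  have op: "openin (zariski RS) ?U"
  proof (rule openin_zariskiI)
    fix f assume "f \<in> ?U"
    then show "\<exists>q\<in>poly_functions RS. q f \<noteq> 0 \<and> (\<forall>y\<in>carrier RS. q y \<noteq> 0 \<longrightarrow> y \<in> ?U)"
      using iso_locus_neighbourhood[OF N ext] unfolding carrier_RS by blast
  qed (auto simp: carrier_RS)
  have "zariski RS closure_of ?U = topspace (zariski RS)"
    by (rule zariski_dense[OF assms(1) kspace_RS op ne])
  with op show ?thesis by (simp add: Let_def)
qed

end
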